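(* Let $R$ and $S$ be rings and let ${}_SC_R$ be a faithfully semidualizing bimodule. Then: (1) the class $\mathcal{WF}_C(S)$ of $C$-weak flat left $S$-modules is closed under pure submodules and pure quotients; (2) the class $\mathcal{WI}_C(R)$ of $C$-weak injective left $R$-modules is closed under pure submodules and pure quotients.
   Context: Rings are associative with unit and modules are unitary; right $R$-modules are identified with left $R^{op}$-modules. Classes of modules are closed under isomorphism. A module is super finitely presented if it has a degreewise finite projective resolution, i.e. a projective resolution $\cdots\to P_1\to P_0\to M\to 0$ with each $P_i$ finitely generated projective. An $(S,R)$-bimodule $C={}_SC_R$ is semidualizing if: ${}_SC$ and $C_R$ both admit degreewise finite projective resolutions (over $S$, resp. $R^{op}$); the homothety maps $S\to\mathrm{Hom}_{R^{op}}(C,C)$ and $R\to\mathrm{Hom}_S(C,C)$ are isomorphisms; and $\mathrm{Ext}^i_S(C,C)=0=\mathrm{Ext}^i_{R^{op}}(C,C)$ for all $i\ge1$. It is faithfully semidualizing if moreover, for all left $S$-modules $N$ and right $R$-modules $M$: $\mathrm{Hom}_S(C,N)=0$ implies $N=0$, and $\mathrm{Hom}_{R^{op}}(C,M)=0$ implies $M=0$. A left $S$-module $I$ is weak injective if $\mathrm{Ext}^1_S(F,I)=0$ for every super finitely presented left $S$-module $F$. A left $R$-module $M$ is weak flat if $\mathrm{Tor}^R_1(F,M)=0$ for every super finitely presented right $R$-module $F$. A left $S$-module is $C$-weak flat if it has the form $C\otimes_RF$ with $F$ a weak flat left $R$-module; a left $R$-module is $C$-weak injective if it has the form $\mathrm{Hom}_S(C,I)$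 with $I$ a weak injective left $S$-module. A short exact sequence $0\to A\to B\to D\to0$ of left modules ($A$ a submodule of $B$, $D$ the quotient) is pure exact if $\mathrm{Hom}(P,B)\to\mathrm{Hom}(P,D)\to0$ is exact for every finitely presented left module $P$; then $A$ is called a pure submodule and $D$ a pure quotient of $B$. *)

theory Defs
  imports "HOL-Algebra.Module" "HOL-Algebra.Free_Abelian_Groups"
    "HOL-Algebra.Elementary_Groups"
begin

section \<open>Modules over arbitrary rings\<close>

text \<open>
  \<^locale>\<open>module\<close> of HOL-Algebra requires a commutative ring of scalars. The locale below drops
  commutativity and keeps the record type; the fields \<open>mult\<close> and \<open>one\<close> which that record inherits
  play no role for modules and are left unspecified by the constructions in this theory.
\<close>

locale left_module = R?: ring R + M?: abelian_group M
  for R :: "('r, 'q) ring_scheme" (structure) and M :: "('r, 'm, 'e) module_scheme" (structure) +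
  assumes smult_closed [simp, intro]:
      "\<lbrakk>a \<in> carrier R; x \<in> carrier M\<rbrakk> \<Longrightarrow> a \<odot>\<^bsub>M\<^esub> x \<in> carrier M"
    and smult_l_distr:
      "\<lbrakk>a \<in> carrier R; b \<in> carrier R; x \<in> carrier M\<rbrakk> \<Longrightarrow>
        (a \<oplus> b) \<odot>\<^bsub>M\<^esub> x = a \<odot>\<^bsub>M\<^esub> x \<oplus>\<^bsub>M\<^esub> b \<odot>\<^bsub>M\<^esub> x"
    and smult_r_distr:
      "\<lbrakk>a \<in> carrier R; x \<in> carrier M; y \<in> carrier M\<rbrakk> \<Longrightarrow>
        a \<odot>\<^bsub>M\<^esub> (x \<oplus>\<^bsub>M\<^esub> y) = a \<odot>\<^bsub>M\<^esub> x \<oplus>\<^bsub>M\<^esub> a \<odot>\<^bsub>M\<^esub> y"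
    and smult_assoc1:
      "\<lbrakk>a \<in> carrier R; b \<in> carrier R; x \<in> carrier M\<rbrakk> \<Longrightarrow>
        (a \<otimes> b) \<odot>\<^bsub>M\<^esub> x = a \<odot>\<^bsub>M\<^esub> (b \<odot>\<^bsub>M\<^esub> x)"
    and smult_one [simp]: "x \<in> carrier M \<Longrightarrow> \<one> \<odot>\<^bsub>M\<^esub> x = x"

text \<open>Right \<open>R\<close>-modules are left modules over \<open>op_ring R\<close>.\<close>

definition op_ring :: "'r ring \<Rightarrow> 'r ring" where
  "op_ring R = R\<lparr>monoid.mult := (\<lambda>x y. y \<otimes>\<^bsub>R\<^esub> x)\<rparr>"

definition mk_module ::
    "'m set \<Rightarrow> ('m \<Rightarrow> 'm \<Rightarrow> 'm) \<Rightarrow> 'm \<Rightarrow> ('r \<Rightarrow> 'm \<Rightarrow> 'm) \<Rightarrow> ('r, 'm) module" where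
  "mk_module A pls zer sm =
     \<lparr>carrier = A, monoid.mult = undefined, one = undefined, ring.zero = zer, ring.add = pls, module.smult = sm\<rparr>"

text \<open>Homomorphisms are extensional functions, so that they form a set of the expected size.\<close>

definition mod_hom :: "'r ring \<Rightarrow> ('r, 'm) module \<Rightarrow> ('r, 'n) module \<Rightarrow> ('m \<Rightarrow> 'n) set" where
  "mod_hom R M N = {f \<in> carrier M \<rightarrow>\<^sub>E carrier N.
     (\<forall>x\<in>carrier M. \<forall>y\<in>carrier M. f (x \<oplus>\<^bsub>M\<^esub> y) = f x \<oplus>\<^bsub>N\<^esub> f y) \<and>
     (\<forall>a\<in>carrier R. \<forall>x\<in>carrier M. f (a \<odot>\<^bsub>M\<^esub> x) = a \<odot>\<^bsub>N\<^esub> f x)}"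

definition mod_isomorphic :: "'r ring \<Rightarrow> ('r, 'm) module \<Rightarrow> ('r, 'n) module \<Rightarrow> bool" where
  "mod_isomorphic R M N \<longleftrightarrow> (\<exists>f\<in>mod_hom R M N. bij_betw f (carrier M) (carrier N))"

definition mod_kernel :: "('r, 'm) module \<Rightarrow> ('r, 'n) module \<Rightarrow> ('m \<Rightarrow> 'n) \<Rightarrow> 'm set" where
  "mod_kernel M N f = {x \<in> carrier M. f x = \<zero>\<^bsub>N\<^esub>}"

definition hom_group :: "'r ring \<Rightarrow> ('r, 'm) module \<Rightarrow> ('r, 'n) module \<Rightarrow> ('m \<Rightarrow> 'n) monoid" where
  "hom_group R M N =
     \<lparr>carrier = mod_hom R M N,
      monoid.mult = (\<lambda>f g. \<lambda>x\<in>carrier M. f x \<oplus>\<^bsub>N\<^esub> g x),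
      one = (\<lambda>x\<in>carrier M. \<zero>\<^bsub>N\<^esub>)\<rparr>"

definition hom_zero :: "'r ring \<Rightarrow> ('r, 'm) module \<Rightarrow> ('r, 'n) module \<Rightarrow> bool" where
  "hom_zero R M N \<longleftrightarrow> mod_hom R M N = {\<lambda>x\<in>carrier M. \<zero>\<^bsub>N\<^esub>}"


section \<open>Finiteness conditions and projectivity\<close>

definition free_mod :: "'r ring \<Rightarrow> 'x set \<Rightarrow> ('r, 'x \<Rightarrow> 'r) module" where
  "free_mod R X = mk_module
     {f \<in> X \<rightarrow>\<^sub>E carrier R. finite {x \<in> X. f x \<noteq> \<zero>\<^bsub>R\<^esub>}}
     (\<lambda>f g. \<lambda>x\<in>X. f x \<oplus>\<^bsub>R\<^esub> g x) (\<lambda>x\<in>X. \<zero>\<^bsub>R\<^esub>) (\<lambda>a f. \<lambda>x\<in>X. a \<otimes>\<^bsub>R\<^esub> f x)"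

definition fin_gen :: "'r ring \<Rightarrow> ('r, 'm) module \<Rightarrow> bool" where
  "fin_gen R M \<longleftrightarrow>
     (\<exists>X. finite X \<and> X \<subseteq> carrier M \<and> (\<forall>H. submodule H R M \<longrightarrow> X \<subseteq> H \<longrightarrow> H = carrier M))"

text \<open>
  A projective module is a direct summand of a free module. It is then a direct summand of the
  free module on its own underlying set, which therefore is the only one that has to be mentioned.
\<close>

definition projective :: "'r ring \<Rightarrow> ('r, 'm) module \<Rightarrow> bool" where
  "projective R P \<longleftrightarrow> left_module R P \<and>
     (\<exists>i\<in>mod_hom R P (free_mod R (carrier P)). \<exists>p\<in>mod_hom R (free_mod R (carrier P)) P.
        \<forall>x\<in>carrier P. p (i x) = x)"

definition fin_presented :: "'r ring \<Rightarrow> ('r, 'm) module \<Rightarrow> bool" where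
  "fin_presented R M \<longleftrightarrow> left_module R M \<and>
     (\<exists>(n::nat). \<exists>p\<in>mod_hom R (free_mod R {..<n}) M.
        p ` carrier (free_mod R {..<n}) = carrier M \<and>
        fin_gen R ((free_mod R {..<n})\<lparr>carrier := mod_kernel (free_mod R {..<n}) M p\<rparr>))"

definition projective_resolution :: "'r ring \<Rightarrow> ('r, 'm) module \<Rightarrow>
    (nat \<Rightarrow> ('r, 'p) module) \<Rightarrow> (nat \<Rightarrow> 'p \<Rightarrow> 'p) \<Rightarrow> ('p \<Rightarrow> 'm) \<Rightarrow> bool" where
  "projective_resolution R M P d e \<longleftrightarrow> left_module R M \<and>
     (\<forall>n. projective R (P n)) \<and>
     (\<forall>n. d n \<in> mod_hom R (P (Suc n)) (P n)) \<and>
     e \<in> mod_hom R (P 0) M \<and>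
     e ` carrier (P 0) = carrier M \<and>
     mod_kernel (P 0) M e = d 0 ` carrier (P 1) \<and>
     (\<forall>n. mod_kernel (P (Suc n)) (P n) (d n) = d (Suc n) ` carrier (P (Suc (Suc n))))"

text \<open>
  Quantification over all modules has to be replaced by quantification over the modules whose
  underlying set lies in a fixed type. Two types are used, both large enough to lose nothing up
  to isomorphism:

  \<^item> \<open>'r list\<close> for the finitely generated modules over a ring of type \<open>'r\<close> (lemma \<open>fin_gen_copy\<close>);

  \<^item> \<open>('r + 'm) list\<close> for the terms of projective resolutions of a module of type \<open>'m\<close>. This type is
    infinite and at least as large as \<open>'r\<close> and \<open>'m\<close>, so that it contains a copy of the free module
    on each of its subsets; hence every module of type \<open>'m\<close> has a free resolution there. By the
    previous item it also contains a copy of every degreewise finite projective resolution.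
\<close>

definition super_fin_presented :: "'r ring \<Rightarrow> ('r, 'm) module \<Rightarrow> bool" where
  "super_fin_presented R M \<longleftrightarrow>
     (\<exists>(P :: nat \<Rightarrow> ('r, ('r + 'm) list) module) d e.
        projective_resolution R M P d e \<and> (\<forall>n. fin_gen R (P n)))"


section \<open>Ext\<close>

text \<open>
  \<open>ext_group R P d N n\<close> is the \<open>n\<close>-th cohomology group of the complex \<open>Hom(P, N)\<close>; for a projective
  resolution \<open>(P, d)\<close> of \<open>M\<close> this is \<open>Ext\<^sup>n(M, N)\<close>, up to an isomorphism between different
  resolutions.
\<close>

definition ext_cocycles :: "'r ring \<Rightarrow> (nat \<Rightarrow> ('r, 'p) module) \<Rightarrow> (nat \<Rightarrow> 'p \<Rightarrow> 'p) \<Rightarrow>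
    ('r, 'n) module \<Rightarrow> nat \<Rightarrow> ('p \<Rightarrow> 'n) set" where
  "ext_cocycles R P d N n =
     {f \<in> mod_hom R (P n) N. \<forall>x\<in>carrier (P (Suc n)). f (d n x) = \<zero>\<^bsub>N\<^esub>}"

definition ext_coboundaries :: "'r ring \<Rightarrow> (nat \<Rightarrow> ('r, 'p) module) \<Rightarrow> (nat \<Rightarrow> 'p \<Rightarrow> 'p) \<Rightarrow>
    ('r, 'n) module \<Rightarrow> nat \<Rightarrow> ('p \<Rightarrow> 'n) set" where
  "ext_coboundaries R P d N n = (case n of
       0 \<Rightarrow> {\<one>\<^bsub>hom_group R (P 0) N\<^esub>}
     | Suc m \<Rightarrow> (\<lambda>f. compose (carrier (P (Suc m))) f (d m)) ` mod_hom R (P m) N)"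

definition ext_group :: "'r ring \<Rightarrow> (nat \<Rightarrow> ('r, 'p) module) \<Rightarrow> (nat \<Rightarrow> 'p \<Rightarrow> 'p) \<Rightarrow>
    ('r, 'n) module \<Rightarrow> nat \<Rightarrow> ('p \<Rightarrow> 'n) set monoid" where
  "ext_group R P d N n =
     (hom_group R (P n) N)\<lparr>carrier := ext_cocycles R P d N n\<rparr> Mod ext_coboundaries R P d N n"

definition Ext_vanishes :: "'r ring \<Rightarrow> nat \<Rightarrow> ('r, 'm) module \<Rightarrow> ('r, 'n) module \<Rightarrow> bool" where
  "Ext_vanishes R n M N \<longleftrightarrow>
     (\<forall>(P :: nat \<Rightarrow> ('r, ('r + 'm) list) module) d e.
        projective_resolution R M P d e \<longrightarrow> trivial_group (ext_group R P d N n))"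


section \<open>Tensor products and Tor\<close>

text \<open>
  The tensor product over \<open>R\<close> of a right module \<open>N\<close> and a left module \<open>M\<close>: the free abelian group
  on the pairs, modulo biadditivity and \<open>(x a, y) = (x, a y)\<close>. As \<open>N\<close> is a left
  \<open>op_ring R\<close>-module, \<open>x a\<close> is written \<open>a \<odot>\<^bsub>N\<^esub> x\<close>.
\<close>

definition tensor_relators ::
    "'r ring \<Rightarrow> ('r, 'n) module \<Rightarrow> ('r, 'm) module \<Rightarrow> ('n \<times> 'm \<Rightarrow>\<^sub>0 int) set" where
  "tensor_relators R N M =
     {frag_of (x \<oplus>\<^bsub>N\<^esub> x', y) - frag_of (x, y) - frag_of (x', y) | x x' y.
        x \<in> carrier N \<and> x' \<in> carrier N \<and> y \<in> carrier M} \<union>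
     {frag_of (x, y \<oplus>\<^bsub>M\<^esub> y') - frag_of (x, y) - frag_of (x, y') | x y y'.
        x \<in> carrier N \<and> y \<in> carrier M \<and> y' \<in> carrier M} \<union>
     {frag_of (a \<odot>\<^bsub>N\<^esub> x, y) - frag_of (x, a \<odot>\<^bsub>M\<^esub> y) | a x y.
        a \<in> carrier R \<and> x \<in> carrier N \<and> y \<in> carrier M}"

definition tensor_kernel ::
    "'r ring \<Rightarrow> ('r, 'n) module \<Rightarrow> ('r, 'm) module \<Rightarrow> ('n \<times> 'm \<Rightarrow>\<^sub>0 int) set" where
  "tensor_kernel R N M =
     generate (free_Abelian_group (carrier N \<times> carrier M)) (tensor_relators R N M)"

definition tensor_group ::
    "'r ring \<Rightarrow> ('r, 'n) module \<Rightarrow> ('r, 'm) module \<Rightarrow> ('n \<times> 'm \<Rightarrow>\<^sub>0 int) set monoid" where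
  "tensor_group R N M = free_Abelian_group (carrier N \<times> carrier M) Mod tensor_kernel R N M"

text \<open>
  The map \<open>h \<otimes> id\<close> for \<open>h : N \<rightarrow> N'\<close>. The union over the representatives \<open>u\<close> of the coset \<open>X\<close> is
  a union of equal cosets.
\<close>

definition tensor_map :: "'r ring \<Rightarrow> ('r, 'n) module \<Rightarrow> ('r, 'k) module \<Rightarrow> ('r, 'm) module \<Rightarrow>
    ('n \<Rightarrow> 'k) \<Rightarrow> ('n \<times> 'm \<Rightarrow>\<^sub>0 int) set \<Rightarrow> ('k \<times> 'm \<Rightarrow>\<^sub>0 int) set" where
  "tensor_map R N N' M h X =
     (\<Union>u\<in>X. tensor_kernel R N' M #>\<^bsub>free_Abelian_group (carrier N' \<times> carrier M)\<^esub>
        frag_extend (\<lambda>(x, y). frag_of (h x, y)) u)"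

definition tor_cycles :: "'r ring \<Rightarrow> (nat \<Rightarrow> ('r, 'p) module) \<Rightarrow> (nat \<Rightarrow> 'p \<Rightarrow> 'p) \<Rightarrow>
    ('r, 'm) module \<Rightarrow> nat \<Rightarrow> ('p \<times> 'm \<Rightarrow>\<^sub>0 int) set set" where
  "tor_cycles R P d M n = (case n of
       0 \<Rightarrow> carrier (tensor_group R (P 0) M)
     | Suc m \<Rightarrow> kernel (tensor_group R (P (Suc m)) M) (tensor_group R (P m) M)
                  (tensor_map R (P (Suc m)) (P m) M (d m)))"

definition tor_boundaries :: "'r ring \<Rightarrow> (nat \<Rightarrow> ('r, 'p) module) \<Rightarrow> (nat \<Rightarrow> 'p \<Rightarrow> 'p) \<Rightarrow>
    ('r, 'm) module \<Rightarrow> nat \<Rightarrow> ('p \<times> 'm \<Rightarrow>\<^sub>0 int) set set" where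
  "tor_boundaries R P d M n =
     tensor_map R (P (Suc n)) (P n) M (d n) ` carrier (tensor_group R (P (Suc n)) M)"

text \<open>
  The homology of \<open>P \<otimes> M\<close>; for a projective resolution \<open>(P, d)\<close> over \<open>op_ring R\<close> of a right module
  \<open>N\<close> this is \<open>Tor\<^sub>n(N, M)\<close>.
\<close>

definition tor_group :: "'r ring \<Rightarrow> (nat \<Rightarrow> ('r, 'p) module) \<Rightarrow> (nat \<Rightarrow> 'p \<Rightarrow> 'p) \<Rightarrow>
    ('r, 'm) module \<Rightarrow> nat \<Rightarrow> ('p \<times> 'm \<Rightarrow>\<^sub>0 int) set set monoid" where
  "tor_group R P d M n =
     (tensor_group R (P n) M)\<lparr>carrier := tor_cycles R P d M n\<rparr> Mod tor_boundaries R P d M n"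

definition Tor_vanishes :: "'r ring \<Rightarrow> nat \<Rightarrow> ('r, 'n) module \<Rightarrow> ('r, 'm) module \<Rightarrow> bool" where
  "Tor_vanishes R n N M \<longleftrightarrow>
     (\<forall>(P :: nat \<Rightarrow> ('r, ('r + 'n) list) module) d e.
        projective_resolution (op_ring R) N P d e \<longrightarrow> trivial_group (tor_group R P d M n))"


section \<open>Weak injective and weak flat modules\<close>

definition weak_injective :: "'s ring \<Rightarrow> ('s, 'm) module \<Rightarrow> bool" where
  "weak_injective S I \<longleftrightarrow> left_module S I \<and>
     (\<forall>F :: ('s, 's list) module. super_fin_presented S F \<longrightarrow> Ext_vanishes S 1 F I)"

definition weak_flat :: "'r ring \<Rightarrow> ('r, 'm) module \<Rightarrow> bool" where
  "weak_flat R M \<longleftrightarrow> left_module R M \<and>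
     (\<forall>F :: ('r, 'r list) module. super_fin_presented (op_ring R) F \<longrightarrow> Tor_vanishes R 1 F M)"


section \<open>Semidualizing bimodules\<close>

record ('s, 'c, 'r) bimodule = "('s, 'c) module" +
  rsmult :: "'c \<Rightarrow> 'r \<Rightarrow> 'c"

definition left_mod :: "('s, 'c, 'r) bimodule \<Rightarrow> ('s, 'c) module" where
  "left_mod C = mk_module (carrier C) (ring.add C) \<zero>\<^bsub>C\<^esub> (module.smult C)"

definition right_mod :: "('s, 'c, 'r) bimodule \<Rightarrow> ('r, 'c) module" where
  "right_mod C = mk_module (carrier C) (ring.add C) \<zero>\<^bsub>C\<^esub> (\<lambda>r c. rsmult C c r)"

definition is_bimodule :: "'s ring \<Rightarrow> 'r ring \<Rightarrow> ('s, 'c, 'r) bimodule \<Rightarrow> bool" where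
  "is_bimodule S R C \<longleftrightarrow>
     left_module S (left_mod C) \<and> left_module (op_ring R) (right_mod C) \<and>
     (\<forall>s\<in>carrier S. \<forall>c\<in>carrier C. \<forall>r\<in>carrier R.
        rsmult C (s \<odot>\<^bsub>C\<^esub> c) r = s \<odot>\<^bsub>C\<^esub> rsmult C c r)"

text \<open>
  The homothety maps are always homomorphisms (of rings, up to passing to the opposite, and of
  bimodules), so that they are isomorphisms as soon as they are bijective.
\<close>

definition semidualizing :: "'s ring \<Rightarrow> 'r ring \<Rightarrow> ('s, 'c, 'r) bimodule \<Rightarrow> bool" where
  "semidualizing S R C \<longleftrightarrow> is_bimodule S R C \<and>
     super_fin_presented S (left_mod C) \<and>
     super_fin_presented (op_ring R) (right_mod C) \<and>
     bij_betw (\<lambda>s. \<lambda>c\<in>carrier C. s \<odot>\<^bsub>C\<^esub> c)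
       (carrier S) (mod_hom (op_ring R) (right_mod C) (right_mod C)) \<and>
     bij_betw (\<lambda>r. \<lambda>c\<in>carrier C. rsmult C c r)
       (carrier R) (mod_hom S (left_mod C) (left_mod C)) \<and>
     (\<forall>i\<ge>1. Ext_vanishes S i (left_mod C) (left_mod C)) \<and>
     (\<forall>i\<ge>1. Ext_vanishes (op_ring R) i (right_mod C) (right_mod C))"

text \<open>
  It suffices to test faithfulness on cyclic modules, since \<open>Hom(C, N) = 0\<close> is inherited by the
  submodules of \<open>N\<close>; see lemma \<open>faithful_all_types\<close>.
\<close>

definition faithfully_semidualizing ::
    "'s ring \<Rightarrow> 'r ring \<Rightarrow> ('s, 'c, 'r) bimodule \<Rightarrow> bool" where
  "faithfully_semidualizing S R C \<longleftrightarrow> semidualizing S R C \<and>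
     (\<forall>N :: ('s, 's list) module. left_module S N \<longrightarrow>
        hom_zero S (left_mod C) N \<longrightarrow> carrier N = {\<zero>\<^bsub>N\<^esub>}) \<and>
     (\<forall>M :: ('r, 'r list) module. left_module (op_ring R) M \<longrightarrow>
        hom_zero (op_ring R) (right_mod C) M \<longrightarrow> carrier M = {\<zero>\<^bsub>M\<^esub>})"

text \<open>The left \<open>S\<close>-module \<open>C \<otimes>\<^sub>R F\<close>.\<close>

definition tensor_mod ::
    "'r ring \<Rightarrow> ('s, 'c, 'r) bimodule \<Rightarrow> ('r, 'f) module \<Rightarrow> ('s, ('c \<times> 'f \<Rightarrow>\<^sub>0 int) set) module" where
  "tensor_mod R C F = (let T = tensor_group R (right_mod C) F in
     mk_module (carrier T) (monoid.mult T) \<one>\<^bsub>T\<^esub>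
       (\<lambda>s. tensor_map R (right_mod C) (right_mod C) F (\<lambda>c. s \<odot>\<^bsub>C\<^esub> c)))"

text \<open>The left \<open>R\<close>-module \<open>Hom\<^sub>S(C, I)\<close>, where \<open>(r f)(c) = f(c r)\<close>.\<close>

definition hom_mod ::
    "'s ring \<Rightarrow> ('s, 'c, 'r) bimodule \<Rightarrow> ('s, 'i) module \<Rightarrow> ('r, 'c \<Rightarrow> 'i) module" where
  "hom_mod S C I = (let H = hom_group S (left_mod C) I in
     mk_module (carrier H) (monoid.mult H) \<one>\<^bsub>H\<^esub>
       (\<lambda>r f. \<lambda>c\<in>carrier C. f (rsmult C c r)))"

text \<open>
  The first argument fixes the type of the modules from which \<open>F\<close> and \<open>I\<close> are taken. If \<open>C\<close> is
  semidualizing, weak flat \<open>F\<close> and weak injective \<open>I\<close> are recovered as \<open>F \<cong> Hom\<^sub>S(C, M)\<close> and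
  \<open>I \<cong> C \<otimes>\<^sub>R M\<close>, so that the types \<open>'c \<Rightarrow> 'm\<close> and \<open>('c \<times> 'm \<Rightarrow>\<^sub>0 int) set\<close> give the
  whole class.
\<close>

definition C_weak_flat ::
    "'f itself \<Rightarrow> 's ring \<Rightarrow> 'r ring \<Rightarrow> ('s, 'c, 'r) bimodule \<Rightarrow> ('s, 'm) module \<Rightarrow> bool" where
  "C_weak_flat _ S R C M \<longleftrightarrow> left_module S M \<and>
     (\<exists>F :: ('r, 'f) module. weak_flat R F \<and> mod_isomorphic S M (tensor_mod R C F))"

definition C_weak_injective ::
    "'i itself \<Rightarrow> 's ring \<Rightarrow> 'r ring \<Rightarrow> ('s, 'c, 'r) bimodule \<Rightarrow> ('r, 'm) module \<Rightarrow> bool" where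
  "C_weak_injective _ S R C M \<longleftrightarrow> left_module R M \<and>
     (\<exists>I :: ('s, 'i) module. weak_injective S I \<and> mod_isomorphic R M (hom_mod S C I))"


section \<open>Purity\<close>

definition short_exact :: "'r ring \<Rightarrow> ('r, 'a) module \<Rightarrow> ('a \<Rightarrow> 'b) \<Rightarrow> ('r, 'b) module \<Rightarrow>
    ('b \<Rightarrow> 'd) \<Rightarrow> ('r, 'd) module \<Rightarrow> bool" where
  "short_exact R A f B g D \<longleftrightarrow>
     left_module R A \<and> left_module R B \<and> left_module R D \<and>
     f \<in> mod_hom R A B \<and> g \<in> mod_hom R B D \<and>
     inj_on f (carrier A) \<and> f ` carrier A = mod_kernel B D g \<and> g ` carrier B = carrier D"

definition pure_exact :: "'r ring \<Rightarrow> ('r, 'a) module \<Rightarrow> ('a \<Rightarrow> 'b) \<Rightarrow> ('r, 'b) module \<Rightarrow>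
    ('b \<Rightarrow> 'd) \<Rightarrow> ('r, 'd) module \<Rightarrow> bool" where
  "pure_exact R A f B g D \<longleftrightarrow> short_exact R A f B g D \<and>
     (\<forall>P :: ('r, 'r list) module. fin_presented R P \<longrightarrow>
        (\<lambda>h. compose (carrier P) g h) ` mod_hom R P B = mod_hom R P D)"


section \<open>The types of test modules are large enough\<close>

lemma copy_along_injection:
  fixes M :: "('r, 'm) module" and \<iota> :: "'m \<Rightarrow> 'u"
  assumes M: "left_module R M" and inj: "inj_on \<iota> (carrier M)"
  obtains M' :: "('r, 'u) module" and f g where "left_module R M'"
    and "f \<in> mod_hom R M M'" and "bij_betw f (carrier M) (carrier M')"
    and "g \<in> mod_hom R M' M" and "bij_betw g (carrier M') (carrier M)"
proof -
  interpret left_module R M by (fact M)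
  define j where "j = inv_into (carrier M) \<iota>"
  have j [simp]: "j (\<iota> x) = x" if "x \<in> carrier M" for x
    using inj that by (simp add: j_def)
  define M' :: "('r, 'u) module" where "M' = mk_module (\<iota> ` carrier M)
    (\<lambda>u v. \<iota> (j u \<oplus>\<^bsub>M\<^esub> j v)) (\<iota> \<zero>\<^bsub>M\<^esub>) (\<lambda>a u. \<iota> (a \<odot>\<^bsub>M\<^esub> j u))"
  note M'_simps = M'_def mk_module_def
  have "abelian_group M'"
  proof (rule abelian_groupI)
    fix u assume "u \<in> carrier M'"
    then obtain x where "x \<in> carrier M" "u = \<iota> x" by (auto simp: M'_simps)
    then show "\<exists>v\<in>carrier M'. v \<oplus>\<^bsub>M'\<^esub> u = \<zero>\<^bsub>M'\<^esub>"
      by (intro bexI[of _ "\<iota> (\<ominus>\<^bsub>M\<^esub> x)"]) (auto simp: M'_simps M.l_neg)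
  qed (auto simp: M'_simps M.a_ac)
  then have 1: "left_module R M'"
    by (intro left_module.intro R.ring_axioms left_module_axioms.intro)
       (auto simp: M'_simps smult_l_distr smult_r_distr smult_assoc1)
  moreover have "restrict \<iota> (carrier M) \<in> mod_hom R M M'"
    by (auto simp: mod_hom_def M'_simps)
  moreover have "bij_betw (restrict \<iota> (carrier M)) (carrier M) (carrier M')"
    using inj by (auto simp: bij_betw_def M'_simps)
  moreover have "restrict j (carrier M') \<in> mod_hom R M' M"
    by (auto simp: mod_hom_def M'_simps)
  moreover have "bij_betw (restrict j (carrier M')) (carrier M') (carrier M)"
    by (auto simp: bij_betw_def M'_simps inj_on_def image_image)
  ultimately show thesis by (rule that)
qed

lemma (in left_module) smult_zero_l:
  assumes "x \<in> carrier M" shows "\<zero>\<^bsub>R\<^esub> \<odot>\<^bsub>M\<^esub> x = \<zero>\<^bsub>M\<^esub>"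
proof -
  have "\<zero>\<^bsub>R\<^esub> \<odot>\<^bsub>M\<^esub> x \<oplus>\<^bsub>M\<^esub> \<zero>\<^bsub>R\<^esub> \<odot>\<^bsub>M\<^esub> x = \<zero>\<^bsub>R\<^esub> \<odot>\<^bsub>M\<^esub> x \<oplus>\<^bsub>M\<^esub> \<zero>\<^bsub>M\<^esub>"
    using smult_l_distr[of "\<zero>\<^bsub>R\<^esub>" "\<zero>\<^bsub>R\<^esub>" x] assms by simp
  then show ?thesis using assms by (simp add: M.add.l_cancel_one)
qed

lemma (in left_module) smult_zero_r:
  assumes "a \<in> carrier R" shows "a \<odot>\<^bsub>M\<^esub> \<zero>\<^bsub>M\<^esub> = \<zero>\<^bsub>M\<^esub>"
proof -
  have "a \<odot>\<^bsub>M\<^esub> \<zero>\<^bsub>M\<^esub> \<oplus>\<^bsub>M\<^esub> a \<odot>\<^bsub>M\<^esub> \<zero>\<^bsub>M\<^esub> = a \<odot>\<^bsub>M\<^esub> \<zero>\<^bsub>M\<^esub> \<oplus>\<^bsub>M\<^esub> \<zero>\<^bsub>M\<^esub>"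
    using smult_r_distr[of a "\<zero>\<^bsub>M\<^esub>" "\<zero>\<^bsub>M\<^esub>"] assms by simp
  then show ?thesis using assms by (simp add: M.add.l_cancel_one)
qed

lemma (in left_module) smult_neg:
  assumes "a \<in> carrier R" "x \<in> carrier M"
  shows "\<ominus>\<^bsub>M\<^esub> (a \<odot>\<^bsub>M\<^esub> x) = (\<ominus>\<^bsub>R\<^esub> a) \<odot>\<^bsub>M\<^esub> x"
    and "\<ominus>\<^bsub>M\<^esub> (a \<odot>\<^bsub>M\<^esub> x) = a \<odot>\<^bsub>M\<^esub> (\<ominus>\<^bsub>M\<^esub> x)"
proof -
  have "(\<ominus>\<^bsub>R\<^esub> a) \<odot>\<^bsub>M\<^esub> x \<oplus>\<^bsub>M\<^esub> a \<odot>\<^bsub>M\<^esub> x = \<zero>\<^bsub>M\<^esub>"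
    using smult_l_distr[of "\<ominus>\<^bsub>R\<^esub> a" a x] assms smult_zero_l by (simp add: R.l_neg)
  then show "\<ominus>\<^bsub>M\<^esub> (a \<odot>\<^bsub>M\<^esub> x) = (\<ominus>\<^bsub>R\<^esub> a) \<odot>\<^bsub>M\<^esub> x"
    using assms by (intro M.minus_equality) auto
  have "a \<odot>\<^bsub>M\<^esub> (\<ominus>\<^bsub>M\<^esub> x) \<oplus>\<^bsub>M\<^esub> a \<odot>\<^bsub>M\<^esub> x = \<zero>\<^bsub>M\<^esub>"
    using smult_r_distr[of a "\<ominus>\<^bsub>M\<^esub> x" x] assms smult_zero_r by (simp add: M.l_neg)
  then show "\<ominus>\<^bsub>M\<^esub> (a \<odot>\<^bsub>M\<^esub> x) = a \<odot>\<^bsub>M\<^esub> (\<ominus>\<^bsub>M\<^esub> x)"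
    using assms by (intro M.minus_equality) auto
qed

lemma (in left_module) left_submoduleI:
  assumes "H \<subseteq> carrier M" "\<zero>\<^bsub>M\<^esub> \<in> H" "\<And>x. x \<in> H \<Longrightarrow> \<ominus>\<^bsub>M\<^esub> x \<in> H"
    "\<And>x y. x \<in> H \<Longrightarrow> y \<in> H \<Longrightarrow> x \<oplus>\<^bsub>M\<^esub> y \<in> H"
    "\<And>a x. a \<in> carrier R \<Longrightarrow> x \<in> H \<Longrightarrow> a \<odot>\<^bsub>M\<^esub> x \<in> H"
  shows "submodule H R M"
  by (intro submodule.intro subgroup.intro submodule_axioms.intro)
     (use assms in \<open>auto simp: a_inv_def\<close>)

lemma (in left_module) left_submoduleD:
  assumes "submodule H R M"
  shows "H \<subseteq> carrier M" "\<zero>\<^bsub>M\<^esub> \<in> H" "\<And>x. x \<in> H \<Longrightarrow> \<ominus>\<^bsub>M\<^esub> x \<in> H"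
    "\<And>x y. x \<in> H \<Longrightarrow> y \<in> H \<Longrightarrow> x \<oplus>\<^bsub>M\<^esub> y \<in> H"
    "\<And>a x. a \<in> carrier R \<Longrightarrow> x \<in> H \<Longrightarrow> a \<odot>\<^bsub>M\<^esub> x \<in> H"
proof -
  interpret H: submodule H R M by (fact assms)
  show "H \<subseteq> carrier M" "\<zero>\<^bsub>M\<^esub> \<in> H" "\<And>x. x \<in> H \<Longrightarrow> \<ominus>\<^bsub>M\<^esub> x \<in> H"
    "\<And>x y. x \<in> H \<Longrightarrow> y \<in> H \<Longrightarrow> x \<oplus>\<^bsub>M\<^esub> y \<in> H"
    "\<And>a x. a \<in> carrier R \<Longrightarrow> x \<in> H \<Longrightarrow> a \<odot>\<^bsub>M\<^esub> x \<in> H"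
    using H.subset H.one_closed H.m_inv_closed H.m_closed by (auto simp: a_inv_def)
qed

lemma (in left_module) left_submodule_is_module:
  assumes "submodule H R M" shows "left_module R (M\<lparr>carrier := H\<rparr>)"
proof -
  note H = left_submoduleD[OF assms]
  have "abelian_group (M\<lparr>carrier := H\<rparr>)"
  proof (rule abelian_groupI)
    fix x assume x: "x \<in> carrier (M\<lparr>carrier := H\<rparr>)"
    then show "\<exists>y\<in>carrier (M\<lparr>carrier := H\<rparr>).
        y \<oplus>\<^bsub>M\<lparr>carrier := H\<rparr>\<^esub> x = \<zero>\<^bsub>M\<lparr>carrier := H\<rparr>\<^esub>"
      using H by (intro bexI[of _ "\<ominus>\<^bsub>M\<^esub> x"]) (auto simp: M.l_neg subset_iff)
  qed (use H in \<open>auto simp: subset_iff M.a_ac\<close>)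
  then show ?thesis
    by (intro left_module.intro R.ring_axioms left_module_axioms.intro)
       (use H in \<open>auto simp: subset_iff smult_l_distr smult_r_distr smult_assoc1\<close>)
qed

lemma (in left_module) finite_span_parametrized:
  assumes "finite X" "X \<subseteq> carrier M"
  shows "\<exists>H (\<phi> :: 'r list \<Rightarrow> 'm). submodule H R M \<and> X \<subseteq> H \<and> H \<subseteq> range \<phi>"
  using assms
proof (induction X rule: finite_induct)
  case empty
  have "submodule {\<zero>\<^bsub>M\<^esub>} R M" by (rule left_submoduleI) (auto simp: smult_zero_r)
  then show ?case by (intro exI[of _ "{\<zero>\<^bsub>M\<^esub>}"] exI[of _ "\<lambda>_. \<zero>\<^bsub>M\<^esub>"]) auto
next
  case (insert x X)
  then obtain H and \<phi> :: "'r list \<Rightarrow> 'm" where sub: "submodule H R M" and "X \<subseteq> H" and \<phi>: "H \<subseteq> range \<phi>"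
    by auto
  note H = left_submoduleD[OF sub]
  have x: "x \<in> carrier M" using insert by auto
  define H' where "H' = {a \<odot>\<^bsub>M\<^esub> x \<oplus>\<^bsub>M\<^esub> h | a h. a \<in> carrier R \<and> h \<in> H}"
  have H'I: "a \<odot>\<^bsub>M\<^esub> x \<oplus>\<^bsub>M\<^esub> h \<in> H'" if "a \<in> carrier R" "h \<in> H" for a h
    using that by (auto simp: H'_def)
  have "submodule H' R M"
  proof (rule left_submoduleI)
    show "H' \<subseteq> carrier M" using H x by (auto simp: H'_def)
    show "\<zero>\<^bsub>M\<^esub> \<in> H'" using H'I[of "\<zero>\<^bsub>R\<^esub>" "\<zero>\<^bsub>M\<^esub>"] H x by (simp add: smult_zero_l)
  next
    fix u assume "u \<in> H'"
    then obtain a h where ah: "a \<in> carrier R" "h \<in> H" "u = a \<odot>\<^bsub>M\<^esub> x \<oplus>\<^bsub>M\<^esub> h" by (auto simp: H'_def)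
    then have h: "h \<in> carrier M" using H by auto
    show "\<ominus>\<^bsub>M\<^esub> u \<in> H'"
      using H'I[of "\<ominus>\<^bsub>R\<^esub> a" "\<ominus>\<^bsub>M\<^esub> h"] H(3) ah h x by (simp add: M.minus_add smult_neg(1)[symmetric])
    fix b assume b: "b \<in> carrier R"
    show "b \<odot>\<^bsub>M\<^esub> u \<in> H'"
      using H'I[of "b \<otimes>\<^bsub>R\<^esub> a" "b \<odot>\<^bsub>M\<^esub> h"] H(5) ah h x b by (simp add: smult_r_distr smult_assoc1)
  next
    fix u v assume "u \<in> H'" "v \<in> H'"
    then obtain a h b k where ah: "a \<in> carrier R" "h \<in> H" "u = a \<odot>\<^bsub>M\<^esub> x \<oplus>\<^bsub>M\<^esub> h"
      "b \<in> carrier R" "k \<in> H" "v = b \<odot>\<^bsub>M\<^esub> x \<oplus>\<^bsub>M\<^esub> k" by (auto simp: H'_def)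
    then have hk: "h \<in> carrier M" "k \<in> carrier M" using H by auto
    have "u \<oplus>\<^bsub>M\<^esub> v = (a \<oplus>\<^bsub>R\<^esub> b) \<odot>\<^bsub>M\<^esub> x \<oplus>\<^bsub>M\<^esub> (h \<oplus>\<^bsub>M\<^esub> k)"
      using ah hk x by (simp add: smult_l_distr M.a_ac)
    then show "u \<oplus>\<^bsub>M\<^esub> v \<in> H'" using H'I[of "a \<oplus>\<^bsub>R\<^esub> b" "h \<oplus>\<^bsub>M\<^esub> k"] H(4) ah by simp
  qed
  moreover have "insert x X \<subseteq> H'"
  proof -
    have "x \<in> H'" using H'I[of "\<one>\<^bsub>R\<^esub>" "\<zero>\<^bsub>M\<^esub>"] H x by simp
    moreover have "h \<in> H'" if "h \<in> H" for h
      using H'I[of "\<zero>\<^bsub>R\<^esub>" h] H that x by (auto simp: smult_zero_l subset_iff)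
    ultimately show ?thesis using \<open>X \<subseteq> H\<close> by auto
  qed
  moreover have "H' \<subseteq> range (\<lambda>l. hd l \<odot>\<^bsub>M\<^esub> x \<oplus>\<^bsub>M\<^esub> \<phi> (tl l))"
  proof
    fix u assume "u \<in> H'"
    then obtain a l where "u = a \<odot>\<^bsub>M\<^esub> x \<oplus>\<^bsub>M\<^esub> \<phi> l" using \<phi> by (auto simp: H'_def)
    then show "u \<in> range (\<lambda>l. hd l \<odot>\<^bsub>M\<^esub> x \<oplus>\<^bsub>M\<^esub> \<phi> (tl l))" by (intro range_eqI[of _ _ "a # l"]) simp
  qed
  ultimately show ?case by blast
qed

lemma fin_gen_copy:
  fixes M :: "('r, 'm) module"
  assumes "left_module R M" "fin_gen R M"
  shows "\<exists>M' :: ('r, 'r list) module. left_module R M' \<and> mod_isomorphic R M M'"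
proof -
  interpret left_module R M by fact
  obtain \<phi> :: "'r list \<Rightarrow> 'm" where \<phi>: "carrier M \<subseteq> range \<phi>"
    using assms(2) finite_span_parametrized unfolding fin_gen_def by metis
  then have "inj_on (inv_into UNIV \<phi>) (carrier M)" by (rule inj_on_inv_into)
  then show ?thesis using copy_along_injection[OF assms(1)] unfolding mod_isomorphic_def by metis
qed

lemma hom_zero_all_types:
  fixes K :: "('r, 'c) module" and N :: "('r, 'n) module"
  assumes faithful: "\<And>N' :: ('r, 'r list) module. left_module R N' \<Longrightarrow>
      hom_zero R K N' \<Longrightarrow> carrier N' = {\<zero>\<^bsub>N'\<^esub>}"
    and K: "left_module R K" and N: "left_module R N" and triv: "hom_zero R K N"
  shows "carrier N = {\<zero>\<^bsub>N\<^esub>}"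
proof -
  interpret K: left_module R K by (fact K)
  interpret N: left_module R N by (fact N)
  have "x = \<zero>\<^bsub>N\<^esub>" if x: "x \<in> carrier N" for x
  proof -
    obtain H and \<phi> :: "'r list \<Rightarrow> 'n" where sub: "submodule H R N" and xH: "{x} \<subseteq> H" and \<phi>: "H \<subseteq> range \<phi>"
      using N.finite_span_parametrized[of "{x}"] x by auto
    note H = N.left_submoduleD[OF sub]
    define L where "L = N\<lparr>carrier := H\<rparr>"
    have L: "left_module R L" unfolding L_def by (rule N.left_submodule_is_module[OF sub])
    have "inj_on (inv_into UNIV \<phi>) (carrier L)" using \<phi> by (simp add: L_def inj_on_inv_into)
    then obtain N' :: "('r, 'r list) module" and f g where N': "left_module R N'"
      and f: "bij_betw f (carrier L) (carrier N')"
      and g: "g \<in> mod_hom R N' L" "bij_betw g (carrier N') (carrier L)"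
      by (rule copy_along_injection[OF L])
    interpret N': left_module R N' by (fact N')
    have "h = (\<lambda>c\<in>carrier K. \<zero>\<^bsub>N'\<^esub>)" if h: "h \<in> mod_hom R K N'" for h
    proof -
      have "compose (carrier K) g h' \<in> mod_hom R K N" if "h' \<in> mod_hom R K N'" for h'
        using that g(1) H(1) unfolding mod_hom_def L_def
        by (auto simp: compose_def PiE_iff subset_iff)
      moreover have "mod_hom R K N = {\<lambda>c\<in>carrier K. \<zero>\<^bsub>N\<^esub>}"
        using triv by (simp add: hom_zero_def)
      moreover have z: "(\<lambda>c\<in>carrier K. \<zero>\<^bsub>N'\<^esub>) \<in> mod_hom R K N'"
        by (auto simp: mod_hom_def N'.smult_zero_r)
      ultimately have eq: "compose (carrier K) g h = compose (carrier K) g (\<lambda>c\<in>carrier K. \<zero>\<^bsub>N'\<^esub>)"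
        using h by (metis singletonD)
      have "h c = \<zero>\<^bsub>N'\<^esub>" if "c \<in> carrier K" for c
      proof -
        have "g (h c) = g \<zero>\<^bsub>N'\<^esub>" using fun_cong[OF eq, of c] that by (simp add: compose_def)
        moreover have "h c \<in> carrier N'" using h that by (auto simp: mod_hom_def)
        ultimately show ?thesis using g(2) by (auto simp: bij_betw_def inj_on_def)
      qed
      then show ?thesis using h by (auto simp: mod_hom_def PiE_iff extensional_def fun_eq_iff)
    qed
    moreover have "(\<lambda>c\<in>carrier K. \<zero>\<^bsub>N'\<^esub>) \<in> mod_hom R K N'"
      by (auto simp: mod_hom_def N'.smult_zero_r)
    ultimately have "hom_zero R K N'"
      unfolding hom_zero_def by blast
    then have "carrier N' = {\<zero>\<^bsub>N'\<^esub>}" using faithful N' by blast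
    moreover have "\<zero>\<^bsub>N\<^esub> \<in> carrier L" "x \<in> carrier L" using H(2) xH by (auto simp: L_def)
    ultimately show ?thesis using f by (metis bij_betw_apply bij_betw_imp_inj_on inj_onD singletonD)
  qed
  then show ?thesis by auto
qed

lemma faithful_all_types:
  fixes N :: "('s, 'n) module" and M :: "('r, 'm) module"
    and C :: "('s, 'c, 'r) bimodule"
  assumes C: "faithfully_semidualizing S R C"
  shows "left_module S N \<Longrightarrow> hom_zero S (left_mod C) N \<Longrightarrow> carrier N = {\<zero>\<^bsub>N\<^esub>}"
    and "left_module (op_ring R) M \<Longrightarrow> hom_zero (op_ring R) (right_mod C) M \<Longrightarrow>
      carrier M = {\<zero>\<^bsub>M\<^esub>}"
proof -
  have mods: "left_module S (left_mod C)" "left_module (op_ring R) (right_mod C)"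
    using C by (auto simp: faithfully_semidualizing_def semidualizing_def is_bimodule_def)
  have l: "\<And>N :: ('s, 's list) module. left_module S N \<Longrightarrow>
      hom_zero S (left_mod C) N \<Longrightarrow> carrier N = {\<zero>\<^bsub>N\<^esub>}"
    and r: "\<And>M :: ('r, 'r list) module. left_module (op_ring R) M \<Longrightarrow>
      hom_zero (op_ring R) (right_mod C) M \<Longrightarrow> carrier M = {\<zero>\<^bsub>M\<^esub>}"
    using C unfolding faithfully_semidualizing_def by blast+
  show "left_module S N \<Longrightarrow> hom_zero S (left_mod C) N \<Longrightarrow> carrier N = {\<zero>\<^bsub>N\<^esub>}"
    by (rule hom_zero_all_types[OF l mods(1)])
  show "left_module (op_ring R) M \<Longrightarrow> hom_zero (op_ring R) (right_mod C) M \<Longrightarrow>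
      carrier M = {\<zero>\<^bsub>M\<^esub>}"
    by (rule hom_zero_all_types[OF r mods(2)])
qed

end

theory Submission
  imports Defs
begin

text \<open>
  If \<open>F\<^sub>2 \<rightarrow> F\<^sub>1 \<rightarrow> F\<^sub>0 \<rightarrow> K \<rightarrow> 0\<close> is the beginning of a resolution by finitely generated free modules,
  then \<open>Ext\<^sup>1(K, I) = 0\<close> and \<open>Tor\<^sub>1(K, M) = 0\<close> say that two matrices form an exact sequence on powers
  of \<open>I\<close> and of \<open>M\<close>. Purity means that finite systems of linear equations can be solved in the
  submodule, so that weak injectivity and weak flatness pass to pure submodules and pure quotients.

  Applying \<open>Hom(-, C)\<close> to a presentation of \<open>C\<close> gives an exact sequence \<open>0 \<rightarrow> R \<rightarrow> C\<^sup>n \<rightarrow> C\<^sup>m\<close> whose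
  cokernels are super finitely presented. Hence \<open>F \<rightarrow> Hom(C, C \<otimes> F)\<close> is bijective for weak flat \<open>F\<close>,
  and symmetrically \<open>C \<otimes> Hom(C, I) \<rightarrow> I\<close> is bijective for weak injective \<open>I\<close>. Since \<open>C\<close> is finitely
  presented on both sides, \<open>Hom(C, -)\<close> and \<open>C \<otimes> -\<close> preserve pure exact sequences. For a pure exact
  sequence with middle term \<open>C \<otimes> F\<close>, the modules \<open>Hom(C, A)\<close> and \<open>Hom(C, D)\<close> are therefore weak
  flat. By faithfulness, \<open>C \<otimes> Hom(C, D) \<rightarrow> D\<close> is injective, because its kernel \<open>K\<close> satisfies
  \<open>Hom(C, K) = 0\<close>; the same holds for \<open>A\<close>, and a diagram chase gives surjectivity. The second part
  is dual, with faithfulness showing that \<open>A \<rightarrow> Hom(C, C \<otimes> A)\<close> is surjective.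
\<close>

section \<open>Homomorphisms and submodules\<close>

text \<open>Ext and Tor are defined through all projective resolutions with terms in a fixed type,
  whereas purity speaks of single matrices. The bridge is a condition on a surjection
  \<open>Y \<rightarrow> K\<close>: homomorphisms on its kernel extend to \<open>Y\<close>, or its
  kernel still embeds after tensoring. If this holds for one projective \<open>Y\<close>, it holds
  for every \<open>Y\<close>, projective or not. The arbitrary \<open>Y\<close> serves twice: it
  makes the choice of the resolution irrelevant, and it lets powers of \<open>C\<close> stand where
  a free module would, so that weak injectivity and weak flatness apply to the coresolution without
  connecting homomorphisms. The cokernels there are super finitely presented because this class is
  closed under extensions and, through syzygies, under cokernels of injections between its members.
  Purity passes through Hom(C, -) and \<open>C \<otimes> -\<close> in the form of linear systems: a
  system over Hom(C, A) is a question about homomorphisms on a power of \<open>C\<close>, a system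
  over \<open>C \<otimes> A\<close> a question about tensoring \<open>A\<close> with the cokernel of
  a matrix on powers of \<open>C\<close>.\<close>

lemma mk_module_simps [simp]:
  "carrier (mk_module A p z s) = A" "ring.add (mk_module A p z s) = p"
  "ring.zero (mk_module A p z s) = z" "module.smult (mk_module A p z s) = s"
  by (simp_all add: mk_module_def)

lemma mod_homI:
  assumes "\<And>x. x \<in> carrier M \<Longrightarrow> f x \<in> carrier N"
    and "\<And>x y. x \<in> carrier M \<Longrightarrow> y \<in> carrier M \<Longrightarrow> f (x \<oplus>\<^bsub>M\<^esub> y) = f x \<oplus>\<^bsub>N\<^esub> f y"
    and "\<And>a x. a \<in> carrier R \<Longrightarrow> x \<in> carrier M \<Longrightarrow> f (a \<odot>\<^bsub>M\<^esub> x) = a \<odot>\<^bsub>N\<^esub> f x"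
    and "f \<in> extensional (carrier M)"
  shows "f \<in> mod_hom R M N"
  using assms by (auto simp: mod_hom_def PiE_iff)

lemma mod_hom_restrictI:
  assumes "left_module R M" "\<And>x. x \<in> carrier M \<Longrightarrow> f x \<in> carrier N"
    and "\<And>x y. x \<in> carrier M \<Longrightarrow> y \<in> carrier M \<Longrightarrow> f (x \<oplus>\<^bsub>M\<^esub> y) = f x \<oplus>\<^bsub>N\<^esub> f y"
    and "\<And>a x. a \<in> carrier R \<Longrightarrow> x \<in> carrier M \<Longrightarrow> f (a \<odot>\<^bsub>M\<^esub> x) = a \<odot>\<^bsub>N\<^esub> f x"
  shows "restrict f (carrier M) \<in> mod_hom R M N"
proof -
  interpret M: left_module R M by fact
  show ?thesis using assms(2-) by (intro mod_homI) auto
qed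

abbreviation idm :: "('r, 'm) module \<Rightarrow> 'm \<Rightarrow> 'm" where
  "idm M \<equiv> restrict (\<lambda>x. x) (carrier M)"

lemma mod_hom_id: "left_module R M \<Longrightarrow> idm M \<in> mod_hom R M M"
  by (rule mod_hom_restrictI) auto

lemma mod_homD:
  assumes "f \<in> mod_hom R M N"
  shows mod_hom_closed: "x \<in> carrier M \<Longrightarrow> f x \<in> carrier N"
    and mod_hom_add: "x \<in> carrier M \<Longrightarrow> y \<in> carrier M \<Longrightarrow> f (x \<oplus>\<^bsub>M\<^esub> y) = f x \<oplus>\<^bsub>N\<^esub> f y"
    and mod_hom_smult: "a \<in> carrier R \<Longrightarrow> x \<in> carrier M \<Longrightarrow> f (a \<odot>\<^bsub>M\<^esub> x) = a \<odot>\<^bsub>N\<^esub> f x"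
    and mod_hom_ext: "f \<in> extensional (carrier M)"
  using assms by (auto simp: mod_hom_def PiE_iff)

lemma mod_hom_eqI:
  assumes "f \<in> mod_hom R M N" "g \<in> mod_hom R M N" "\<And>x. x \<in> carrier M \<Longrightarrow> f x = g x"
  shows "f = g"
  using assms by (meson extensionalityI mod_hom_ext)

lemma mod_hom_zero:
  assumes "left_module R M" "left_module R N" "f \<in> mod_hom R M N"
  shows "f \<zero>\<^bsub>M\<^esub> = \<zero>\<^bsub>N\<^esub>"
proof -
  interpret M: left_module R M by fact
  interpret N: left_module R N by fact
  have "f \<zero>\<^bsub>M\<^esub> = \<zero>\<^bsub>R\<^esub> \<odot>\<^bsub>N\<^esub> f \<zero>\<^bsub>M\<^esub>"
    by (metis M.M.zero_closed M.R.zero_closed M.smult_zero_l assms(3) mod_hom_smult)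
  then show ?thesis using assms(3) N.smult_zero_l by (simp add: mod_hom_closed)
qed

lemma mod_hom_neg:
  assumes "left_module R M" "left_module R N" "f \<in> mod_hom R M N" "x \<in> carrier M"
  shows "f (\<ominus>\<^bsub>M\<^esub> x) = \<ominus>\<^bsub>N\<^esub> f x"
proof -
  interpret M: left_module R M by fact
  interpret N: left_module R N by fact
  have "f (\<ominus>\<^bsub>M\<^esub> x) \<oplus>\<^bsub>N\<^esub> f x = \<zero>\<^bsub>N\<^esub>"
    using assms mod_hom_zero[OF assms(1-3)]
    by (metis M.M.a_inv_closed M.M.l_neg mod_hom_add)
  then have "\<ominus>\<^bsub>N\<^esub> f x = f (\<ominus>\<^bsub>M\<^esub> x)"
    using assms by (intro N.M.minus_equality) (auto simp: mod_hom_closed)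
  then show ?thesis by simp
qed

lemma mod_hom_minus:
  assumes "left_module R M" "left_module R N" "f \<in> mod_hom R M N" "x \<in> carrier M" "y \<in> carrier M"
  shows "f (x \<ominus>\<^bsub>M\<^esub> y) = f x \<ominus>\<^bsub>N\<^esub> f y"
proof -
  interpret M: left_module R M by fact
  show ?thesis using assms by (simp add: a_minus_def mod_hom_add mod_hom_neg)
qed

lemma (in left_module) neg_zero [simp]: "\<ominus>\<^bsub>M\<^esub> \<zero>\<^bsub>M\<^esub> = \<zero>\<^bsub>M\<^esub>"
  by (intro M.minus_equality) auto

lemma (in left_module) minus_eq_zero:
  assumes "x \<in> carrier M" "y \<in> carrier M"
  shows "x \<ominus>\<^bsub>M\<^esub> y = \<zero>\<^bsub>M\<^esub> \<longleftrightarrow> x = y"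
  using assms by (metis M.add.inv_closed M.add.inv_equality M.add.inv_inv M.r_neg a_minus_def)

lemma (in left_module) minus_smult:
  assumes "a \<in> carrier R" "x \<in> carrier M" "y \<in> carrier M"
  shows "a \<odot>\<^bsub>M\<^esub> (x \<ominus>\<^bsub>M\<^esub> y) = a \<odot>\<^bsub>M\<^esub> x \<ominus>\<^bsub>M\<^esub> a \<odot>\<^bsub>M\<^esub> y"
  using assms by (simp add: a_minus_def smult_r_distr smult_neg(2))

lemma (in left_module) minus_add_cancel:
  assumes "x \<in> carrier M" "y \<in> carrier M"
  shows "(x \<ominus>\<^bsub>M\<^esub> y) \<oplus>\<^bsub>M\<^esub> y = x" "y \<oplus>\<^bsub>M\<^esub> (x \<ominus>\<^bsub>M\<^esub> y) = x" "(x \<oplus>\<^bsub>M\<^esub> y) \<ominus>\<^bsub>M\<^esub> y = x"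
    "(y \<oplus>\<^bsub>M\<^esub> x) \<ominus>\<^bsub>M\<^esub> y = x" "x \<ominus>\<^bsub>M\<^esub> (x \<ominus>\<^bsub>M\<^esub> y) = y"
  using assms
      apply (simp_all add: a_minus_def M.minus_add)
      apply (metis M.a_assoc M.a_inv_closed M.l_neg M.r_zero)
     apply (metis M.a_inv_closed M.a_lcomm M.r_neg M.r_zero)
    apply (metis M.a_assoc M.a_inv_closed M.r_neg M.r_zero)
   apply (metis M.a_assoc M.a_comm M.a_inv_closed M.r_neg M.r_zero)
  by (metis M.a_assoc M.a_inv_closed M.l_zero M.minus_minus M.r_neg)

lemma mod_hom_inj_iff:
  assumes "left_module R M" "left_module R N" "f \<in> mod_hom R M N"
  shows "inj_on f (carrier M) \<longleftrightarrow> (\<forall>x\<in>carrier M. f x = \<zero>\<^bsub>N\<^esub> \<longrightarrow> x = \<zero>\<^bsub>M\<^esub>)"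
proof -
  interpret M: left_module R M by fact
  interpret N: left_module R N by fact
  show ?thesis
  proof
    assume "inj_on f (carrier M)"
    then show "\<forall>x\<in>carrier M. f x = \<zero>\<^bsub>N\<^esub> \<longrightarrow> x = \<zero>\<^bsub>M\<^esub>"
      using mod_hom_zero[OF assms] by (metis M.M.zero_closed inj_onD)
  next
    assume *: "\<forall>x\<in>carrier M. f x = \<zero>\<^bsub>N\<^esub> \<longrightarrow> x = \<zero>\<^bsub>M\<^esub>"
    show "inj_on f (carrier M)"
    proof (rule inj_onI)
      fix x y assume xy: "x \<in> carrier M" "y \<in> carrier M" "f x = f y"
      then have "f (x \<ominus>\<^bsub>M\<^esub> y) = \<zero>\<^bsub>N\<^esub>"
        using mod_hom_minus[OF assms] assms by (simp add: N.minus_eq_zero mod_hom_closed)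
      then show "x = y" using * xy by (metis M.M.minus_closed M.minus_eq_zero)
    qed
  qed
qed

lemma mod_hom_compose:
  assumes "left_module R M" "f \<in> mod_hom R M N" "g \<in> mod_hom R N P"
  shows "compose (carrier M) g f \<in> mod_hom R M P"
proof -
  interpret M: left_module R M by fact
  show ?thesis using assms(2,3)
    by (intro mod_homI) (auto simp: compose_def mod_hom_closed mod_hom_add mod_hom_smult)
qed

lemma mod_hom_inverse:
  assumes "left_module R M" "left_module R N" "f \<in> mod_hom R M N"
    and "bij_betw f (carrier M) (carrier N)"
  shows "restrict (inv_into (carrier M) f) (carrier N) \<in> mod_hom R N M"
proof (rule mod_hom_restrictI[OF assms(2)])
  interpret M: left_module R M by fact
  interpret N: left_module R N by fact
  let ?g = "inv_into (carrier M) f"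
  note cl = bij_betw_inv_into[OF assms(4), THEN bij_betwE, THEN bspec]
  show "\<And>y. y \<in> carrier N \<Longrightarrow> ?g y \<in> carrier M" by (rule cl)
  have fg: "f (?g y) = y" if "y \<in> carrier N" for y
    using that assms(4) by (simp add: bij_betw_inv_into_right)
  have gf: "?g (f x) = x" if "x \<in> carrier M" for x
    using that assms(4) by (simp add: bij_betw_inv_into_left)
  show "?g (x \<oplus>\<^bsub>N\<^esub> y) = ?g x \<oplus>\<^bsub>M\<^esub> ?g y" if "x \<in> carrier N" "y \<in> carrier N" for x y
    using gf[of "?g x \<oplus>\<^bsub>M\<^esub> ?g y"] that cl fg assms(3) by (simp add: mod_hom_add)
  show "?g (a \<odot>\<^bsub>N\<^esub> x) = a \<odot>\<^bsub>M\<^esub> ?g x" if "a \<in> carrier R" "x \<in> carrier N" for a x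
    using gf[of "a \<odot>\<^bsub>M\<^esub> ?g x"] that cl fg assms(3) by (simp add: mod_hom_smult)
qed

lemma mod_isomorphic_sym:
  assumes "left_module R M" "left_module R N" "mod_isomorphic R M N"
  shows "mod_isomorphic R N M"
proof -
  obtain f where f: "f \<in> mod_hom R M N" "bij_betw f (carrier M) (carrier N)"
    using assms(3) by (auto simp: mod_isomorphic_def)
  have "bij_betw (restrict (inv_into (carrier M) f) (carrier N)) (carrier N) (carrier M)"
    using bij_betw_inv_into[OF f(2)] by (subst bij_betw_restrict_eq)
  then show ?thesis unfolding mod_isomorphic_def by (rule bexI[OF _ mod_hom_inverse[OF assms(1,2) f]])
qed

lemma mod_kernel_submodule:
  assumes "left_module R M" "left_module R N" "f \<in> mod_hom R M N"
  shows "submodule (mod_kernel M N f) R M"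
proof -
  interpret M: left_module R M by fact
  interpret N: left_module R N by fact
  show ?thesis
    using assms mod_hom_zero[OF assms] mod_hom_neg[OF assms]
    by (intro M.left_submoduleI)
      (auto simp: mod_kernel_def mod_hom_add mod_hom_smult N.smult_zero_r)
qed

lemma mod_image_submodule:
  assumes "left_module R M" "left_module R N" "f \<in> mod_hom R M N"
  shows "submodule (f ` carrier M) R N"
proof -
  interpret M: left_module R M by fact
  interpret N: left_module R N by fact
  show ?thesis
  proof (rule N.left_submoduleI)
    show "f ` carrier M \<subseteq> carrier N" using assms(3) by (auto simp: mod_hom_closed)
    show "\<zero>\<^bsub>N\<^esub> \<in> f ` carrier M" using mod_hom_zero[OF assms] by (metis M.M.zero_closed imageI)
    show "\<ominus>\<^bsub>N\<^esub> x \<in> f ` carrier M" if "x \<in> f ` carrier M" for x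
    proof -
      from \<open>x \<in> f ` carrier M\<close> obtain u where "u \<in> carrier M" "x = f u" by auto
      then show ?thesis using mod_hom_neg[OF assms, of u] by (intro image_eqI[of _ _ "\<ominus>\<^bsub>M\<^esub> u"]) auto
    qed
    show "x \<oplus>\<^bsub>N\<^esub> y \<in> f ` carrier M" if "x \<in> f ` carrier M" "y \<in> f ` carrier M" for x y
    proof -
      from that obtain u v where "u \<in> carrier M" "x = f u" "v \<in> carrier M" "y = f v" by auto
      then show ?thesis using mod_hom_add[OF assms(3), of u v]
        by (intro image_eqI[of _ _ "u \<oplus>\<^bsub>M\<^esub> v"]) auto
    qed
    show "a \<odot>\<^bsub>N\<^esub> x \<in> f ` carrier M" if "a \<in> carrier R" "x \<in> f ` carrier M" for a x
    proof -
      from \<open>x \<in> f ` carrier M\<close> obtain u where "u \<in> carrier M" "x = f u" by auto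
      then show ?thesis using mod_hom_smult[OF assms(3) that(1), of u] that(1)
        by (intro image_eqI[of _ _ "a \<odot>\<^bsub>M\<^esub> u"]) auto
    qed
  qed
qed

lemma submodule_inclusion_hom:
  assumes "left_module R M" "submodule H R M"
  shows "restrict (\<lambda>x. x) H \<in> mod_hom R (M\<lparr>carrier := H\<rparr>) M"
  using left_module.left_submoduleD[OF assms] by (intro mod_homI) auto

section \<open>Short exact sequences, quotients and factorization\<close>

lemma short_exact_zero:
  assumes "short_exact R A f B g D" "x \<in> carrier A"
  shows "g (f x) = \<zero>\<^bsub>D\<^esub>"
  using assms by (auto simp: short_exact_def mod_kernel_def)

lemma short_exact_lift:
  assumes "short_exact R A f B g D" "y \<in> carrier B" "g y = \<zero>\<^bsub>D\<^esub>"
  obtains x where "x \<in> carrier A" "f x = y"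
proof -
  have "y \<in> f ` carrier A" using assms by (simp add: short_exact_def mod_kernel_def)
  then show thesis using that by blast
qed

lemma short_exact_kernel:
  assumes "left_module R M" "left_module R N" "f \<in> mod_hom R M N" "f ` carrier M = carrier N"
  shows "short_exact R (M\<lparr>carrier := mod_kernel M N f\<rparr>) (restrict (\<lambda>x. x) (mod_kernel M N f)) M f N"
  using assms mod_kernel_submodule[OF assms(1-3)]
    submodule_inclusion_hom[OF assms(1) mod_kernel_submodule[OF assms(1-3)]]
    left_module.left_submodule_is_module[OF assms(1) mod_kernel_submodule[OF assms(1-3)]]
  by (auto simp: short_exact_def inj_on_def)

text \<open>The quotient is realized on representatives, so that it lives in the same type.\<close>

lemma quotient_exists:
  fixes M :: "('r, 'm) module"
  assumes M: "left_module R M" and H: "submodule H R M"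
  obtains Q :: "('r, 'm) module" and g
  where "short_exact R (M\<lparr>carrier := H\<rparr>) (restrict (\<lambda>x. x) H) M g Q"
proof -
  interpret M: left_module R M by fact
  note H' = M.left_submoduleD[OF H]
  define rel where "rel x y \<longleftrightarrow> x \<in> carrier M \<and> y \<in> carrier M \<and> x \<ominus>\<^bsub>M\<^esub> y \<in> H" for x y
  have refl: "rel x x" if "x \<in> carrier M" for x
    using that H' by (auto simp: rel_def M.minus_eq_zero[THEN iffD2])
  have sym: "rel y x" if "rel x y" for x y
  proof -
    have "\<ominus>\<^bsub>M\<^esub> (x \<ominus>\<^bsub>M\<^esub> y) = y \<ominus>\<^bsub>M\<^esub> x"
      using that by (simp add: rel_def a_minus_def M.M.minus_add M.M.a_comm)
    then show ?thesis using that H'(3) by (metis rel_def)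
  qed
  have trans: "rel x z" if "rel x y" "rel y z" for x y z
  proof -
    have "(x \<ominus>\<^bsub>M\<^esub> y) \<oplus>\<^bsub>M\<^esub> (y \<ominus>\<^bsub>M\<^esub> z) = x \<ominus>\<^bsub>M\<^esub> z"
      using that unfolding rel_def a_minus_def
      by (smt (verit) M.M.a_assoc M.M.a_inv_closed M.M.add.m_closed M.M.l_neg M.M.l_zero)
    then show ?thesis using that H'(4) by (metis rel_def)
  qed
  have add: "rel (x \<oplus>\<^bsub>M\<^esub> y) (x' \<oplus>\<^bsub>M\<^esub> y')" if "rel x x'" "rel y y'" for x y x' y'
  proof -
    have "(x \<ominus>\<^bsub>M\<^esub> x') \<oplus>\<^bsub>M\<^esub> (y \<ominus>\<^bsub>M\<^esub> y') = (x \<oplus>\<^bsub>M\<^esub> y) \<ominus>\<^bsub>M\<^esub> (x' \<oplus>\<^bsub>M\<^esub> y')"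
      using that unfolding rel_def a_minus_def by (simp add: M.M.minus_add M.M.a_ac)
    then show ?thesis using that H'(4) by (metis rel_def M.M.add.m_closed)
  qed
  have smult: "rel (a \<odot>\<^bsub>M\<^esub> x) (a \<odot>\<^bsub>M\<^esub> y)" if "rel x y" "a \<in> carrier R" for x y a
    using that H'(5)[of a "x \<ominus>\<^bsub>M\<^esub> y"] by (auto simp: rel_def M.minus_smult)
  define rep where "rep x = (SOME y. rel x y)" for x
  have rep: "rel x (rep x)" if "x \<in> carrier M" for x
    unfolding rep_def using refl[OF that] by (rule someI)
  have rep_eq: "rep x = rep y" if "rel x y" for x y
  proof -
    \<comment> \<open>Related elements have the same predicate \<open>rel x\<close>, so the choice
      in \<open>rep\<close> returns the same representative for both.\<close>
    have "rel x = rel y" using that trans sym by blast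
    then show ?thesis by (simp add: rep_def)
  qed
  have rep_cl [simp]: "rep x \<in> carrier M" if "x \<in> carrier M" for x
    using rep[OF that] by (simp add: rel_def)
  have rep_add: "rep (rep x \<oplus>\<^bsub>M\<^esub> rep y) = rep (x \<oplus>\<^bsub>M\<^esub> y)"
    if "x \<in> carrier M" "y \<in> carrier M" for x y
    using that by (intro rep_eq add sym[OF rep])
  have rep_addl: "rep (rep x \<oplus>\<^bsub>M\<^esub> y) = rep (x \<oplus>\<^bsub>M\<^esub> y)"
    if "x \<in> carrier M" "y \<in> carrier M" for x y
    using that by (intro rep_eq add sym[OF rep] refl)
  have rep_addr: "rep (x \<oplus>\<^bsub>M\<^esub> rep y) = rep (x \<oplus>\<^bsub>M\<^esub> y)"
    if "x \<in> carrier M" "y \<in> carrier M" for x y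
    using that by (intro rep_eq add sym[OF rep] refl)
  have rep_sm: "rep (a \<odot>\<^bsub>M\<^esub> rep x) = rep (a \<odot>\<^bsub>M\<^esub> x)" if "x \<in> carrier M" "a \<in> carrier R" for x a
    using that by (intro rep_eq smult sym[OF rep])
  have rep_sm2: "rep (a \<odot>\<^bsub>M\<^esub> rep x \<oplus>\<^bsub>M\<^esub> b \<odot>\<^bsub>M\<^esub> rep x) = rep (a \<odot>\<^bsub>M\<^esub> x \<oplus>\<^bsub>M\<^esub> b \<odot>\<^bsub>M\<^esub> x)"
    and rep_sm3: "rep (a \<odot>\<^bsub>M\<^esub> (b \<odot>\<^bsub>M\<^esub> rep x)) = rep (a \<odot>\<^bsub>M\<^esub> (b \<odot>\<^bsub>M\<^esub> x))"
    if "a \<in> carrier R" "b \<in> carrier R" "x \<in> carrier M" for x a b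
    using that by (intro rep_eq add smult sym[OF rep]; simp)+
  have rep_rep: "rep (rep x) = rep x" if "x \<in> carrier M" for x
    using that by (intro rep_eq sym[OF rep])
  define Q :: "('r, 'm) module" where "Q = mk_module (rep ` carrier M)
    (\<lambda>x y. rep (x \<oplus>\<^bsub>M\<^esub> y)) (rep \<zero>\<^bsub>M\<^esub>) (\<lambda>a x. rep (a \<odot>\<^bsub>M\<^esub> x))"
  note Q = Q_def mk_module_simps
  have "abelian_group Q"
  proof (rule abelian_groupI)
    fix x assume "x \<in> carrier Q"
    then obtain u where u: "u \<in> carrier M" "x = rep u" by (auto simp: Q)
    then show "\<exists>y\<in>carrier Q. y \<oplus>\<^bsub>Q\<^esub> x = \<zero>\<^bsub>Q\<^esub>"
      by (intro bexI[of _ "rep (\<ominus>\<^bsub>M\<^esub> u)"]) (auto simp: Q rep_add M.M.l_neg)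
  next
    fix x y assume "x \<in> carrier Q" "y \<in> carrier Q"
    then show "x \<oplus>\<^bsub>Q\<^esub> y = y \<oplus>\<^bsub>Q\<^esub> x" by (auto simp: Q M.M.a_comm)
  qed (auto simp: Q rep_add rep_addl rep_addr rep_rep M.M.a_assoc)
  then have Qm: "left_module R Q"
    by (intro left_module.intro M.R.ring_axioms left_module_axioms.intro)
       (auto simp: Q rep_sm rep_add rep_rep rep_sm2 rep_sm3 M.smult_l_distr M.smult_r_distr
         M.smult_assoc1)
  have g: "restrict rep (carrier M) \<in> mod_hom R M Q"
    by (rule mod_hom_restrictI[OF M]) (auto simp: Q rep_add rep_sm)
  have ker: "rep x = rep \<zero>\<^bsub>M\<^esub> \<longleftrightarrow> x \<in> H" if "x \<in> carrier M" for x
  proof -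
    have "rep x = rep \<zero>\<^bsub>M\<^esub> \<longleftrightarrow> rel x \<zero>\<^bsub>M\<^esub>"
      using rep_eq rep[OF that] rep[OF M.M.zero_closed] sym trans by metis
    then show ?thesis using that by (simp add: rel_def a_minus_def M.neg_zero)
  qed
  have "short_exact R (M\<lparr>carrier := H\<rparr>) (restrict (\<lambda>x. x) H) M (restrict rep (carrier M)) Q"
    unfolding short_exact_def
  proof (intro conjI)
    show "restrict (\<lambda>x. x) H ` carrier (M\<lparr>carrier := H\<rparr>) = mod_kernel M Q (restrict rep (carrier M))"
      using ker H'(1) by (auto simp: mod_kernel_def Q)
  qed (use M Qm g submodule_inclusion_hom[OF M H] M.left_submodule_is_module[OF H] in
        \<open>auto simp: inj_on_def Q\<close>)
  then show thesis by (rule that)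
qed

text \<open>Two elements with the same image under \<open>g\<close> differ by an element of the
  kernel, on which \<open>h\<close> vanishes. So \<open>h\<close> composed with any set-theoretic
  section of \<open>g\<close> is a homomorphism.\<close>

lemma factor_through:
  assumes "left_module R M" "left_module R N" "left_module R L"
    and g: "g \<in> mod_hom R M N" "g ` carrier M = carrier N" and h: "h \<in> mod_hom R M L"
    and ker: "\<And>x. x \<in> carrier M \<Longrightarrow> g x = \<zero>\<^bsub>N\<^esub> \<Longrightarrow> h x = \<zero>\<^bsub>L\<^esub>"
  obtains k where "k \<in> mod_hom R N L" "\<And>x. x \<in> carrier M \<Longrightarrow> k (g x) = h x"
proof -
  interpret M: left_module R M by fact
  interpret N: left_module R N by fact
  interpret L: left_module R L by fact
  have eq: "h x = h y" if "x \<in> carrier M" "y \<in> carrier M" "g x = g y" for x y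
  proof -
    have "g (x \<ominus>\<^bsub>M\<^esub> y) = \<zero>\<^bsub>N\<^esub>"
      using that g by (simp add: mod_hom_minus[OF assms(1,2)] mod_hom_closed N.minus_eq_zero)
    then have "h x \<ominus>\<^bsub>L\<^esub> h y = \<zero>\<^bsub>L\<^esub>"
      using ker that h by (metis M.M.minus_closed assms(1,3) mod_hom_minus)
    then show ?thesis using that h by (simp add: L.minus_eq_zero mod_hom_closed)
  qed
  define s where "s = inv_into (carrier M) g"
  have s: "s y \<in> carrier M" "g (s y) = y" if "y \<in> carrier N" for y
    using that g(2) by (auto simp: s_def inv_into_into f_inv_into_f)
  have kg: "h (s (g x)) = h x" if "x \<in> carrier M" for x
    using that g s by (intro eq) (auto simp: mod_hom_closed)
  have "restrict (\<lambda>y. h (s y)) (carrier N) \<in> mod_hom R N L"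
  proof (rule mod_hom_restrictI[OF assms(2)])
    show "h (s y) \<in> carrier L" if "y \<in> carrier N" for y using s that h by (simp add: mod_hom_closed)
    show "h (s (x \<oplus>\<^bsub>N\<^esub> y)) = h (s x) \<oplus>\<^bsub>L\<^esub> h (s y)" if "x \<in> carrier N" "y \<in> carrier N" for x y
      using kg[of "s x \<oplus>\<^bsub>M\<^esub> s y"] s that g h by (simp add: mod_hom_add)
    show "h (s (a \<odot>\<^bsub>N\<^esub> x)) = a \<odot>\<^bsub>L\<^esub> h (s x)" if "a \<in> carrier R" "x \<in> carrier N" for a x
      using kg[of "a \<odot>\<^bsub>M\<^esub> s x"] s that g h by (simp add: mod_hom_smult)
  qed
  then show thesis using kg g by (intro that) (auto simp: mod_hom_closed)
qed

section \<open>Linear combinations and powers\<close>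

text \<open>The sum ends with the shorter list. Hence closure and scalar multiples hold for all
  lists, and equal lengths are demanded only where vectors are added or concatenated.\<close>

fun lc :: "('r, 'm, 'e) module_scheme \<Rightarrow> 'r list \<Rightarrow> 'm list \<Rightarrow> 'm" where
  "lc M (a # as) (x # xs) = a \<odot>\<^bsub>M\<^esub> x \<oplus>\<^bsub>M\<^esub> lc M as xs"
| "lc M _ _ = \<zero>\<^bsub>M\<^esub>"

definition vecs :: "'a set \<Rightarrow> nat \<Rightarrow> 'a list set" where
  "vecs A n = {l. length l = n \<and> set l \<subseteq> A}"

text \<open>Powers consist of lists, so that the free modules of finite rank and all their
  submodules have the type \<open>'r list\<close> in which the test modules live. Generators,
  relations and matrices are then lists as well.\<close>

definition pow_mod :: "('r, 'm) module \<Rightarrow> nat \<Rightarrow> ('r, 'm list) module" where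
  "pow_mod M n = mk_module (vecs (carrier M) n) (map2 (ring.add M)) (replicate n \<zero>\<^bsub>M\<^esub>)
     (\<lambda>a. map (module.smult M a))"

definition reg_mod :: "'r ring \<Rightarrow> ('r, 'r) module" where
  "reg_mod R = mk_module (carrier R) (ring.add R) \<zero>\<^bsub>R\<^esub> (monoid.mult R)"

abbreviation free_pow :: "'r ring \<Rightarrow> nat \<Rightarrow> ('r, 'r list) module" where
  "free_pow R n \<equiv> pow_mod (reg_mod R) n"

lemma reg_mod_simps [simp]:
  "carrier (reg_mod R) = carrier R" "ring.add (reg_mod R) = ring.add R"
  "ring.zero (reg_mod R) = \<zero>\<^bsub>R\<^esub>" "module.smult (reg_mod R) = monoid.mult R"
  by (simp_all add: reg_mod_def)

lemma reg_mod_module: "ring R \<Longrightarrow> left_module R (reg_mod R)"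
proof -
  assume "ring R"
  then interpret ring R .
  have "abelian_group (reg_mod R)"
    by (rule abelian_groupI) (auto simp: a_ac intro: bexI[of _ "\<ominus>\<^bsub>R\<^esub> _"] l_neg)
  then show ?thesis
    by (intro left_module.intro ring_axioms left_module_axioms.intro)
       (auto simp: l_distr r_distr m_assoc)
qed

lemma vecs_iff_nth: "l \<in> vecs A n \<longleftrightarrow> length l = n \<and> (\<forall>i<n. l ! i \<in> A)"
  by (auto simp: vecs_def set_conv_nth)

lemma vecs_length: "l \<in> vecs A n \<Longrightarrow> length l = n" by (simp add: vecs_def)

lemma vecs_nth: "l \<in> vecs A n \<Longrightarrow> i < n \<Longrightarrow> l ! i \<in> A" by (simp add: vecs_iff_nth)

lemma vecs_set: "l \<in> vecs A n \<Longrightarrow> set l \<subseteq> A" by (simp add: vecs_def)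

lemma vecsI: "set l \<subseteq> A \<Longrightarrow> l \<in> vecs A (length l)" by (simp add: vecs_def)

lemma vecs_0 [simp]: "vecs A 0 = {[]}" by (auto simp: vecs_def)

lemma vecs_Cons [simp]: "x # l \<in> vecs A (Suc n) \<longleftrightarrow> x \<in> A \<and> l \<in> vecs A n" by (auto simp: vecs_def)

lemma vecs_Suc_iff: "l \<in> vecs A (Suc n) \<longleftrightarrow> (\<exists>x l'. l = x # l' \<and> x \<in> A \<and> l' \<in> vecs A n)"
  by (cases l) (auto simp: vecs_def)

lemma vecs_append: "a \<in> vecs A m \<Longrightarrow> b \<in> vecs A n \<Longrightarrow> a @ b \<in> vecs A (m + n)"
  by (auto simp: vecs_def)

lemma vecs_replicate: "x \<in> A \<Longrightarrow> replicate n x \<in> vecs A n" by (auto simp: vecs_def)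

lemma vecs_map: "l \<in> vecs A n \<Longrightarrow> (\<And>x. x \<in> A \<Longrightarrow> f x \<in> B) \<Longrightarrow> map f l \<in> vecs B n"
  by (auto simp: vecs_def)

lemma pow_mod_simps [simp]:
  "carrier (pow_mod M n) = vecs (carrier M) n" "ring.add (pow_mod M n) = map2 (ring.add M)"
  "ring.zero (pow_mod M n) = replicate n \<zero>\<^bsub>M\<^esub>" "module.smult (pow_mod M n) a = map (module.smult M a)"
  by (simp_all add: pow_mod_def)

lemma pow_mod_module:
  assumes "left_module R M" shows "left_module R (pow_mod M n)"
proof -
  interpret M: left_module R M by fact
  have "abelian_group (pow_mod M n)"
  proof (rule abelian_groupI)
    fix x assume "x \<in> carrier (pow_mod M n)"
    then show "\<exists>y\<in>carrier (pow_mod M n). y \<oplus>\<^bsub>pow_mod M n\<^esub> x = \<zero>\<^bsub>pow_mod M n\<^esub>"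
      by (intro bexI[of _ "map (\<lambda>x. \<ominus>\<^bsub>M\<^esub> x) x"])
         (auto simp: vecs_iff_nth M.M.l_neg intro!: nth_equalityI)
  qed (auto simp: vecs_iff_nth M.M.a_ac intro!: nth_equalityI)
  then show ?thesis
    by (intro left_module.intro M.R.ring_axioms left_module_axioms.intro)
       (auto simp: vecs_iff_nth M.smult_l_distr M.smult_r_distr M.smult_assoc1 in_set_conv_nth
          intro!: nth_equalityI)
qed

lemma free_pow_module: "ring R \<Longrightarrow> left_module R (free_pow R n)"
  by (intro pow_mod_module reg_mod_module)

lemma coord_hom:
  assumes "left_module R M" "i < n"
  shows "restrict (\<lambda>v. v ! i) (vecs (carrier M) n) \<in> mod_hom R (pow_mod M n) M"
  using assms mod_hom_restrictI[OF pow_mod_module[OF assms(1)], of n "\<lambda>v. v ! i" M]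
  by (auto simp: vecs_iff_nth)

context left_module begin

lemma lc_closed [simp]:
  "set a \<subseteq> carrier R \<Longrightarrow> set xs \<subseteq> carrier M \<Longrightarrow> lc M a xs \<in> carrier M"
  by (induction a xs rule: list_induct2') auto

lemma lc_zero_left: "set xs \<subseteq> carrier M \<Longrightarrow> lc M (replicate n \<zero>\<^bsub>R\<^esub>) xs = \<zero>\<^bsub>M\<^esub>"
  by (induction xs arbitrary: n) (case_tac n; auto simp: smult_zero_l)+

lemma lc_zero_right: "set a \<subseteq> carrier R \<Longrightarrow> lc M a (replicate n \<zero>\<^bsub>M\<^esub>) = \<zero>\<^bsub>M\<^esub>"
  by (induction a arbitrary: n) (case_tac n; auto simp: smult_zero_r)+

lemma lc_add_left:
  assumes "length a = length b" "length b = length xs"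
    "set a \<subseteq> carrier R" "set b \<subseteq> carrier R" "set xs \<subseteq> carrier M"
  shows "lc M (map2 (ring.add R) a b) xs = lc M a xs \<oplus>\<^bsub>M\<^esub> lc M b xs"
  using assms by (induction a b xs rule: list_induct3) (auto simp: smult_l_distr M.a_ac)

lemma lc_add_right:
  assumes "length a = length xs" "length xs = length ys"
    "set a \<subseteq> carrier R" "set xs \<subseteq> carrier M" "set ys \<subseteq> carrier M"
  shows "lc M a (map2 (ring.add M) xs ys) = lc M a xs \<oplus>\<^bsub>M\<^esub> lc M a ys"
  using assms by (induction a xs ys rule: list_induct3) (auto simp: smult_r_distr M.a_ac)

lemma lc_smult_left:
  assumes "r \<in> carrier R" "set a \<subseteq> carrier R" "set xs \<subseteq> carrier M"
  shows "lc M (map (\<lambda>x. r \<otimes>\<^bsub>R\<^esub> x) a) xs = r \<odot>\<^bsub>M\<^esub> lc M a xs"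
  using assms
  by (induction a xs rule: list_induct2') (auto simp: smult_r_distr smult_assoc1 smult_zero_r)

lemma lc_append:
  assumes "length a = length xs" "set a \<subseteq> carrier R" "set b \<subseteq> carrier R"
    "set xs \<subseteq> carrier M" "set ys \<subseteq> carrier M"
  shows "lc M (a @ b) (xs @ ys) = lc M a xs \<oplus>\<^bsub>M\<^esub> lc M b ys"
  using assms by (induction a xs rule: list_induct2) (auto simp: M.a_ac)

lemma lc_delta_right:
  assumes "i < n" "a \<in> vecs (carrier R) n" "x \<in> carrier M"
  shows "lc M a ((replicate n \<zero>\<^bsub>M\<^esub>)[i := x]) = (a ! i) \<odot>\<^bsub>M\<^esub> x"
  using assms
proof (induction n arbitrary: i a)
  case (Suc n)
  then obtain r b where ab: "a = r # b" "r \<in> carrier R" "b \<in> vecs (carrier R) n"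
    by (auto simp: vecs_Suc_iff)
  show ?case
  proof (cases i)
    case 0 then show ?thesis using ab Suc.prems lc_zero_right[of b n] vecs_set[OF ab(3)] by simp
  next
    case (Suc j)
    then show ?thesis using ab Suc.prems Suc.IH[of j b] vecs_nth[OF ab(3), of j] by (simp add: smult_zero_r)
  qed
qed simp

lemma lc_delta_left:
  assumes "i < n" "xs \<in> vecs (carrier M) n" "r \<in> carrier R"
  shows "lc M ((replicate n \<zero>\<^bsub>R\<^esub>)[i := r]) xs = r \<odot>\<^bsub>M\<^esub> (xs ! i)"
  using assms
proof (induction n arbitrary: i xs)
  case (Suc n)
  then obtain x ys where xy: "xs = x # ys" "x \<in> carrier M" "ys \<in> vecs (carrier M) n"
    by (auto simp: vecs_Suc_iff)
  show ?case
  proof (cases i)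
    case 0 then show ?thesis using xy Suc.prems lc_zero_left[of ys n] vecs_set[OF xy(3)] by simp
  next
    case (Suc j)
    then show ?thesis using xy Suc.prems Suc.IH[of j ys] vecs_nth[OF xy(3), of j] by (simp add: smult_zero_l)
  qed
qed simp

end

lemma lc_hom_right:
  assumes M: "left_module R M" and xs: "xs \<in> vecs (carrier M) n"
  shows "restrict (\<lambda>a. lc M a xs) (vecs (carrier R) n) \<in> mod_hom R (free_pow R n) M"
proof -
  interpret M: left_module R M by fact
  note xs' = vecs_length[OF xs] vecs_set[OF xs]
  have "restrict (\<lambda>a. lc M a xs) (carrier (free_pow R n)) \<in> mod_hom R (free_pow R n) M"
  proof (rule mod_hom_restrictI[OF free_pow_module])
    show "ring R" by (rule M.R.ring_axioms)
  qed (use xs' in \<open>auto simp: M.lc_add_left M.lc_smult_left vecs_def\<close>)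
  then show ?thesis by simp
qed

lemma mod_hom_lc:
  assumes "left_module R M" "left_module R N" "f \<in> mod_hom R M N"
    "set a \<subseteq> carrier R" "set xs \<subseteq> carrier M"
  shows "f (lc M a xs) = lc N a (map f xs)"
proof -
  interpret M: left_module R M by fact
  interpret N: left_module R N by fact
  show ?thesis using assms(4,5)
    by (induction a xs rule: list_induct2')
       (use assms(1-3) in \<open>auto simp: mod_hom_add mod_hom_smult mod_hom_zero\<close>)
qed

lemma lc_update_carrier [simp]: "lc (M\<lparr>carrier := H\<rparr>) a xs = lc M a xs"
  by (induction a xs rule: list_induct2') auto

lemma lc_pow_nth:
  fixes R :: "'r ring"
  assumes "left_module R M" "set a \<subseteq> carrier R" "set zs \<subseteq> vecs (carrier M) n" "i < n"
  shows "lc (pow_mod M n) a zs ! i = lc M a (map (\<lambda>z. z ! i) zs)"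
proof -
  have "restrict (\<lambda>v. v ! i) (vecs (carrier M) n) (lc (pow_mod M n) a zs) =
    lc M a (map (restrict (\<lambda>v. v ! i) (vecs (carrier M) n)) zs)"
    using assms by (intro mod_hom_lc[OF pow_mod_module[OF assms(1)] assms(1) coord_hom[OF assms(1)]]) auto
  moreover have "lc (pow_mod M n) a zs \<in> vecs (carrier M) n"
    using left_module.lc_closed[OF pow_mod_module[OF assms(1)], of a zs n] assms by simp
  moreover have "map (restrict (\<lambda>v. v ! i) (vecs (carrier M) n)) zs = map (\<lambda>z. z ! i) zs"
    using assms(3) by auto
  ultimately show ?thesis by simp
qed

definition unit_vecs :: "'r ring \<Rightarrow> nat \<Rightarrow> 'r list list" where
  "unit_vecs R n = map (\<lambda>i. (replicate n \<zero>\<^bsub>R\<^esub>)[i := \<one>\<^bsub>R\<^esub>]) [0..<n]"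

lemma length_unit_vecs [simp]: "length (unit_vecs R n) = n" by (simp add: unit_vecs_def)

lemma unit_vecs_in:
  assumes "ring R" shows "unit_vecs R n \<in> vecs (vecs (carrier R) n) n"
proof -
  interpret ring R by fact
  show ?thesis by (auto simp: vecs_iff_nth unit_vecs_def nth_list_update)
qed

lemma lc_unit_vecs:
  assumes "ring R" "a \<in> vecs (carrier R) n"
  shows "lc (free_pow R n) a (unit_vecs R n) = a"
proof (rule nth_equalityI)
  interpret ring R by fact
  interpret RM: left_module R "reg_mod R" by (rule reg_mod_module[OF assms(1)])
  note a = vecs_length[OF assms(2)] vecs_set[OF assms(2)]
  note us = vecs_set[OF unit_vecs_in[OF assms(1)], of n]
  have "lc (free_pow R n) a (unit_vecs R n) \<in> vecs (carrier R) n"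
    using left_module.lc_closed[OF free_pow_module[OF assms(1)], of a "unit_vecs R n" n] a us by simp
  then show len: "length (lc (free_pow R n) a (unit_vecs R n)) = length a"
    using a by (simp add: vecs_length)
  fix i assume "i < length (lc (free_pow R n) a (unit_vecs R n))"
  then have i: "i < n" using len a by simp
  have "map (\<lambda>z. z ! i) (unit_vecs R n) = (replicate n \<zero>\<^bsub>reg_mod R\<^esub>)[i := \<one>\<^bsub>R\<^esub>]"
    using i by (intro nth_equalityI) (auto simp: unit_vecs_def nth_list_update)
  then show "lc (free_pow R n) a (unit_vecs R n) ! i = a ! i"
    using lc_pow_nth[OF reg_mod_module[OF assms(1)] a(2) _ i, of "unit_vecs R n"] us i
      RM.lc_delta_right[OF i assms(2), of "\<one>\<^bsub>R\<^esub>"] vecs_nth[OF assms(2) i]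
    by simp
qed

lemma map_lc_unit_vecs:
  assumes "left_module R M" "xs \<in> vecs (carrier M) n"
  shows "map (\<lambda>a. lc M a xs) (unit_vecs R n) = xs"
proof (rule nth_equalityI)
  interpret left_module R M by fact
  show "length (map (\<lambda>a. lc M a xs) (unit_vecs R n)) = length xs"
    using assms by (simp add: vecs_length)
  fix i assume "i < length (map (\<lambda>a. lc M a xs) (unit_vecs R n))"
  then show "map (\<lambda>a. lc M a xs) (unit_vecs R n) ! i = xs ! i"
    using assms lc_delta_left[of i n xs "\<one>\<^bsub>R\<^esub>"] vecs_nth[OF assms(2), of i] by (simp add: unit_vecs_def)
qed

section \<open>Generators, syzygies and infinite presentations\<close>

definition gens :: "'r ring \<Rightarrow> ('r, 'm) module \<Rightarrow> 'm list \<Rightarrow> bool" where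
  "gens R M xs \<longleftrightarrow> set xs \<subseteq> carrier M \<and>
     (\<forall>x\<in>carrier M. \<exists>a\<in>vecs (carrier R) (length xs). lc M a xs = x)"

text \<open>Whatever the type of \<open>M\<close>, its syzygies form a submodule of a free module
  and have type \<open>'r list\<close>. So passing to syzygies can be iterated without changing the
  type again.\<close>

definition syz :: "'r ring \<Rightarrow> ('r, 'm) module \<Rightarrow> 'm list \<Rightarrow> ('r, 'r list) module" where
  "syz R M xs = (free_pow R (length xs))\<lparr>carrier :=
     {a \<in> vecs (carrier R) (length xs). lc M a xs = \<zero>\<^bsub>M\<^esub>}\<rparr>"

lemma syz_simps [simp]:
  "carrier (syz R M xs) = {a \<in> vecs (carrier R) (length xs). lc M a xs = \<zero>\<^bsub>M\<^esub>}"
  "ring.add (syz R M xs) = map2 (ring.add R)" "ring.zero (syz R M xs) = replicate (length xs) \<zero>\<^bsub>R\<^esub>"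
  "module.smult (syz R M xs) a = map (monoid.mult R a)"
  by (simp_all add: syz_def)

lemma gens_set: "gens R M xs \<Longrightarrow> set xs \<subseteq> carrier M" by (simp add: gens_def)

lemma gensE:
  assumes "gens R M xs" "x \<in> carrier M"
  obtains a where "a \<in> vecs (carrier R) (length xs)" "lc M a xs = x"
  using assms by (auto simp: gens_def)

lemma syz_short_exact:
  assumes "left_module R M" "gens R M xs"
  shows "short_exact R (syz R M xs) (idm (syz R M xs))
    (free_pow R (length xs)) (restrict (\<lambda>a. lc M a xs) (vecs (carrier R) (length xs))) M"
proof -
  interpret M: left_module R M by fact
  let ?g = "restrict (\<lambda>a. lc M a xs) (vecs (carrier R) (length xs))"
  have "xs \<in> vecs (carrier M) (length xs)" using assms(2) by (simp add: gens_def vecsI)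
  then have g: "?g \<in> mod_hom R (free_pow R (length xs)) M"
    by (rule lc_hom_right[OF assms(1)])
  have "?g ` carrier (free_pow R (length xs)) = carrier M"
    using mod_hom_closed[OF g] assms(2) by (force simp: gens_def image_iff)
  from short_exact_kernel[OF free_pow_module[OF M.R.ring_axioms] assms(1) g this] show ?thesis
    by (simp add: mod_kernel_def syz_def cong: conj_cong)
qed

lemma syz_module:
  assumes "left_module R M" "set xs \<subseteq> carrier M" shows "left_module R (syz R M xs)"
proof -
  interpret M: left_module R M by fact
  have "xs \<in> vecs (carrier M) (length xs)" using assms(2) by (rule vecsI)
  from mod_kernel_submodule[OF free_pow_module[OF M.R.ring_axioms] assms(1) lc_hom_right[OF assms(1) this]]
  have "submodule (carrier (syz R M xs)) R (free_pow R (length xs))"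
    by (simp add: mod_kernel_def syz_def cong: conj_cong)
  from left_module.left_submodule_is_module[OF free_pow_module[OF M.R.ring_axioms] this]
  show ?thesis by (simp add: syz_def)
qed

lemma gens_image:
  assumes "left_module R M" "left_module R N" "f \<in> mod_hom R M N" "f ` carrier M = carrier N"
    "gens R M xs"
  shows "gens R N (map f xs)"
  unfolding gens_def
proof (intro conjI ballI)
  show "set (map f xs) \<subseteq> carrier N" using assms(3) gens_set[OF assms(5)] by (auto simp: mod_hom_closed)
  fix y assume "y \<in> carrier N"
  then obtain x where x: "x \<in> carrier M" "y = f x" using assms(4) by auto
  then obtain a where "a \<in> vecs (carrier R) (length xs)" "lc M a xs = x" using assms(5) gensE by metis
  then show "\<exists>a\<in>vecs (carrier R) (length (map f xs)). lc N a (map f xs) = y"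
    using x mod_hom_lc[OF assms(1-3), of a xs] gens_set[OF assms(5)] by (intro bexI[of _ a]) (auto simp: vecs_set)
qed

text \<open>Syzygies are vectors of coefficients, so an injective homomorphism leaves the syzygy
  module literally unchanged and not only up to isomorphism. Infinite presentations can therefore be
  carried along an isomorphism in a single step.\<close>

lemma syz_image:
  assumes "left_module R M" "left_module R N" "f \<in> mod_hom R M N" "inj_on f (carrier M)"
    "set xs \<subseteq> carrier M"
  shows "syz R N (map f xs) = syz R M xs"
proof -
  interpret M: left_module R M by fact
  have "lc N a (map f xs) = \<zero>\<^bsub>N\<^esub> \<longleftrightarrow> lc M a xs = \<zero>\<^bsub>M\<^esub>" if "a \<in> vecs (carrier R) (length xs)" for a
    using mod_hom_lc[OF assms(1-3) vecs_set[OF that] assms(5)] mod_hom_zero[OF assms(1-3)]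
      mod_hom_inj_iff[OF assms(1-3)] assms(4) M.lc_closed[OF vecs_set[OF that] assms(5)] by metis
  then show ?thesis by (simp add: syz_def cong: conj_cong)
qed

text \<open>
  The modules with a resolution by finitely generated free modules: the largest class of modules
  whose members have a finite generating list with its syzygies again in the class.
\<close>

definition sfp :: "'r ring \<Rightarrow> ('r, 'm) module \<Rightarrow> bool" where
  "sfp R M \<longleftrightarrow> left_module R M \<and> (\<exists>X :: ('r, 'r list) module set.
     (\<forall>N\<in>X. left_module R N \<and> (\<exists>ys. gens R N ys \<and> syz R N ys \<in> X)) \<and>
     (\<exists>xs. gens R M xs \<and> syz R M xs \<in> X))"

lemma sfp_module: "sfp R M \<Longrightarrow> left_module R M" by (simp add: sfp_def)

text \<open>\<open>M\<close> itself may have any type, but its syzygies have type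
  \<open>'r list\<close>. The invariant \<open>P\<close> is therefore a predicate on modules of that
  type and is required from the first syzygies on.\<close>

lemma sfp_coinduct:
  fixes P :: "('r, 'r list) module \<Rightarrow> bool"
  assumes "left_module R M" "gens R M xs" "P (syz R M xs)"
    and "\<And>N. P N \<Longrightarrow> left_module R N \<and> (\<exists>ys. gens R N ys \<and> P (syz R N ys))"
  shows "sfp R M"
  unfolding sfp_def
  using assms by (intro conjI exI[of _ "Collect P"] exI[of _ xs]) auto

lemma sfp_step:
  assumes "sfp R M" obtains xs where "gens R M xs" "sfp R (syz R M xs)"
proof -
  from assms obtain X xs where *: "\<forall>N\<in>X. left_module R N \<and> (\<exists>ys. gens R N ys \<and> syz R N ys \<in> X)"
    "gens R M xs" "syz R M xs \<in> X" by (auto simp: sfp_def)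
  then have "sfp R (syz R M xs)" unfolding sfp_def by blast
  with * that show thesis by blast
qed

lemma sfp_intro:
  assumes "left_module R M" "gens R M xs" "sfp R (syz R M xs)"
  shows "sfp R M"
proof (rule sfp_coinduct[where P = "sfp R"])
  fix N :: "('a, 'a list) module" assume "sfp R N"
  then show "left_module R N \<and> (\<exists>ys. gens R N ys \<and> sfp R (syz R N ys))"
    using sfp_module sfp_step by metis
qed (use assms in auto)

lemma gens_Nil: "carrier M = {\<zero>\<^bsub>M\<^esub>} \<Longrightarrow> gens R M []"
  by (simp add: gens_def)

text \<open>The syzygies of the empty generating list form the zero module of vectors of length 0,
  so the class of zero modules reproduces itself.\<close>

lemma sfp_zero:
  assumes "left_module R M" "carrier M = {\<zero>\<^bsub>M\<^esub>}"
  shows "sfp R M"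
proof (rule sfp_coinduct[where xs = "[]" and P = "\<lambda>N. left_module R N \<and> carrier N = {\<zero>\<^bsub>N\<^esub>}"])
  have *: "carrier (syz R N []) = {\<zero>\<^bsub>syz R N []\<^esub>}" for N :: "('a, 'x) module" by auto
  have **: "left_module R (syz R N [])" if "left_module R N" for N :: "('a, 'x) module"
    using that by (intro syz_module) auto
  show "left_module R (syz R M []) \<and> carrier (syz R M []) = {\<zero>\<^bsub>syz R M []\<^esub>}"
    using assms by (intro conjI * **)
  show "left_module R N \<and> (\<exists>ys. gens R N ys \<and> left_module R (syz R N ys) \<and>
      carrier (syz R N ys) = {\<zero>\<^bsub>syz R N ys\<^esub>})"
    if "left_module R N \<and> carrier N = {\<zero>\<^bsub>N\<^esub>}" for N :: "('a, 'a list) module"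
    using that by (intro conjI exI[of _ "[]"] * ** gens_Nil) auto
qed (use assms gens_Nil in auto)

lemma sfp_iso:
  assumes "sfp R M" "left_module R N" "f \<in> mod_hom R M N" "bij_betw f (carrier M) (carrier N)"
  shows "sfp R N"
proof -
  obtain xs where xs: "gens R M xs" "sfp R (syz R M xs)" using assms(1) by (rule sfp_step)
  have f: "inj_on f (carrier M)" "f ` carrier M = carrier N" using assms(4) by (auto simp: bij_betw_def)
  show ?thesis
    using gens_image[OF sfp_module[OF assms(1)] assms(2,3) f(2) xs(1)]
      syz_image[OF sfp_module[OF assms(1)] assms(2,3) f(1) gens_set[OF xs(1)]] xs(2)
    by (intro sfp_intro[OF assms(2)]) auto
qed

section \<open>Extensions and quotients of infinitely presented modules\<close>

lemma short_exactD:
  assumes "short_exact R X f Y g Z"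
  shows "left_module R X" "left_module R Y" "left_module R Z" "f \<in> mod_hom R X Y" "g \<in> mod_hom R Y Z"
    "inj_on f (carrier X)" "g ` carrier Y = carrier Z"
  using assms by (auto simp: short_exact_def)

lemma short_exactI:
  assumes "left_module R X" "left_module R Y" "left_module R Z" "f \<in> mod_hom R X Y" "g \<in> mod_hom R Y Z"
    "inj_on f (carrier X)" "\<And>z. z \<in> carrier Z \<Longrightarrow> \<exists>y\<in>carrier Y. g y = z"
    "\<And>x. x \<in> carrier X \<Longrightarrow> g (f x) = \<zero>\<^bsub>Z\<^esub>"
    "\<And>y. y \<in> carrier Y \<Longrightarrow> g y = \<zero>\<^bsub>Z\<^esub> \<Longrightarrow> \<exists>x\<in>carrier X. f x = y"
  shows "short_exact R X f Y g Z"
  unfolding short_exact_def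
proof (intro conjI assms)
  show "f ` carrier X = mod_kernel Y Z g"
    using assms(8,9) mod_hom_closed[OF assms(4)] by (fastforce simp: mod_kernel_def image_iff)
  show "g ` carrier Y = carrier Z"
    using assms(7) mod_hom_closed[OF assms(5)] by (fastforce simp: image_iff)
qed

lemma short_exact_image:
  assumes "short_exact R A f B g D" "y \<in> carrier B" "g y = \<zero>\<^bsub>D\<^esub>"
  shows "y \<in> f ` carrier A"
  using assms by (simp add: short_exact_def mod_kernel_def)

lemma short_exact_corestrict:
  assumes se: "short_exact R A f B g D" and Y: "left_module R Y" and h: "h \<in> mod_hom R Y B"
    and z: "\<And>y. y \<in> carrier Y \<Longrightarrow> g (h y) = \<zero>\<^bsub>D\<^esub>"
  obtains h' where "h' \<in> mod_hom R Y A" "\<And>y. y \<in> carrier Y \<Longrightarrow> f (h' y) = h y"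
proof -
  note D = short_exactD[OF se]
  interpret Y: left_module R Y by (rule Y)
  interpret A: left_module R A by (rule D)
  define h' where "h' = restrict (\<lambda>y. inv_into (carrier A) f (h y)) (carrier Y)"
  have "h y \<in> f ` carrier A" if "y \<in> carrier Y" for y
    by (rule short_exact_image[OF se mod_hom_closed[OF h that] z[OF that]])
  then have h': "h' y \<in> carrier A" "f (h' y) = h y" if "y \<in> carrier Y" for y
    using that by (auto simp: h'_def inv_into_into f_inv_into_f)
  have I: "h' y = a" if "y \<in> carrier Y" "a \<in> carrier A" "f a = h y" for y a
    using h'[OF that(1)] that D(6) by (metis inj_onD)
  have "h' \<in> mod_hom R Y A"
  proof (rule mod_homI)
    show "h' (x \<oplus>\<^bsub>Y\<^esub> y) = h' x \<oplus>\<^bsub>A\<^esub> h' y" if "x \<in> carrier Y" "y \<in> carrier Y" for x y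
      using that h' by (intro I) (auto simp: mod_hom_add[OF D(4)] mod_hom_add[OF h])
    show "h' (r \<odot>\<^bsub>Y\<^esub> x) = r \<odot>\<^bsub>A\<^esub> h' x" if "r \<in> carrier R" "x \<in> carrier Y" for r x
      using that h' by (intro I) (auto simp: mod_hom_smult[OF D(4)] mod_hom_smult[OF h])
  qed (use h' in \<open>auto simp: h'_def\<close>)
  then show thesis using h'(2) by (rule that)
qed

text \<open>The kernel of the composite of \<open>g\<close> and \<open>g'\<close> is an extension of
  the kernel of \<open>g'\<close> by the kernel of \<open>g\<close>: on it \<open>g\<close> takes
  values in the image of \<open>f'\<close>, and \<open>p\<close> is \<open>g\<close> read inside
  \<open>X'\<close>.\<close>

lemma short_exact_compose:
  assumes se: "short_exact R X f Y g Z" and se': "short_exact R X' f' Z g' Z'"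
    and h: "h \<in> mod_hom R Y Z'" "\<And>y. y \<in> carrier Y \<Longrightarrow> h y = g' (g y)"
  obtains p where "short_exact R X f (Y\<lparr>carrier := mod_kernel Y Z' h\<rparr>) p X'"
proof -
  note D = short_exactD[OF se] and D' = short_exactD[OF se']
  interpret Y: left_module R Y by (rule D)
  interpret X': left_module R X' by (rule D')
  let ?K = "mod_kernel Y Z' h"
  define W where "W = Y\<lparr>carrier := ?K\<rparr>"
  have W: "left_module R W"
    unfolding W_def by (rule Y.left_submodule_is_module[OF mod_kernel_submodule[OF D(2) D'(3) h(1)]])
  have WK: "w \<in> carrier W \<longleftrightarrow> w \<in> carrier Y \<and> g' (g w) = \<zero>\<^bsub>Z'\<^esub>" for w using h(2) by (auto simp: W_def mod_kernel_def)
  have gW: "restrict g (carrier W) \<in> mod_hom R W Z"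
    by (rule mod_hom_restrictI[OF W])
      (auto simp: WK mod_hom_closed[OF D(5)] W_def mod_kernel_def mod_hom_add[OF D(5)] mod_hom_smult[OF D(5)])
  obtain p where p: "p \<in> mod_hom R W X'" "\<And>w. w \<in> carrier W \<Longrightarrow> f' (p w) = g w"
    by (rule short_exact_corestrict[OF se' W gW]) (auto simp: WK)
  have pI: "p w = x" if "w \<in> carrier W" "x \<in> carrier X'" "f' x = g w" for w x
    using inj_onD[OF D'(6)] p(2)[OF that(1)] mod_hom_closed[OF p(1) that(1)] that(2,3) by metis
  note z = mod_hom_zero[OF D'(1,2,4)] mod_hom_zero[OF D'(2,3,5)]
  have fW: "f x \<in> carrier W" if "x \<in> carrier X" for x
    using mod_hom_closed[OF D(4) that] short_exact_zero[OF se that] z(2) by (simp add: WK)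
  have "short_exact R X f W p X'"
  proof (rule short_exactI[OF D(1) W D'(1) _ p(1) D(6)])
    show "f \<in> mod_hom R X W" using D(4) fW by (auto simp: mod_hom_def PiE_iff W_def)
    show "\<exists>w\<in>carrier W. p w = x" if x: "x \<in> carrier X'" for x
    proof -
      have "f' x \<in> g ` carrier Y" using mod_hom_closed[OF D'(4) x] unfolding D(7) .
      then obtain y where y: "f' x = g y" "y \<in> carrier Y" by (rule imageE)
      have "y \<in> carrier W" using y short_exact_zero[OF se' x] by (simp add: WK)
      then show ?thesis using pI x y(1) by blast
    qed
    show "p (f x) = \<zero>\<^bsub>X'\<^esub>" if "x \<in> carrier X" for x
      using pI[OF fW[OF that] X'.M.zero_closed] short_exact_zero[OF se that] z(1) by simp
    show "\<exists>x\<in>carrier X. f x = w" if w: "w \<in> carrier W" "p w = \<zero>\<^bsub>X'\<^esub>" for w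
      using short_exact_image[OF se, of w] p(2)[OF w(1)] w z(1) by (auto simp: WK)
  qed
  then show thesis unfolding W_def by (rule that)
qed

lemma mod_hom_diff:
  assumes M: "left_module R M" and N: "left_module R N" and f: "f \<in> mod_hom R M N" and g: "g \<in> mod_hom R M N"
  shows "restrict (\<lambda>x. f x \<ominus>\<^bsub>N\<^esub> g x) (carrier M) \<in> mod_hom R M N"
proof -
  interpret N: left_module R N by (rule N)
  note cl = mod_hom_closed[OF f] mod_hom_closed[OF g]
  show ?thesis
  proof (rule mod_hom_restrictI[OF M])
    fix x y assume xy: "x \<in> carrier M" "y \<in> carrier M"
    show "f (x \<oplus>\<^bsub>M\<^esub> y) \<ominus>\<^bsub>N\<^esub> g (x \<oplus>\<^bsub>M\<^esub> y) = f x \<ominus>\<^bsub>N\<^esub> g x \<oplus>\<^bsub>N\<^esub> (f y \<ominus>\<^bsub>N\<^esub> g y)"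
      using cl xy unfolding mod_hom_add[OF f xy] mod_hom_add[OF g xy]
      by (simp add: a_minus_def N.M.minus_add N.M.a_ac)
  qed (use cl in \<open>auto simp: mod_hom_smult[OF f] mod_hom_smult[OF g] N.minus_smult\<close>)
qed

lemma lift_list:
  assumes "g ` A = B" "set ws \<subseteq> B"
  obtains ys where "set ys \<subseteq> A" "map g ys = ws"
proof -
  have "\<And>w. w \<in> B \<Longrightarrow> inv_into A g w \<in> A \<and> g (inv_into A g w) = w"
    using assms(1) by (auto simp: inv_into_into f_inv_into_f)
  then show thesis using assms(2) by (intro that[of "map (inv_into A g) ws"]) (auto intro!: map_idI)
qed

text \<open>The generators of \<open>Y\<close> are the images of \<open>us\<close> followed by lifts
  \<open>ys\<close> of \<open>ws\<close>. A relation among them is a vector in two blocks: the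
  second block is a relation among \<open>ws\<close>, and if it is zero, the first block is a
  relation among \<open>us\<close> because \<open>f\<close> is injective.\<close>

lemma horseshoe:
  assumes se: "short_exact R X f Y g Z" and us: "gens R X us" and ws: "gens R Z ws"
  obtains vs f' g' where "gens R Y vs" "short_exact R (syz R X us) f' (syz R Y vs) g' (syz R Z ws)"
proof -
  note D = short_exactD[OF se]
  interpret X: left_module R X by (rule D)
  interpret Y: left_module R Y by (rule D)
  interpret Z: left_module R Z by (rule D)
  note us' = gens_set[OF us] and ws' = gens_set[OF ws]
  obtain ys where ys: "set ys \<subseteq> carrier Y" "map g ys = ws"
    using lift_list[OF D(7) ws'] by metis
  define m n where "m = length us" and "n = length ws"
  have ly: "length ys = n" using ys(2) by (auto simp: n_def)
  define vs where "vs = map f us @ ys"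
  have lv: "length vs = m + n" by (simp add: vs_def m_def ly)
  have fus: "set (map f us) \<subseteq> carrier Y" using us' D(4) by (auto simp: mod_hom_closed)
  then have vs: "set vs \<subseteq> carrier Y" using ys(1) by (simp add: vs_def)
  have lcv: "lc Y (a @ b) vs = f (lc X a us) \<oplus>\<^bsub>Y\<^esub> lc Y b ys"
    if "a \<in> vecs (carrier R) m" "b \<in> vecs (carrier R) n" for a b
    using that fus ys(1) us' unfolding vs_def
    by (subst Y.lc_append) (auto simp: vecs_def m_def mod_hom_lc[OF D(1,2,4)])
  have glc: "g (lc Y b ys) = lc Z b ws" if "b \<in> vecs (carrier R) n" for b
    using mod_hom_lc[OF D(2,3,5) vecs_set[OF that] ys(1)] ys(2) by simp
  have fcl: "f (lc X a us) \<in> carrier Y" "lc X a us \<in> carrier X" "g (f (lc X a us)) = \<zero>\<^bsub>Z\<^esub>"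
    if "a \<in> vecs (carrier R) m" for a
    using that us' D(4) short_exact_zero[OF se, of "lc X a us"] by (auto simp: mod_hom_closed vecs_set)
  have lcl: "lc Y b ys \<in> carrier Y" if "b \<in> vecs (carrier R) n" for b
    using that ys(1) by (simp add: vecs_set)
  have zl: "lc Z b ws \<in> carrier Z" if "b \<in> vecs (carrier R) n" for b
    using that ws' by (simp add: vecs_set)
  have glcv: "g (lc Y (a @ b) vs) = lc Z b ws"
    if "a \<in> vecs (carrier R) m" "b \<in> vecs (carrier R) n" for a b
    using that by (simp add: lcv mod_hom_add[OF D(5)] fcl lcl glc zl)
  have split: "\<exists>a b. v = a @ b \<and> a \<in> vecs (carrier R) m \<and> b \<in> vecs (carrier R) n"
    if "v \<in> vecs (carrier R) (m + n)" for v
    using that by (intro exI[of _ "take m v"] exI[of _ "drop m v"])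
      (auto simp: vecs_def dest: in_set_takeD in_set_dropD)
  have cover: "\<exists>a\<in>vecs (carrier R) m. f (lc X a us) = y" if "y \<in> carrier Y" "g y = \<zero>\<^bsub>Z\<^esub>" for y
    using short_exact_lift[OF se that] gensE[OF us] by (metis m_def)
  have gvs: "gens R Y vs"
    unfolding gens_def
  proof (intro conjI ballI vs)
    fix y assume y: "y \<in> carrier Y"
    then obtain b where b: "b \<in> vecs (carrier R) n" "lc Z b ws = g y"
      using gensE[OF ws] mod_hom_closed[OF D(5)] by (metis n_def)
    have "g (y \<ominus>\<^bsub>Y\<^esub> lc Y b ys) = \<zero>\<^bsub>Z\<^esub>"
      using y b mod_hom_minus[OF D(2,3,5) y lcl[OF b(1)]] mod_hom_closed[OF D(5) y]
      by (simp add: glc Z.minus_eq_zero[THEN iffD2])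
    then obtain a where a: "a \<in> vecs (carrier R) m" "f (lc X a us) = y \<ominus>\<^bsub>Y\<^esub> lc Y b ys"
      using cover y lcl[OF b(1)] by (metis Y.M.minus_closed)
    then have "lc Y (a @ b) vs = y"
      using b y lcl[OF b(1)] by (simp add: lcv Y.minus_add_cancel)
    then show "\<exists>a\<in>vecs (carrier R) (length vs). lc Y a vs = y"
      using vecs_append[OF a(1) b(1)] lv by auto
  qed
  define f' g' where "f' = restrict (\<lambda>a. a @ replicate n \<zero>\<^bsub>R\<^esub>) (carrier (syz R X us))"
    and "g' = restrict (drop m) (carrier (syz R Y vs))"
  have mods: "left_module R (syz R X us)" "left_module R (syz R Y vs)" "left_module R (syz R Z ws)"
    using syz_module D us' vs ws' by blast+
  have z: "replicate n \<zero>\<^bsub>R\<^esub> \<in> vecs (carrier R) n" by (simp add: vecs_replicate)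
  have lz: "lc Y (replicate n \<zero>\<^bsub>R\<^esub>) ys = \<zero>\<^bsub>Y\<^esub>" using ys(1) by (rule Y.lc_zero_left)
  have sy: "v \<in> carrier (syz R Y vs) \<longleftrightarrow> (\<exists>a b. v = a @ b \<and> a \<in> vecs (carrier R) m \<and>
      b \<in> vecs (carrier R) n \<and> f (lc X a us) \<oplus>\<^bsub>Y\<^esub> lc Y b ys = \<zero>\<^bsub>Y\<^esub>)" for v
  proof
    assume v: "v \<in> carrier (syz R Y vs)"
    then obtain a b where "v = a @ b" "a \<in> vecs (carrier R) m" "b \<in> vecs (carrier R) n"
      using split[of v] by (auto simp: lv)
    with v show "\<exists>a b. v = a @ b \<and> a \<in> vecs (carrier R) m \<and>
      b \<in> vecs (carrier R) n \<and> f (lc X a us) \<oplus>\<^bsub>Y\<^esub> lc Y b ys = \<zero>\<^bsub>Y\<^esub>"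
      by (intro exI[of _ a] exI[of _ b]) (simp add: lcv)
  qed (auto simp: lv lcv vecs_append)
  have "short_exact R (syz R X us) f' (syz R Y vs) g' (syz R Z ws)"
  proof (rule short_exactI[OF mods])
    show "f' \<in> mod_hom R (syz R X us) (syz R Y vs)"
      unfolding f'_def
    proof (rule mod_hom_restrictI[OF mods(1)])
      fix a assume "a \<in> carrier (syz R X us)"
      then have "a \<in> vecs (carrier R) m" "lc X a us = \<zero>\<^bsub>X\<^esub>" by (auto simp: m_def)
      then show "a @ replicate n \<zero>\<^bsub>R\<^esub> \<in> carrier (syz R Y vs)"
        unfolding sy using z lz mod_hom_zero[OF D(1,2,4)] by fastforce
    qed (auto simp: vecs_def map_replicate)
    show "g' \<in> mod_hom R (syz R Y vs) (syz R Z ws)"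
      unfolding g'_def
    proof (rule mod_hom_restrictI[OF mods(2)])
      fix v assume v: "v \<in> carrier (syz R Y vs)"
      then obtain a b where ab: "v = a @ b" "a \<in> vecs (carrier R) m" "b \<in> vecs (carrier R) n"
        unfolding sy by auto
      have "lc Z b ws = \<zero>\<^bsub>Z\<^esub>"
        using v glcv[OF ab(2,3)] mod_hom_zero[OF D(2,3,5)] by (simp add: ab(1))
      then show "drop m v \<in> carrier (syz R Z ws)" using ab by (simp add: vecs_length n_def)
    qed (auto simp: drop_map drop_zip)
    show "inj_on f' (carrier (syz R X us))" by (auto simp: inj_on_def f'_def)
    show "g' (f' a) = \<zero>\<^bsub>syz R Z ws\<^esub>" if "a \<in> carrier (syz R X us)" for a
    proof -
      have "length a = m" "lc X a us = \<zero>\<^bsub>X\<^esub>" "a \<in> vecs (carrier R) m" using that by (auto simp: m_def vecs_length)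
      moreover from this have "a @ replicate n \<zero>\<^bsub>R\<^esub> \<in> carrier (syz R Y vs)"
        unfolding sy using z lz mod_hom_zero[OF D(1,2,4)] by fastforce
      ultimately show ?thesis using that by (simp add: f'_def g'_def n_def)
    qed
    show "\<exists>a\<in>carrier (syz R X us). f' a = v"
      if v: "v \<in> carrier (syz R Y vs)" "g' v = \<zero>\<^bsub>syz R Z ws\<^esub>" for v
    proof -
      from v(1) obtain a b where ab: "v = a @ b" "a \<in> vecs (carrier R) m" "b \<in> vecs (carrier R) n"
        "f (lc X a us) \<oplus>\<^bsub>Y\<^esub> lc Y b ys = \<zero>\<^bsub>Y\<^esub>"
        unfolding sy by auto
      have b: "b = replicate n \<zero>\<^bsub>R\<^esub>" using v ab(1,2) by (simp add: g'_def n_def vecs_length)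
      then have "f (lc X a us) = \<zero>\<^bsub>Y\<^esub>" using ab(4) lz fcl[OF ab(2)] by simp
      then have "lc X a us = \<zero>\<^bsub>X\<^esub>" using D(6) fcl[OF ab(2)] mod_hom_inj_iff[OF D(1,2,4)] by blast
      then have "a \<in> carrier (syz R X us)" using ab(2) by (simp add: m_def)
      then show ?thesis using ab(1) b by (intro bexI[of _ a]) (auto simp: f'_def)
    qed
    show "\<exists>v\<in>carrier (syz R Y vs). g' v = b" if "b \<in> carrier (syz R Z ws)" for b
    proof -
      have b: "b \<in> vecs (carrier R) n" "lc Z b ws = \<zero>\<^bsub>Z\<^esub>" using that by (auto simp: n_def)
      \<comment> \<open>A relation \<open>b\<close> among \<open>ws\<close> gives a combination of
        \<open>ys\<close> in the kernel of \<open>g\<close>, that is, in the image of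
        \<open>f\<close>; the first block \<open>a\<close> is chosen to cancel it.\<close>
      then have "g (\<ominus>\<^bsub>Y\<^esub> lc Y b ys) = \<zero>\<^bsub>Z\<^esub>"
        by (simp add: mod_hom_neg[OF D(2,3,5)] lcl glc)
      then obtain a where a: "a \<in> vecs (carrier R) m" "f (lc X a us) = \<ominus>\<^bsub>Y\<^esub> lc Y b ys"
        using cover lcl[OF b(1)] by (metis Y.M.a_inv_closed)
      then have "a @ b \<in> carrier (syz R Y vs)"
        unfolding sy using b lcl[OF b(1)] by (intro exI[of _ a] exI[of _ b]) (simp add: Y.M.l_neg)
      then show ?thesis using a(1) by (intro bexI[of _ "a @ b"]) (auto simp: g'_def vecs_length)
    qed
  qed
  with gvs show thesis by (rule that)
qed

text \<open>The coinductive invariant is to be the middle term of an extension of two members of the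
  class. The horseshoe replaces such an extension by one of syzygies, and the syzygies of the outer
  terms can be chosen in the class.\<close>

lemma sfp_extension:
  assumes "short_exact R X f Y g Z" "sfp R X" "sfp R Z"
  shows "sfp R Y"
proof -
  define P where "P Y' \<longleftrightarrow> (\<exists>(X' :: ('a, 'a list) module) (Z' :: ('a, 'a list) module) f' g'.
    short_exact R X' f' Y' g' Z' \<and> sfp R X' \<and> sfp R Z')" for Y' :: "('a, 'a list) module"
  \<comment> \<open>The types are arbitrary here, because the step is taken both for the given
    sequence and for the sequences of syzygies in \<open>'a list\<close>.\<close>
  have step: "\<exists>vs. gens R Y' vs \<and> P (syz R Y' vs)"
    if se: "short_exact R X' f' Y' g' Z'" and X': "sfp R X'" and Z': "sfp R Z'"
    for X' :: "('a, 'x) module" and Y' :: "('a, 'y) module" and Z' :: "('a, 'z) module" and f' g'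
  proof -
    obtain us where us: "gens R X' us" "sfp R (syz R X' us)" using X' by (rule sfp_step)
    obtain ws where ws: "gens R Z' ws" "sfp R (syz R Z' ws)" using Z' by (rule sfp_step)
    obtain vs h k where "gens R Y' vs" "short_exact R (syz R X' us) h (syz R Y' vs) k (syz R Z' ws)"
      by (rule horseshoe[OF se us(1) ws(1)])
    then show ?thesis using us(2) ws(2) unfolding P_def by blast
  qed
  obtain vs where "gens R Y vs" "P (syz R Y vs)" using step[OF assms] by blast
  then show ?thesis
  proof (rule sfp_coinduct[OF short_exactD(2)[OF assms(1)]])
    fix N assume "P N"
    then show "left_module R N \<and> (\<exists>ys. gens R N ys \<and> P (syz R N ys))"
      unfolding P_def[of N] using step short_exactD(2) by blast
  qed
qed

lemma gens_surj:
  assumes "left_module R K" "gens R K xs"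
  shows "restrict (\<lambda>a. lc K a xs) (vecs (carrier R) (length xs)) \<in> mod_hom R (free_pow R (length xs)) K"
    "restrict (\<lambda>a. lc K a xs) (vecs (carrier R) (length xs)) ` carrier (free_pow R (length xs)) = carrier K"
  using short_exactD(5,7)[OF syz_short_exact[OF assms]] by blast+

lemma gens_span:
  assumes M: "left_module R M" and xs: "set xs \<subseteq> carrier M"
  defines "H \<equiv> (\<lambda>a. lc M a xs) ` vecs (carrier R) (length xs)"
  shows "submodule H R M" "gens R (M\<lparr>carrier := H\<rparr>) xs"
proof -
  interpret M: left_module R M by (rule M)
  have "restrict (\<lambda>a. lc M a xs) (vecs (carrier R) (length xs)) \<in> mod_hom R (free_pow R (length xs)) M"
    using xs by (intro lc_hom_right[OF M] vecsI)
  from mod_image_submodule[OF free_pow_module[OF M.R.ring_axioms] M this]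
  show "submodule H R M" by (simp add: H_def)
  have "x \<in> H" if x: "x \<in> set xs" for x
  proof -
    obtain i where i: "i < length xs" "xs ! i = x" using x by (auto simp: in_set_conv_nth)
    then have "lc M ((replicate (length xs) \<zero>\<^bsub>R\<^esub>)[i := \<one>\<^bsub>R\<^esub>]) xs = x"
      using M.lc_delta_left[OF i(1) vecsI[OF xs], of "\<one>\<^bsub>R\<^esub>"] x xs by auto
    moreover have "(replicate (length xs) \<zero>\<^bsub>R\<^esub>)[i := \<one>\<^bsub>R\<^esub>] \<in> vecs (carrier R) (length xs)"
      using i by (auto simp: vecs_iff_nth nth_list_update)
    ultimately show ?thesis by (auto simp: H_def)
  qed
  then show "gens R (M\<lparr>carrier := H\<rparr>) xs" by (auto simp: gens_def H_def)
qed

text \<open>A vector is a relation among the images of \<open>ys\<close> exactly when its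
  combination of \<open>ys\<close> lies in the image of \<open>X\<close>. Sending it to that element
  of \<open>X\<close> is onto because \<open>ys\<close> generate \<open>Y\<close>, and the kernel
  consists of the relations among \<open>ys\<close>.\<close>

lemma syz_quotient_exact:
  assumes se: "short_exact R X f Y g Z" and ys: "gens R Y ys"
  obtains p where "short_exact R (syz R Y ys) (idm (syz R Y ys)) (syz R Z (map g ys)) p X"
proof -
  note D = short_exactD[OF se]
  let ?h = "restrict (\<lambda>a. lc Z a (map g ys)) (vecs (carrier R) (length ys))"
  have h: "?h \<in> mod_hom R (free_pow R (length ys)) Z"
    using gens_surj(1)[OF D(3) gens_image[OF D(2,3,5,7) ys]] by simp
  have eq: "(free_pow R (length ys))\<lparr>carrier := mod_kernel (free_pow R (length ys)) Z ?h\<rparr> = syz R Z (map g ys)"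
    by (simp add: syz_def mod_kernel_def cong: conj_cong)
  have "?h a = g (restrict (\<lambda>a. lc Y a ys) (vecs (carrier R) (length ys)) a)" if "a \<in> carrier (free_pow R (length ys))" for a
    using that mod_hom_lc[OF D(2,3,5) vecs_set gens_set[OF ys], of a "length ys"] by simp
  from short_exact_compose[OF syz_short_exact[OF D(2) ys] se h this] that show thesis
    unfolding eq by blast
qed

text \<open>The syzygies of \<open>Z\<close> on the images of generators of \<open>Y\<close> are an
  extension of \<open>X\<close> by syzygies of \<open>Y\<close>, so that closure under extensions
  applies to them.\<close>

lemma sfp_quotient:
  assumes se: "short_exact R X f Y g Z" and X: "sfp R X" and Y: "sfp R Y"
  shows "sfp R Z"
proof -
  note D = short_exactD[OF se]
  obtain ys where ys: "gens R Y ys" "sfp R (syz R Y ys)" using Y by (rule sfp_step)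
  obtain p where "short_exact R (syz R Y ys) (idm (syz R Y ys)) (syz R Z (map g ys)) p X"
    by (rule syz_quotient_exact[OF se ys(1)])
  then have "sfp R (syz R Z (map g ys))" using ys(2) X by (rule sfp_extension)
  then show ?thesis by (rule sfp_intro[OF D(3) gens_image[OF D(2,3,5,7) ys(1)]])
qed

lemma sfp_reg_mod:
  assumes "ring R" shows "sfp R (reg_mod R)"
proof (rule sfp_intro[OF reg_mod_module[OF assms]])
  interpret ring R by fact
  have "carrier (syz R (reg_mod R) [\<one>\<^bsub>R\<^esub>]) = {[\<zero>\<^bsub>R\<^esub>]}" by (auto simp: vecs_Suc_iff)
  then show "sfp R (syz R (reg_mod R) [\<one>\<^bsub>R\<^esub>])"
    using assms by (intro sfp_zero syz_module reg_mod_module) auto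
  show "gens R (reg_mod R) [\<one>\<^bsub>R\<^esub>]" by (force simp: gens_def vecs_Suc_iff)
qed

lemma pow_mod_Suc_exact:
  assumes "left_module R M"
  shows "short_exact R M (restrict (\<lambda>x. x # replicate n \<zero>\<^bsub>M\<^esub>) (carrier M)) (pow_mod M (Suc n))
    (restrict tl (vecs (carrier M) (Suc n))) (pow_mod M n)"
proof -
  interpret M: left_module R M by fact
  note P = pow_mod_module[OF assms]
  have 1: "restrict tl (carrier (pow_mod M (Suc n))) \<in> mod_hom R (pow_mod M (Suc n)) (pow_mod M n)"
    by (rule mod_hom_restrictI[OF P]) (auto simp: vecs_Suc_iff)
  show ?thesis
  proof (rule short_exactI[OF assms P P])
    show "restrict (\<lambda>x. x # replicate n \<zero>\<^bsub>M\<^esub>) (carrier M) \<in> mod_hom R M (pow_mod M (Suc n))"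
      by (rule mod_hom_restrictI[OF assms])
         (auto simp: vecs_replicate zip_replicate1 map_replicate_const M.smult_zero_r map_replicate)
    show "\<exists>y\<in>carrier (pow_mod M (Suc n)). restrict tl (vecs (carrier M) (Suc n)) y = z"
      if "z \<in> carrier (pow_mod M n)" for z
      using that by (intro bexI[of _ "\<zero>\<^bsub>M\<^esub> # z"]) auto
  qed (use 1 in \<open>auto simp: inj_on_def vecs_replicate vecs_Suc_iff\<close>)
qed

lemma sfp_pow_mod:
  assumes "sfp R M" shows "sfp R (pow_mod M n)"
proof (induction n)
  case 0 show ?case by (rule sfp_zero[OF pow_mod_module[OF sfp_module[OF assms]]]) auto
next
  case (Suc n) show ?case
    by (rule sfp_extension[OF pow_mod_Suc_exact[OF sfp_module[OF assms]] assms Suc])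
qed

section \<open>Projective modules\<close>

text \<open>For \<open>x\<close> outside \<open>X\<close> this is the zero function, so that it
  belongs to the free module for every \<open>x\<close>.\<close>

definition delta :: "'r ring \<Rightarrow> 'x set \<Rightarrow> 'x \<Rightarrow> 'x \<Rightarrow> 'r" where
  "delta R X x = (\<lambda>y\<in>X. if y = x then \<one>\<^bsub>R\<^esub> else \<zero>\<^bsub>R\<^esub>)"

lemma free_mod_simps [simp]:
  "carrier (free_mod R X) = {f \<in> X \<rightarrow>\<^sub>E carrier R. finite {x \<in> X. f x \<noteq> \<zero>\<^bsub>R\<^esub>}}"
  "ring.add (free_mod R X) = (\<lambda>f g. \<lambda>x\<in>X. f x \<oplus>\<^bsub>R\<^esub> g x)"
  "ring.zero (free_mod R X) = (\<lambda>x\<in>X. \<zero>\<^bsub>R\<^esub>)"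
  "module.smult (free_mod R X) = (\<lambda>a f. \<lambda>x\<in>X. a \<otimes>\<^bsub>R\<^esub> f x)"
  by (simp_all add: free_mod_def)

lemma free_mod_module:
  assumes "ring R" shows "left_module R (free_mod R X)"
proof -
  interpret ring R by fact
  have fin2: "finite {x \<in> X. h x \<noteq> \<zero>\<^bsub>R\<^esub>}" if "finite {x \<in> X. f x \<noteq> \<zero>\<^bsub>R\<^esub>}" "finite {x \<in> X. g x \<noteq> \<zero>\<^bsub>R\<^esub>}"
    "\<And>x. x \<in> X \<Longrightarrow> f x = \<zero>\<^bsub>R\<^esub> \<Longrightarrow> g x = \<zero>\<^bsub>R\<^esub> \<Longrightarrow> h x = \<zero>\<^bsub>R\<^esub>" for f g h :: "'b \<Rightarrow> 'a"
    by (rule finite_subset[OF _ finite_UnI[OF that(1,2)]]) (use that(3) in auto)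
  have "abelian_group (free_mod R X)"
  proof (rule abelian_groupI)
    fix f g assume fg: "f \<in> carrier (free_mod R X)" "g \<in> carrier (free_mod R X)"
    have "finite {x \<in> X. (f \<oplus>\<^bsub>free_mod R X\<^esub> g) x \<noteq> \<zero>\<^bsub>R\<^esub>}"
      by (rule fin2[of f g]) (use fg in auto)
    then show "f \<oplus>\<^bsub>free_mod R X\<^esub> g \<in> carrier (free_mod R X)"
      using fg by auto
    show "f \<oplus>\<^bsub>free_mod R X\<^esub> g = g \<oplus>\<^bsub>free_mod R X\<^esub> f"
      using fg by (auto simp: PiE_iff a_comm intro!: restrict_ext)
  next
    fix f assume f: "f \<in> carrier (free_mod R X)"
    then show "\<zero>\<^bsub>free_mod R X\<^esub> \<oplus>\<^bsub>free_mod R X\<^esub> f = f"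
      by (auto simp: PiE_iff fun_eq_iff extensional_def)
    have "(\<lambda>x\<in>X. \<ominus>\<^bsub>R\<^esub> f x) \<in> carrier (free_mod R X)"
    proof -
      have "finite {x \<in> X. (\<lambda>x\<in>X. \<ominus>\<^bsub>R\<^esub> f x) x \<noteq> \<zero>\<^bsub>R\<^esub>}"
        by (rule fin2[of f f]) (use f in auto)
      then show ?thesis using f by auto
    qed
    then show "\<exists>g\<in>carrier (free_mod R X). g \<oplus>\<^bsub>free_mod R X\<^esub> f = \<zero>\<^bsub>free_mod R X\<^esub>"
      by (rule bexI[rotated]) (use f in \<open>auto simp: PiE_iff l_neg intro!: restrict_ext\<close>)
  qed (auto simp: PiE_iff a_assoc intro!: restrict_ext)
  then show ?thesis
  proof (intro left_module.intro ring_axioms left_module_axioms.intro)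
    fix a f assume af: "a \<in> carrier R" "f \<in> carrier (free_mod R X)"
    have "finite {x \<in> X. (a \<odot>\<^bsub>free_mod R X\<^esub> f) x \<noteq> \<zero>\<^bsub>R\<^esub>}"
      by (rule fin2[of f f]) (use af in auto)
    then show "a \<odot>\<^bsub>free_mod R X\<^esub> f \<in> carrier (free_mod R X)"
      using af by auto
  qed (auto simp: PiE_iff l_distr r_distr m_assoc fun_eq_iff extensional_def)
qed

lemma delta_closed:
  assumes "ring R" shows "delta R X x \<in> carrier (free_mod R X)"
proof -
  interpret ring R by fact
  have "finite {y \<in> X. delta R X x y \<noteq> \<zero>\<^bsub>R\<^esub>}"
    by (rule finite_subset[of _ "{x}"]) (auto simp: delta_def)
  then show ?thesis by (auto simp: delta_def)
qed

lemma (in left_module) finsum_smult: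
  assumes "finite T" "h \<in> T \<rightarrow> carrier M" "a \<in> carrier R"
  shows "a \<odot>\<^bsub>M\<^esub> finsum M h T = finsum M (\<lambda>x. a \<odot>\<^bsub>M\<^esub> h x) T"
  using assms
proof (induction T rule: finite_induct)
  case (insert x T)
  then have "h \<in> T \<rightarrow> carrier M" "h x \<in> carrier M" "(\<lambda>x. a \<odot>\<^bsub>M\<^esub> h x) \<in> T \<rightarrow> carrier M" by auto
  then show ?case using insert by (simp add: smult_r_distr M.finsum_closed)
qed (simp add: smult_zero_r)

lemma free_mod_universal:
  assumes M: "left_module R M" and m: "\<And>x. x \<in> X \<Longrightarrow> m x \<in> carrier M"
  obtains \<phi> where "\<phi> \<in> mod_hom R (free_mod R X) M" "\<And>x. x \<in> X \<Longrightarrow> \<phi> (delta R X x) = m x"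
proof -
  interpret M: left_module R M by fact
  note F = free_mod_module[OF M.R.ring_axioms, of X]
  define S where "S f = {x \<in> X. f x \<noteq> \<zero>\<^bsub>R\<^esub>}" for f
  define \<phi> where "\<phi> = restrict (\<lambda>f. finsum M (\<lambda>x. f x \<odot>\<^bsub>M\<^esub> m x) (S f)) (carrier (free_mod R X))"
  \<comment> \<open>The sum may be taken over any finite subset of \<open>X\<close> containing the
    support. Additivity can then be checked over the union of two supports.\<close>
  have \<phi>: "\<phi> f = finsum M (\<lambda>x. f x \<odot>\<^bsub>M\<^esub> m x) T"
    if f: "f \<in> carrier (free_mod R X)" and T: "finite T" "S f \<subseteq> T" "T \<subseteq> X" for f T
  proof -
    have "finsum M (\<lambda>x. f x \<odot>\<^bsub>M\<^esub> m x) (S f) = finsum M (\<lambda>x. f x \<odot>\<^bsub>M\<^esub> m x) T"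
    proof (rule M.M.add.finprod_mono_neutral_cong_left[OF T(1,2)])
      show "\<And>x. x \<in> T - S f \<Longrightarrow> f x \<odot>\<^bsub>M\<^esub> m x = \<zero>\<^bsub>M\<^esub>"
        using T m by (auto simp: S_def M.smult_zero_l)
      show "(\<lambda>x. f x \<odot>\<^bsub>M\<^esub> m x) \<in> T \<rightarrow> carrier M" using f T m by (auto simp: PiE_iff subset_iff)
    qed auto
    then show ?thesis using f by (simp add: \<phi>_def)
  qed
  have "\<phi> \<in> mod_hom R (free_mod R X) M"
  proof (rule mod_homI)
    fix f assume f: "f \<in> carrier (free_mod R X)"
    have fin: "finite (S f)" "S f \<subseteq> X" using f by (auto simp: S_def)
    have *: "(\<lambda>x. f x \<odot>\<^bsub>M\<^esub> m x) \<in> S f \<rightarrow> carrier M" using f fin m by auto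
    then show "\<phi> f \<in> carrier M" using \<phi>[OF f fin(1) _ fin(2)] by (simp add: M.M.finsum_closed)
    {
      fix a assume a: "a \<in> carrier R"
      have af: "a \<odot>\<^bsub>free_mod R X\<^esub> f \<in> carrier (free_mod R X)"
        by (rule left_module.smult_closed[OF F a f])
      have "S (a \<odot>\<^bsub>free_mod R X\<^esub> f) \<subseteq> S f" using a by (auto simp: S_def)
      from \<phi>[OF af fin(1) this fin(2)]
      have "\<phi> (a \<odot>\<^bsub>free_mod R X\<^esub> f) = finsum M (\<lambda>x. a \<odot>\<^bsub>M\<^esub> (f x \<odot>\<^bsub>M\<^esub> m x)) (S f)"
      proof (rule trans, intro M.M.finsum_cong')
        fix x assume "x \<in> S f"
        then have "x \<in> X" by (simp add: S_def)
        then show "(a \<odot>\<^bsub>free_mod R X\<^esub> f) x \<odot>\<^bsub>M\<^esub> m x = a \<odot>\<^bsub>M\<^esub> (f x \<odot>\<^bsub>M\<^esub> m x)"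
          using f m a by (auto simp: M.smult_assoc1 PiE_iff)
      qed (use * a in auto)
      then show "\<phi> (a \<odot>\<^bsub>free_mod R X\<^esub> f) = a \<odot>\<^bsub>M\<^esub> \<phi> f"
        using \<phi>[OF f fin(1) subset_refl fin(2)] M.finsum_smult[OF fin(1) * a] by simp
    }
    fix g assume g: "g \<in> carrier (free_mod R X)"
    let ?T = "S f \<union> S g"
    have T: "finite ?T" "?T \<subseteq> X" using fin g by (auto simp: S_def)
    have fg: "f \<oplus>\<^bsub>free_mod R X\<^esub> g \<in> carrier (free_mod R X)"
      using F f g by (meson abelian_group.axioms(1) abelian_monoid.a_closed left_module_def)
    have fgx: "f x \<in> carrier R" "g x \<in> carrier R" "m x \<in> carrier M" "x \<in> X" if "x \<in> ?T" for x
      using that T(2) f g m by auto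
    have sfg: "S (f \<oplus>\<^bsub>free_mod R X\<^esub> g) \<subseteq> ?T" by (auto simp: S_def)
    have "\<phi> (f \<oplus>\<^bsub>free_mod R X\<^esub> g) = finsum M (\<lambda>x. (f \<oplus>\<^bsub>free_mod R X\<^esub> g) x \<odot>\<^bsub>M\<^esub> m x) ?T"
      by (rule \<phi>[OF fg T(1) sfg T(2)])
    also have "\<dots> = finsum M (\<lambda>x. f x \<odot>\<^bsub>M\<^esub> m x \<oplus>\<^bsub>M\<^esub> g x \<odot>\<^bsub>M\<^esub> m x) ?T"
    proof (rule M.M.finsum_cong')
      show "(\<lambda>x. f x \<odot>\<^bsub>M\<^esub> m x \<oplus>\<^bsub>M\<^esub> g x \<odot>\<^bsub>M\<^esub> m x) \<in> ?T \<rightarrow> carrier M" using fgx by blast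
      show "(f \<oplus>\<^bsub>free_mod R X\<^esub> g) x \<odot>\<^bsub>M\<^esub> m x = f x \<odot>\<^bsub>M\<^esub> m x \<oplus>\<^bsub>M\<^esub> g x \<odot>\<^bsub>M\<^esub> m x" if "x \<in> ?T" for x
        using fgx[OF that] by (simp add: M.smult_l_distr)
    qed simp
    also have "\<dots> = \<phi> f \<oplus>\<^bsub>M\<^esub> \<phi> g"
    proof -
      have "(\<lambda>x. f x \<odot>\<^bsub>M\<^esub> m x) \<in> ?T \<rightarrow> carrier M" "(\<lambda>x. g x \<odot>\<^bsub>M\<^esub> m x) \<in> ?T \<rightarrow> carrier M"
        using fgx by blast+
      then show ?thesis
        using \<phi>[OF f T(1) _ T(2)] \<phi>[OF g T(1) _ T(2)] by (simp add: M.M.finsum_addf)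
    qed
    finally show "\<phi> (f \<oplus>\<^bsub>free_mod R X\<^esub> g) = \<phi> f \<oplus>\<^bsub>M\<^esub> \<phi> g" .
  qed (simp add: \<phi>_def)
  moreover have "\<phi> (delta R X x) = m x" if "x \<in> X" for x
  proof -
    have "\<phi> (delta R X x) = finsum M (\<lambda>y. delta R X x y \<odot>\<^bsub>M\<^esub> m y) {x}"
      using that by (intro \<phi> delta_closed M.R.ring_axioms) (auto simp: S_def delta_def)
    then show ?thesis using that m by (simp add: delta_def)
  qed
  ultimately show thesis by (rule that)
qed

lemma free_mod_hom_eqI:
  assumes M: "left_module R M" and \<phi>: "\<phi> \<in> mod_hom R (free_mod R X) M" and \<psi>: "\<psi> \<in> mod_hom R (free_mod R X) M"
    and eq: "\<And>x. x \<in> X \<Longrightarrow> \<phi> (delta R X x) = \<psi> (delta R X x)"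
    and f: "f \<in> carrier (free_mod R X)"
  shows "\<phi> f = \<psi> f"
proof -
  interpret M: left_module R M by fact
  have F: "left_module R (free_mod R X)" by (rule free_mod_module[OF M.R.ring_axioms])
  interpret F: left_module R "free_mod R X" by (rule F)
  \<comment> \<open>The induction runs over a finite bound \<open>T\<close> for the support:
    splitting off the coordinate at \<open>x\<close> leaves a function supported in the smaller
    set.\<close>
  have "\<forall>f\<in>carrier (free_mod R X). {x \<in> X. f x \<noteq> \<zero>\<^bsub>R\<^esub>} \<subseteq> T \<longrightarrow> \<phi> f = \<psi> f" if "finite T" for T
    using that
  proof (induction T rule: finite_induct)
    case empty
    show ?case
    proof (intro ballI impI)
      fix f assume f: "f \<in> carrier (free_mod R X)" "{x \<in> X. f x \<noteq> \<zero>\<^bsub>R\<^esub>} \<subseteq> {}"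
      then have "f = \<zero>\<^bsub>free_mod R X\<^esub>" by (auto simp: PiE_iff extensional_def fun_eq_iff)
      then show "\<phi> f = \<psi> f" using mod_hom_zero[OF F M \<phi>] mod_hom_zero[OF F M \<psi>] by metis
    qed
  next
    case (insert x T)
    show ?case
    proof (intro ballI impI)
      fix f assume f: "f \<in> carrier (free_mod R X)" "{x \<in> X. f x \<noteq> \<zero>\<^bsub>R\<^esub>} \<subseteq> insert x T"
      show "\<phi> f = \<psi> f"
      proof (cases "x \<in> X")
        case True
        let ?h = "f(x := \<zero>\<^bsub>R\<^esub>)"
        have h: "?h \<in> carrier (free_mod R X)"
        proof -
          have "finite {y \<in> X. ?h y \<noteq> \<zero>\<^bsub>R\<^esub>}"
            by (rule finite_subset[of _ "{y \<in> X. f y \<noteq> \<zero>\<^bsub>R\<^esub>}"]) (use f in auto)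
          then show ?thesis using f True by (auto simp: PiE_iff extensional_def)
        qed
        have fx: "f x \<in> carrier R" using f True by auto
        have fh: "f = ?h \<oplus>\<^bsub>free_mod R X\<^esub> f x \<odot>\<^bsub>free_mod R X\<^esub> delta R X x"
          using f True by (auto simp: fun_eq_iff delta_def PiE_iff extensional_def)
        note d = delta_closed[OF M.R.ring_axioms, of X x]
        have "{y \<in> X. ?h y \<noteq> \<zero>\<^bsub>R\<^esub>} \<subseteq> T" using f(2) by (auto split: if_splits)
        then have "\<phi> ?h = \<psi> ?h" using insert.IH h by blast
        moreover have "\<phi> f = \<phi> ?h \<oplus>\<^bsub>M\<^esub> f x \<odot>\<^bsub>M\<^esub> \<phi> (delta R X x)"
          using mod_hom_add[OF \<phi> h F.smult_closed[OF fx d]] mod_hom_smult[OF \<phi> fx d] fh by metis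
        moreover have "\<psi> f = \<psi> ?h \<oplus>\<^bsub>M\<^esub> f x \<odot>\<^bsub>M\<^esub> \<psi> (delta R X x)"
          using mod_hom_add[OF \<psi> h F.smult_closed[OF fx d]] mod_hom_smult[OF \<psi> fx d] fh by metis
        ultimately show ?thesis using eq True by simp
      next
        case False
        then have "{x \<in> X. f x \<noteq> \<zero>\<^bsub>R\<^esub>} \<subseteq> T" using f by auto
        then show ?thesis using insert.IH f by blast
      qed
    qed
  qed
  then show ?thesis using f by auto
qed

text \<open>The composite of \<open>e\<close> with the projection of the free module onto
  \<open>P\<close> is lifted on basis vectors. Preceding this lift by the section \<open>i\<close>
  gives the lift on \<open>P\<close>.\<close>

lemma projective_lift:
  assumes P: "projective R P" and Y: "left_module R Y" and K: "left_module R K"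
    and q: "q \<in> mod_hom R Y K" "q ` carrier Y = carrier K" and e: "e \<in> mod_hom R P K"
  obtains l where "l \<in> mod_hom R P Y" "\<And>x. x \<in> carrier P \<Longrightarrow> q (l x) = e x"
proof -
  let ?F = "free_mod R (carrier P)"
  obtain i p where i: "i \<in> mod_hom R P ?F" and p: "p \<in> mod_hom R ?F P"
    and pi: "\<And>x. x \<in> carrier P \<Longrightarrow> p (i x) = x"
    using P by (auto simp: projective_def)
  have PM: "left_module R P" using P by (simp add: projective_def)
  interpret P: left_module R P by (rule PM)
  note F = free_mod_module[OF P.R.ring_axioms, of "carrier P"]
  note d = delta_closed[OF P.R.ring_axioms, of "carrier P"]
  have ep: "compose (carrier ?F) e p \<in> mod_hom R ?F K" by (rule mod_hom_compose[OF F p e])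
  have "\<exists>y\<in>carrier Y. q y = e (p (delta R (carrier P) x))" for x
    using mod_hom_closed[OF e mod_hom_closed[OF p d]] q(2) by (metis imageE)
  then obtain m where m: "\<And>x. m x \<in> carrier Y" "\<And>x. q (m x) = e (p (delta R (carrier P) x))" by metis
  obtain \<phi> where \<phi>: "\<phi> \<in> mod_hom R ?F Y" "\<And>x. x \<in> carrier P \<Longrightarrow> \<phi> (delta R (carrier P) x) = m x"
    using free_mod_universal[OF Y, of "carrier P" m] m(1) by metis
  have q\<phi>: "compose (carrier ?F) q \<phi> \<in> mod_hom R ?F K" by (rule mod_hom_compose[OF F \<phi>(1) q(1)])
  have "compose (carrier ?F) q \<phi> f = compose (carrier ?F) e p f" if "f \<in> carrier ?F" for f
    by (rule free_mod_hom_eqI[OF K q\<phi> ep _ that]) (use \<phi>(2) m d in \<open>simp add: compose_eq\<close>)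
  then have "q (\<phi> (i x)) = e x" if "x \<in> carrier P" for x
    using that mod_hom_closed[OF i that] pi by (simp add: compose_eq)
  moreover have "compose (carrier P) \<phi> i \<in> mod_hom R P Y" by (rule mod_hom_compose[OF PM i \<phi>(1)])
  ultimately show thesis by (intro that[of "compose (carrier P) \<phi> i"]) (auto simp: compose_eq)
qed

text \<open>Sending the basis vector at \<open>x\<close> to \<open>x\<close> always gives a
  surjection from the free module on the underlying set; what has to be supplied is a
  splitting.\<close>

lemma projectiveI:
  assumes P: "left_module R P"
    and lift: "\<And>p. p \<in> mod_hom R (free_mod R (carrier P)) P \<Longrightarrow>
      p ` carrier (free_mod R (carrier P)) = carrier P \<Longrightarrow>
      \<exists>i\<in>mod_hom R P (free_mod R (carrier P)). \<forall>x\<in>carrier P. p (i x) = x"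
  shows "projective R P"
proof -
  interpret P: left_module R P by fact
  let ?F = "free_mod R (carrier P)"
  obtain p where p: "p \<in> mod_hom R ?F P" "\<And>x. x \<in> carrier P \<Longrightarrow> p (delta R (carrier P) x) = x"
    using free_mod_universal[OF P, of "carrier P" "\<lambda>x. x"] by metis
  have "p ` carrier ?F = carrier P"
  proof
    show "carrier P \<subseteq> p ` carrier ?F"
      using p(2) delta_closed[OF P.R.ring_axioms] by (metis imageI subsetI)
  qed (use mod_hom_closed[OF p(1)] in auto)
  from lift[OF p(1) this] p(1) P show ?thesis by (auto simp: projective_def)
qed

lemma projective_iso:
  assumes P: "projective R P" and P': "left_module R P'" and f: "f \<in> mod_hom R P P'" "bij_betw f (carrier P) (carrier P')"
  shows "projective R P'"
proof (rule projectiveI[OF P'])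
  let ?F = "free_mod R (carrier P')"
  interpret P': left_module R P' by fact
  have PM: "left_module R P" using P by (simp add: projective_def)
  let ?g = "restrict (inv_into (carrier P) f) (carrier P')"
  have g: "?g \<in> mod_hom R P' P" by (rule mod_hom_inverse[OF PM P' f])
  fix p assume p: "p \<in> mod_hom R ?F P'" "p ` carrier ?F = carrier P'"
  obtain l where l: "l \<in> mod_hom R P ?F" "\<And>x. x \<in> carrier P \<Longrightarrow> p (l x) = f x"
    using projective_lift[OF P free_mod_module[OF P'.R.ring_axioms] P' p f(1)] by metis
  have "compose (carrier P') l ?g \<in> mod_hom R P' ?F" by (rule mod_hom_compose[OF P' g l(1)])
  moreover have "p (compose (carrier P') l ?g x) = x" if "x \<in> carrier P'" for x
    using that l(2) mod_hom_closed[OF g that] f(2) by (simp add: compose_eq bij_betw_inv_into_right)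
  ultimately show "\<exists>i\<in>mod_hom R P' ?F. \<forall>x\<in>carrier P'. p (i x) = x" by blast
qed

lemma free_pow_lift:
  assumes Y: "left_module R Y" and K: "left_module R K"
    and q: "q \<in> mod_hom R Y K" "q ` carrier Y = carrier K" and e: "e \<in> mod_hom R (free_pow R n) K"
  obtains l where "l \<in> mod_hom R (free_pow R n) Y" "\<And>x. x \<in> vecs (carrier R) n \<Longrightarrow> q (l x) = e x"
proof -
  interpret Y: left_module R Y by fact
  note F = free_pow_module[OF Y.R.ring_axioms, of n]
  note u = vecs_set[OF unit_vecs_in[OF Y.R.ring_axioms], of n]
  obtain ys where ys: "set ys \<subseteq> carrier Y" "map q ys = map e (unit_vecs R n)"
    using lift_list[OF q(2), of "map e (unit_vecs R n)"] u mod_hom_closed[OF e] by auto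
  have "length ys = n" using arg_cong[OF ys(2), of length] by simp
  then have ys': "ys \<in> vecs (carrier Y) n" using ys by (simp add: vecs_def)
  let ?l = "restrict (\<lambda>a. lc Y a ys) (vecs (carrier R) n)"
  have l: "?l \<in> mod_hom R (free_pow R n) Y" by (rule lc_hom_right[OF Y ys'])
  have "q (?l x) = e x" if x: "x \<in> vecs (carrier R) n" for x
  proof -
    have "q (?l x) = lc K x (map e (unit_vecs R n))"
      using x mod_hom_lc[OF Y K q(1) vecs_set[OF x] ys(1)] ys(2) by simp
    also have "\<dots> = e (lc (free_pow R n) x (unit_vecs R n))"
      using mod_hom_lc[OF F K e vecs_set[OF x], of "unit_vecs R n"] u by simp
    finally show ?thesis by (simp add: lc_unit_vecs[OF Y.R.ring_axioms x])
  qed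
  with l show thesis by (rule that)
qed

lemma projective_free_pow:
  assumes "ring R" shows "projective R (free_pow R n)"
proof (rule projectiveI[OF free_pow_module[OF assms]])
  let ?F = "free_mod R (carrier (free_pow R n))"
  fix p assume p: "p \<in> mod_hom R ?F (free_pow R n)" "p ` carrier ?F = carrier (free_pow R n)"
  note M = free_pow_module[OF assms, of n]
  have "idm (free_pow R n) \<in> mod_hom R (free_pow R n) (free_pow R n)"
    by (rule mod_hom_restrictI[OF M]) auto
  then obtain l where "l \<in> mod_hom R (free_pow R n) ?F"
    "\<And>x. x \<in> vecs (carrier R) n \<Longrightarrow> p (l x) = idm (free_pow R n) x"
    using free_pow_lift[OF free_mod_module[OF assms] M p] by blast
  then show "\<exists>i\<in>mod_hom R (free_pow R n) ?F. \<forall>x\<in>carrier (free_pow R n). p (i x) = x"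
    by (intro bexI[of _ l]) auto
qed

lemma gens_imp_fin_gen:
  assumes "left_module R M" "gens R M xs" shows "fin_gen R M"
proof -
  have "H = carrier M" if H: "submodule H R M" "set xs \<subseteq> H" for H
  proof
    interpret M: left_module R M by fact
    note H' = M.left_submoduleD[OF H(1)]
    show "H \<subseteq> carrier M" by (rule H')
    interpret H: left_module R "M\<lparr>carrier := H\<rparr>" by (rule M.left_submodule_is_module[OF H(1)])
    show "carrier M \<subseteq> H"
    proof
      fix x assume "x \<in> carrier M"
      from gensE[OF assms(2) this] obtain a where "a \<in> vecs (carrier R) (length xs)" "lc M a xs = x" .
      then show "x \<in> H" using H.lc_closed[of a xs] H(2) by (simp add: vecs_set)
    qed
  qed
  then show ?thesis using assms(2) unfolding fin_gen_def gens_def by blast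
qed

lemma fin_gen_imp_gens:
  assumes M: "left_module R M" and "fin_gen R M" obtains xs where "gens R M xs"
proof -
  obtain X where X: "finite X" "X \<subseteq> carrier M" "\<And>H. submodule H R M \<Longrightarrow> X \<subseteq> H \<Longrightarrow> H = carrier M"
    using assms(2) by (auto simp: fin_gen_def)
  obtain xs where xs: "set xs = X" using finite_list[OF X(1)] by blast
  let ?H = "(\<lambda>a. lc M a xs) ` vecs (carrier R) (length xs)"
  have H: "submodule ?H R M" "gens R (M\<lparr>carrier := ?H\<rparr>) xs" using gens_span[OF M, of xs] xs X(2) by auto
  then have "?H = carrier M" using X(3)[OF H(1)] gens_set[OF H(2)] xs by simp
  then show thesis using H(2) that by simp
qed

section \<open>Degreewise finite projective resolutions\<close>

text \<open>A section \<open>s\<close> makes \<open>M\<close> a direct summand of a free module of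
  finite rank, and the syzygies form the complement. The projection onto the complement sends the
  unit vectors to generators, and for these generators the inclusion of the complement is again a
  section. So the situation reproduces itself in every degree.\<close>

lemma sfp_of_split:
  assumes M: "left_module R M" and zs: "gens R M zs"
    and s: "s \<in> mod_hom R M (free_pow R (length zs))" "\<And>x. x \<in> carrier M \<Longrightarrow> lc M (s x) zs = x"
  shows "sfp R (syz R M zs)"
proof -
  define P where "P N \<longleftrightarrow> (\<exists>zs s. left_module R N \<and> gens R N zs \<and>
    s \<in> mod_hom R N (free_pow R (length zs)) \<and> (\<forall>x\<in>carrier N. lc N (s x) zs = x))"
    for N :: "('a, 'a list) module"
  have step: "P (syz R N zs)" if N: "left_module R N" and zs: "gens R N zs"
    and s: "s \<in> mod_hom R N (free_pow R (length zs))" "\<And>x. x \<in> carrier N \<Longrightarrow> lc N (s x) zs = x"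
    for N :: "('a, 'n) module" and zs s
  proof -
    interpret N: left_module R N by fact
    define n where "n = length zs"
    let ?F = "free_pow R n" and ?W = "syz R N zs" and ?g = "restrict (\<lambda>a. lc N a zs) (vecs (carrier R) n)"
    note F = free_pow_module[OF N.R.ring_axioms, of n] and W = syz_module[OF N gens_set[OF zs]]
    interpret F: left_module R ?F by (rule F)
    have g: "?g \<in> mod_hom R ?F N" using gens_surj(1)[OF N zs] by (simp add: n_def)
    let ?sg = "compose (carrier ?F) s ?g" and ?id = "idm ?F"
    have sg: "?sg \<in> mod_hom R ?F ?F" by (rule mod_hom_compose[OF F g s(1)[folded n_def]])
    have id: "?id \<in> mod_hom R ?F ?F" by (rule mod_hom_restrictI[OF F]) auto
    have d: "?id a \<ominus>\<^bsub>?F\<^esub> ?sg a = a \<ominus>\<^bsub>?F\<^esub> s (lc N a zs)" if "a \<in> carrier ?F" for a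
      using that by (simp add: compose_eq)
    \<comment> \<open>The idempotent complementary to \<open>s\<close> after \<open>?g\<close>: its
      values are syzygies, and it fixes every syzygy.\<close>
    define u where "u = restrict (\<lambda>a. ?id a \<ominus>\<^bsub>?F\<^esub> ?sg a) (carrier ?F)"
    have u: "u \<in> mod_hom R ?F ?F" unfolding u_def by (rule mod_hom_diff[OF F F id sg])
    have z: "?g (u a) = \<zero>\<^bsub>N\<^esub>" if a: "a \<in> carrier ?F" for a
    proof -
      have ga: "?g a \<in> carrier N" "?g (?sg a) = ?g a"
        using mod_hom_closed[OF g a] mod_hom_closed[OF sg a] s(2)[of "?g a"] a by (simp_all add: compose_eq)
      show ?thesis
        unfolding u_def restrict_apply'[OF a, of "\<lambda>a. ?id a \<ominus>\<^bsub>?F\<^esub> ?sg a"]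
          mod_hom_minus[OF F N g mod_hom_closed[OF id a] mod_hom_closed[OF sg a]]
        unfolding restrict_apply'[OF a, of "\<lambda>x. x"] ga(2) by (simp only: N.minus_eq_zero[OF ga(1,1)])
    qed
    obtain e where e: "e \<in> mod_hom R ?F ?W"
      "\<And>a. a \<in> carrier ?F \<Longrightarrow> idm ?W (e a) = u a"
      by (rule short_exact_corestrict[OF syz_short_exact[OF N zs, folded n_def] F u z]) blast+
    have ea: "e a = a \<ominus>\<^bsub>?F\<^esub> s (lc N a zs)" if "a \<in> carrier ?F" for a
      using e(2)[OF that] mod_hom_closed[OF e(1) that] d[OF that] that
      unfolding u_def restrict_apply'[OF that] by (simp only: restrict_apply')
    have WF: "a \<in> carrier ?F" if "a \<in> carrier ?W" for a using that by (simp add: n_def)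
    have ew: "e a = a" if "a \<in> carrier ?W" for a
    proof -
      have "s (lc N a zs) = \<zero>\<^bsub>?F\<^esub>" using that mod_hom_zero[OF N F s(1)[folded n_def]] by simp
      then show ?thesis
        unfolding ea[OF WF[OF that]] a_minus_def using WF[OF that] by (simp only: F.neg_zero F.M.r_zero)
    qed
    define us where "us = map e (unit_vecs R n)"
    note uv = vecs_set[OF unit_vecs_in[OF N.R.ring_axioms], of n]
    have uF: "set (unit_vecs R n) \<subseteq> carrier ?F" using uv by simp
    have lu: "length us = n" by (simp add: us_def)
    have lce: "lc ?W a us = e a" if a: "a \<in> vecs (carrier R) n" for a
      unfolding us_def mod_hom_lc[OF F W e(1) vecs_set[OF a] uF, symmetric] lc_unit_vecs[OF N.R.ring_axioms a] ..
    have gus: "gens R ?W us"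
      unfolding gens_def lu
    proof (intro conjI ballI)
      show "set us \<subseteq> carrier ?W" using mod_hom_closed[OF e(1)] uF unfolding us_def by auto
      show "\<exists>b\<in>vecs (carrier R) n. lc ?W b us = a" if a: "a \<in> carrier ?W" for a
        using a lce ew n_def by (intro bexI[of _ a]) auto
    qed
    have "idm ?W \<in> mod_hom R ?W (free_pow R (length us))"
      unfolding lu by (rule mod_hom_restrictI[OF W]) (auto simp: n_def)
    moreover have "lc ?W (idm ?W a) us = a" if "a \<in> carrier ?W" for a
      using that lce[of a] ew[OF that] by (simp add: n_def)
    ultimately show ?thesis unfolding P_def using W gus by blast
  qed
  have next_step: "left_module R N \<and> (\<exists>ys. gens R N ys \<and> P (syz R N ys))" if "P N" for N
    using that step unfolding P_def[of N] by metis
  then obtain ys where "gens R (syz R M zs) ys" "P (syz R (syz R M zs) ys)" using step[OF M zs s] by metis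
  then show ?thesis by (rule sfp_coinduct[OF syz_module[OF M gens_set[OF zs]] _ _ next_step])
qed

text \<open>\<open>M\<close> is generated by the images of generators of \<open>P\<close>. Their
  syzygies are an extension of the kernel of \<open>e\<close> by the syzygies \<open>Q\<close> of
  \<open>P\<close>, and \<open>Q\<close> is infinitely presented because the presentation of a
  projective module splits.\<close>

lemma fg_projective_syz_exact:
  fixes P :: "('r, 'p) module" and M :: "('r, 'm) module"
  assumes P: "projective R P" "fin_gen R P" and M: "left_module R M"
    and e: "e \<in> mod_hom R P M" "e ` carrier P = carrier M"
  obtains xs and Q :: "('r, 'r list) module" and f g where "gens R M xs" "sfp R Q"
    "short_exact R Q f (syz R M xs) g (P\<lparr>carrier := mod_kernel P M e\<rparr>)"
proof -
  have PM: "left_module R P" using P(1) by (simp add: projective_def)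
  interpret P: left_module R P by (rule PM)
  obtain zs where zs: "gens R P zs" using fin_gen_imp_gens[OF PM P(2)] .
  note F = free_pow_module[OF P.R.ring_axioms]
  let ?q = "restrict (\<lambda>a. lc P a zs) (vecs (carrier R) (length zs))"
  have "idm P \<in> mod_hom R P P" by (rule mod_hom_restrictI[OF PM]) auto
  from projective_lift[OF P(1) F PM gens_surj[OF PM zs] this] obtain s
    where s: "s \<in> mod_hom R P (free_pow R (length zs))" "\<And>x. x \<in> carrier P \<Longrightarrow> ?q (s x) = x"
    by (metis (no_types, lifting) restrict_apply')
  have "lc P (s x) zs = x" if "x \<in> carrier P" for x
    using s(2)[OF that] mod_hom_closed[OF s(1) that] by simp
  then have "sfp R (syz R P zs)" using sfp_of_split[OF PM zs s(1)] by blast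
  with syz_quotient_exact[OF short_exact_kernel[OF PM M e] zs] that[OF gens_image[OF PM M e zs]] show thesis by blast
qed

text \<open>The invariant is to be an extension \<open>N\<close> of some \<open>K k\<close> by a
  member \<open>Q\<close> of the class. By the horseshoe the syzygies of \<open>N\<close> map onto
  the syzygies of \<open>K k\<close>, and these map onto \<open>K (Suc k)\<close>. The kernel of the
  composite is an extension of \<open>Q'\<close> by syzygies of \<open>Q\<close>, hence in the
  class, so the syzygies of \<open>N\<close> satisfy the invariant with
  \<open>Suc k\<close>.\<close>

lemma sfp_of_syzygies:
  fixes K :: "nat \<Rightarrow> ('r, 'p) module"
  assumes K: "\<And>k. left_module R (K k)"
    and step: "\<And>k. \<exists>xs (Q :: ('r, 'r list) module) f g. gens R (K k) xs \<and> sfp R Q \<and>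
      short_exact R Q f (syz R (K k) xs) g (K (Suc k))"
  shows "sfp R (K k)"
proof -
  define P where "P N \<longleftrightarrow> (\<exists>k (Q :: ('r, 'r list) module) f g. sfp R Q \<and> short_exact R Q f N g (K k))"
    for N :: "('r, 'r list) module"
  obtain xs where xs: "gens R (K k) xs" "P (syz R (K k) xs)" using step[of k] unfolding P_def by blast
  show ?thesis
  proof (rule sfp_coinduct[where P = P, OF K xs])
    fix N assume "P N"
    then obtain k and Q :: "('r, 'r list) module" and f g
      where Q: "sfp R Q" and se: "short_exact R Q f N g (K k)" unfolding P_def by blast
    obtain us where us: "gens R Q us" "sfp R (syz R Q us)" using Q by (rule sfp_step)
    obtain xs and Q' :: "('r, 'r list) module" and h j where xs: "gens R (K k) xs" and Q': "sfp R Q'"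
      and se': "short_exact R Q' h (syz R (K k) xs) j (K (Suc k))" using step[of k] by blast
    obtain vs f' g' where vs: "gens R N vs"
      and hs: "short_exact R (syz R Q us) f' (syz R N vs) g' (syz R (K k) xs)"
      by (rule horseshoe[OF se us(1) xs])
    let ?N = "syz R N vs" and ?c = "compose (carrier (syz R N vs)) j g'"
    note D = short_exactD[OF hs] and D' = short_exactD[OF se']
    have c: "?c \<in> mod_hom R ?N (K (Suc k))" by (rule mod_hom_compose[OF D(2,5) D'(5)])
    have cs: "?c ` carrier ?N = carrier (K (Suc k))"
      using D(7) D'(7) by (simp add: compose_def image_image[symmetric, of j g'] cong: image_cong_simp)
    have "?c v = j (g' v)" if "v \<in> carrier ?N" for v using that by (rule compose_eq)
    from short_exact_compose[OF hs se' c this] us(2) Q' have "sfp R (?N\<lparr>carrier := mod_kernel ?N (K (Suc k)) ?c\<rparr>)"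
      using sfp_extension by metis
    with short_exact_kernel[OF D(2) D'(3) c cs] have "P ?N" unfolding P_def by blast
    with vs show "left_module R N \<and> (\<exists>ys. gens R N ys \<and> P (syz R N ys))"
      using short_exactD(2)[OF se] by blast
  qed
qed

lemma sfp_of_resolution:
  assumes res: "projective_resolution R M P d e" and fg: "\<And>n. fin_gen R (P n)"
  shows "sfp R M"
proof -
  have M: "left_module R M" and P: "\<And>n. projective R (P n)" and d: "\<And>n. d n \<in> mod_hom R (P (Suc n)) (P n)"
    and e: "e \<in> mod_hom R (P 0) M" "e ` carrier (P 0) = carrier M"
    and ex0: "mod_kernel (P 0) M e = d 0 ` carrier (P 1)"
    and ex: "\<And>n. mod_kernel (P (Suc n)) (P n) (d n) = d (Suc n) ` carrier (P (Suc (Suc n)))"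
    using res by (auto simp: projective_resolution_def)
  have PM: "left_module R (P n)" for n using P by (simp add: projective_def)
  \<comment> \<open>\<open>K k\<close> is the image of \<open>d k\<close>. By exactness the
    surjection of \<open>P (Suc k)\<close> onto it has the kernel \<open>K (Suc k)\<close>, while
    \<open>K 0\<close> is the kernel of \<open>e\<close>.\<close>
  define K where "K k = (P k)\<lparr>carrier := d k ` carrier (P (Suc k))\<rparr>" for k
  have K: "left_module R (K k)" for k
    unfolding K_def by (intro left_module.left_submodule_is_module[OF PM] mod_image_submodule PM d)
  have dK: "d k \<in> mod_hom R (P (Suc k)) (K k)" for k
    using d[of k] by (auto simp: K_def mod_hom_def PiE_iff)
  have "sfp R (K k)" for k
  proof (rule sfp_of_syzygies[OF K])
    fix k
    have "d k ` carrier (P (Suc k)) = carrier (K k)" by (simp add: K_def)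
    moreover have "(P (Suc k))\<lparr>carrier := mod_kernel (P (Suc k)) (K k) (d k)\<rparr> = K (Suc k)"
      using ex[of k] by (simp add: K_def mod_kernel_def)
    ultimately show "\<exists>xs Q f g. gens R (K k) xs \<and> sfp R (Q :: ('a, 'a list) module) \<and>
        short_exact R Q f (syz R (K k) xs) g (K (Suc k))"
      using fg_projective_syz_exact[OF P fg K dK, of k] by metis
  qed
  moreover have "(P 0)\<lparr>carrier := mod_kernel (P 0) M e\<rparr> = K 0" using ex0 by (simp add: K_def)
  ultimately show ?thesis
    using fg_projective_syz_exact[OF P fg M e] sfp_extension sfp_intro[OF M] by metis
qed

text \<open>A choice \<open>pick\<close> of generators for all members of the class makes taking
  syzygies a function, whose iterates \<open>K\<close> are the kernels in the resolution. Each
  differential takes linear combinations of the chosen generators of \<open>K k\<close>.\<close>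

lemma sfp_resolution:
  fixes M :: "('r, 'm) module"
  assumes "sfp R M"
  obtains P :: "nat \<Rightarrow> ('r, 'r list) module" and d e
  where "projective_resolution R M P d e" "\<And>n. fin_gen R (P n)"
proof -
  have M: "left_module R M" by (rule sfp_module[OF assms])
  interpret M: left_module R M by (rule M)
  from assms obtain X xs where X: "\<And>N. N \<in> X \<Longrightarrow> left_module R N \<and> (\<exists>ys. gens R N ys \<and> syz R N ys \<in> X)"
    and xs: "gens R M xs" "syz R M xs \<in> X" by (auto simp: sfp_def)
  from X obtain pick where pick: "\<And>N. N \<in> X \<Longrightarrow> gens R N (pick N) \<and> syz R N (pick N) \<in> X" by metis
  define K where "K = rec_nat (syz R M xs) (\<lambda>_ N. syz R N (pick N))"
  have K_simps: "K 0 = syz R M xs" "\<And>k. K (Suc k) = syz R (K k) (pick (K k))" by (simp_all add: K_def)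
  have KX: "K k \<in> X" for k by (induction k) (use pick xs in \<open>auto simp: K_simps\<close>)
  have KM: "left_module R (K k)" for k using X[OF KX] by blast
  have Kg: "gens R (K k) (pick (K k))" for k using pick[OF KX] by blast
  \<comment> \<open>The shift reflects that \<open>P 0\<close> covers \<open>M\<close>, while
    \<open>P (Suc k)\<close> covers the syzygy module \<open>K k\<close>.\<close>
  define l where "l k = (case k of 0 \<Rightarrow> length xs | Suc k \<Rightarrow> length (pick (K k)))" for k
  define P where "P k = free_pow R (l k)" for k
  have PM: "left_module R (P k)" for k unfolding P_def by (rule free_pow_module[OF M.R.ring_axioms])
  have KP1: "K k = (P k)\<lparr>carrier := carrier (K k)\<rparr>" for k
    by (cases k) (simp_all add: K_simps P_def l_def syz_def)
  have KP2: "carrier (K k) \<subseteq> carrier (P k)" for k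
    by (cases k) (auto simp: K_simps P_def l_def)
  define e where "e = restrict (\<lambda>a. lc M a xs) (carrier (P 0))"
  define d where "d k = restrict (\<lambda>a. lc (K k) a (pick (K k))) (carrier (P (Suc k)))" for k
  have e: "short_exact R (K 0) (idm (K 0)) (P 0) e M"
    using syz_short_exact[OF M xs(1)] by (simp add: K_simps e_def P_def l_def)
  have d: "short_exact R (K (Suc k)) (idm (K (Suc k))) (P (Suc k)) (d k) (K k)" for k
    using syz_short_exact[OF KM Kg, of k] by (simp add: K_simps(2) d_def P_def l_def)
  have "projective_resolution R M P d e"
    unfolding projective_resolution_def
  proof (intro conjI allI)
    show "projective R (P n)" for n unfolding P_def by (rule projective_free_pow[OF M.R.ring_axioms])
    show "d n \<in> mod_hom R (P (Suc n)) (P n)" for n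
    proof -
      have "d n \<in> mod_hom R (P (Suc n)) ((P n)\<lparr>carrier := carrier (K n)\<rparr>)"
        using short_exactD(5)[OF d[of n]] KP1[of n] by simp
      then show ?thesis using KP2[of n] by (auto simp: mod_hom_def PiE_iff)
    qed
    have im: "d n ` carrier (P (Suc n)) = carrier (K n)" for n by (rule short_exactD(7)[OF d])
    show "mod_kernel (P 0) M e = d 0 ` carrier (P 1)"
      using e im[of 0] by (simp add: short_exact_def)
    show "mod_kernel (P (Suc n)) (P n) (d n) = d (Suc n) ` carrier (P (Suc (Suc n)))" for n
    proof -
      have "mod_kernel (P (Suc n)) (P n) (d n) = mod_kernel (P (Suc n)) (K n) (d n)"
      proof -
        have "\<zero>\<^bsub>K n\<^esub> = \<zero>\<^bsub>P n\<^esub>" by (subst KP1) simp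
        then show ?thesis by (simp add: mod_kernel_def)
      qed
      then show ?thesis using d[of n] im[of "Suc n"] by (simp add: short_exact_def)
    qed
  qed (use M short_exactD(5,7)[OF e] in auto)
  moreover have "fin_gen R (P n)" for n
  proof (rule gens_imp_fin_gen[OF PM])
    show "gens R (P n) (unit_vecs R (l n))"
      unfolding gens_def P_def
      using vecs_set[OF unit_vecs_in[OF M.R.ring_axioms], of "l n"] lc_unit_vecs[OF M.R.ring_axioms] by auto
  qed
  ultimately show thesis by (rule that)
qed

section \<open>Moving resolutions between types\<close>

lemma fin_gen_iso:
  assumes "left_module R M" "left_module R N" "f \<in> mod_hom R M N" "bij_betw f (carrier M) (carrier N)" "fin_gen R M"
  shows "fin_gen R N"
proof -
  obtain xs where "gens R M xs" using fin_gen_imp_gens[OF assms(1,5)] .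
  from gens_image[OF assms(1-3) _ this] assms(4) show ?thesis
    by (intro gens_imp_fin_gen[OF assms(2)]) (auto simp: bij_betw_def)
qed

text \<open>Each term is copied along \<open>\<iota>\<close> and the differentials are conjugated
  with the copying isomorphisms. This brings a resolution into the type that
  \<open>super_fin_presented\<close> prescribes.\<close>

lemma resolution_copy:
  fixes P :: "nat \<Rightarrow> ('r, 'p) module" and \<iota> :: "'p \<Rightarrow> 'q"
  assumes res: "projective_resolution R M P d e" and \<iota>: "inj \<iota>"
  obtains P' :: "nat \<Rightarrow> ('r, 'q) module" and d' e'
  where "projective_resolution R M P' d' e'" "\<And>n. fin_gen R (P n) \<Longrightarrow> fin_gen R (P' n)"
proof -
  have M: "left_module R M" and P: "\<And>n. projective R (P n)" and d: "\<And>n. d n \<in> mod_hom R (P (Suc n)) (P n)"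
    and e: "e \<in> mod_hom R (P 0) M" "e ` carrier (P 0) = carrier M"
    and ex0: "mod_kernel (P 0) M e = d 0 ` carrier (P 1)"
    and ex: "\<And>n. mod_kernel (P (Suc n)) (P n) (d n) = d (Suc n) ` carrier (P (Suc (Suc n)))"
    using res by (auto simp: projective_resolution_def)
  have PM: "left_module R (P n)" for n using P by (simp add: projective_def)
  have "\<exists>p :: ('r, 'q) module \<times> ('p \<Rightarrow> 'q). left_module R (fst p) \<and> snd p \<in> mod_hom R (P n) (fst p) \<and>
      bij_betw (snd p) (carrier (P n)) (carrier (fst p))" for n
  proof -
    have "inj_on \<iota> (carrier (P n))" using \<iota> by (rule inj_on_subset) simp
    then obtain P' :: "('r, 'q) module" and f g where "left_module R P'" "f \<in> mod_hom R (P n) P'"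
      "bij_betw f (carrier (P n)) (carrier P')" "g \<in> mod_hom R P' (P n)"
      "bij_betw g (carrier P') (carrier (P n))"
      by (rule copy_along_injection[OF PM])
    then show ?thesis by (intro exI[of _ "(P', f)"]) simp
  qed
  then obtain p :: "nat \<Rightarrow> ('r, 'q) module \<times> ('p \<Rightarrow> 'q)" where p: "\<And>n. left_module R (fst (p n)) \<and>
      snd (p n) \<in> mod_hom R (P n) (fst (p n)) \<and> bij_betw (snd (p n)) (carrier (P n)) (carrier (fst (p n)))"
    by metis
  define P' f where "P' n = fst (p n)" and "f n = snd (p n)" for n
  have P': "left_module R (P' n)"
    and f: "f n \<in> mod_hom R (P n) (P' n)" "bij_betw (f n) (carrier (P n)) (carrier (P' n))" for n
    using p by (simp_all add: P'_def f_def)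
  define g where "g n = restrict (inv_into (carrier (P n)) (f n)) (carrier (P' n))" for n
  have g: "g n \<in> mod_hom R (P' n) (P n)" for n
    unfolding g_def by (rule mod_hom_inverse[OF PM P' f])
  have gf: "g n (f n x) = x" if "x \<in> carrier (P n)" for n x
    using f(2)[of n] that by (simp add: g_def bij_betw_inv_into_left bij_betw_apply)
  have fg: "f n (g n y) = y" if "y \<in> carrier (P' n)" for n y
    using f(2)[of n] that by (simp add: g_def bij_betw_inv_into_right)
  note fc = mod_hom_closed[OF f(1)] and gc = mod_hom_closed[OF g] and dc = mod_hom_closed[OF d]
  define d' where "d' n = compose (carrier (P' (Suc n))) (f n) (compose (carrier (P' (Suc n))) (d n) (g (Suc n)))" for n
  have d': "d' n \<in> mod_hom R (P' (Suc n)) (P' n)" for n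
    unfolding d'_def by (intro mod_hom_compose[OF P' _ f(1)] mod_hom_compose[OF P' g d])
  have d'f: "d' n (f (Suc n) x) = f n (d n x)" if "x \<in> carrier (P (Suc n))" for n x
    using that fc by (simp add: d'_def compose_eq gf)
  have d'e: "d' n y = f n (d n (g (Suc n) y))" if "y \<in> carrier (P' (Suc n))" for n y
    using that by (simp add: d'_def compose_eq)
  define e' where "e' = compose (carrier (P' 0)) e (g 0)"
  have e': "e' \<in> mod_hom R (P' 0) M" unfolding e'_def by (rule mod_hom_compose[OF P' g e(1)])
  have e'e: "e' y = e (g 0 y)" if "y \<in> carrier (P' 0)" for y using that by (simp add: e'_def compose_eq)
  have im: "d' n ` carrier (P' (Suc n)) = f n ` d n ` carrier (P (Suc n))" for n
  proof
    show "d' n ` carrier (P' (Suc n)) \<subseteq> f n ` d n ` carrier (P (Suc n))"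
      using d'e gc by (auto simp del: One_nat_def)
    show "f n ` d n ` carrier (P (Suc n)) \<subseteq> d' n ` carrier (P' (Suc n))"
      using d'f fc by (force simp: image_iff)
  qed
  have f0: "f n x = \<zero>\<^bsub>P' n\<^esub> \<longleftrightarrow> x = \<zero>\<^bsub>P n\<^esub>" if "x \<in> carrier (P n)" for n x
    using that f(2)[of n] mod_hom_zero[OF PM P' f(1)] mod_hom_inj_iff[OF PM P' f(1)]
    by (metis bij_betw_imp_inj_on)
  have ker: "y \<in> f n ` A \<longleftrightarrow> g n y \<in> A" if "y \<in> carrier (P' n)" "A \<subseteq> carrier (P n)" for n y A
  proof
    assume "y \<in> f n ` A"
    then obtain x where "x \<in> A" "y = f n x" by auto
    then show "g n y \<in> A" using gf that(2) by auto
  next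
    assume "g n y \<in> A"
    then show "y \<in> f n ` A" using fg[OF that(1)] by (intro image_eqI[of _ _ "g n y"]) simp_all
  qed
  have "projective_resolution R M P' d' e'"
    unfolding projective_resolution_def
  proof (intro conjI allI M d' e')
    show "projective R (P' n)" for n by (rule projective_iso[OF P P' f])
    show "e' ` carrier (P' 0) = carrier M"
    proof
      show "carrier M \<subseteq> e' ` carrier (P' 0)"
      proof
        fix y assume "y \<in> carrier M"
        then obtain x where "x \<in> carrier (P 0)" "e x = y" using e(2) by (metis imageE)
        then show "y \<in> e' ` carrier (P' 0)" by (intro image_eqI[of _ _ "f 0 x"]) (auto simp: e'e gf fc)
      qed
    qed (use mod_hom_closed[OF e'] in auto)
    have "mod_kernel (P' 0) M e' = f 0 ` mod_kernel (P 0) M e"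
    proof (rule Set.set_eqI)
      fix y
      have sub: "mod_kernel (P 0) M e \<subseteq> carrier (P 0)" by (auto simp: mod_kernel_def)
      show "y \<in> mod_kernel (P' 0) M e' \<longleftrightarrow> y \<in> f 0 ` mod_kernel (P 0) M e"
      proof (cases "y \<in> carrier (P' 0)")
        case True
        then show ?thesis unfolding ker[OF True sub] using gc[of y 0] by (simp add: mod_kernel_def e'e)
      qed (use fc sub in \<open>auto simp: mod_kernel_def\<close>)
    qed
    then show "mod_kernel (P' 0) M e' = d' 0 ` carrier (P' 1)" using im[of 0] ex0 by simp
    show "mod_kernel (P' (Suc n)) (P' n) (d' n) = d' (Suc n) ` carrier (P' (Suc (Suc n)))" for n
    proof -
      have "mod_kernel (P' (Suc n)) (P' n) (d' n) = f (Suc n) ` mod_kernel (P (Suc n)) (P n) (d n)"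
      proof (rule Set.set_eqI)
        fix y
        have sub: "mod_kernel (P (Suc n)) (P n) (d n) \<subseteq> carrier (P (Suc n))" by (auto simp: mod_kernel_def)
        show "y \<in> mod_kernel (P' (Suc n)) (P' n) (d' n) \<longleftrightarrow> y \<in> f (Suc n) ` mod_kernel (P (Suc n)) (P n) (d n)"
        proof (cases "y \<in> carrier (P' (Suc n))")
          case True
          then show ?thesis unfolding ker[OF True sub]
            using gc[of y "Suc n"] dc[of "g (Suc n) y" n] by (simp add: mod_kernel_def d'e f0)
        qed (use fc sub in \<open>auto simp: mod_kernel_def\<close>)
      qed
      then show ?thesis using im[of "Suc n"] ex by simp
    qed
  qed
  moreover have "fin_gen R (P' n)" if "fin_gen R (P n)" for n
    by (rule fin_gen_iso[OF PM P' f that])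
  ultimately show thesis by (rule that)
qed

text \<open>In one direction finitely generated projective terms are traded for free ones. In the
  other the free resolution has terms of type \<open>'r list\<close>, and \<open>map Inl\<close>
  carries them into the type of lists over a sum.\<close>

lemma super_fin_presented_iff_sfp: "super_fin_presented R M \<longleftrightarrow> sfp R M"
proof
  assume "super_fin_presented R M"
  then show "sfp R M" unfolding super_fin_presented_def using sfp_of_resolution by blast
next
  assume "sfp R M"
  then obtain P :: "nat \<Rightarrow> ('a, 'a list) module" and d e
    where P: "projective_resolution R M P d e" "\<And>n. fin_gen R (P n)" by (rule sfp_resolution) blast
  have "inj (map (Inl :: 'a \<Rightarrow> 'a + 'b))" by (simp add: inj_map)
  from resolution_copy[OF P(1) this] P(2) show "super_fin_presented R M"
    unfolding super_fin_presented_def by metis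
qed

section \<open>Finite presentations and purity\<close>

text \<open>A finite presentation with named generators \<open>xs\<close> and relations
  \<open>ls\<close>. The names are kept because \<open>ls\<close> will act as a matrix on powers of
  coefficient modules.\<close>

definition fin_rel :: "'r ring \<Rightarrow> ('r, 'm) module \<Rightarrow> 'm list \<Rightarrow> 'r list list \<Rightarrow> bool" where
  "fin_rel R M xs ls \<longleftrightarrow> left_module R M \<and> gens R M xs \<and> gens R (syz R M xs) ls"

lemma sfp_fin_rel:
  assumes "sfp R M"
  obtains xs ls where "fin_rel R M xs ls" "sfp R (syz R M xs)"
proof -
  obtain xs where xs: "gens R M xs" "sfp R (syz R M xs)" using assms by (rule sfp_step)
  obtain ls where "gens R (syz R M xs) ls" using xs(2) by (rule sfp_step)
  then show thesis using that xs sfp_module[OF assms] by (simp add: fin_rel_def)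
qed

text \<open>Only the encoding of the free module changes: \<open>v\<close> and \<open>w\<close>
  translate between functions on an initial segment of the natural numbers and lists, and carry the
  kernel of the presentation to the syzygies.\<close>

lemma fin_rel_imp_fin_presented:
  assumes "fin_rel R M xs ls" shows "fin_presented R M"
proof -
  have M: "left_module R M" and xs: "gens R M xs" and ls: "gens R (syz R M xs) ls"
    using assms by (auto simp: fin_rel_def)
  interpret M: left_module R M by (rule M)
  define n where "n = length xs"
  note xs' = gens_set[OF xs]
  let ?F = "free_mod R {..<n}"
  have F: "left_module R ?F" by (rule free_mod_module[OF M.R.ring_axioms])
  interpret F: left_module R ?F by (rule F)
  define v where "v f = map f [0..<n]" for f :: "nat \<Rightarrow> 'a"
  define w where "w a = (\<lambda>i\<in>{..<n}. a ! i)" for a :: "'a list"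
  have v: "v f \<in> vecs (carrier R) n" if "f \<in> carrier ?F" for f
  proof -
    have "f i \<in> carrier R" if "i < n" for i using \<open>f \<in> carrier ?F\<close> that by (auto simp: PiE_iff)
    then show ?thesis by (simp add: v_def vecs_iff_nth)
  qed
  have w: "w a \<in> carrier ?F" if "a \<in> vecs (carrier R) n" for a
  proof -
    have "finite {i \<in> {..<n}. w a i \<noteq> \<zero>\<^bsub>R\<^esub>}" by (rule finite_subset[of _ "{..<n}"]) auto
    moreover have "w a \<in> {..<n} \<rightarrow>\<^sub>E carrier R" using that by (simp add: w_def vecs_iff_nth)
    ultimately show ?thesis by simp
  qed
  have vw: "v (w a) = a" if "a \<in> vecs (carrier R) n" for a
    using that by (simp add: v_def w_def vecs_iff_nth list_eq_iff_nth_eq)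
  have wv: "w (v f) = f" if "f \<in> carrier ?F" for f
    using that by (simp add: v_def w_def PiE_iff extensional_def fun_eq_iff)
  have vadd: "v (f \<oplus>\<^bsub>?F\<^esub> g) = map2 (ring.add R) (v f) (v g)" for f g
    by (simp add: v_def list_eq_iff_nth_eq)
  have vsm: "v (r \<odot>\<^bsub>?F\<^esub> f) = map (monoid.mult R r) (v f)" for r f
    by (simp add: v_def list_eq_iff_nth_eq)
  let ?p = "restrict (\<lambda>f. lc M (v f) xs) (carrier ?F)"
  have p: "?p \<in> mod_hom R ?F M"
  proof (rule mod_hom_restrictI[OF F])
    show "lc M (v f) xs \<in> carrier M" if "f \<in> carrier ?F" for f
      using v[OF that] xs' by (simp add: vecs_set)
    show "lc M (v (f \<oplus>\<^bsub>?F\<^esub> g)) xs = lc M (v f) xs \<oplus>\<^bsub>M\<^esub> lc M (v g) xs"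
      if "f \<in> carrier ?F" "g \<in> carrier ?F" for f g
      unfolding vadd using v[OF that(1)] v[OF that(2)] xs' by (auto simp: M.lc_add_left vecs_def n_def)
    show "lc M (v (r \<odot>\<^bsub>?F\<^esub> f)) xs = r \<odot>\<^bsub>M\<^esub> lc M (v f) xs"
      if "r \<in> carrier R" "f \<in> carrier ?F" for r f
      unfolding vsm using v[OF that(2)] that(1) xs' by (auto simp: M.lc_smult_left vecs_def)
  qed
  have ps: "?p ` carrier ?F = carrier M"
  proof
    show "carrier M \<subseteq> ?p ` carrier ?F"
    proof
      fix x assume "x \<in> carrier M"
      from gensE[OF xs this] obtain a where a: "a \<in> vecs (carrier R) (length xs)" "lc M a xs = x" .
      then have "?p (w a) = x" using w vw by (simp add: n_def del: free_mod_simps)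
      then show "x \<in> ?p ` carrier ?F" using w a(1) n_def by (metis image_eqI)
    qed
  qed (use mod_hom_closed[OF p] in blast)
  let ?K = "?F\<lparr>carrier := mod_kernel ?F M ?p\<rparr>"
  have K: "left_module R ?K" by (rule F.left_submodule_is_module[OF mod_kernel_submodule[OF F M p]])
  have S: "left_module R (syz R M xs)" by (rule syz_module[OF M xs'])
  have wK: "w a \<in> carrier ?K" if "a \<in> carrier (syz R M xs)" for a
    using that w[of a] vw[of a] by (simp add: mod_kernel_def n_def del: free_mod_simps)
  have "restrict w (carrier (syz R M xs)) \<in> mod_hom R (syz R M xs) ?K"
  proof (rule mod_hom_restrictI[OF S])
    show "w (a \<oplus>\<^bsub>syz R M xs\<^esub> b) = w a \<oplus>\<^bsub>?K\<^esub> w b"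
      if "a \<in> carrier (syz R M xs)" "b \<in> carrier (syz R M xs)" for a b
      using that by (auto simp: w_def n_def vecs_def intro!: restrict_ext)
    show "w (r \<odot>\<^bsub>syz R M xs\<^esub> a) = r \<odot>\<^bsub>?K\<^esub> w a"
      if "r \<in> carrier R" "a \<in> carrier (syz R M xs)" for r a
      using that by (auto simp: w_def n_def vecs_def intro!: restrict_ext)
  qed (rule wK)
  moreover have "restrict w (carrier (syz R M xs)) ` carrier (syz R M xs) = carrier ?K"
  proof
    show "carrier ?K \<subseteq> restrict w (carrier (syz R M xs)) ` carrier (syz R M xs)"
    proof
      fix f assume "f \<in> carrier ?K"
      then have "f \<in> mod_kernel ?F M ?p" by (simp del: free_mod_simps)
      then have f: "f \<in> carrier ?F" "lc M (v f) xs = \<zero>\<^bsub>M\<^esub>"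
        unfolding mod_kernel_def by (simp_all del: free_mod_simps split: if_splits)
      then have "v f \<in> carrier (syz R M xs)" using v by (simp add: n_def)
      then show "f \<in> restrict w (carrier (syz R M xs)) ` carrier (syz R M xs)"
        using wv[OF f(1)] by (metis imageI image_restrict_eq)
    qed
  qed (use wK in auto)
  ultimately have "fin_gen R ?K" by (intro gens_imp_fin_gen[OF K gens_image[OF S K _ _ ls]])
  then show ?thesis using M p ps unfolding fin_presented_def by blast
qed

lemma fin_rel_iso:
  assumes "fin_rel R M xs ls" "left_module R N" "f \<in> mod_hom R M N" "bij_betw f (carrier M) (carrier N)"
  shows "fin_rel R N (map f xs) ls"
  using assms gens_image[OF _ assms(2,3), of xs] syz_image[OF _ assms(2,3), of xs] gens_set[of R M xs]
  by (simp add: fin_rel_def bij_betw_def)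

text \<open>The relations of the quotient are an extension of \<open>X\<close> by the relations of
  \<open>Y\<close>, and both are finitely generated.\<close>

lemma fin_rel_quotient:
  assumes Y: "fin_rel R Y ys ls" and se: "short_exact R X f Y q Q" and xs: "gens R X xs"
  obtains ls' where "fin_rel R Q (map q ys) ls'"
proof -
  note D = short_exactD[OF se]
  have ys: "gens R Y ys" and ls: "gens R (syz R Y ys) ls" using Y by (auto simp: fin_rel_def)
  obtain p where "short_exact R (syz R Y ys) (idm (syz R Y ys)) (syz R Q (map q ys)) p X"
    by (rule syz_quotient_exact[OF se ys])
  then obtain ls' where "gens R (syz R Q (map q ys)) ls'" using horseshoe[OF _ ls xs] by metis
  then show thesis using that D(3) gens_image[OF D(2,3,5,7) ys] by (simp add: fin_rel_def)
qed

text \<open>Purity is tested on modules of type \<open>'r list\<close>. As \<open>Y\<close> is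
  finitely generated, it has a copy there, and the lift found for the copy is pulled back.\<close>

lemma pure_lift:
  fixes Y :: "('r, 'y) module"
  assumes pe: "pure_exact R A f B g D" and Y: "fin_rel R Y ys ls" and h: "h \<in> mod_hom R Y D"
  obtains h' where "h' \<in> mod_hom R Y B" "\<And>y. y \<in> carrier Y \<Longrightarrow> g (h' y) = h y"
proof -
  have YM: "left_module R Y" and "fin_gen R Y" using Y by (auto simp: fin_rel_def intro: gens_imp_fin_gen)
  then obtain Q :: "('r, 'r list) module" and j where Q: "left_module R Q"
    and j: "j \<in> mod_hom R Y Q" "bij_betw j (carrier Y) (carrier Q)"
    using fin_gen_copy[OF YM] unfolding mod_isomorphic_def by metis
  have fp: "fin_presented R Q" by (rule fin_rel_imp_fin_presented[OF fin_rel_iso[OF Y Q j]])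
  let ?i = "restrict (inv_into (carrier Y) j) (carrier Q)"
  have i: "?i \<in> mod_hom R Q Y" by (rule mod_hom_inverse[OF YM Q j])
  have ij: "?i (j y) = y" if "y \<in> carrier Y" for y
    using that j(2) mod_hom_closed[OF j(1)] by (simp add: bij_betw_inv_into_left)
  have "compose (carrier Q) h ?i \<in> mod_hom R Q D" by (rule mod_hom_compose[OF Q i h])
  then have "compose (carrier Q) h ?i \<in> (\<lambda>h. compose (carrier Q) g h) ` mod_hom R Q B"
    using pe fp unfolding pure_exact_def by blast
  then obtain h1 where h1: "h1 \<in> mod_hom R Q B" "compose (carrier Q) h ?i = compose (carrier Q) g h1" by auto
  have "g (compose (carrier Y) h1 j y) = h y" if y: "y \<in> carrier Y" for y
    using fun_cong[OF h1(2), of "j y"] mod_hom_closed[OF j(1) y] ij[OF y] y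
    by (simp add: compose_eq del: restrict_apply)
  moreover have "compose (carrier Y) h1 j \<in> mod_hom R Y B" by (rule mod_hom_compose[OF YM j(1) h1(1)])
  ultimately show thesis using that by blast
qed

text \<open>
  Lifting along \<^term>\<open>g\<close> from the finitely presented quotient of \<^term>\<open>Y\<close> by \<^term>\<open>xs\<close> corrects
  \<^term>\<open>h\<close> to a homomorphism into the submodule without changing it on \<^term>\<open>xs\<close>.
\<close>

lemma pure_extend:
  fixes A :: "('r, 'a) module" and Y :: "('r, 'y) module"
  assumes pe: "pure_exact R A f B g D" and Y: "fin_rel R Y ys ls" and xs: "set xs \<subseteq> carrier Y"
    and h: "h \<in> mod_hom R Y B" and hx: "\<And>x. x \<in> set xs \<Longrightarrow> h x \<in> f ` carrier A"
  obtains h' where "h' \<in> mod_hom R Y A" "\<And>x. x \<in> set xs \<Longrightarrow> f (h' x) = h x"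
proof -
  have se: "short_exact R A f B g D" using pe by (simp add: pure_exact_def)
  note D = short_exactD[OF se]
  have YM: "left_module R Y" using Y by (simp add: fin_rel_def)
  interpret B: left_module R B by (rule D)
  interpret D: left_module R D by (rule D)
  define H where "H = (\<lambda>a. lc Y a xs) ` vecs (carrier R) (length xs)"
  note H = gens_span[OF YM xs, folded H_def]
  obtain Q :: "('r, 'y) module" and q where q: "short_exact R (Y\<lparr>carrier := H\<rparr>) (restrict (\<lambda>x. x) H) Y q Q"
    by (rule quotient_exists[OF YM H(1)])
  note Dq = short_exactD[OF q]
  obtain ls' where Q: "fin_rel R Q (map q ys) ls'" by (rule fin_rel_quotient[OF Y q H(2)])
  have qH: "y \<in> H" if "y \<in> carrier Y" "q y = \<zero>\<^bsub>Q\<^esub>" for y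
    using short_exact_image[OF q that] by auto
  have hg: "compose (carrier Y) g h \<in> mod_hom R Y D" by (rule mod_hom_compose[OF YM h D(5)])
  have hz: "compose (carrier Y) g h y = \<zero>\<^bsub>D\<^esub>" if y: "y \<in> carrier Y" "q y = \<zero>\<^bsub>Q\<^esub>" for y
  proof -
    obtain a where a: "a \<in> vecs (carrier R) (length xs)" "y = lc Y a xs" using qH[OF y] by (auto simp: H_def)
    have "g (h x) = \<zero>\<^bsub>D\<^esub>" if "x \<in> set xs" for x using hx[OF that] short_exact_zero[OF se] by auto
    then have "map (compose (carrier Y) g h) xs = replicate (length xs) \<zero>\<^bsub>D\<^esub>"
      using xs by (auto simp: map_replicate_const[symmetric] compose_eq subset_iff)
    then show ?thesis
      unfolding a(2) using mod_hom_lc[OF YM D(3) hg vecs_set[OF a(1)] xs] D.lc_zero_right[OF vecs_set[OF a(1)]] by simp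
  qed
  obtain k where k: "k \<in> mod_hom R Q D" "\<And>y. y \<in> carrier Y \<Longrightarrow> k (q y) = compose (carrier Y) g h y"
    using factor_through[OF YM Dq(3) D(3) Dq(5,7) hg hz] by metis
  obtain h1 where h1: "h1 \<in> mod_hom R Q B" "\<And>x. x \<in> carrier Q \<Longrightarrow> g (h1 x) = k x"
    by (rule pure_lift[OF pe Q k(1)]) blast
  have h2: "compose (carrier Y) h1 q \<in> mod_hom R Y B" by (rule mod_hom_compose[OF YM Dq(5) h1(1)])
  let ?h3 = "restrict (\<lambda>y. h y \<ominus>\<^bsub>B\<^esub> compose (carrier Y) h1 q y) (carrier Y)"
  have h3: "?h3 \<in> mod_hom R Y B" by (rule mod_hom_diff[OF YM D(2) h h2])
  have gz: "g (?h3 y) = \<zero>\<^bsub>D\<^esub>" if y: "y \<in> carrier Y" for y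
  proof -
    have "g (compose (carrier Y) h1 q y) = g (h y)"
      using k(2)[OF y] h1(2)[OF mod_hom_closed[OF Dq(5) y]] y by (simp add: compose_eq)
    then show ?thesis
      using y mod_hom_minus[OF D(2,3,5) mod_hom_closed[OF h y] mod_hom_closed[OF h2 y]]
        mod_hom_closed[OF D(5) mod_hom_closed[OF h y]] by (simp add: D.minus_eq_zero)
  qed
  obtain h' where h': "h' \<in> mod_hom R Y A" "\<And>y. y \<in> carrier Y \<Longrightarrow> f (h' y) = ?h3 y"
    by (rule short_exact_corestrict[OF se YM h3 gz]) blast+
  have "f (h' x) = h x" if x: "x \<in> set xs" for x
  proof -
    have xY: "x \<in> carrier Y" using x xs by auto
    have "x \<in> H" using gens_set[OF H(2)] x by auto
    then have "q x = \<zero>\<^bsub>Q\<^esub>" using short_exact_zero[OF q, of x] by simp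
    then have "compose (carrier Y) h1 q x = \<zero>\<^bsub>B\<^esub>"
      using xY mod_hom_zero[OF Dq(3) D(2) h1(1)] by (simp add: compose_eq)
    then show ?thesis using h'(2)[OF xY] xY mod_hom_closed[OF h xY] by (simp add: a_minus_def B.neg_zero)
  qed
  with h'(1) show thesis by (rule that)
qed

text \<open>The middle term is replaced by an isomorphic one, the outer terms stay as they are. In
  this way a \<open>C\<close>-weak flat or \<open>C\<close>-weak injective middle term becomes
  literally a tensor or a Hom module.\<close>

lemma pure_exact_transfer:
  assumes pe: "pure_exact R A f B g D" and B': "left_module R B'" and iso: "mod_isomorphic R B B'"
  obtains f' g' where "pure_exact R A f' B' g' D"
proof -
  have se: "short_exact R A f B g D" using pe by (simp add: pure_exact_def)
  note D = short_exactD[OF se]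
  obtain \<beta> where \<beta>: "\<beta> \<in> mod_hom R B B'" "bij_betw \<beta> (carrier B) (carrier B')"
    using iso unfolding mod_isomorphic_def by blast
  define \<gamma> where "\<gamma> = restrict (inv_into (carrier B) \<beta>) (carrier B')"
  have \<gamma>: "\<gamma> \<in> mod_hom R B' B" unfolding \<gamma>_def by (rule mod_hom_inverse[OF D(2) B' \<beta>])
  have \<gamma>\<beta>: "\<gamma> (\<beta> x) = x" if "x \<in> carrier B" for x
    using that \<beta>(2) mod_hom_closed[OF \<beta>(1) that] by (simp add: \<gamma>_def bij_betw_inv_into_left)
  have \<beta>\<gamma>: "\<beta> (\<gamma> y) = y" if "y \<in> carrier B'" for y using that \<beta>(2) by (simp add: \<gamma>_def bij_betw_inv_into_right)
  note fc = mod_hom_closed[OF D(4)] and \<beta>c = mod_hom_closed[OF \<beta>(1)] and \<gamma>c = mod_hom_closed[OF \<gamma>]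
  define f' g' where "f' = compose (carrier A) \<beta> f" and "g' = compose (carrier B') g \<gamma>"
  have f': "f' \<in> mod_hom R A B'" unfolding f'_def by (rule mod_hom_compose[OF D(1,4) \<beta>(1)])
  have g': "g' \<in> mod_hom R B' D" unfolding g'_def by (rule mod_hom_compose[OF B' \<gamma> D(5)])
  have g'\<beta>: "g' (\<beta> x) = g x" if "x \<in> carrier B" for x
    unfolding g'_def compose_eq[OF \<beta>c[OF that]] \<gamma>\<beta>[OF that] ..
  have se': "short_exact R A f' B' g' D"
  proof (rule short_exactI[OF D(1) B' D(3) f' g'])
    show "inj_on f' (carrier A)"
      using inj_onD[OF D(6)] fc \<gamma>\<beta> by (intro inj_onI) (metis compose_eq f'_def)
    show "\<exists>y\<in>carrier B'. g' y = z" if "z \<in> carrier D" for z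
    proof -
      have "z \<in> g ` carrier B" using that unfolding D(7) .
      then show ?thesis using g'\<beta> \<beta>c by blast
    qed
    show "g' (f' x) = \<zero>\<^bsub>D\<^esub>" if "x \<in> carrier A" for x
      unfolding f'_def compose_eq[OF that] g'\<beta>[OF fc[OF that]] by (rule short_exact_zero[OF se that])
    show "\<exists>x\<in>carrier A. f' x = y" if y: "y \<in> carrier B'" "g' y = \<zero>\<^bsub>D\<^esub>" for y
    proof -
      have "g (\<gamma> y) = \<zero>\<^bsub>D\<^esub>" using y(2) unfolding g'_def compose_eq[OF y(1)] .
      from short_exact_lift[OF se \<gamma>c[OF y(1)] this] obtain x where x: "x \<in> carrier A" "f x = \<gamma> y" .
      then have "f' x = y" unfolding f'_def compose_eq[OF x(1)] by (simp only: \<beta>\<gamma>[OF y(1)])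
      then show ?thesis using x(1) by blast
    qed
  qed
  have "(\<lambda>h. compose (carrier P) g' h) ` mod_hom R P B' = mod_hom R P D"
    if P: "fin_presented R P" for P :: "('a, 'a list) module"
  proof
    have PM: "left_module R P" using P by (simp add: fin_presented_def)
    show "(\<lambda>h. compose (carrier P) g' h) ` mod_hom R P B' \<subseteq> mod_hom R P D"
      using mod_hom_compose[OF PM _ g'] by blast
    show "mod_hom R P D \<subseteq> (\<lambda>h. compose (carrier P) g' h) ` mod_hom R P B'"
    proof
      fix k assume k: "k \<in> mod_hom R P D"
      then have "k \<in> (\<lambda>h. compose (carrier P) g h) ` mod_hom R P B" using pe P unfolding pure_exact_def by blast
      then obtain h where h: "k = compose (carrier P) g h" "h \<in> mod_hom R P B" by (rule imageE)
      have bh: "compose (carrier P) \<beta> h \<in> mod_hom R P B'" by (rule mod_hom_compose[OF PM h(2) \<beta>(1)])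
      have "compose (carrier P) g' (compose (carrier P) \<beta> h) = k"
      proof (rule mod_hom_eqI[OF mod_hom_compose[OF PM bh g'] k])
        show "compose (carrier P) g' (compose (carrier P) \<beta> h) x = k x" if "x \<in> carrier P" for x
          unfolding h(1) compose_eq[OF that] by (rule g'\<beta>[OF mod_hom_closed[OF h(2) that]])
      qed
      then show "k \<in> (\<lambda>h. compose (carrier P) g' h) ` mod_hom R P B'" using bh by blast
    qed
  qed
  then have "pure_exact R A f' B' g' D" using se' by (simp add: pure_exact_def)
  then show thesis by (rule that)
qed

text \<open>Purity as a statement about linear systems: if the system with rows \<open>G\<close> and
  right-hand sides \<open>a\<close> in \<open>A\<close> has a solution in \<open>B\<close>, it has
  one in \<open>A\<close>. This form refers to no quotient and to no test modules, hence to no types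
  of test modules, and is the one that is carried through functors.\<close>

definition sys_pure :: "'r ring \<Rightarrow> ('r, 'a) module \<Rightarrow> ('a \<Rightarrow> 'b) \<Rightarrow> ('r, 'b) module \<Rightarrow> bool" where
  "sys_pure R A f B \<longleftrightarrow> (\<forall>n G a b. set G \<subseteq> vecs (carrier R) n \<longrightarrow> a \<in> vecs (carrier A) (length G) \<longrightarrow>
     b \<in> vecs (carrier B) n \<longrightarrow> map (\<lambda>r. lc B r b) G = map f a \<longrightarrow>
     (\<exists>x\<in>vecs (carrier A) n. map (\<lambda>r. lc A r x) G = a))"

lemma fin_rel_free_pow:
  assumes "ring R" shows "fin_rel R (free_pow R n) (unit_vecs R n) []"
proof -
  interpret ring R by fact
  have u: "gens R (free_pow R n) (unit_vecs R n)"
    using vecs_set[OF unit_vecs_in[OF assms], of n] lc_unit_vecs[OF assms] by (auto simp: gens_def)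
  have "carrier (syz R (free_pow R n) (unit_vecs R n)) = {\<zero>\<^bsub>syz R (free_pow R n) (unit_vecs R n)\<^esub>}"
    by (auto simp: lc_unit_vecs[OF assms] vecs_replicate)
  then show ?thesis using u free_pow_module[OF assms] gens_Nil by (auto simp: fin_rel_def simp del: syz_simps)
qed

text \<open>A solution \<open>b\<close> is a homomorphism from a free module to \<open>B\<close>
  whose values on the rows lie in \<open>A\<close>. Correcting it by \<open>pure_extend\<close> to a
  homomorphism into \<open>A\<close> with the same values on the rows gives a solution in
  \<open>A\<close>.\<close>

lemma pure_exact_imp_sys_pure:
  assumes pe: "pure_exact R A f B g D" shows "sys_pure R A f B"
  unfolding sys_pure_def
proof (intro allI impI)
  have se: "short_exact R A f B g D" using pe by (simp add: pure_exact_def)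
  note D = short_exactD[OF se]
  interpret A: left_module R A by (rule D)
  interpret B: left_module R B by (rule D)
  note F = free_pow_module[OF A.R.ring_axioms]
  fix n G a b
  assume G: "set G \<subseteq> vecs (carrier R) n" and a: "a \<in> vecs (carrier A) (length G)"
    and b: "b \<in> vecs (carrier B) n" and eq: "map (\<lambda>r. lc B r b) G = map f a"
  let ?h = "restrict (\<lambda>r. lc B r b) (vecs (carrier R) n)"
  have h: "?h \<in> mod_hom R (free_pow R n) B" by (rule lc_hom_right[OF D(2) b])
  have hG: "?h r = lc B r b" if "r \<in> set G" for r using that G by auto
  have la: "length a = length G" using a by (rule vecs_length)
  have eqi: "lc B (G ! i) b = f (a ! i)" if "i < length G" for i
    using arg_cong[OF eq, of "\<lambda>l. l ! i"] that la by simp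
  have "?h r \<in> f ` carrier A" if "r \<in> set G" for r
  proof -
    obtain i where i: "i < length G" "G ! i = r" using \<open>r \<in> set G\<close> by (auto simp: in_set_conv_nth)
    then show ?thesis using eqi[OF i(1)] hG[OF that] vecs_nth[OF a i(1)] by auto
  qed
  then obtain h' where h': "h' \<in> mod_hom R (free_pow R n) A" "\<And>r. r \<in> set G \<Longrightarrow> f (h' r) = ?h r"
    using pure_extend[OF pe fin_rel_free_pow[OF A.R.ring_axioms] _ h, of G] G by auto
  let ?x = "map h' (unit_vecs R n)"
  note u = vecs_set[OF unit_vecs_in[OF A.R.ring_axioms], of n]
  have x: "?x \<in> vecs (carrier A) n" using u mod_hom_closed[OF h'(1)] by (auto simp: vecs_def)
  have lx: "lc A r ?x = h' r" if "r \<in> vecs (carrier R) n" for r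
    using mod_hom_lc[OF F D(1) h'(1) vecs_set[OF that], of "unit_vecs R n"] u
    by (simp add: lc_unit_vecs[OF A.R.ring_axioms that])
  have "map (\<lambda>r. lc A r ?x) G = a"
  proof (rule nth_equalityI)
    fix i assume "i < length (map (\<lambda>r. lc A r ?x) G)"
    then have i: "i < length G" by simp
    then have r: "G ! i \<in> vecs (carrier R) n" "G ! i \<in> set G" using G by auto
    have "f (h' (G ! i)) = f (a ! i)" using h'(2)[OF r(2)] hG[OF r(2)] eqi[OF i] by simp
    then have "h' (G ! i) = a ! i"
      using D(6) mod_hom_closed[OF h'(1), of "G ! i"] r(1) vecs_nth[OF a i] by (auto simp: inj_on_def)
    then show "map (\<lambda>r. lc A r ?x) G ! i = a ! i" using i lx[OF r(1)] by simp
  qed (simp add: la)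
  with x show "\<exists>x\<in>vecs (carrier A) n. map (\<lambda>r. lc A r x) G = a" by blast
qed

text \<open>
  Exactness of \<open>M\<^sup>a \<rightarrow> M\<^sup>b \<rightarrow> M\<^sup>c\<close> in the middle; the maps are the matrices with
  rows \<open>G\<close> and \<open>H\<close>.
\<close>

definition exact_at :: "('r, 'm) module \<Rightarrow> nat \<Rightarrow> nat \<Rightarrow> 'r list list \<Rightarrow> 'r list list \<Rightarrow> bool" where
  "exact_at M a b G H \<longleftrightarrow> (\<forall>y\<in>vecs (carrier M) b. (\<forall>r\<in>set H. lc M r y = \<zero>\<^bsub>M\<^esub>) \<longrightarrow>
     (\<exists>x\<in>vecs (carrier M) a. map (\<lambda>r. lc M r x) G = y))"

text \<open>A vector over \<open>A\<close> that is killed by \<open>H\<close> is in the image of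
  \<open>G\<close> over \<open>B\<close>. This is a system solvable in \<open>B\<close> with
  right-hand sides in \<open>A\<close>.\<close>

lemma exact_at_sub:
  assumes A: "left_module R A" and B: "left_module R B" and f: "f \<in> mod_hom R A B"
    and sp: "sys_pure R A f B" and G: "set G \<subseteq> vecs (carrier R) a" "length G = b" and H: "set H \<subseteq> vecs (carrier R) b"
    and ex: "exact_at B a b G H"
  shows "exact_at A a b G H"
  unfolding exact_at_def
proof (intro ballI impI)
  fix y assume y: "y \<in> vecs (carrier A) b" and z: "\<forall>r\<in>set H. lc A r y = \<zero>\<^bsub>A\<^esub>"
  have "lc B r (map f y) = \<zero>\<^bsub>B\<^esub>" if "r \<in> set H" for r
    using mod_hom_lc[OF A B f vecs_set vecs_set[OF y], of r b] that H z mod_hom_zero[OF A B f] by auto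
  moreover have "map f y \<in> vecs (carrier B) b" using y mod_hom_closed[OF f] by (rule vecs_map)
  ultimately obtain x where "x \<in> vecs (carrier B) a" "map (\<lambda>r. lc B r x) G = map f y"
    using ex unfolding exact_at_def by blast
  then show "\<exists>x\<in>vecs (carrier A) a. map (\<lambda>r. lc A r x) G = y"
    using sp[unfolded sys_pure_def, rule_format, OF G(1), of y x] y G(2) by simp
qed

text \<open>Lift a vector \<open>z\<close> killed by \<open>H\<close> to \<open>y\<close> over
  \<open>B\<close>. The entries of \<open>H y\<close> lie in \<open>A\<close>, so purity gives
  \<open>x\<close> over \<open>A\<close> with \<open>H x = H y\<close>. The difference of
  \<open>y\<close> and \<open>x\<close> is killed by \<open>H\<close> and still maps to
  \<open>z\<close>; a preimage of it under \<open>G\<close> over \<open>B\<close> maps to the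
  solution over \<open>D\<close>.\<close>

lemma exact_at_quotient:
  assumes se: "short_exact R A f B g D"
    and sp: "sys_pure R A f B" and G: "set G \<subseteq> vecs (carrier R) a" "length G = b" and H: "set H \<subseteq> vecs (carrier R) b"
    and ex: "exact_at B a b G H"
  shows "exact_at D a b G H"
  unfolding exact_at_def
proof (intro ballI impI)
  note D = short_exactD[OF se]
  interpret A: left_module R A by (rule D)
  interpret B: left_module R B by (rule D)
  interpret D: left_module R D by (rule D)
  fix z assume z: "z \<in> vecs (carrier D) b" and z0: "\<forall>r\<in>set H. lc D r z = \<zero>\<^bsub>D\<^esub>"
  obtain y where y: "set y \<subseteq> carrier B" "map g y = z" using lift_list[OF D(7) vecs_set[OF z]] by metis
  have yb: "y \<in> vecs (carrier B) b" using y vecs_length[OF z] by (auto simp: vecs_def)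
  have Hs: "set r \<subseteq> carrier R" "length r = b" if "r \<in> set H" for r using that H by (auto simp: vecs_def)
  have Gs: "set r \<subseteq> carrier R" if "r \<in> set G" for r using that G by (auto simp: vecs_def)
  have "set (map (\<lambda>r. lc B r y) H) \<subseteq> f ` carrier A"
  proof -
    have "lc B r y \<in> f ` carrier A" if r: "r \<in> set H" for r
    proof -
      have "g (lc B r y) = \<zero>\<^bsub>D\<^esub>" using mod_hom_lc[OF D(2,3,5) Hs(1)[OF r] y(1)] y(2) z0 r by simp
      with B.lc_closed[OF Hs(1)[OF r] y(1)] show ?thesis by (rule short_exact_image[OF se])
    qed
    then show ?thesis by auto
  qed
  then obtain a' where a': "set a' \<subseteq> carrier A" "map f a' = map (\<lambda>r. lc B r y) H"
    using lift_list[of f "carrier A"] by metis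
  have "length a' = length H" using arg_cong[OF a'(2), of length] by simp
  then have "a' \<in> vecs (carrier A) (length H)" using a'(1) by (simp add: vecs_def)
  then obtain x where x: "x \<in> vecs (carrier A) b" "map (\<lambda>r. lc A r x) H = a'"
    using sp[unfolded sys_pure_def, rule_format, OF H, of a' y] yb a'(2) by auto
  let ?w = "map2 (\<lambda>u v. u \<oplus>\<^bsub>B\<^esub> v) y (map f (map (\<lambda>v. \<ominus>\<^bsub>A\<^esub> v) x))"
  have nx: "map (\<lambda>v. \<ominus>\<^bsub>A\<^esub> v) x \<in> vecs (carrier A) b" using x(1) by (rule vecs_map) simp
  then have fnx: "map f (map (\<lambda>v. \<ominus>\<^bsub>A\<^esub> v) x) \<in> vecs (carrier B) b" using mod_hom_closed[OF D(4)] by (rule vecs_map)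
  have lneg: "lc A r (map (\<lambda>v. \<ominus>\<^bsub>A\<^esub> v) x) = \<ominus>\<^bsub>A\<^esub> lc A r x" if "set r \<subseteq> carrier R" for r
    using that vecs_set[OF x(1)]
    by (induction r x rule: list_induct2') (auto simp: A.smult_neg(2)[symmetric] A.M.minus_add)
  have w: "?w \<in> vecs (carrier B) b"
    using yb fnx by (auto simp: vecs_iff_nth)
  have "lc B r ?w = \<zero>\<^bsub>B\<^esub>" if r: "r \<in> set H" for r
  proof -
    have "lc B r ?w = lc B r y \<oplus>\<^bsub>B\<^esub> lc B r (map f (map (\<lambda>v. \<ominus>\<^bsub>A\<^esub> v) x))"
      using Hs[OF r] yb fnx by (intro B.lc_add_right) (auto simp: vecs_def)
    also have "lc B r (map f (map (\<lambda>v. \<ominus>\<^bsub>A\<^esub> v) x)) = \<ominus>\<^bsub>B\<^esub> f (lc A r x)"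
      using mod_hom_lc[OF D(1,2,4) Hs(1)[OF r] vecs_set[OF nx]] lneg[OF Hs(1)[OF r]]
        mod_hom_neg[OF D(1,2,4)] A.lc_closed[OF Hs(1)[OF r] vecs_set[OF x(1)]] by simp
    also have "f (lc A r x) = lc B r y"
    proof -
      obtain i where i: "i < length H" "H ! i = r" using r by (auto simp: in_set_conv_nth)
      have "map f (map (\<lambda>r. lc A r x) H) ! i = map (\<lambda>r. lc B r y) H ! i" using x(2) a'(2) by simp
      then show ?thesis using i by simp
    qed
    finally show ?thesis using B.lc_closed[OF Hs(1)[OF r] y(1)] by (simp add: B.M.r_neg)
  qed
  then obtain u where u: "u \<in> vecs (carrier B) a" "map (\<lambda>r. lc B r u) G = ?w"
    using ex w unfolding exact_at_def by blast
  have gw: "map g ?w = z"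
  proof (rule nth_equalityI)
    have l: "length y = b" "length x = b" "length z = b" using yb x z by (auto simp: vecs_length)
    then show "length (map g ?w) = length z" by simp
    fix i assume "i < length (map g ?w)"
    then have i: "i < b" using l by simp
    have "g (y ! i \<oplus>\<^bsub>B\<^esub> f (\<ominus>\<^bsub>A\<^esub> (x ! i))) = g (y ! i)"
      using i vecs_nth[OF yb i] vecs_nth[OF x(1) i] mod_hom_closed[OF D(4)] mod_hom_closed[OF D(5)]
      by (simp add: mod_hom_add[OF D(5)] short_exact_zero[OF se])
    then show "map g ?w ! i = z ! i" using i l y(2) by auto
  qed
  have "map (\<lambda>r. lc D r (map g u)) G = z"
    unfolding gw[symmetric] u(2)[symmetric]
    using Gs mod_hom_lc[OF D(2,3,5) _ vecs_set[OF u(1)]] by simp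
  moreover have "map g u \<in> vecs (carrier D) a" using u(1) mod_hom_closed[OF D(5)] by (rule vecs_map)
  ultimately show "\<exists>x\<in>vecs (carrier D) a. map (\<lambda>r. lc D r x) G = z" by blast
qed

section \<open>Tensor products\<close>

lemma op_ring_simps [simp]:
  "carrier (op_ring R) = carrier R" "ring.add (op_ring R) = ring.add R" "\<zero>\<^bsub>op_ring R\<^esub> = \<zero>\<^bsub>R\<^esub>"
  "\<one>\<^bsub>op_ring R\<^esub> = \<one>\<^bsub>R\<^esub>" "monoid.mult (op_ring R) x y = y \<otimes>\<^bsub>R\<^esub> x"
  by (simp_all add: op_ring_def)

lemma coset_eq_iff:
  assumes "comm_group G" "subgroup B G" "x \<in> carrier G" "y \<in> carrier G"
  shows "B #>\<^bsub>G\<^esub> x = B #>\<^bsub>G\<^esub> y \<longleftrightarrow> x \<otimes>\<^bsub>G\<^esub> inv\<^bsub>G\<^esub> y \<in> B"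
proof -
  interpret comm_group G by fact
  note B = subgroup.subset[OF assms(2)]
  show ?thesis
  proof
    assume "B #>\<^bsub>G\<^esub> x = B #>\<^bsub>G\<^esub> y"
    then have "B #>\<^bsub>G\<^esub> (x \<otimes>\<^bsub>G\<^esub> inv\<^bsub>G\<^esub> y) = B" using assms(3,4) B by (rule coset_mult_inv2)
    then show "x \<otimes>\<^bsub>G\<^esub> inv\<^bsub>G\<^esub> y \<in> B" by (rule coset_join1) (simp_all add: assms(2,3,4))
  next
    assume "x \<otimes>\<^bsub>G\<^esub> inv\<^bsub>G\<^esub> y \<in> B"
    then have "B #>\<^bsub>G\<^esub> (x \<otimes>\<^bsub>G\<^esub> inv\<^bsub>G\<^esub> y) = B"
      by (rule coset_join2[rotated 2]) (simp_all add: assms(2,3,4))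
    then show "B #>\<^bsub>G\<^esub> x = B #>\<^bsub>G\<^esub> y" using assms(3,4) B by (rule coset_mult_inv1)
  qed
qed

lemma coset_hom:
  assumes "comm_group G" "subgroup B G"
  shows "(\<lambda>x. B #>\<^bsub>G\<^esub> x) \<in> hom G (G Mod B)"
  using assms by (intro normal.r_coset_hom_Mod) (simp add: comm_group.normal_iff_subgroup)

lemma hom_vanishing_on_subgroup:
  assumes "group G" "group H" "h \<in> hom G H" "X \<subseteq> carrier G" "\<And>x. x \<in> X \<Longrightarrow> h x = \<one>\<^bsub>H\<^esub>" "x \<in> generate G X"
  shows "h x = \<one>\<^bsub>H\<^esub>"
proof -
  interpret group_hom G H h using assms by (simp add: group_hom_def group_hom_axioms_def)
  have "generate G X \<subseteq> kernel G H h"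
    using assms by (intro G.generate_subgroup_incl subgroup_kernel) (auto simp: kernel_def)
  then show ?thesis using assms(6) by (auto simp: kernel_def)
qed

lemma hom_factor_Mod:
  assumes G: "comm_group G" and H: "comm_group H" and h: "h \<in> hom G H" and B: "subgroup B G"
    and z: "\<And>b. b \<in> B \<Longrightarrow> h b = \<one>\<^bsub>H\<^esub>"
  obtains g where "g \<in> hom (G Mod B) H" "\<And>x. x \<in> carrier G \<Longrightarrow> g (B #>\<^bsub>G\<^esub> x) = h x"
proof -
  interpret G: comm_group G by fact
  interpret H: comm_group H by fact
  interpret h: group_hom G H h using h by unfold_locales
  show thesis
  proof (rule FactGroup_universal[OF h])
    show "B \<lhd> G" using B by (simp add: G.normal_iff_subgroup)
    fix x y assume xy: "x \<in> carrier G" "y \<in> carrier G" "B #>\<^bsub>G\<^esub> x = B #>\<^bsub>G\<^esub> y"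
    then have "h (x \<otimes>\<^bsub>G\<^esub> inv\<^bsub>G\<^esub> y) = \<one>\<^bsub>H\<^esub>" using coset_eq_iff[OF G B] z by blast
    then show "h x = h y" using xy by (simp add: H.inv_solve_right')
  qed (rule that)
qed

lemma frag_diff_induct [consumes 1, case_names zero diff frag_of]:
  assumes "Poly_Mapping.keys x \<subseteq> S" "P 0"
    "\<And>x y. Poly_Mapping.keys x \<subseteq> S \<Longrightarrow> Poly_Mapping.keys y \<subseteq> S \<Longrightarrow> P x \<Longrightarrow> P y \<Longrightarrow> P (x - y)"
    "\<And>a. a \<in> S \<Longrightarrow> P (frag_of a)"
  shows "P x"
  using assms by (rule free_Abelian_group_induct)

lemma frag_hom_diff:
  assumes "group H" "h \<in> hom (free_Abelian_group S) H"
    "u \<in> carrier (free_Abelian_group S)" "v \<in> carrier (free_Abelian_group S)"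
  shows "h (u - v) = h u \<otimes>\<^bsub>H\<^esub> inv\<^bsub>H\<^esub> h v"
proof -
  interpret group_hom "free_Abelian_group S" H h
    using assms(1,2) by (simp add: group_hom_def group_hom_axioms_def)
  have "inv\<^bsub>free_Abelian_group S\<^esub> v = - v" using assms(4) by simp
  then have "u - v = u \<otimes>\<^bsub>free_Abelian_group S\<^esub> inv\<^bsub>free_Abelian_group S\<^esub> v" by simp
  then show ?thesis using assms(3,4) by (simp only: hom_mult G.inv_closed hom_inv)
qed

definition tens :: "'r ring \<Rightarrow> ('r, 'n) module \<Rightarrow> ('r, 'm) module \<Rightarrow> 'n \<Rightarrow> 'm \<Rightarrow> ('n \<times> 'm \<Rightarrow>\<^sub>0 int) set" where
  "tens R N M x y = tensor_kernel R N M #>\<^bsub>free_Abelian_group (carrier N \<times> carrier M)\<^esub> frag_of (x, y)"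

text \<open>A sum of elementary tensors. Tensor groups are written multiplicatively, so products
  stand for sums and \<one> is the zero tensor.\<close>

fun tsum :: "'r ring \<Rightarrow> ('r, 'n) module \<Rightarrow> ('r, 'm) module \<Rightarrow> 'n list \<Rightarrow> 'm list \<Rightarrow> ('n \<times> 'm \<Rightarrow>\<^sub>0 int) set" where
  "tsum R N M (x # xs) (y # ys) = tens R N M x y \<otimes>\<^bsub>tensor_group R N M\<^esub> tsum R N M xs ys"
| "tsum R N M _ _ = \<one>\<^bsub>tensor_group R N M\<^esub>"

locale tensor_pair = N: left_module "op_ring R" N + M: left_module R M
  for R :: "'r ring" and N :: "('r, 'n) module" and M :: "('r, 'm) module"
begin

abbreviation "G \<equiv> free_Abelian_group (carrier N \<times> carrier M)"
abbreviation "K \<equiv> tensor_kernel R N M"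
abbreviation "T \<equiv> tensor_group R N M"
abbreviation "t \<equiv> tens R N M"

lemma G_group: "comm_group G" by (rule abelian_free_Abelian_group)

lemma relators_in: "tensor_relators R N M \<subseteq> carrier G"
proof -
  have *: "frag_of p - frag_of q - frag_of r \<in> carrier G"
    if "p \<in> carrier N \<times> carrier M" "q \<in> carrier N \<times> carrier M" "r \<in> carrier N \<times> carrier M" for p q r
    using that by (auto dest!: subsetD[OF keys_diff])
  have **: "frag_of p - frag_of q \<in> carrier G"
    if "p \<in> carrier N \<times> carrier M" "q \<in> carrier N \<times> carrier M" for p q
    using that by (auto dest!: subsetD[OF keys_diff])
  show ?thesis
  proof
    fix u assume "u \<in> tensor_relators R N M"
    then show "u \<in> carrier G"
      unfolding tensor_relators_def
    proof (elim UnE CollectE exE conjE)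
      show "u \<in> carrier G" if "u = frag_of (x \<oplus>\<^bsub>N\<^esub> x', y) - frag_of (x, y) - frag_of (x', y)"
        "x \<in> carrier N" "x' \<in> carrier N" "y \<in> carrier M" for x x' y
        unfolding that(1) by (rule *) (use that in auto)
      show "u \<in> carrier G" if "u = frag_of (x, y \<oplus>\<^bsub>M\<^esub> y') - frag_of (x, y) - frag_of (x, y')"
        "x \<in> carrier N" "y \<in> carrier M" "y' \<in> carrier M" for x y y'
        unfolding that(1) by (rule *) (use that in auto)
      show "u \<in> carrier G" if "u = frag_of (a \<odot>\<^bsub>N\<^esub> x, y) - frag_of (x, a \<odot>\<^bsub>M\<^esub> y)"
        "a \<in> carrier R" "x \<in> carrier N" "y \<in> carrier M" for a x y
        unfolding that(1) by (rule **) (use that in auto)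
    qed
  qed
qed

lemma K_subgroup: "subgroup K G"
  unfolding tensor_kernel_def by (rule group.generate_is_subgroup[OF _ relators_in]) simp

lemma T_group: "comm_group T"
  unfolding tensor_group_def by (rule comm_group.abelian_FactGroup[OF G_group K_subgroup])

sublocale T: comm_group T by (rule T_group)

lemma q_hom: "(\<lambda>u. K #>\<^bsub>G\<^esub> u) \<in> hom G T"
  unfolding tensor_group_def by (rule coset_hom[OF G_group K_subgroup])

lemma q_eqI: "u \<in> carrier G \<Longrightarrow> v \<in> carrier G \<Longrightarrow> u - v \<in> tensor_relators R N M \<Longrightarrow> K #>\<^bsub>G\<^esub> u = K #>\<^bsub>G\<^esub> v"
  by (subst coset_eq_iff[OF G_group K_subgroup])
     (auto simp: tensor_kernel_def intro!: generate.incl)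

lemma carrier_T: "carrier T = (\<lambda>u. K #>\<^bsub>G\<^esub> u) ` carrier G"
  by (simp add: tensor_group_def carrier_FactGroup)

lemma q_diff: "u \<in> carrier G \<Longrightarrow> v \<in> carrier G \<Longrightarrow> K #>\<^bsub>G\<^esub> (u - v) = (K #>\<^bsub>G\<^esub> u) \<otimes>\<^bsub>T\<^esub> inv\<^bsub>T\<^esub> (K #>\<^bsub>G\<^esub> v)"
  by (rule frag_hom_diff[OF T.group_axioms q_hom])

lemma q_add: "u \<in> carrier G \<Longrightarrow> v \<in> carrier G \<Longrightarrow> K #>\<^bsub>G\<^esub> (u + v) = (K #>\<^bsub>G\<^esub> u) \<otimes>\<^bsub>T\<^esub> (K #>\<^bsub>G\<^esub> v)"
  using hom_mult[OF q_hom, of u v] by simp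

lemma t_closed [simp, intro]: "x \<in> carrier N \<Longrightarrow> y \<in> carrier M \<Longrightarrow> t x y \<in> carrier T"
  by (auto simp: tens_def carrier_T)

lemma t_add_left:
  assumes "x \<in> carrier N" "x' \<in> carrier N" "y \<in> carrier M"
  shows "t (x \<oplus>\<^bsub>N\<^esub> x') y = t x y \<otimes>\<^bsub>T\<^esub> t x' y"
proof -
  have "t (x \<oplus>\<^bsub>N\<^esub> x') y = K #>\<^bsub>G\<^esub> (frag_of (x, y) + frag_of (x', y))"
    unfolding tens_def
  proof (rule q_eqI)
    have "frag_of (x \<oplus>\<^bsub>N\<^esub> x', y) - frag_of (x, y) - frag_of (x', y) \<in> tensor_relators R N M"
      using assms unfolding tensor_relators_def by blast
    then show "frag_of (x \<oplus>\<^bsub>N\<^esub> x', y) - (frag_of (x, y) + frag_of (x', y)) \<in> tensor_relators R N M"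
      by (simp add: diff_diff_eq)
  qed (use assms in \<open>auto dest!: subsetD[OF keys_add]\<close>)
  then show ?thesis using assms by (simp add: q_add tens_def)
qed

lemma t_add_right:
  assumes "x \<in> carrier N" "y \<in> carrier M" "y' \<in> carrier M"
  shows "t x (y \<oplus>\<^bsub>M\<^esub> y') = t x y \<otimes>\<^bsub>T\<^esub> t x y'"
proof -
  have "t x (y \<oplus>\<^bsub>M\<^esub> y') = K #>\<^bsub>G\<^esub> (frag_of (x, y) + frag_of (x, y'))"
    unfolding tens_def
  proof (rule q_eqI)
    have "frag_of (x, y \<oplus>\<^bsub>M\<^esub> y') - frag_of (x, y) - frag_of (x, y') \<in> tensor_relators R N M"
      using assms unfolding tensor_relators_def by blast
    then show "frag_of (x, y \<oplus>\<^bsub>M\<^esub> y') - (frag_of (x, y) + frag_of (x, y')) \<in> tensor_relators R N M"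
      by (simp add: diff_diff_eq)
  qed (use assms in \<open>auto dest!: subsetD[OF keys_add]\<close>)
  then show ?thesis using assms by (simp add: q_add tens_def)
qed

lemma t_balanced:
  assumes "a \<in> carrier R" "x \<in> carrier N" "y \<in> carrier M"
  shows "t (a \<odot>\<^bsub>N\<^esub> x) y = t x (a \<odot>\<^bsub>M\<^esub> y)"
  unfolding tens_def
proof (rule q_eqI)
  show "frag_of (a \<odot>\<^bsub>N\<^esub> x, y) - frag_of (x, a \<odot>\<^bsub>M\<^esub> y) \<in> tensor_relators R N M"
    using assms unfolding tensor_relators_def by blast
qed (use assms in auto)

lemma t_zero_left: "y \<in> carrier M \<Longrightarrow> t \<zero>\<^bsub>N\<^esub> y = \<one>\<^bsub>T\<^esub>"
  using t_add_left[of "\<zero>\<^bsub>N\<^esub>" "\<zero>\<^bsub>N\<^esub>" y] by (simp add: T.l_cancel_one')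

lemma t_zero_right: "x \<in> carrier N \<Longrightarrow> t x \<zero>\<^bsub>M\<^esub> = \<one>\<^bsub>T\<^esub>"
  using t_add_right[of x "\<zero>\<^bsub>M\<^esub>" "\<zero>\<^bsub>M\<^esub>"] by (simp add: T.l_cancel_one')

lemma t_neg_left: "x \<in> carrier N \<Longrightarrow> y \<in> carrier M \<Longrightarrow> t (\<ominus>\<^bsub>N\<^esub> x) y = inv\<^bsub>T\<^esub> t x y"
  using t_add_left[of "\<ominus>\<^bsub>N\<^esub> x" x y] by (intro T.inv_equality[symmetric]) (auto simp: N.M.l_neg t_zero_left)

text \<open>The free abelian group is generated from the pairs by differences, so the property is
  carried along for inverses too. The inverse of an elementary tensor is elementary again, which is
  why sums are the only combination left in the rule.\<close>

lemma tensor_induct [consumes 1, case_names one tens mult]: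
  assumes "X \<in> carrier T" and one: "P \<one>\<^bsub>T\<^esub>" and t: "\<And>x y. x \<in> carrier N \<Longrightarrow> y \<in> carrier M \<Longrightarrow> P (t x y)"
    and mult: "\<And>X Y. X \<in> carrier T \<Longrightarrow> Y \<in> carrier T \<Longrightarrow> P X \<Longrightarrow> P Y \<Longrightarrow> P (X \<otimes>\<^bsub>T\<^esub> Y)"
  shows "P X"
proof -
  define Q where "Q X \<longleftrightarrow> X \<in> carrier T \<and> P X \<and> P (inv\<^bsub>T\<^esub> X)" for X
  obtain u where u: "u \<in> carrier G" "X = K #>\<^bsub>G\<^esub> u" using assms(1) by (auto simp: carrier_T)
  then have "Poly_Mapping.keys u \<subseteq> carrier N \<times> carrier M" by simp
  then have "Q (K #>\<^bsub>G\<^esub> u)"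
  proof (induction u rule: frag_diff_induct)
    case zero
    have "K #>\<^bsub>G\<^esub> 0 = \<one>\<^bsub>T\<^esub>" using q_diff[of 0 0] by (simp add: carrier_T T.r_inv)
    then show ?case using one by (simp add: Q_def)
  next
    case (diff u v)
    then show ?case using mult by (auto simp: Q_def q_diff T.inv_mult T.m_comm)
  next
    case (frag_of p)
    then obtain x y where p: "p = (x, y)" "x \<in> carrier N" "y \<in> carrier M" by auto
    have "P (t x y)" "P (t (\<ominus>\<^bsub>N\<^esub> x) y)" using p t by auto
    then show ?case using p t_closed[of x y] by (simp add: Q_def t_neg_left flip: tens_def)
  qed
  then show ?thesis by (simp add: Q_def u)
qed

lemma tensor_universal:
  fixes H :: "('h, 'x) monoid_scheme"
  assumes H: "comm_group H" and cl: "\<And>x y. x \<in> carrier N \<Longrightarrow> y \<in> carrier M \<Longrightarrow> \<phi> x y \<in> carrier H"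
    and l: "\<And>x x' y. x \<in> carrier N \<Longrightarrow> x' \<in> carrier N \<Longrightarrow> y \<in> carrier M \<Longrightarrow> \<phi> (x \<oplus>\<^bsub>N\<^esub> x') y = \<phi> x y \<otimes>\<^bsub>H\<^esub> \<phi> x' y"
    and r: "\<And>x y y'. x \<in> carrier N \<Longrightarrow> y \<in> carrier M \<Longrightarrow> y' \<in> carrier M \<Longrightarrow> \<phi> x (y \<oplus>\<^bsub>M\<^esub> y') = \<phi> x y \<otimes>\<^bsub>H\<^esub> \<phi> x y'"
    and b: "\<And>a x y. a \<in> carrier R \<Longrightarrow> x \<in> carrier N \<Longrightarrow> y \<in> carrier M \<Longrightarrow> \<phi> (a \<odot>\<^bsub>N\<^esub> x) y = \<phi> x (a \<odot>\<^bsub>M\<^esub> y)"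
  obtains \<Phi> where "\<Phi> \<in> hom T H" "\<And>x y. x \<in> carrier N \<Longrightarrow> y \<in> carrier M \<Longrightarrow> \<Phi> (t x y) = \<phi> x y"
proof -
  interpret H: comm_group H by fact
  have "case_prod \<phi> ` (carrier N \<times> carrier M) \<subseteq> carrier H" using cl by auto
  then obtain h where h: "h \<in> hom G H" and hf: "\<And>p. p \<in> carrier N \<times> carrier M \<Longrightarrow> h (frag_of p) = case_prod \<phi> p"
    using H.free_Abelian_group_universal by metis
  have d: "h (u - v) = h u \<otimes>\<^bsub>H\<^esub> inv\<^bsub>H\<^esub> h v" if "u \<in> carrier G" "v \<in> carrier G" for u v
    by (rule frag_hom_diff[OF H.group_axioms h that])
  have kd: "frag_of p - frag_of q \<in> carrier G" if "p \<in> carrier N \<times> carrier M" "q \<in> carrier N \<times> carrier M" for p q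
    using that by (auto dest!: subsetD[OF keys_diff])
  have h3: "h (frag_of p - frag_of q - frag_of s) = \<one>\<^bsub>H\<^esub>"
    if "p \<in> carrier N \<times> carrier M" "q \<in> carrier N \<times> carrier M" "s \<in> carrier N \<times> carrier M"
      "case_prod \<phi> p = case_prod \<phi> q \<otimes>\<^bsub>H\<^esub> case_prod \<phi> s" for p q s
  proof -
    have c: "case_prod \<phi> q \<in> carrier H" "case_prod \<phi> s \<in> carrier H" using that cl by auto
    have "h (frag_of p - frag_of q - frag_of s) =
        case_prod \<phi> q \<otimes>\<^bsub>H\<^esub> case_prod \<phi> s \<otimes>\<^bsub>H\<^esub> inv\<^bsub>H\<^esub> case_prod \<phi> q \<otimes>\<^bsub>H\<^esub> inv\<^bsub>H\<^esub> case_prod \<phi> s"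
      using that kd[OF that(1,2)] by (simp add: d hf)
    also have "\<dots> = (case_prod \<phi> q \<otimes>\<^bsub>H\<^esub> case_prod \<phi> s) \<otimes>\<^bsub>H\<^esub> inv\<^bsub>H\<^esub> (case_prod \<phi> q \<otimes>\<^bsub>H\<^esub> case_prod \<phi> s)"
      unfolding H.inv_mult[OF c] using c by (simp only: H.m_assoc H.m_closed H.inv_closed)
    also have "\<dots> = \<one>\<^bsub>H\<^esub>" using c by (simp only: H.r_inv H.m_closed)
    finally show ?thesis .
  qed
  have h2: "h (frag_of p - frag_of q) = \<one>\<^bsub>H\<^esub>"
    if "p \<in> carrier N \<times> carrier M" "q \<in> carrier N \<times> carrier M" "case_prod \<phi> p = case_prod \<phi> q" for p q
  proof -
    have "case_prod \<phi> q \<in> carrier H" using that cl by auto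
    then show ?thesis using that by (simp add: d hf)
  qed
  have hr: "h u = \<one>\<^bsub>H\<^esub>" if "u \<in> tensor_relators R N M" for u
    using that unfolding tensor_relators_def
  proof (elim UnE CollectE exE conjE)
    show "h u = \<one>\<^bsub>H\<^esub>" if "u = frag_of (x \<oplus>\<^bsub>N\<^esub> x', y) - frag_of (x, y) - frag_of (x', y)"
      "x \<in> carrier N" "x' \<in> carrier N" "y \<in> carrier M" for x x' y
      unfolding that(1) by (rule h3) (use that l in auto)
    show "h u = \<one>\<^bsub>H\<^esub>" if "u = frag_of (x, y \<oplus>\<^bsub>M\<^esub> y') - frag_of (x, y) - frag_of (x, y')"
      "x \<in> carrier N" "y \<in> carrier M" "y' \<in> carrier M" for x y y'
      unfolding that(1) by (rule h3) (use that r in auto)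
    show "h u = \<one>\<^bsub>H\<^esub>" if "u = frag_of (a \<odot>\<^bsub>N\<^esub> x, y) - frag_of (x, a \<odot>\<^bsub>M\<^esub> y)"
      "a \<in> carrier R" "x \<in> carrier N" "y \<in> carrier M" for a x y
      unfolding that(1) by (rule h2) (use that b in auto)
  qed
  have "h u = \<one>\<^bsub>H\<^esub>" if "u \<in> K" for u
    by (rule hom_vanishing_on_subgroup[OF group_free_Abelian_group H.group_axioms h relators_in hr
          that[unfolded tensor_kernel_def]])
  then obtain \<Phi> where \<Phi>: "\<Phi> \<in> hom (G Mod K) H" "\<And>u. u \<in> carrier G \<Longrightarrow> \<Phi> (K #>\<^bsub>G\<^esub> u) = h u"
    using hom_factor_Mod[OF G_group H h K_subgroup] by blast
  show thesis
  proof (rule that)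
    show "\<Phi> \<in> hom T H" using \<Phi>(1) by (simp add: tensor_group_def)
    show "\<Phi> (t x y) = \<phi> x y" if "x \<in> carrier N" "y \<in> carrier M" for x y
      using that \<Phi>(2)[of "frag_of (x, y)"] hf[of "(x, y)"] by (simp add: tens_def)
  qed
qed

lemma tensor_hom_eqI:
  assumes H: "group H" and \<Phi>: "\<Phi> \<in> hom T H" and \<Psi>: "\<Psi> \<in> hom T H"
    and eq: "\<And>x y. x \<in> carrier N \<Longrightarrow> y \<in> carrier M \<Longrightarrow> \<Phi> (t x y) = \<Psi> (t x y)" and X: "X \<in> carrier T"
  shows "\<Phi> X = \<Psi> X"
  using X
proof (induction rule: tensor_induct)
  case one then show ?case using hom_one[OF \<Phi> T.group_axioms H] hom_one[OF \<Psi> T.group_axioms H] by simp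
next
  case (mult X Y) then show ?case using hom_mult[OF \<Phi>, of X Y] hom_mult[OF \<Psi>, of X Y] by simp
qed (rule eq)

lemma tsum_closed [simp]: "set xs \<subseteq> carrier N \<Longrightarrow> set ys \<subseteq> carrier M \<Longrightarrow> tsum R N M xs ys \<in> carrier T"
  by (induction xs ys rule: list_induct2') auto

lemma tsum_zero_right: "set xs \<subseteq> carrier N \<Longrightarrow> tsum R N M xs (replicate n \<zero>\<^bsub>M\<^esub>) = \<one>\<^bsub>T\<^esub>"
  by (induction xs arbitrary: n) (case_tac n; auto simp: t_zero_right)+

lemma tsum_zero_left: "set ys \<subseteq> carrier M \<Longrightarrow> tsum R N M (replicate n \<zero>\<^bsub>N\<^esub>) ys = \<one>\<^bsub>T\<^esub>"
  by (induction ys arbitrary: n) (case_tac n; auto simp: t_zero_left)+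

lemma tsum_add_right:
  assumes "length xs = length ys" "length ys = length zs"
    "set xs \<subseteq> carrier N" "set ys \<subseteq> carrier M" "set zs \<subseteq> carrier M"
  shows "tsum R N M xs (map2 (ring.add M) ys zs) = tsum R N M xs ys \<otimes>\<^bsub>T\<^esub> tsum R N M xs zs"
  using assms by (induction xs ys zs rule: list_induct3) (auto simp: t_add_right T.m_ac)

lemma tens_lc:
  assumes "length a = length xs" "set a \<subseteq> carrier R" "set xs \<subseteq> carrier N" "y \<in> carrier M"
  shows "t (lc N a xs) y = tsum R N M xs (map (\<lambda>r. r \<odot>\<^bsub>M\<^esub> y) a)"
  using assms(1-3)
  by (induction a xs rule: list_induct2) (use assms(4) in \<open>auto simp: t_zero_left t_add_left t_balanced\<close>)

text \<open>The coefficients of the left factor with respect to \<open>xs\<close> are moved across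
  the tensor sign, and terms with the same generator are collected.\<close>

lemma tensor_gens:
  assumes xs: "gens (op_ring R) N xs" and X: "X \<in> carrier T"
  obtains ys where "ys \<in> vecs (carrier M) (length xs)" "X = tsum R N M xs ys"
proof -
  note xs' = gens_set[OF xs]
  have "\<exists>ys\<in>vecs (carrier M) (length xs). X = tsum R N M xs ys"
    using X
  proof (induction rule: tensor_induct)
    case one
    show ?case
      by (intro bexI[of _ "replicate (length xs) \<zero>\<^bsub>M\<^esub>"]) (auto simp: tsum_zero_right xs' vecs_replicate)
  next
    case (tens x y)
    obtain a where a: "a \<in> vecs (carrier (op_ring R)) (length xs)" "lc N a xs = x" using gensE[OF xs tens(1)] .
    then show ?case using tens_lc[of a xs y] tens(2) xs'
      by (intro bexI[of _ "map (\<lambda>r. r \<odot>\<^bsub>M\<^esub> y) a"]) (auto simp: vecs_def)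
  next
    case (mult X Y)
    then obtain ys zs where "ys \<in> vecs (carrier M) (length xs)" "X = tsum R N M xs ys"
      "zs \<in> vecs (carrier M) (length xs)" "Y = tsum R N M xs zs" by blast
    then show ?case
      by (intro bexI[of _ "map2 (ring.add M) ys zs"]) (auto simp: tsum_add_right xs' vecs_def dest: set_zip_leftD set_zip_rightD)
  qed
  then show thesis using that by blast
qed

lemma tensor_tsum:
  assumes X: "X \<in> carrier T"
  obtains xs ys where "set xs \<subseteq> carrier N" "ys \<in> vecs (carrier M) (length xs)" "X = tsum R N M xs ys"
proof -
  have app: "tsum R N M (xs @ xs') (ys @ ys') = tsum R N M xs ys \<otimes>\<^bsub>T\<^esub> tsum R N M xs' ys'"
    if "length xs = length ys" "set xs \<subseteq> carrier N" "set ys \<subseteq> carrier M" "set xs' \<subseteq> carrier N" "set ys' \<subseteq> carrier M"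
    for xs ys xs' ys'
    using that by (induction xs ys rule: list_induct2) (auto simp: T.m_assoc)
  have "\<exists>xs ys. set xs \<subseteq> carrier N \<and> ys \<in> vecs (carrier M) (length xs) \<and> X = tsum R N M xs ys"
    using X
  proof (induction rule: tensor_induct)
    case one show ?case by (intro exI[of _ "[]"]) auto
  next
    case (tens x y) then show ?case by (intro exI[of _ "[x]"] exI[of _ "[y]"]) auto
  next
    case (mult X Y)
    then obtain xs ys xs' ys' where "set xs \<subseteq> carrier N" "ys \<in> vecs (carrier M) (length xs)" "X = tsum R N M xs ys"
      "set xs' \<subseteq> carrier N" "ys' \<in> vecs (carrier M) (length xs')" "Y = tsum R N M xs' ys'" by blast
    then show ?case
      by (intro exI[of _ "xs @ xs'"] exI[of _ "ys @ ys'"]) (auto simp: app vecs_def)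
  qed
  then show thesis using that by blast
qed

end

section \<open>Maps between tensor products and right exactness\<close>

definition tmap :: "'r ring \<Rightarrow> ('r, 'n) module \<Rightarrow> ('r, 'm) module \<Rightarrow> ('r, 'k) module \<Rightarrow> ('r, 'l) module \<Rightarrow>
    ('n \<Rightarrow> 'k) \<Rightarrow> ('m \<Rightarrow> 'l) \<Rightarrow> ('n \<times> 'm \<Rightarrow>\<^sub>0 int) set \<Rightarrow> ('k \<times> 'l \<Rightarrow>\<^sub>0 int) set" where
  "tmap R N M N' M' h f = (SOME \<Phi>. \<Phi> \<in> hom (tensor_group R N M) (tensor_group R N' M') \<and>
     (\<forall>x\<in>carrier N. \<forall>y\<in>carrier M. \<Phi> (tens R N M x y) = tens R N' M' (h x) (f y)))"

lemma tmap:
  assumes "tensor_pair R N M" "tensor_pair R N' M'" "h \<in> mod_hom (op_ring R) N N'" "f \<in> mod_hom R M M'"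
  shows tmap_hom: "tmap R N M N' M' h f \<in> hom (tensor_group R N M) (tensor_group R N' M')"
    and tmap_tens: "x \<in> carrier N \<Longrightarrow> y \<in> carrier M \<Longrightarrow>
      tmap R N M N' M' h f (tens R N M x y) = tens R N' M' (h x) (f y)"
proof -
  interpret A: tensor_pair R N M by fact
  interpret B: tensor_pair R N' M' by fact
  note c = mod_hom_closed[OF assms(3)] mod_hom_closed[OF assms(4)]
  have "\<exists>\<Phi>. \<Phi> \<in> hom A.T B.T \<and> (\<forall>x\<in>carrier N. \<forall>y\<in>carrier M. \<Phi> (tens R N M x y) = tens R N' M' (h x) (f y))"
  proof (rule A.tensor_universal[OF B.T_group, of "\<lambda>x y. tens R N' M' (h x) (f y)"])
    show "tens R N' M' (h (a \<odot>\<^bsub>N\<^esub> x)) (f y) = tens R N' M' (h x) (f (a \<odot>\<^bsub>M\<^esub> y))"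
      if "a \<in> carrier R" "x \<in> carrier N" "y \<in> carrier M" for a x y
      using that c mod_hom_smult[OF assms(3), of a x] mod_hom_smult[OF assms(4), of a y] by (simp add: B.t_balanced)
  qed (use c in \<open>auto simp: mod_hom_add[OF assms(3)] mod_hom_add[OF assms(4)] B.t_add_left B.t_add_right\<close>)
  then have "tmap R N M N' M' h f \<in> hom A.T B.T \<and> (\<forall>x\<in>carrier N. \<forall>y\<in>carrier M.
      tmap R N M N' M' h f (tens R N M x y) = tens R N' M' (h x) (f y))"
    unfolding tmap_def by (rule someI_ex)
  then show "tmap R N M N' M' h f \<in> hom A.T B.T"
    "x \<in> carrier N \<Longrightarrow> y \<in> carrier M \<Longrightarrow> tmap R N M N' M' h f (tens R N M x y) = tens R N' M' (h x) (f y)"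
    by auto
qed

lemma tmap_tsum:
  assumes "tensor_pair R N M" "tensor_pair R N' M'" "h \<in> mod_hom (op_ring R) N N'" "f \<in> mod_hom R M M'"
    "set xs \<subseteq> carrier N" "set ys \<subseteq> carrier M"
  shows "tmap R N M N' M' h f (tsum R N M xs ys) = tsum R N' M' (map h xs) (map f ys)"
proof -
  interpret A: tensor_pair R N M by fact
  interpret B: tensor_pair R N' M' by fact
  have one: "tmap R N M N' M' h f \<one>\<^bsub>A.T\<^esub> = \<one>\<^bsub>B.T\<^esub>"
    using hom_one[OF tmap_hom[OF assms(1-4)]] by simp
  show ?thesis using assms(5,6)
    by (induction xs ys rule: list_induct2')
       (auto simp: one tmap_tens[OF assms(1-4)] hom_mult[OF tmap_hom[OF assms(1-4)]])
qed

text \<open>All representatives of the coset \<open>X\<close> contribute the same coset, because the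
  map on free abelian groups and the map from the universal property agree on generators. The
  homomorphism laws and compositions can then be proved for \<open>tmap\<close>.\<close>

lemma tensor_map_eq_tmap:
  assumes A: "tensor_pair R N M" and B: "tensor_pair R N' M" and h: "h \<in> mod_hom (op_ring R) N N'"
    and X: "X \<in> carrier (tensor_group R N M)"
  shows "tensor_map R N N' M h X = tmap R N M N' M h (idm M) X"
proof -
  interpret A: tensor_pair R N M by fact
  interpret B: tensor_pair R N' M by fact
  define \<Phi> where "\<Phi> = tmap R N M N' M h (idm M)"
  note id = mod_hom_id[OF A.M.left_module_axioms]
  note \<Phi> = tmap_hom[OF A B h id, folded \<Phi>_def]
  let ?e = "frag_extend (\<lambda>(x, y). frag_of (h x, y))"
  have e: "Poly_Mapping.keys (?e u) \<subseteq> carrier N' \<times> carrier M \<and> B.K #>\<^bsub>B.G\<^esub> ?e u = \<Phi> (A.K #>\<^bsub>A.G\<^esub> u)"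
    if "Poly_Mapping.keys u \<subseteq> carrier N \<times> carrier M" for u
    using that
  proof (induction u rule: frag_diff_induct)
    case zero
    have "B.K #>\<^bsub>B.G\<^esub> 0 = \<one>\<^bsub>B.T\<^esub>" "A.K #>\<^bsub>A.G\<^esub> 0 = \<one>\<^bsub>A.T\<^esub>"
      using B.q_diff[of 0 0] A.q_diff[of 0 0] by (simp_all add: A.carrier_T B.carrier_T A.T.r_inv B.T.r_inv)
    then show ?case using hom_one[OF \<Phi>] by simp
  next
    case (diff u v)
    have k: "Poly_Mapping.keys (?e u - ?e v) \<subseteq> carrier N' \<times> carrier M"
      by (rule order_trans[OF keys_diff]) (use diff in auto)
    have c: "A.K #>\<^bsub>A.G\<^esub> u \<in> carrier A.T" "A.K #>\<^bsub>A.G\<^esub> v \<in> carrier A.T" using diff by (auto simp: A.carrier_T)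
    have "\<Phi> (inv\<^bsub>A.T\<^esub> (A.K #>\<^bsub>A.G\<^esub> v)) = inv\<^bsub>B.T\<^esub> \<Phi> (A.K #>\<^bsub>A.G\<^esub> v)"
      using group_hom.hom_inv[of A.T B.T \<Phi>] \<Phi> c by (simp add: group_hom_def group_hom_axioms_def)
    then show ?case using k diff c by (simp add: frag_extend_diff A.q_diff B.q_diff hom_mult[OF \<Phi>])
  next
    case (frag_of p)
    then obtain x y where p: "p = (x, y)" "x \<in> carrier N" "y \<in> carrier M" by auto
    then show ?case using tmap_tens[OF A B h id p(2,3), folded \<Phi>_def] mod_hom_closed[OF h p(2)]
      by (simp add: tens_def)
  qed
  obtain w where w: "w \<in> carrier A.G" "X = A.K #>\<^bsub>A.G\<^esub> w" using X by (auto simp: A.carrier_T)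
  have "B.K #>\<^bsub>B.G\<^esub> ?e u = \<Phi> X" if u: "u \<in> X" for u
  proof -
    have "u \<in> carrier A.G" using u w subgroup.elemrcos_carrier[OF A.K_subgroup] by (metis group_free_Abelian_group)
    moreover have "A.K #>\<^bsub>A.G\<^esub> u = X"
      using u w group.repr_independence[OF group_free_Abelian_group _ _ A.K_subgroup] by metis
    ultimately show ?thesis using e[of u] by simp
  qed
  moreover have "w \<in> X" unfolding w(2) using w(1) by (rule group.rcos_self[OF group_free_Abelian_group _ A.K_subgroup])
  ultimately show ?thesis unfolding tensor_map_def \<Phi>_def by blast
qed

lemma tmap_compose:
  assumes A: "tensor_pair R N M" and B: "tensor_pair R N' M'" and C: "tensor_pair R N'' M''"
    and "h \<in> mod_hom (op_ring R) N N'" "f \<in> mod_hom R M M'"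
    and "h' \<in> mod_hom (op_ring R) N' N''" "f' \<in> mod_hom R M' M''"
    and "k \<in> mod_hom (op_ring R) N N''" "j \<in> mod_hom R M M''"
    and "\<And>x. x \<in> carrier N \<Longrightarrow> h' (h x) = k x" "\<And>y. y \<in> carrier M \<Longrightarrow> f' (f y) = j y"
    and X: "X \<in> carrier (tensor_group R N M)"
  shows "tmap R N' M' N'' M'' h' f' (tmap R N M N' M' h f X) = tmap R N M N'' M'' k j X"
proof -
  interpret A: tensor_pair R N M by fact
  interpret B: tensor_pair R N' M' by fact
  interpret C: tensor_pair R N'' M'' by fact
  note 1 = tmap_hom[OF A B assms(4,5)] and 2 = tmap_hom[OF B C assms(6,7)] and 3 = tmap_hom[OF A C assms(8,9)]
  have "(tmap R N' M' N'' M'' h' f' \<circ> tmap R N M N' M' h f) X = tmap R N M N'' M'' k j X"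
    by (rule A.tensor_hom_eqI[OF C.T.group_axioms hom_compose[OF 1 2] 3 _ X])
       (use assms(10,11) mod_hom_closed[OF assms(4)] mod_hom_closed[OF assms(5)] in
        \<open>simp add: tmap_tens[OF A B assms(4,5)] tmap_tens[OF B C assms(6,7)] tmap_tens[OF A C assms(8,9)]\<close>)
  then show ?thesis by simp
qed

lemma tmap_id:
  assumes A: "tensor_pair R N M" and "h \<in> mod_hom (op_ring R) N N" "f \<in> mod_hom R M M"
    "\<And>x. x \<in> carrier N \<Longrightarrow> h x = x" "\<And>y. y \<in> carrier M \<Longrightarrow> f y = y"
    and X: "X \<in> carrier (tensor_group R N M)"
  shows "tmap R N M N M h f X = X"
proof -
  interpret A: tensor_pair R N M by fact
  have "tmap R N M N M h f X = (\<lambda>X. X) X"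
    by (rule A.tensor_hom_eqI[OF A.T.group_axioms tmap_hom[OF A A assms(2,3)] _ _ X])
       (use assms in \<open>simp_all add: tmap_tens[OF A A assms(2,3)] hom_def\<close>)
  then show ?thesis .
qed

lemma tmap_zero:
  assumes A: "tensor_pair R N M" and B: "tensor_pair R N' M'"
    and "h \<in> mod_hom (op_ring R) N N'" "f \<in> mod_hom R M M'"
    and "\<And>x y. x \<in> carrier N \<Longrightarrow> y \<in> carrier M \<Longrightarrow> h x = \<zero>\<^bsub>N'\<^esub> \<or> f y = \<zero>\<^bsub>M'\<^esub>"
    and X: "X \<in> carrier (tensor_group R N M)"
  shows "tmap R N M N' M' h f X = \<one>\<^bsub>tensor_group R N' M'\<^esub>"
proof -
  interpret A: tensor_pair R N M by fact
  interpret B: tensor_pair R N' M' by fact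
  have t: "tens R N' M' (h x) (f y) = \<one>\<^bsub>B.T\<^esub>" if "x \<in> carrier N" "y \<in> carrier M" for x y
    using assms(5)[OF that] mod_hom_closed[OF assms(3) that(1)] mod_hom_closed[OF assms(4) that(2)]
    by (auto simp: B.t_zero_left B.t_zero_right)
  have "tmap R N M N' M' h f X = (\<lambda>_. \<one>\<^bsub>B.T\<^esub>) X"
    by (rule A.tensor_hom_eqI[OF B.T.group_axioms tmap_hom[OF A B assms(3,4)] _ _ X])
       (simp_all add: tmap_tens[OF A B assms(3,4)] hom_def t)
  then show ?thesis .
qed

lemma tmap_compose_zero:
  assumes A: "tensor_pair R N M" and B: "tensor_pair R N' M'" and C: "tensor_pair R N'' M''"
    and h: "h \<in> mod_hom (op_ring R) N N'" and f: "f \<in> mod_hom R M M'"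
    and h': "h' \<in> mod_hom (op_ring R) N' N''" and f': "f' \<in> mod_hom R M' M''"
    and z: "\<And>x y. x \<in> carrier N \<Longrightarrow> y \<in> carrier M \<Longrightarrow> h' (h x) = \<zero>\<^bsub>N''\<^esub> \<or> f' (f y) = \<zero>\<^bsub>M''\<^esub>"
    and X: "X \<in> carrier (tensor_group R N M)"
  shows "tmap R N' M' N'' M'' h' f' (tmap R N M N' M' h f X) = \<one>\<^bsub>tensor_group R N'' M''\<^esub>"
proof -
  interpret A: tensor_pair R N M by (rule A)
  note c = mod_hom_compose[OF A.N.left_module_axioms h h'] mod_hom_compose[OF A.M.left_module_axioms f f']
  have "tmap R N' M' N'' M'' h' f' (tmap R N M N' M' h f X) =
      tmap R N M N'' M'' (compose (carrier N) h' h) (compose (carrier M) f' f) X"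
    by (rule tmap_compose[OF A B C h f h' f' c _ _ X]) (simp_all add: compose_eq)
  also have "\<dots> = \<one>\<^bsub>tensor_group R N'' M''\<^esub>"
    by (rule tmap_zero[OF A C c _ X]) (use z in \<open>simp add: compose_eq\<close>)
  finally show ?thesis .
qed

lemma tmap_one:
  assumes A: "tensor_pair R N M" and B: "tensor_pair R N' M'"
    and "h \<in> mod_hom (op_ring R) N N'" "f \<in> mod_hom R M M'"
  shows "tmap R N M N' M' h f \<one>\<^bsub>tensor_group R N M\<^esub> = \<one>\<^bsub>tensor_group R N' M'\<^esub>"
proof -
  interpret A: tensor_pair R N M by fact
  interpret B: tensor_pair R N' M' by fact
  show ?thesis using hom_one[OF tmap_hom[OF assms]] by simp
qed

text \<open>The quotient of the middle group by the image \<open>Im\<close> receives a map from the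
  tensor product with \<open>N''\<close>: choose preimages \<open>s\<close> under \<open>p\<close>.
  The class of the resulting tensor does not depend on the choice, since preimages of one element
  differ by an element of the image of \<open>h\<close>. Thus an element trivial over
  \<open>N''\<close> is trivial modulo \<open>Im\<close>.\<close>

lemma tensor_right_exact:
  assumes A: "tensor_pair R N' M" and B: "tensor_pair R N M" and C: "tensor_pair R N'' M"
    and h: "h \<in> mod_hom (op_ring R) N' N" and p: "p \<in> mod_hom (op_ring R) N N''" "p ` carrier N = carrier N''"
    and ker: "\<And>x. x \<in> carrier N \<Longrightarrow> p x = \<zero>\<^bsub>N''\<^esub> \<Longrightarrow> x \<in> h ` carrier N'"
    and i: "i = idm M"
    and u: "u \<in> carrier (tensor_group R N M)" "tmap R N M N'' M p i u = \<one>\<^bsub>tensor_group R N'' M\<^esub>"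
  obtains w where "w \<in> carrier (tensor_group R N' M)" "tmap R N' M N M h i w = u"
proof -
  interpret A: tensor_pair R N' M by fact
  interpret B: tensor_pair R N M by fact
  interpret C: tensor_pair R N'' M by fact
  have id: "i \<in> mod_hom R M M" unfolding i by (rule mod_hom_id[OF A.M.left_module_axioms])
  have iy [simp]: "i y = y" if "y \<in> carrier M" for y using that by (simp add: i)
  note hh = tmap_hom[OF A B h id] and ph = tmap_hom[OF B C p(1) id]
  define Im where "Im = tmap R N' M N M h i ` carrier A.T"
  interpret hh: group_hom A.T B.T "tmap R N' M N M h i"
    by (intro group_hom.intro group_hom_axioms.intro A.T.group_axioms B.T.group_axioms hh)
  have Im: "subgroup Im B.T" unfolding Im_def by (rule hh.img_is_subgroup)
  let ?H = "B.T Mod Im"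
  have H: "comm_group ?H" by (rule B.T.abelian_FactGroup[OF Im])
  interpret H: comm_group ?H by (rule H)
  have q: "(\<lambda>X. Im #>\<^bsub>B.T\<^esub> X) \<in> hom B.T ?H" by (rule coset_hom[OF B.T_group Im])
  define s where "s = inv_into (carrier N) p"
  have s: "s x \<in> carrier N" "p (s x) = x" if "x \<in> carrier N''" for x
    using that p(2) by (auto simp: s_def inv_into_into f_inv_into_f)
  have ind: "Im #>\<^bsub>B.T\<^esub> B.t x y = Im #>\<^bsub>B.T\<^esub> B.t x' y"
    if xy: "x \<in> carrier N" "x' \<in> carrier N" "y \<in> carrier M" "p x = p x'" for x x' y
  proof -
    have "p (x \<ominus>\<^bsub>N\<^esub> x') = \<zero>\<^bsub>N''\<^esub>"
      using xy mod_hom_closed[OF p(1) xy(1)] mod_hom_minus[OF B.N.left_module_axioms C.N.left_module_axioms p(1) xy(1,2)]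
      by (simp add: C.N.minus_eq_zero)
    then obtain n where n: "n \<in> carrier N'" "h n = x \<ominus>\<^bsub>N\<^esub> x'" using ker[of "x \<ominus>\<^bsub>N\<^esub> x'"] xy by auto
    have "B.t (x \<ominus>\<^bsub>N\<^esub> x') y = B.t x y \<otimes>\<^bsub>B.T\<^esub> inv\<^bsub>B.T\<^esub> B.t x' y"
      using xy by (simp add: a_minus_def B.t_add_left B.t_neg_left)
    moreover have "B.t (h n) y \<in> Im"
      unfolding Im_def using tmap_tens[OF A B h id n(1) xy(3)] n(1) xy(3) by (intro image_eqI[of _ _ "A.t n y"]) auto
    ultimately show ?thesis using xy n by (subst coset_eq_iff[OF B.T_group Im]) auto
  qed
  obtain \<Phi> where \<Phi>: "\<Phi> \<in> hom C.T ?H" "\<And>x y. x \<in> carrier N'' \<Longrightarrow> y \<in> carrier M \<Longrightarrow> \<Phi> (C.t x y) = Im #>\<^bsub>B.T\<^esub> B.t (s x) y"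
  proof (rule C.tensor_universal[OF H, of "\<lambda>x y. Im #>\<^bsub>B.T\<^esub> B.t (s x) y"])
    fix x y assume xy: "x \<in> carrier N''" "y \<in> carrier M"
    show "Im #>\<^bsub>B.T\<^esub> B.t (s x) y \<in> carrier ?H" using hom_in_carrier[OF q] s xy by auto
    {
      fix y' assume y': "y' \<in> carrier M"
      show "Im #>\<^bsub>B.T\<^esub> B.t (s x) (y \<oplus>\<^bsub>M\<^esub> y') = (Im #>\<^bsub>B.T\<^esub> B.t (s x) y) \<otimes>\<^bsub>?H\<^esub> (Im #>\<^bsub>B.T\<^esub> B.t (s x) y')"
        using s xy y' hom_mult[OF q] by (simp add: B.t_add_right)
    }
    {
      fix x' assume x': "x' \<in> carrier N''"
      have "Im #>\<^bsub>B.T\<^esub> B.t (s (x \<oplus>\<^bsub>N''\<^esub> x')) y = Im #>\<^bsub>B.T\<^esub> B.t (s x \<oplus>\<^bsub>N\<^esub> s x') y"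
        using s xy x' by (intro ind) (auto simp: mod_hom_add[OF p(1)])
      then show "Im #>\<^bsub>B.T\<^esub> B.t (s (x \<oplus>\<^bsub>N''\<^esub> x')) y = (Im #>\<^bsub>B.T\<^esub> B.t (s x) y) \<otimes>\<^bsub>?H\<^esub> (Im #>\<^bsub>B.T\<^esub> B.t (s x') y)"
        using s xy x' hom_mult[OF q] by (simp add: B.t_add_left)
    }
    fix a assume a: "a \<in> carrier R"
    have "Im #>\<^bsub>B.T\<^esub> B.t (s (a \<odot>\<^bsub>N''\<^esub> x)) y = Im #>\<^bsub>B.T\<^esub> B.t (a \<odot>\<^bsub>N\<^esub> s x) y"
      using s xy a C.N.smult_closed[of a x] B.N.smult_closed[of a "s x"]
      by (intro ind) (auto simp: mod_hom_smult[OF p(1)])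
    then show "Im #>\<^bsub>B.T\<^esub> B.t (s (a \<odot>\<^bsub>N''\<^esub> x)) y = Im #>\<^bsub>B.T\<^esub> B.t (s x) (a \<odot>\<^bsub>M\<^esub> y)"
      using s xy a by (simp add: B.t_balanced)
  qed blast
  have "(\<Phi> \<circ> tmap R N M N'' M p i) u = Im #>\<^bsub>B.T\<^esub> u"
  proof (rule B.tensor_hom_eqI[OF H.group_axioms hom_compose[OF ph \<Phi>(1)] q _ u(1)])
    fix x y assume xy: "x \<in> carrier N" "y \<in> carrier M"
    then show "(\<Phi> \<circ> tmap R N M N'' M p i) (B.t x y) = Im #>\<^bsub>B.T\<^esub> B.t x y"
      using s mod_hom_closed[OF p(1) xy(1)] ind[of "s (p x)" x y]
      by (simp add: tmap_tens[OF B C p(1) id] \<Phi>(2))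
  qed
  then have "Im #>\<^bsub>B.T\<^esub> u = \<one>\<^bsub>?H\<^esub>" using u(2) hom_one[OF \<Phi>(1) C.T.group_axioms H.group_axioms] by simp
  then have "Im #>\<^bsub>B.T\<^esub> u = Im" by simp
  then have "u \<in> Im" using u(1) Im by (rule B.T.coset_join1)
  then show thesis using that by (auto simp: Im_def)
qed

lemma tensor_pairI: "left_module (op_ring R) N \<Longrightarrow> left_module R M \<Longrightarrow> tensor_pair R N M"
  by (simp add: tensor_pair_def)

section \<open>Exactness on coefficient modules\<close>

text \<open>The transpose of the matrix with rows \<open>ls\<close>. The width is a parameter
  because it cannot be read off when \<open>ls\<close> is empty.\<close>

definition columns :: "nat \<Rightarrow> 'r list list \<Rightarrow> 'r list list" where
  "columns n ls = map (\<lambda>i. map (\<lambda>l. l ! i) ls) [0..<n]"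

lemma length_columns [simp]: "length (columns n ls) = n" by (simp add: columns_def)

lemma columns_vecs: "set ls \<subseteq> vecs A n \<Longrightarrow> set (columns n ls) \<subseteq> vecs A (length ls)"
  by (auto simp: columns_def vecs_def in_set_conv_nth) (metis nth_mem subsetD vecs_def vecs_nth)

text \<open>The map \<open>\<kappa>\<close> is coordinate \<open>i\<close> under the identification
  of the tensor product of a free module of rank \<open>n\<close> and \<open>M\<close> with the
  power of \<open>M\<close>; it comes from the universal property.\<close>

lemma free_tensor_coord:
  assumes "tensor_pair R (free_pow (op_ring R) n) M" "i < n"
  obtains \<kappa> where "\<kappa> \<in> hom (tensor_group R (free_pow (op_ring R) n) M) (add_monoid M)"
    "\<And>as ys. set as \<subseteq> vecs (carrier R) n \<Longrightarrow> set ys \<subseteq> carrier M \<Longrightarrow>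
      \<kappa> (tsum R (free_pow (op_ring R) n) M as ys) = lc M (map (\<lambda>a. a ! i) as) ys"
proof -
  interpret tensor_pair R "free_pow (op_ring R) n" M by fact
  have c: "a ! i \<in> carrier R" if "a \<in> vecs (carrier R) n" for a using that assms(2) by (rule vecs_nth)
  obtain \<kappa> where \<kappa>: "\<kappa> \<in> hom T (add_monoid M)"
    "\<And>a y. a \<in> carrier (free_pow (op_ring R) n) \<Longrightarrow> y \<in> carrier M \<Longrightarrow> \<kappa> (t a y) = (a ! i) \<odot>\<^bsub>M\<^esub> y"
  proof (rule tensor_universal[of "add_monoid M" "\<lambda>a y. (a ! i) \<odot>\<^bsub>M\<^esub> y"])
    show "comm_group (add_monoid M)" by (rule M.M.a_comm_group)
  qed (use assms(2) in \<open>auto simp: c vecs_length M.smult_l_distr M.smult_r_distr M.smult_assoc1\<close>)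
  have one: "\<kappa> \<one>\<^bsub>T\<^esub> = \<zero>\<^bsub>M\<^esub>"
    using hom_one[OF \<kappa>(1) T.group_axioms] M.M.a_comm_group by (simp add: comm_group_def)
  have "\<kappa> (tsum R (free_pow (op_ring R) n) M as ys) = lc M (map (\<lambda>a. a ! i) as) ys"
    if "set as \<subseteq> vecs (carrier R) n" "set ys \<subseteq> carrier M" for as ys
    using that
    by (induction as ys rule: list_induct2') (auto simp: one hom_mult[OF \<kappa>(1)] \<kappa>(2))
  with \<kappa>(1) show thesis by (rule that)
qed

lemma unit_vecs_gens: "ring R \<Longrightarrow> gens R (free_pow R n) (unit_vecs R n)"
  using fin_rel_free_pow by (auto simp: fin_rel_def)

lemma unit_vecs_coord:
  assumes M: "left_module R M" and y: "y \<in> vecs (carrier M) n" and i: "i < n"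
  shows "lc M (map (\<lambda>u. u ! i) (unit_vecs (op_ring R) n)) y = y ! i"
proof -
  interpret M: left_module R M by (rule M)
  have "map (\<lambda>u. u ! i) (unit_vecs (op_ring R) n) = (replicate n \<zero>\<^bsub>R\<^esub>)[i := \<one>\<^bsub>R\<^esub>]"
    using i by (intro nth_equalityI) (auto simp: unit_vecs_def nth_list_update)
  then show ?thesis using M.lc_delta_left[OF i y, of "\<one>\<^bsub>R\<^esub>"] vecs_nth[OF y i] by simp
qed

lemma op_ring_ring: "ring R \<Longrightarrow> ring (op_ring R)"
proof -
  assume "ring R"
  then interpret ring R .
  have "abelian_group (op_ring R)"
    by (rule abelian_groupI) (auto simp: a_ac intro: bexI[of _ "\<ominus>\<^bsub>R\<^esub> _"] l_neg)
  then show ?thesis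
    by (intro ringI monoidI) (auto simp: l_distr r_distr m_assoc)
qed

text \<open>Both tensors can be written with the unit vectors on the left. The entries on the right
  are then recovered by the coordinate maps, so equal coordinates give equal tensors.\<close>

lemma free_tensor_eq:
  assumes M: "left_module R M" and F: "F = free_pow (op_ring R) n"
    and as: "set as \<subseteq> vecs (carrier R) n" and bs: "set bs \<subseteq> vecs (carrier R) n"
    and ys: "set ys \<subseteq> carrier M" and zs: "set zs \<subseteq> carrier M"
    and eq: "\<And>i. i < n \<Longrightarrow> lc M (map (\<lambda>a. a ! i) as) ys = lc M (map (\<lambda>a. a ! i) bs) zs"
  shows "tsum R F M as ys = tsum R F M bs zs"
proof -
  interpret M: left_module R M by (rule M)
  note Rop = op_ring_ring[OF M.R.ring_axioms]
  have TP: "tensor_pair R F M" unfolding F by (intro tensor_pairI free_pow_module Rop M)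
  interpret tensor_pair R F M by (rule TP)
  note u = unit_vecs_gens[OF Rop, of n, folded F]
  have cF: "carrier F = vecs (carrier R) n" by (simp add: F)
  have us: "set (unit_vecs (op_ring R) n) \<subseteq> vecs (carrier R) n" using gens_set[OF u] cF by simp
  obtain y where y: "y \<in> vecs (carrier M) n" "tsum R F M as ys = tsum R F M (unit_vecs (op_ring R) n) y"
    using tensor_gens[OF u, of "tsum R F M as ys"] as ys cF by auto
  obtain z where z: "z \<in> vecs (carrier M) n" "tsum R F M bs zs = tsum R F M (unit_vecs (op_ring R) n) z"
    using tensor_gens[OF u, of "tsum R F M bs zs"] bs zs cF by auto
  have "y = z"
  proof (rule nth_equalityI)
    show "length y = length z" using y(1) z(1) by (simp add: vecs_length)
    fix i assume "i < length y"
    then have i: "i < n" using y(1) by (simp add: vecs_length)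
    obtain \<kappa> where "\<And>as ys. set as \<subseteq> vecs (carrier R) n \<Longrightarrow> set ys \<subseteq> carrier M \<Longrightarrow>
        \<kappa> (tsum R F M as ys) = lc M (map (\<lambda>a. a ! i) as) ys"
      using free_tensor_coord[OF TP[unfolded F] i, folded F] by metis
    then have "lc M (map (\<lambda>u. u ! i) (unit_vecs (op_ring R) n)) y = lc M (map (\<lambda>u. u ! i) (unit_vecs (op_ring R) n)) z"
      using y z as bs ys zs us eq[OF i] by (metis vecs_set)
    then show "y ! i = z ! i" using unit_vecs_coord[OF M _ i] y(1) z(1) by simp
  qed
  then show ?thesis using y z by simp
qed

text \<open>The presentation of \<open>N\<close> stays right exact after tensoring with
  \<open>M\<close>, and tensors over free modules are vectors over \<open>M\<close>. So a sum of
  tensors over the generators vanishes exactly if its vector is an image under the transposed matrix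
  of relations. Vanishing of a tensor thereby becomes solvability of a linear system.\<close>

lemma tensor_presentation:
  assumes M: "left_module R M" and N: "fin_rel (op_ring R) N xs ls" and ys: "ys \<in> vecs (carrier M) (length xs)"
  shows "tsum R N M xs ys = \<one>\<^bsub>tensor_group R N M\<^esub> \<longleftrightarrow>
    (\<exists>z\<in>vecs (carrier M) (length ls). map (\<lambda>r. lc M r z) (columns (length xs) ls) = ys)"
proof -
  interpret M: left_module R M by (rule M)
  note Rop = op_ring_ring[OF M.R.ring_axioms]
  define n k where "n = length xs" and "k = length ls"
  define F where "F = free_pow (op_ring R) n"
  define E where "E = free_pow (op_ring R) k"
  have cF: "carrier F = vecs (carrier R) n" and cE: "carrier E = vecs (carrier R) k" by (simp_all add: F_def E_def)
  have F: "left_module (op_ring R) F" and E: "left_module (op_ring R) E"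
    unfolding F_def E_def by (intro free_pow_module Rop)+
  have NM: "left_module (op_ring R) N" and xs: "gens (op_ring R) N xs" and ls: "gens (op_ring R) (syz (op_ring R) N xs) ls"
    using N by (auto simp: fin_rel_def)
  note TF = tensor_pairI[OF F M] and TE = tensor_pairI[OF E M] and TN = tensor_pairI[OF NM M]
  interpret F: tensor_pair R F M by (rule TF)
  interpret E: tensor_pair R E M by (rule TE)
  interpret N: tensor_pair R N M by (rule TN)
  have xs': "set xs \<subseteq> carrier N" by (rule gens_set[OF xs])
  have ls': "set ls \<subseteq> vecs (carrier R) n" "\<And>l. l \<in> set ls \<Longrightarrow> lc N l xs = \<zero>\<^bsub>N\<^esub>"
    using gens_set[OF ls] by (auto simp: n_def)
  define h where "h = restrict (\<lambda>c. lc F c ls) (vecs (carrier R) k)"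
  define p where "p = restrict (\<lambda>a. lc N a xs) (vecs (carrier R) n)"
  define i where "i = idm M"
  have h: "h \<in> mod_hom (op_ring R) E F"
    using lc_hom_right[OF F, of ls k] ls'(1) by (simp add: h_def E_def cF vecs_def k_def)
  have p: "p \<in> mod_hom (op_ring R) F N"
    using lc_hom_right[OF NM, of xs n] xs' by (simp add: p_def F_def vecs_def n_def)
  have ps: "p ` carrier F = carrier N"
    using short_exactD(7)[OF syz_short_exact[OF NM xs]] by (simp add: p_def F_def n_def)
  have i: "i \<in> mod_hom R M M" unfolding i_def by (rule mod_hom_id[OF M])
  have ii: "map i zs = zs" if "set zs \<subseteq> carrier M" for zs using that by (auto simp: i_def intro!: map_idI)
  have ker: "x \<in> h ` carrier E" if "x \<in> carrier F" "p x = \<zero>\<^bsub>N\<^esub>" for x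
  proof -
    have "x \<in> carrier (syz (op_ring R) N xs)" using that by (simp add: cF p_def n_def)
    from gensE[OF ls this] obtain c where c: "c \<in> vecs (carrier R) k" "lc (syz (op_ring R) N xs) c ls = x"
      by (auto simp: k_def)
    then have "h c = x" by (simp add: h_def syz_def F_def n_def)
    then show ?thesis using c(1) cE by blast
  qed
  note uF = unit_vecs_gens[OF Rop, of n, folded F_def] and uE = unit_vecs_gens[OF Rop, of k, folded E_def]
  let ?uF = "unit_vecs (op_ring R) n" and ?uE = "unit_vecs (op_ring R) k"
  have puF: "map p ?uF = xs"
  proof -
    have "map p ?uF = map (\<lambda>a. lc N a xs) ?uF" using gens_set[OF uF] by (auto simp: p_def cF)
    also have "\<dots> = xs" using map_lc_unit_vecs[OF NM, of xs n] xs' by (simp add: vecs_def n_def)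
    finally show ?thesis .
  qed
  have huE: "map h ?uE = ls"
  proof -
    have "map h ?uE = map (\<lambda>a. lc F a ls) ?uE" using gens_set[OF uE] by (auto simp: h_def cE)
    also have "\<dots> = ls" using map_lc_unit_vecs[OF F, of ls k] ls'(1) by (simp add: vecs_def k_def cF)
    finally show ?thesis .
  qed
  have ysM: "set ys \<subseteq> carrier M" "length ys = n" using ys by (auto simp: vecs_def n_def)
  \<comment> \<open>In terms of tensors over free modules the system says that the combination of
    the relations with coefficients \<open>z\<close> equals the combination of the unit vectors with
    coefficients \<open>ys\<close>.\<close>
  have tr: "map (\<lambda>r. lc M r z) (columns n ls) = ys \<longleftrightarrow> tsum R F M ls z = tsum R F M ?uF ys"
    if z: "z \<in> vecs (carrier M) k" for z
  proof
    assume eq: "map (\<lambda>r. lc M r z) (columns n ls) = ys"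
    show "tsum R F M ls z = tsum R F M ?uF ys"
    proof (rule free_tensor_eq[OF M F_def ls'(1) _ vecs_set[OF z] ysM(1)])
      show "set ?uF \<subseteq> vecs (carrier R) n" using gens_set[OF uF] cF by simp
      fix i assume i: "i < n"
      have "lc M (map (\<lambda>a. a ! i) ls) z = ys ! i"
        using arg_cong[OF eq, of "\<lambda>l. l ! i"] i by (simp add: columns_def)
      then show "lc M (map (\<lambda>a. a ! i) ls) z = lc M (map (\<lambda>a. a ! i) ?uF) ys"
        using unit_vecs_coord[OF M ys, of i] i by (simp add: n_def)
    qed
  next
    assume eq: "tsum R F M ls z = tsum R F M ?uF ys"
    show "map (\<lambda>r. lc M r z) (columns n ls) = ys"
    proof (rule nth_equalityI)
      fix i assume "i < length (map (\<lambda>r. lc M r z) (columns n ls))"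
      then have i: "i < n" by simp
      obtain \<kappa> where \<kappa>: "\<And>as ys. set as \<subseteq> vecs (carrier R) n \<Longrightarrow> set ys \<subseteq> carrier M \<Longrightarrow>
          \<kappa> (tsum R F M as ys) = lc M (map (\<lambda>a. a ! i) as) ys"
        using free_tensor_coord[OF TF[unfolded F_def] i, folded F_def] by metis
      have "lc M (map (\<lambda>a. a ! i) ls) z = lc M (map (\<lambda>a. a ! i) ?uF) ys"
        using \<kappa>[OF ls'(1) vecs_set[OF z]] \<kappa>[OF _ ysM(1), of ?uF] gens_set[OF uF] eq cF by simp
      then show "map (\<lambda>r. lc M r z) (columns n ls) ! i = ys ! i"
        using unit_vecs_coord[OF M ys, of i] i by (simp add: columns_def n_def)
    qed (simp add: ysM)
  qed
  have eF: "tmap R F M N M p i (tsum R F M ?uF ys) = tsum R N M xs ys"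
    using tmap_tsum[OF TF TN p i gens_set[OF uF] ysM(1)] by (simp add: puF ii ysM)
  have eE: "tmap R E M F M h i (tsum R E M ?uE z) = tsum R F M ls z" if "set z \<subseteq> carrier M" for z
    using tmap_tsum[OF TE TF h i gens_set[OF uE] that] by (simp add: huE ii that)
  show ?thesis
    unfolding n_def[symmetric] k_def[symmetric]
  proof
    assume "tsum R N M xs ys = \<one>\<^bsub>tensor_group R N M\<^esub>"
    then have "tmap R F M N M p i (tsum R F M ?uF ys) = \<one>\<^bsub>tensor_group R N M\<^esub>" by (simp add: eF)
    then obtain w where w: "w \<in> carrier (tensor_group R E M)" "tmap R E M F M h i w = tsum R F M ?uF ys"
      using tensor_right_exact[OF TE TF TN h p ps ker i_def, of "tsum R F M ?uF ys"] gens_set[OF uF] ysM by auto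
    obtain z where z: "z \<in> vecs (carrier M) k" "w = tsum R E M ?uE z"
      using E.tensor_gens[OF uE w(1)] by auto
    then have "tsum R F M ls z = tsum R F M ?uF ys" using eE vecs_set[OF z(1)] w(2) by simp
    then show "\<exists>z\<in>vecs (carrier M) k. map (\<lambda>r. lc M r z) (columns n ls) = ys" using tr[OF z(1)] z(1) by blast
  next
    assume "\<exists>z\<in>vecs (carrier M) k. map (\<lambda>r. lc M r z) (columns n ls) = ys"
    then obtain z where z: "z \<in> vecs (carrier M) k" "tsum R F M ls z = tsum R F M ?uF ys" using tr by blast
    have "map p ls = replicate k \<zero>\<^bsub>N\<^esub>" using ls' by (auto simp: p_def k_def map_replicate_const[symmetric] subset_iff)
    then have "tmap R F M N M p i (tsum R F M ls z) = \<one>\<^bsub>tensor_group R N M\<^esub>"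
      using tmap_tsum[OF TF TN p i _ vecs_set[OF z(1)], of ls] ls'(1)
      by (simp add: cF ii vecs_set[OF z(1)] N.tsum_zero_left)
    then show "tsum R N M xs ys = \<one>\<^bsub>tensor_group R N M\<^esub>" using z(2) eF by simp
  qed
qed

lemma tmap_surj:
  assumes A: "tensor_pair R N M" and B: "tensor_pair R N' M"
    and h: "h \<in> mod_hom (op_ring R) N N'" "h ` carrier N = carrier N'" and i: "i = idm M"
    and u: "u \<in> carrier (tensor_group R N' M)"
  obtains w where "w \<in> carrier (tensor_group R N M)" "tmap R N M N' M h i w = u"
proof -
  interpret A: tensor_pair R N M by fact
  interpret B: tensor_pair R N' M by fact
  have id: "i \<in> mod_hom R M M" unfolding i by (rule mod_hom_id[OF A.M.left_module_axioms])
  obtain xs ys where u': "set xs \<subseteq> carrier N'" "ys \<in> vecs (carrier M) (length xs)" "u = tsum R N' M xs ys"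
    using B.tensor_tsum[OF u] by metis
  obtain zs where zs: "set zs \<subseteq> carrier N" "map h zs = xs" using lift_list[OF h(2) u'(1)] by metis
  note ys = vecs_set[OF u'(2)]
  have "map i ys = ys" using ys by (auto simp: i intro!: map_idI)
  then have "tmap R N M N' M h i (tsum R N M zs ys) = u"
    using tmap_tsum[OF A B h(1) id zs(1) ys] zs(2) u'(3) by simp
  moreover have "tsum R N M zs ys \<in> carrier (tensor_group R N M)" using zs(1) ys by (rule A.tsum_closed)
  ultimately show thesis using that by blast
qed

section \<open>Independence of the resolution in degree one\<close>

definition dsum :: "('r, 'm) module \<Rightarrow> ('r, 'n) module \<Rightarrow> ('r, 'm \<times> 'n) module" where
  "dsum X Y = mk_module (carrier X \<times> carrier Y) (\<lambda>(x, y) (x', y'). (x \<oplus>\<^bsub>X\<^esub> x', y \<oplus>\<^bsub>Y\<^esub> y')) (\<zero>\<^bsub>X\<^esub>, \<zero>\<^bsub>Y\<^esub>)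
     (\<lambda>a (x, y). (a \<odot>\<^bsub>X\<^esub> x, a \<odot>\<^bsub>Y\<^esub> y))"

lemma dsum_simps [simp]:
  "carrier (dsum X Y) = carrier X \<times> carrier Y" "(x, y) \<oplus>\<^bsub>dsum X Y\<^esub> (x', y') = (x \<oplus>\<^bsub>X\<^esub> x', y \<oplus>\<^bsub>Y\<^esub> y')"
  "\<zero>\<^bsub>dsum X Y\<^esub> = (\<zero>\<^bsub>X\<^esub>, \<zero>\<^bsub>Y\<^esub>)" "a \<odot>\<^bsub>dsum X Y\<^esub> (x, y) = (a \<odot>\<^bsub>X\<^esub> x, a \<odot>\<^bsub>Y\<^esub> y)"
  by (simp_all add: dsum_def)

lemma dsum_module:
  assumes "left_module R X" "left_module R Y" shows "left_module R (dsum X Y)"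
proof -
  interpret X: left_module R X by fact
  interpret Y: left_module R Y by fact
  have "abelian_group (dsum X Y)"
  proof (rule abelian_groupI)
    fix z assume "z \<in> carrier (dsum X Y)"
    then show "\<exists>w\<in>carrier (dsum X Y). w \<oplus>\<^bsub>dsum X Y\<^esub> z = \<zero>\<^bsub>dsum X Y\<^esub>"
      by (intro bexI[of _ "(\<ominus>\<^bsub>X\<^esub> fst z, \<ominus>\<^bsub>Y\<^esub> snd z)"]) (auto simp: X.M.l_neg Y.M.l_neg)
  qed (auto simp: X.M.a_ac Y.M.a_ac)
  then show ?thesis
    by (intro left_module.intro X.R.ring_axioms left_module_axioms.intro)
       (auto simp: X.smult_l_distr X.smult_r_distr X.smult_assoc1 Y.smult_l_distr Y.smult_r_distr Y.smult_assoc1)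
qed

lemma dsum_case_hom:
  assumes X: "left_module R X" and Y: "left_module R Y" and Z: "left_module R Z"
    and f: "f \<in> mod_hom R X Z" and g: "g \<in> mod_hom R Y Z"
  shows "restrict (\<lambda>(x, y). f x \<oplus>\<^bsub>Z\<^esub> g y) (carrier (dsum X Y)) \<in> mod_hom R (dsum X Y) Z"
proof -
  interpret Z: left_module R Z by fact
  show ?thesis
    by (rule mod_hom_restrictI[OF dsum_module[OF X Y]])
       (auto simp: mod_hom_closed[OF f] mod_hom_closed[OF g] mod_hom_add[OF f] mod_hom_add[OF g]
         mod_hom_smult[OF f] mod_hom_smult[OF g] Z.M.a_ac Z.smult_r_distr)
qed

lemma dsum_proj_hom:
  assumes X: "left_module R X" and Y: "left_module R Y"
  shows "restrict fst (carrier (dsum X Y)) \<in> mod_hom R (dsum X Y) X"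
    "restrict snd (carrier (dsum X Y)) \<in> mod_hom R (dsum X Y) Y"
    "restrict (\<lambda>y. (\<zero>\<^bsub>X\<^esub>, y)) (carrier Y) \<in> mod_hom R Y (dsum X Y)"
proof -
  interpret X: left_module R X by fact
  show "restrict fst (carrier (dsum X Y)) \<in> mod_hom R (dsum X Y) X"
    "restrict snd (carrier (dsum X Y)) \<in> mod_hom R (dsum X Y) Y"
    by (rule mod_hom_restrictI[OF dsum_module[OF X Y]]; auto)+
  show "restrict (\<lambda>y. (\<zero>\<^bsub>X\<^esub>, y)) (carrier Y) \<in> mod_hom R Y (dsum X Y)"
    by (rule mod_hom_restrictI[OF Y]) (auto simp: X.smult_zero_r)
qed

definition kernel_mod :: "('r, 'm) module \<Rightarrow> ('r, 'n) module \<Rightarrow> ('m \<Rightarrow> 'n) \<Rightarrow> ('r, 'm) module" where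
  "kernel_mod Y K q = Y\<lparr>carrier := mod_kernel Y K q\<rparr>"

lemma kernel_mod_simps [simp]:
  "carrier (kernel_mod Y K q) = mod_kernel Y K q" "ring.add (kernel_mod Y K q) = ring.add Y"
  "ring.zero (kernel_mod Y K q) = ring.zero Y" "module.smult (kernel_mod Y K q) = module.smult Y"
  by (simp_all add: kernel_mod_def)

lemma kernel_mod_module:
  assumes "left_module R Y" "left_module R K" "q \<in> mod_hom R Y K"
  shows "left_module R (kernel_mod Y K q)"
  unfolding kernel_mod_def by (rule left_module.left_submodule_is_module[OF assms(1) mod_kernel_submodule[OF assms]])

lemma mod_kernel_iff: "x \<in> mod_kernel Y K q \<longleftrightarrow> x \<in> carrier Y \<and> q x = \<zero>\<^bsub>K\<^esub>"
  by (simp add: mod_kernel_def)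

definition kernel_incl :: "('r, 'm) module \<Rightarrow> ('r, 'n) module \<Rightarrow> ('m \<Rightarrow> 'n) \<Rightarrow> 'm \<Rightarrow> 'm" where
  "kernel_incl Y K q = restrict (\<lambda>x. x) (mod_kernel Y K q)"

lemma kernel_incl_hom:
  assumes "left_module R Y" "left_module R K" "q \<in> mod_hom R Y K"
  shows "kernel_incl Y K q \<in> mod_hom R (kernel_mod Y K q) Y"
  using submodule_inclusion_hom[OF assms(1) mod_kernel_submodule[OF assms]] by (simp add: kernel_incl_def kernel_mod_def)

text \<open>\<^term>\<open>extends R Y K q I\<close> and \<^term>\<open>stays_inj R Y K q M\<close> say that \<open>Ext\<^sup>1(K, I)\<close> and
  \<open>Tor\<^sub>1(K, M)\<close> vanish, if \<^term>\<open>q\<close> is a surjection from a projective module \<^term>\<open>Y\<close> to \<^term>\<open>K\<close>.\<close>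

definition extends :: "'r ring \<Rightarrow> ('r, 'y) module \<Rightarrow> ('r, 'k) module \<Rightarrow> ('y \<Rightarrow> 'k) \<Rightarrow> ('r, 'i) module \<Rightarrow> bool" where
  "extends R Y K q I \<longleftrightarrow> (\<forall>\<phi>\<in>mod_hom R (kernel_mod Y K q) I. \<exists>\<psi>\<in>mod_hom R Y I. \<forall>x\<in>mod_kernel Y K q. \<psi> x = \<phi> x)"

definition stays_inj :: "'r ring \<Rightarrow> ('r, 'y) module \<Rightarrow> ('r, 'k) module \<Rightarrow> ('y \<Rightarrow> 'k) \<Rightarrow> ('r, 'm) module \<Rightarrow> bool" where
  "stays_inj R Y K q M \<longleftrightarrow> (\<forall>u\<in>carrier (tensor_group R (kernel_mod Y K q) M).
     tmap R (kernel_mod Y K q) M Y M (kernel_incl Y K q) (idm M) u = \<one>\<^bsub>tensor_group R Y M\<^esub> \<longrightarrow>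
     u = \<one>\<^bsub>tensor_group R (kernel_mod Y K q) M\<^esub>)"

text \<open>The map that adds \<open>l x\<close> and \<open>y\<close> is onto: given an element of
  \<open>Y\<close>, choose \<open>x\<close> with the same image in \<open>K\<close>; the difference
  lies in the kernel of \<open>q\<close>. An element \<open>(x, y)\<close> of its kernel has
  \<open>y = - l x\<close> and \<open>e x = 0\<close>. The sequence compares the kernels of
  \<open>e\<close> and \<open>q\<close> using only the map \<open>l\<close> over
  \<open>K\<close>.\<close>

lemma kernel_dsum_exact:
  assumes P: "left_module R P" and Y: "left_module R Y" and K: "left_module R K"
    and e: "e \<in> mod_hom R P K" "e ` carrier P = carrier K" and q: "q \<in> mod_hom R Y K"
    and l: "l \<in> mod_hom R P Y" "\<forall>x\<in>carrier P. q (l x) = e x"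
  shows "short_exact R (kernel_mod P K e) (restrict (\<lambda>x. (x, \<ominus>\<^bsub>Y\<^esub> l x)) (mod_kernel P K e))
    (dsum P (kernel_mod Y K q)) (restrict (\<lambda>(x, y). l x \<oplus>\<^bsub>Y\<^esub> kernel_incl Y K q y) (carrier (dsum P (kernel_mod Y K q)))) Y"
proof -
  interpret Y: left_module R Y by (rule Y)
  interpret K: left_module R K by (rule K)
  interpret P: left_module R P by (rule P)
  let ?X = "kernel_mod Y K q" and ?Z = "kernel_mod P K e"
  let ?D = "dsum P ?X"
  let ?s = "restrict (\<lambda>(x, y). l x \<oplus>\<^bsub>Y\<^esub> kernel_incl Y K q y) (carrier ?D)" and ?j = "restrict (\<lambda>x. (x, \<ominus>\<^bsub>Y\<^esub> l x)) (mod_kernel P K e)"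
  note X = kernel_mod_module[OF Y K q] and Z = kernel_mod_module[OF P K e(1)]
  have s: "?s \<in> mod_hom R ?D Y" by (rule dsum_case_hom[OF P X Y l(1) kernel_incl_hom[OF Y K q]])
  have se: "?s (x, y) = l x \<oplus>\<^bsub>Y\<^esub> y" if "x \<in> carrier P" "y \<in> mod_kernel Y K q" for x y
    using that by (simp add: kernel_incl_def)
  have lk: "\<ominus>\<^bsub>Y\<^esub> l x \<in> mod_kernel Y K q" if "x \<in> mod_kernel P K e" for x
    using that l mod_hom_closed[OF l(1)] mod_hom_neg[OF Y K q, of "l x"] by (simp add: mod_kernel_iff K.neg_zero)
  have "restrict (\<lambda>x. (x, \<ominus>\<^bsub>Y\<^esub> l x)) (carrier ?Z) \<in> mod_hom R ?Z ?D"
  proof (rule mod_hom_restrictI[OF Z])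
    show "(x, \<ominus>\<^bsub>Y\<^esub> l x) \<in> carrier ?D" if "x \<in> carrier ?Z" for x
      using that lk by (auto simp: mod_kernel_iff[of x])
    show "(x \<oplus>\<^bsub>?Z\<^esub> y, \<ominus>\<^bsub>Y\<^esub> l (x \<oplus>\<^bsub>?Z\<^esub> y)) = (x, \<ominus>\<^bsub>Y\<^esub> l x) \<oplus>\<^bsub>?D\<^esub> (y, \<ominus>\<^bsub>Y\<^esub> l y)"
      if "x \<in> carrier ?Z" "y \<in> carrier ?Z" for x y
      using that mod_hom_closed[OF l(1)] by (simp add: mod_kernel_iff mod_hom_add[OF l(1)] Y.M.minus_add)
    show "(a \<odot>\<^bsub>?Z\<^esub> x, \<ominus>\<^bsub>Y\<^esub> l (a \<odot>\<^bsub>?Z\<^esub> x)) = a \<odot>\<^bsub>?D\<^esub> (x, \<ominus>\<^bsub>Y\<^esub> l x)"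
      if "a \<in> carrier R" "x \<in> carrier ?Z" for a x
      using that mod_hom_closed[OF l(1)] by (simp add: mod_kernel_iff mod_hom_smult[OF l(1)] Y.smult_neg(2))
  qed
  then have j: "?j \<in> mod_hom R ?Z ?D" by simp
  show ?thesis
  proof (rule short_exactI[OF Z dsum_module[OF P X] Y j s])
    show "inj_on ?j (carrier ?Z)" by (auto simp: inj_on_def)
    show "\<exists>z\<in>carrier ?D. ?s z = y" if y: "y \<in> carrier Y" for y
    proof -
      have "q y \<in> e ` carrier P" using mod_hom_closed[OF q y] unfolding e(2) .
      then obtain x where x: "q y = e x" "x \<in> carrier P" by (rule imageE)
      have lx: "l x \<in> carrier Y" by (rule mod_hom_closed[OF l(1) x(2)])
      have "y \<ominus>\<^bsub>Y\<^esub> l x \<in> mod_kernel Y K q"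
        using y lx x l(2) mod_hom_minus[OF Y K q y lx] mod_hom_closed[OF q y] by (simp add: mod_kernel_iff K.minus_eq_zero)
      then show ?thesis
        using x(2) se Y.minus_add_cancel(2)[OF y lx] by (intro bexI[of _ "(x, y \<ominus>\<^bsub>Y\<^esub> l x)"]) simp_all
    qed
    show "?s (?j x) = \<zero>\<^bsub>Y\<^esub>" if "x \<in> carrier ?Z" for x
    proof -
      have x: "x \<in> mod_kernel P K e" "x \<in> carrier P" using that by (simp_all add: mod_kernel_iff)
      then show ?thesis using se[OF x(2) lk[OF x(1)]] mod_hom_closed[OF l(1) x(2)] by (simp add: Y.M.r_neg)
    qed
    fix z assume z: "z \<in> carrier ?D" "?s z = \<zero>\<^bsub>Y\<^esub>"
    obtain x y where xy: "z = (x, y)" "x \<in> carrier P" "y \<in> mod_kernel Y K q" using z(1) by auto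
    have y: "y \<in> carrier Y" "q y = \<zero>\<^bsub>K\<^esub>" using xy(3) by (simp_all add: mod_kernel_iff)
    have lx: "l x \<in> carrier Y" by (rule mod_hom_closed[OF l(1) xy(2)])
    have 0: "l x \<oplus>\<^bsub>Y\<^esub> y = \<zero>\<^bsub>Y\<^esub>" using z(2) se[OF xy(2,3)] xy(1) by simp
    have "e x \<oplus>\<^bsub>K\<^esub> \<zero>\<^bsub>K\<^esub> = \<zero>\<^bsub>K\<^esub>"
      using mod_hom_add[OF q lx y(1)] bspec[OF l(2) xy(2)] y(2) mod_hom_zero[OF Y K q] unfolding 0 by simp
    then have xk: "x \<in> mod_kernel P K e" using xy(2) mod_hom_closed[OF e(1) xy(2)] by (simp add: mod_kernel_iff)
    have "y \<oplus>\<^bsub>Y\<^esub> l x = \<zero>\<^bsub>Y\<^esub>" using 0 y lx by (simp add: Y.M.a_comm)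
    then have "\<ominus>\<^bsub>Y\<^esub> l x = y" using y lx by (intro Y.M.minus_equality)
    then show "\<exists>x\<in>carrier ?Z. ?j x = z" using xk xy(1) by (intro bexI[of _ x]) simp_all
  qed
qed

text \<open>Pull \<open>\<phi>\<close> back along \<open>l\<close> to the kernel of \<open>e\<close>
  and extend it to \<open>\<psi>\<close> on \<open>P\<close>. The sum of \<open>\<psi>\<close> and
  \<open>\<phi>\<close> on the direct sum vanishes on the pairs \<open>(x, - l x)\<close>, hence
  descends to \<open>Y\<close>, where it extends \<open>\<phi>\<close>.\<close>

lemma extends_transfer:
  assumes P: "left_module R P" and Y: "left_module R Y" and K: "left_module R K" and I: "left_module R I"
    and e: "e \<in> mod_hom R P K" "e ` carrier P = carrier K" and q: "q \<in> mod_hom R Y K"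
    and l: "l \<in> mod_hom R P Y" "\<And>x. x \<in> carrier P \<Longrightarrow> q (l x) = e x"
    and ext: "extends R P K e I"
  shows "extends R Y K q I"
  unfolding extends_def
proof
  interpret Y: left_module R Y by (rule Y)
  interpret I: left_module R I by (rule I)
  let ?X = "kernel_mod Y K q"
  let ?D = "dsum P ?X"
  have ql: "\<forall>x\<in>carrier P. q (l x) = e x" using l(2) by blast
  note X = kernel_mod_module[OF Y K q] and se = kernel_dsum_exact[OF P Y K e q l(1) ql]
  note D = short_exactD[OF se]
  fix \<phi> assume \<phi>: "\<phi> \<in> mod_hom R ?X I"
  have lk: "l x \<in> mod_kernel Y K q" "x \<in> carrier P" if "x \<in> mod_kernel P K e" for x
    using that l mod_hom_closed[OF l(1)] by (simp_all add: mod_kernel_iff)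
  have "restrict (\<lambda>x. \<phi> (l x)) (carrier (kernel_mod P K e)) \<in> mod_hom R (kernel_mod P K e) I"
  proof (rule mod_hom_restrictI[OF D(1)])
    fix x y assume xy: "x \<in> carrier (kernel_mod P K e)" "y \<in> carrier (kernel_mod P K e)"
    show "\<phi> (l (x \<oplus>\<^bsub>kernel_mod P K e\<^esub> y)) = \<phi> (l x) \<oplus>\<^bsub>I\<^esub> \<phi> (l y)"
      using xy mod_hom_add[OF \<phi>, of "l x" "l y"] lk mod_hom_add[OF l(1), of x y] by simp
  next
    fix a x assume ax: "a \<in> carrier R" "x \<in> carrier (kernel_mod P K e)"
    show "\<phi> (l (a \<odot>\<^bsub>kernel_mod P K e\<^esub> x)) = a \<odot>\<^bsub>I\<^esub> \<phi> (l x)"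
      using ax mod_hom_smult[OF \<phi>, of a "l x"] lk mod_hom_smult[OF l(1), of a x] by simp
  next
    fix x assume "x \<in> carrier (kernel_mod P K e)"
    then show "\<phi> (l x) \<in> carrier I" using lk mod_hom_closed[OF \<phi>] by simp
  qed
  from ext[unfolded extends_def, rule_format, OF this]
  obtain \<psi> where \<psi>: "\<psi> \<in> mod_hom R P I" "\<And>x. x \<in> mod_kernel P K e \<Longrightarrow> \<psi> x = \<phi> (l x)" by auto
  let ?h = "restrict (\<lambda>(x, y). \<psi> x \<oplus>\<^bsub>I\<^esub> \<phi> y) (carrier ?D)"
  have h: "?h \<in> mod_hom R ?D I" by (rule dsum_case_hom[OF P X I \<psi>(1) \<phi>])
  have "?h z = \<zero>\<^bsub>I\<^esub>"
    if "z \<in> carrier ?D" "restrict (\<lambda>(x, y). l x \<oplus>\<^bsub>Y\<^esub> kernel_incl Y K q y) (carrier ?D) z = \<zero>\<^bsub>Y\<^esub>" for z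
  proof -
    have "z \<in> (\<lambda>x. (x, \<ominus>\<^bsub>Y\<^esub> l x)) ` mod_kernel P K e"
      using short_exact_image[OF se that] by simp
    then obtain x where x: "z = (x, \<ominus>\<^bsub>Y\<^esub> l x)" "x \<in> mod_kernel P K e" by (rule imageE)
    have n: "\<ominus>\<^bsub>Y\<^esub> l x \<in> carrier ?X" using that(1) x(1) by simp
    have "\<psi> x \<oplus>\<^bsub>I\<^esub> \<phi> (\<ominus>\<^bsub>Y\<^esub> l x) = \<phi> (l x \<oplus>\<^bsub>?X\<^esub> \<ominus>\<^bsub>Y\<^esub> l x)"
      using mod_hom_add[OF \<phi> _ n, of "l x"] lk[OF x(2)] \<psi>(2)[OF x(2)] by simp
    also have "\<dots> = \<zero>\<^bsub>I\<^esub>" using mod_hom_closed[OF l(1) lk(2)[OF x(2)]] mod_hom_zero[OF X I \<phi>] by (simp add: Y.M.r_neg)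
    finally show ?thesis using that(1) x(1) by simp
  qed
  from factor_through[OF D(2,3) I D(5,7) h this]
  obtain \<Phi> where \<Phi>: "\<Phi> \<in> mod_hom R Y I"
    "\<And>z. z \<in> carrier ?D \<Longrightarrow> \<Phi> (restrict (\<lambda>(x, y). l x \<oplus>\<^bsub>Y\<^esub> kernel_incl Y K q y) (carrier ?D) z) = ?h z" by metis
  interpret P: left_module R P by (rule P)
  have "\<Phi> x = \<phi> x" if x: "x \<in> mod_kernel Y K q" for x
    using \<Phi>(2)[of "(\<zero>\<^bsub>P\<^esub>, x)"] x mod_hom_zero[OF P Y l(1)] mod_hom_zero[OF P I \<psi>(1)] mod_hom_closed[OF \<phi>, of x]
    by (simp add: kernel_incl_def mod_kernel_iff)
  with \<Phi>(1) show "\<exists>\<psi>\<in>mod_hom R Y I. \<forall>x\<in>mod_kernel Y K q. \<psi> x = \<phi> x" by blast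
qed

text \<open>Place \<open>u\<close> in the second summand of the direct sum tensored with
  \<open>M\<close>. It dies in the tensor product with \<open>Y\<close>, so it comes from some
  \<open>z\<close> over the kernel of \<open>e\<close>. The first projection shows that
  \<open>z\<close> dies over \<open>P\<close>, hence \<open>z\<close> is trivial by hypothesis, and
  the second projection returns \<open>u\<close>.\<close>

lemma stays_inj_transfer:
  assumes P: "left_module (op_ring R) P" and Y: "left_module (op_ring R) Y" and K: "left_module (op_ring R) K"
    and M: "left_module R M"
    and e: "e \<in> mod_hom (op_ring R) P K" "e ` carrier P = carrier K" and q: "q \<in> mod_hom (op_ring R) Y K"
    and l: "l \<in> mod_hom (op_ring R) P Y" "\<And>x. x \<in> carrier P \<Longrightarrow> q (l x) = e x"
    and inj: "stays_inj R P K e M"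
  shows "stays_inj R Y K q M"
  unfolding stays_inj_def
proof (intro ballI impI)
  interpret Y: left_module "op_ring R" Y by (rule Y)
  let ?X = "kernel_mod Y K q" and ?Z = "kernel_mod P K e"
  let ?D = "dsum P ?X"
  note X = kernel_mod_module[OF Y K q] and Z = kernel_mod_module[OF P K e(1)]
  define i where "i = idm M"
  have i: "i \<in> mod_hom R M M" unfolding i_def by (rule mod_hom_id[OF M])
  define kX kZ where "kX = kernel_incl Y K q" and "kZ = kernel_incl P K e"
  have kX: "kX \<in> mod_hom (op_ring R) ?X Y" unfolding kX_def by (rule kernel_incl_hom[OF Y K q])
  have kZ: "kZ \<in> mod_hom (op_ring R) ?Z P" unfolding kZ_def by (rule kernel_incl_hom[OF P K e(1)])
  define s where "s = restrict (\<lambda>(x, y). l x \<oplus>\<^bsub>Y\<^esub> kX y) (carrier ?D)"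
  define j where "j = restrict (\<lambda>x. (x, \<ominus>\<^bsub>Y\<^esub> l x)) (mod_kernel P K e)"
  have ql: "\<forall>x\<in>carrier P. q (l x) = e x" using l(2) by blast
  note se = kernel_dsum_exact[OF P Y K e q l(1) ql, folded kX_def, folded s_def j_def]
  note D = short_exactD[OF se]
  note TX = tensor_pairI[OF X M] and TZ = tensor_pairI[OF Z M] and TD = tensor_pairI[OF D(2) M]
    and TY = tensor_pairI[OF Y M] and TP = tensor_pairI[OF P M]
  fix u assume u: "u \<in> carrier (tensor_group R ?X M)"
    and "tmap R ?X M Y M (kernel_incl Y K q) (idm M) u = \<one>\<^bsub>tensor_group R Y M\<^esub>"
  then have u1: "tmap R ?X M Y M kX i u = \<one>\<^bsub>tensor_group R Y M\<^esub>" by (simp only: kX_def i_def)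
  define p1 p2 in2 where "p1 = restrict fst (carrier ?D)" and "p2 = restrict snd (carrier ?D)"
    and "in2 = restrict (\<lambda>y. (\<zero>\<^bsub>P\<^esub>, y)) (carrier ?X)"
  note pr = dsum_proj_hom[OF P X, folded p1_def p2_def in2_def]
  have ii: "i (i y) = i y" "i y = y" if "y \<in> carrier M" for y using that by (auto simp: i_def)
  have pi: "p1 (in2 x) = \<zero>\<^bsub>P\<^esub>" "p2 (in2 x) = x" if "x \<in> carrier ?X" for x
    using mod_hom_closed[OF pr(3) that] that by (simp_all add: p1_def p2_def in2_def)
  define u' where "u' = tmap R ?X M ?D M in2 i u"
  have u'c: "u' \<in> carrier (tensor_group R ?D M)"
    unfolding u'_def by (rule hom_in_carrier[OF tmap_hom[OF TX TD pr(3) i] u])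
  have "tmap R ?D M Y M s i u' = tmap R ?X M Y M kX i u"
    unfolding u'_def
  proof (rule tmap_compose[OF TX TD TY pr(3) i D(5) i kX i _ _ u])
    fix x assume x: "x \<in> carrier ?X"
    show "s (in2 x) = kX x"
      using x mod_hom_closed[OF pr(3) x] mod_hom_zero[OF P Y l(1)] mod_hom_closed[OF kX x] by (simp add: s_def in2_def)
  qed (rule ii)
  then obtain z where z: "z \<in> carrier (tensor_group R ?Z M)" "tmap R ?Z M ?D M j i z = u'"
    using tensor_right_exact[OF TZ TD TY D(4,5,7) short_exact_image[OF se] i_def u'c] u1 by auto
  have "tmap R ?Z M P M kZ i z = tmap R ?D M P M p1 i u'"
    unfolding z(2)[symmetric]
  proof (rule tmap_compose[OF TZ TD TP D(4) i pr(1) i kZ i _ _ z(1), symmetric])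
    show "p1 (j x) = kZ x" if "x \<in> carrier ?Z" for x
      using that mod_hom_closed[OF D(4) that] by (simp add: p1_def j_def kZ_def kernel_incl_def)
  qed (rule ii)
  also have "\<dots> = \<one>\<^bsub>tensor_group R P M\<^esub>"
    unfolding u'_def by (rule tmap_compose_zero[OF TX TD TP pr(3) i pr(1) i _ u]) (simp only: pi simp_thms)
  finally have "z = \<one>\<^bsub>tensor_group R ?Z M\<^esub>"
    using inj z(1) unfolding stays_inj_def kZ_def i_def by blast
  then have "u' = \<one>\<^bsub>tensor_group R ?D M\<^esub>" using z(2) tmap_one[OF TZ TD D(4) i] by simp
  then have "tmap R ?D M ?X M p2 i u' = \<one>\<^bsub>tensor_group R ?X M\<^esub>" using tmap_one[OF TD TX pr(2) i] by simp
  moreover have "tmap R ?D M ?X M p2 i u' = tmap R ?X M ?X M (idm ?X) i u"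
    unfolding u'_def
    by (rule tmap_compose[OF TX TD TX pr(3) i pr(2) i mod_hom_id[OF X] i _ _ u]) (simp_all add: pi ii)
  moreover have "\<dots> = u" by (rule tmap_id[OF TX mod_hom_id[OF X] i _ _ u]) (auto simp: i_def)
  ultimately show "u = \<one>\<^bsub>tensor_group R ?X M\<^esub>" by simp
qed

section \<open>Weak injective and weak flat modules by systems of equations\<close>

lemma trivial_Mod_iff:
  assumes G: "comm_group G" and Z: "subgroup Z G" and B: "subgroup B G" and BZ: "B \<subseteq> Z"
  shows "trivial_group ((G\<lparr>carrier := Z\<rparr>) Mod B) \<longleftrightarrow> Z \<subseteq> B"
proof -
  interpret G: comm_group G by (rule G)
  let ?G = "G\<lparr>carrier := Z\<rparr>"
  have "comm_group ?G"
  proof (rule group.group_comm_groupI)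
    show "group ?G" using Z G.group_axioms by (rule subgroup.subgroup_is_group)
  qed (use subgroup.subset[OF Z] in \<open>auto intro!: G.m_comm\<close>)
  note G' = this
  interpret G': comm_group ?G by (rule G')
  have B': "subgroup B ?G" by (rule G.subgroup_incl[OF B Z BZ])
  have grp: "group (?G Mod B)"
    using comm_group.abelian_FactGroup[OF G' B'] by (simp add: comm_group_def)
  have *: "B #>\<^bsub>?G\<^esub> x = B \<longleftrightarrow> x \<in> B" if "x \<in> Z" for x
    using that B' G'.coset_join1[of B x] G'.coset_join2[of x B] by auto
  have "B \<in> (\<lambda>x. B #>\<^bsub>?G\<^esub> x) ` Z"
    using *[of "\<one>\<^bsub>G\<^esub>"] subgroup.one_closed[OF B] BZ by force
  then show ?thesis
    using grp * by (auto simp: trivial_group_def carrier_FactGroup)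
qed

section \<open>Hom groups and the first Ext and Tor groups\<close>

lemma hom_group_simps [simp]:
  "carrier (hom_group R M N) = mod_hom R M N"
  "monoid.mult (hom_group R M N) = (\<lambda>f g. \<lambda>x\<in>carrier M. f x \<oplus>\<^bsub>N\<^esub> g x)"
  "one (hom_group R M N) = (\<lambda>x\<in>carrier M. \<zero>\<^bsub>N\<^esub>)"
  by (simp_all add: hom_group_def)

lemma hom_group_group:
  assumes M: "left_module R M" and N: "left_module R N" shows "comm_group (hom_group R M N)"
proof -
  interpret M: left_module R M by (rule M)
  interpret N: left_module R N by (rule N)
  show ?thesis
  proof (rule comm_groupI)
    fix f g assume f: "f \<in> carrier (hom_group R M N)" and g: "g \<in> carrier (hom_group R M N)"
    then have f': "f \<in> mod_hom R M N" and g': "g \<in> mod_hom R M N" by simp_all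
    show "f \<otimes>\<^bsub>hom_group R M N\<^esub> g \<in> carrier (hom_group R M N)"
      unfolding hom_group_simps
      by (rule mod_hom_restrictI[OF M])
         (use mod_hom_closed[OF f'] mod_hom_closed[OF g'] in \<open>simp_all add: mod_hom_add[OF f'] mod_hom_add[OF g']
           mod_hom_smult[OF f'] mod_hom_smult[OF g'] N.smult_r_distr N.M.a_ac\<close>)
    show "f \<otimes>\<^bsub>hom_group R M N\<^esub> g = g \<otimes>\<^bsub>hom_group R M N\<^esub> f"
      using mod_hom_closed[OF f'] mod_hom_closed[OF g'] by (auto simp: N.M.a_comm intro!: restrict_ext)
  next
    fix f assume f: "f \<in> carrier (hom_group R M N)"
    then have f': "f \<in> mod_hom R M N" by simp
    show "\<one>\<^bsub>hom_group R M N\<^esub> \<otimes>\<^bsub>hom_group R M N\<^esub> f = f"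
      using mod_hom_closed[OF f'] mod_hom_ext[OF f'] by (auto simp: fun_eq_iff extensional_def)
    have "restrict (\<lambda>x. \<ominus>\<^bsub>N\<^esub> f x) (carrier M) \<in> mod_hom R M N"
      by (rule mod_hom_restrictI[OF M])
         (use mod_hom_closed[OF f'] in \<open>simp_all add: mod_hom_add[OF f'] mod_hom_smult[OF f'] N.smult_neg(2) N.M.minus_add\<close>)
    then show "\<exists>g\<in>carrier (hom_group R M N). g \<otimes>\<^bsub>hom_group R M N\<^esub> f = \<one>\<^bsub>hom_group R M N\<^esub>"
      unfolding hom_group_simps
      by (rule bexI[rotated]) (use mod_hom_closed[OF f'] in \<open>auto simp: N.M.l_neg intro!: restrict_ext\<close>)
  next
    have "restrict (\<lambda>_. \<zero>\<^bsub>N\<^esub>) (carrier M) \<in> mod_hom R M N"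
      by (rule mod_hom_restrictI[OF M]) (auto simp: N.smult_zero_r)
    then show "\<one>\<^bsub>hom_group R M N\<^esub> \<in> carrier (hom_group R M N)" by simp
  next
    fix f g h assume "f \<in> carrier (hom_group R M N)" "g \<in> carrier (hom_group R M N)" "h \<in> carrier (hom_group R M N)"
    then have f': "f \<in> mod_hom R M N" and g': "g \<in> mod_hom R M N" and h': "h \<in> mod_hom R M N" by simp_all
    show "f \<otimes>\<^bsub>hom_group R M N\<^esub> g \<otimes>\<^bsub>hom_group R M N\<^esub> h = f \<otimes>\<^bsub>hom_group R M N\<^esub> (g \<otimes>\<^bsub>hom_group R M N\<^esub> h)"
      using mod_hom_closed[OF f'] mod_hom_closed[OF g'] mod_hom_closed[OF h']
      by (auto simp: N.M.a_assoc intro!: restrict_ext)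
  qed
qed

lemma precomp_group_hom:
  assumes P: "left_module R P" and Q: "left_module R Q" and I: "left_module R I" and d: "d \<in> mod_hom R P Q"
  shows "group_hom (hom_group R Q I) (hom_group R P I) (\<lambda>f. compose (carrier P) f d)"
proof -
  have "(\<lambda>f. compose (carrier P) f d) \<in> hom (hom_group R Q I) (hom_group R P I)"
  proof (rule homI)
    show "compose (carrier P) f d \<in> carrier (hom_group R P I)" if "f \<in> carrier (hom_group R Q I)" for f
      using that mod_hom_compose[OF P d, of f I] by simp
    show "compose (carrier P) (f \<otimes>\<^bsub>hom_group R Q I\<^esub> g) d =
        compose (carrier P) f d \<otimes>\<^bsub>hom_group R P I\<^esub> compose (carrier P) g d" for f g
      using mod_hom_closed[OF d] by (auto simp: compose_def intro!: restrict_ext)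
  qed
  then show ?thesis
    using hom_group_group[OF P I] hom_group_group[OF Q I]
    by (simp add: group_hom_def group_hom_axioms_def comm_group_def)
qed

lemma projective_resolutionD:
  assumes "projective_resolution R K P d e"
  shows "left_module R K" "projective R (P n)" "left_module R (P n)" "d n \<in> mod_hom R (P (Suc n)) (P n)"
    "e \<in> mod_hom R (P 0) K" "e ` carrier (P 0) = carrier K"
    "mod_kernel (P 0) K e = d 0 ` carrier (P (Suc 0))"
    "mod_kernel (P (Suc n)) (P n) (d n) = d (Suc n) ` carrier (P (Suc (Suc n)))"
  using assms by (auto simp: projective_resolution_def projective_def)

lemma resolution_corestrict:
  assumes "projective_resolution R K P d e"
  shows "d 0 \<in> mod_hom R (P (Suc 0)) (kernel_mod (P 0) K e)"
    "d 0 ` carrier (P (Suc 0)) = carrier (kernel_mod (P 0) K e)"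
proof -
  note D = projective_resolutionD[OF assms]
  show "d 0 ` carrier (P (Suc 0)) = carrier (kernel_mod (P 0) K e)" using D(7) by simp
  then show "d 0 \<in> mod_hom R (P (Suc 0)) (kernel_mod (P 0) K e)"
    using D(4)[of 0] D(7) unfolding mod_hom_def by (auto simp: PiE_iff kernel_mod_def)
qed

lemma resolution_dd:
  assumes "projective_resolution R K P d e" "x \<in> carrier (P (Suc (Suc n)))"
  shows "d n (d (Suc n) x) = \<zero>\<^bsub>P n\<^esub>"
proof -
  have "d (Suc n) x \<in> mod_kernel (P (Suc n)) (P n) (d n)"
    using projective_resolutionD(8)[OF assms(1), of n] assms(2) by blast
  then show ?thesis by (simp add: mod_kernel_iff)
qed

text \<open>A cocycle in degree one vanishes on the kernel of \<open>d 0\<close>, so it is a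
  homomorphism on the image of \<open>d 0\<close>, which is the kernel of \<open>e\<close>. It is a
  coboundary exactly if this homomorphism extends to \<open>P 0\<close>.\<close>

lemma ext_group_one_trivial_iff:
  assumes res: "projective_resolution R K P d e" and I: "left_module R I"
  shows "trivial_group (ext_group R P d I 1) \<longleftrightarrow> extends R (P 0) K e I"
proof -
  note D = projective_resolutionD[OF res]
  interpret I: left_module R I by (rule I)
  let ?H = "\<lambda>n. hom_group R (P n) I"
  let ?c = "\<lambda>n f. compose (carrier (P (Suc n))) f (d n)"
  interpret c0: group_hom "?H 0" "?H 1" "?c 0" using precomp_group_hom[OF D(3,3) I D(4), of 0] by simp
  interpret c1: group_hom "?H 1" "?H 2" "?c 1"
    using precomp_group_hom[OF D(3,3) I D(4), of 1] by (simp add: numeral_2_eq_2)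
  have Z: "ext_cocycles R P d I 1 = kernel (?H 1) (?H 2) (?c 1)"
  proof -
    have "compose (carrier (P (Suc (Suc 0)))) f (d (Suc 0)) = (\<lambda>x\<in>carrier (P (Suc (Suc 0))). \<zero>\<^bsub>I\<^esub>) \<longleftrightarrow>
      (\<forall>x\<in>carrier (P (Suc (Suc 0))). f (d (Suc 0) x) = \<zero>\<^bsub>I\<^esub>)" for f
      by (auto simp: compose_def fun_eq_iff)
    then show ?thesis by (auto simp: ext_cocycles_def kernel_def numeral_2_eq_2)
  qed
  have B: "ext_coboundaries R P d I 1 = ?c 0 ` carrier (?H 0)"
    by (simp add: ext_coboundaries_def)
  have B': "g \<in> ext_coboundaries R P d I 1 \<longleftrightarrow> (\<exists>f\<in>mod_hom R (P 0) I. g = ?c 0 f)" for g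
    unfolding B by auto
  have BZ: "ext_coboundaries R P d I 1 \<subseteq> ext_cocycles R P d I 1"
  proof
    fix g assume "g \<in> ext_coboundaries R P d I 1"
    then obtain f where f: "f \<in> mod_hom R (P 0) I" "g = ?c 0 f" unfolding B' by blast
    have "g (d (Suc 0) x) = \<zero>\<^bsub>I\<^esub>" if "x \<in> carrier (P (Suc (Suc 0)))" for x
      using resolution_dd[OF res that] mod_hom_closed[OF D(4) that] mod_hom_zero[OF D(3) I f(1)]
      by (simp add: f(2) compose_eq)
    moreover have "g \<in> mod_hom R (P (Suc 0)) I" unfolding f(2) by (rule mod_hom_compose[OF D(3) D(4) f(1)])
    ultimately show "g \<in> ext_cocycles R P d I 1" by (simp add: ext_cocycles_def)
  qed
  have "trivial_group (ext_group R P d I 1) \<longleftrightarrow> ext_cocycles R P d I 1 \<subseteq> ext_coboundaries R P d I 1"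
    unfolding ext_group_def
    by (rule trivial_Mod_iff[OF hom_group_group[OF D(3) I] _ _ BZ])
       (simp_all only: Z B c1.subgroup_kernel c0.img_is_subgroup)
  also have "\<dots> \<longleftrightarrow> extends R (P 0) K e I"
  proof
    assume sub: "ext_cocycles R P d I 1 \<subseteq> ext_coboundaries R P d I 1"
    show "extends R (P 0) K e I"
      unfolding extends_def
    proof
      fix \<phi> assume \<phi>: "\<phi> \<in> mod_hom R (kernel_mod (P 0) K e) I"
      let ?f = "compose (carrier (P (Suc 0))) \<phi> (d 0)"
      have "?f \<in> mod_hom R (P (Suc 0)) I" by (rule mod_hom_compose[OF D(3) resolution_corestrict(1)[OF res] \<phi>])
      moreover have "?f (d (Suc 0) x) = \<zero>\<^bsub>I\<^esub>" if "x \<in> carrier (P (Suc (Suc 0)))" for x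
        using resolution_dd[OF res that] mod_hom_closed[OF D(4) that]
          mod_hom_zero[OF kernel_mod_module[OF D(3) D(1) D(5)] I \<phi>] by (simp add: compose_eq)
      ultimately have "?f \<in> ext_cocycles R P d I 1" by (simp add: ext_cocycles_def)
      then obtain \<psi> where \<psi>: "\<psi> \<in> mod_hom R (P 0) I" "?f = ?c 0 \<psi>" using sub B' by blast
      have "\<psi> x = \<phi> x" if "x \<in> mod_kernel (P 0) K e" for x
      proof -
        obtain y where y: "y \<in> carrier (P (Suc 0))" "x = d 0 y" using \<open>x \<in> _\<close> D(7) by auto
        then show ?thesis using fun_cong[OF \<psi>(2), of y] by (simp add: compose_eq)
      qed
      with \<psi>(1) show "\<exists>\<psi>\<in>mod_hom R (P 0) I. \<forall>x\<in>mod_kernel (P 0) K e. \<psi> x = \<phi> x" by blast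
    qed
  next
    assume ext: "extends R (P 0) K e I"
    show "ext_cocycles R P d I 1 \<subseteq> ext_coboundaries R P d I 1"
    proof
      fix f assume "f \<in> ext_cocycles R P d I 1"
      then have f: "f \<in> mod_hom R (P (Suc 0)) I" "\<And>x. x \<in> carrier (P (Suc (Suc 0))) \<Longrightarrow> f (d (Suc 0) x) = \<zero>\<^bsub>I\<^esub>"
        by (auto simp: ext_cocycles_def)
      have "f x = \<zero>\<^bsub>I\<^esub>" if x: "x \<in> carrier (P (Suc 0))" "d 0 x = \<zero>\<^bsub>kernel_mod (P 0) K e\<^esub>" for x
      proof -
        have "x \<in> mod_kernel (P (Suc 0)) (P 0) (d 0)" using x by (simp add: mod_kernel_iff)
        then show ?thesis using D(8)[of 0] f(2) by auto
      qed
      then obtain \<phi> where \<phi>: "\<phi> \<in> mod_hom R (kernel_mod (P 0) K e) I" "\<And>x. x \<in> carrier (P (Suc 0)) \<Longrightarrow> \<phi> (d 0 x) = f x"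
        using factor_through[OF D(3) kernel_mod_module[OF D(3) D(1) D(5)] I resolution_corestrict[OF res] f(1)] by metis
      obtain \<psi> where \<psi>: "\<psi> \<in> mod_hom R (P 0) I" "\<And>x. x \<in> mod_kernel (P 0) K e \<Longrightarrow> \<psi> x = \<phi> x"
        using ext \<phi>(1) unfolding extends_def by blast
      have "f = ?c 0 \<psi>"
      proof (rule mod_hom_eqI[OF f(1) mod_hom_compose[OF D(3) D(4) \<psi>(1)]])
        fix x assume "x \<in> carrier (P (Suc 0))"
        then show "f x = ?c 0 \<psi> x" using \<phi>(2) \<psi>(2)[of "d 0 x"] D(7) by (simp add: compose_eq)
      qed
      then show "f \<in> ext_coboundaries R P d I 1" unfolding B' using \<psi>(1) by blast
    qed
  qed
  finally show ?thesis .
qed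

lemma tensor_map_hom:
  assumes "tensor_pair R N M" "tensor_pair R N' M" "h \<in> mod_hom (op_ring R) N N'"
  shows "tensor_map R N N' M h \<in> hom (tensor_group R N M) (tensor_group R N' M)"
proof -
  interpret A: tensor_pair R N M by fact
  note t = tmap_hom[OF assms(1-3) mod_hom_id[OF A.M.left_module_axioms]]
  note eq = tensor_map_eq_tmap[OF assms]
  show ?thesis
    by (rule homI) (simp_all only: eq A.T.m_closed hom_mult[OF t] hom_in_carrier[OF t])
qed

text \<open>After tensoring, \<open>d 0\<close> factors as a surjection \<open>r\<close> onto the
  tensor product with the kernel of \<open>e\<close>, followed by the map \<open>k\<close> induced
  by the inclusion. By right exactness the kernel of \<open>r\<close> consists of the boundaries. So
  all cycles are boundaries exactly if \<open>k\<close> is injective.\<close>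

lemma tor_group_one_trivial_iff:
  assumes res: "projective_resolution (op_ring R) K P d e" and M: "left_module R M"
  shows "trivial_group (tor_group R P d M 1) \<longleftrightarrow> stays_inj R (P 0) K e M"
proof -
  note D = projective_resolutionD[OF res]
  define i where "i = idm M"
  have i: "i \<in> mod_hom R M M" unfolding i_def by (rule mod_hom_id[OF M])
  have iy: "i (i y) = i y" "i y = y" if "y \<in> carrier M" for y using that by (auto simp: i_def)
  have TP: "tensor_pair R (P n) M" for n by (rule tensor_pairI[OF D(3) M])
  let ?Z = "kernel_mod (P 0) K e"
  note Z = kernel_mod_module[OF D(3) D(1) D(5)]
  note TZ = tensor_pairI[OF Z M]
  interpret P0: tensor_pair R "P 0" M by (rule TP)
  interpret P1: tensor_pair R "P (Suc 0)" M by (rule TP)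
  interpret P2: tensor_pair R "P (Suc (Suc 0))" M by (rule TP)
  interpret Z: tensor_pair R ?Z M by (rule TZ)
  define t where "t n = tmap R (P (Suc n)) M (P n) M (d n) i" for n
  have tm: "tensor_map R (P (Suc n)) (P n) M (d n) X = t n X" if "X \<in> carrier (tensor_group R (P (Suc n)) M)" for n X
    unfolding t_def i_def by (rule tensor_map_eq_tmap[OF TP TP D(4) that])
  have gh: "group_hom (tensor_group R (P (Suc n)) M) (tensor_group R (P n) M) (tensor_map R (P (Suc n)) (P n) M (d n))" for n
    using tensor_map_hom[OF TP TP D(4)] tensor_pair.T_group[OF TP]
    by (simp add: group_hom_def group_hom_axioms_def comm_group_def)
  interpret g0: group_hom P1.T P0.T "tensor_map R (P (Suc 0)) (P 0) M (d 0)" by (rule gh)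
  interpret g1: group_hom P2.T P1.T "tensor_map R (P (Suc (Suc 0))) (P (Suc 0)) M (d (Suc 0))" by (rule gh)
  have cyc: "tor_cycles R P d M 1 = kernel P1.T P0.T (tensor_map R (P (Suc 0)) (P 0) M (d 0))"
    by (simp add: tor_cycles_def)
  have cyc': "X \<in> tor_cycles R P d M 1 \<longleftrightarrow> X \<in> carrier P1.T \<and> t 0 X = \<one>\<^bsub>P0.T\<^esub>" for X
    unfolding cyc kernel_def using tm[of X 0] by auto
  have bou: "tor_boundaries R P d M 1 = tensor_map R (P (Suc (Suc 0))) (P (Suc 0)) M (d (Suc 0)) ` carrier P2.T"
    by (simp add: tor_boundaries_def)
  have bou': "tor_boundaries R P d M 1 = t (Suc 0) ` carrier P2.T"
    unfolding bou by (rule image_cong[OF refl tm])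
  note d0 = resolution_corestrict[OF res]
  define r where "r = tmap R (P (Suc 0)) M ?Z M (d 0) i"
  define k where "k = tmap R ?Z M (P 0) M (kernel_incl (P 0) K e) i"
  note ki = kernel_incl_hom[OF D(3) D(1) D(5)]
  have kie: "kernel_incl (P 0) K e x = x" if "x \<in> mod_kernel (P 0) K e" for x
    using that by (simp add: kernel_incl_def)
  have kr: "k (r X) = t 0 X" if "X \<in> carrier P1.T" for X
    unfolding k_def r_def t_def
  proof (rule tmap_compose[OF TP TZ TP d0(1) i ki i D(4) i _ _ that])
    show "kernel_incl (P 0) K e (d 0 x) = d 0 x" if "x \<in> carrier (P (Suc 0))" for x
      using mod_hom_closed[OF d0(1) that] by (intro kie) simp
  qed (rule iy)
  have rt: "r (t (Suc 0) X) = \<one>\<^bsub>Z.T\<^esub>" if X: "X \<in> carrier P2.T" for X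
    unfolding r_def t_def
    by (rule tmap_compose_zero[OF TP TP TZ D(4) i d0(1) i _ X]) (use resolution_dd[OF res, of _ 0] in simp)
  have tc: "t n X \<in> carrier (tensor_group R (P n) M)" if "X \<in> carrier (tensor_group R (P (Suc n)) M)" for n X
    unfolding t_def by (rule hom_in_carrier[OF tmap_hom[OF TP TP D(4) i] that])
  have rc: "r X \<in> carrier Z.T" if "X \<in> carrier P1.T" for X
    unfolding r_def by (rule hom_in_carrier[OF tmap_hom[OF TP TZ d0(1) i] that])
  have BZ: "tor_boundaries R P d M 1 \<subseteq> tor_cycles R P d M 1"
  proof
    fix X assume "X \<in> tor_boundaries R P d M 1"
    then obtain Y where Y: "Y \<in> carrier P2.T" "X = t (Suc 0) Y" unfolding bou' by auto
    have "t 0 X = k \<one>\<^bsub>Z.T\<^esub>" unfolding Y(2) kr[OF tc[OF Y(1)], symmetric] rt[OF Y(1)] ..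
    also have "\<dots> = \<one>\<^bsub>P0.T\<^esub>" unfolding k_def by (rule tmap_one[OF TZ TP ki i])
    finally show "X \<in> tor_cycles R P d M 1" unfolding cyc' using tc[OF Y(1)] Y(2) by simp
  qed
  have "trivial_group (tor_group R P d M 1) \<longleftrightarrow> tor_cycles R P d M 1 \<subseteq> tor_boundaries R P d M 1"
    unfolding tor_group_def
  proof (rule trivial_Mod_iff[OF _ _ _ BZ])
    show "comm_group (tensor_group R (P 1) M)" using P1.T_group by simp
    show "subgroup (tor_cycles R P d M 1) (tensor_group R (P 1) M)" unfolding cyc using g0.subgroup_kernel by simp
    show "subgroup (tor_boundaries R P d M 1) (tensor_group R (P 1) M)" unfolding bou using g1.img_is_subgroup by simp
  qed
  also have "\<dots> \<longleftrightarrow> stays_inj R (P 0) K e M"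
  proof
    assume sub: "tor_cycles R P d M 1 \<subseteq> tor_boundaries R P d M 1"
    have "u = \<one>\<^bsub>Z.T\<^esub>" if u: "u \<in> carrier Z.T" "k u = \<one>\<^bsub>P0.T\<^esub>" for u
    proof -
      obtain X where X: "X \<in> carrier P1.T" "r X = u"
        unfolding r_def using tmap_surj[OF TP TZ d0 i_def u(1)] by metis
      then have "X \<in> tor_cycles R P d M 1" unfolding cyc' using kr[OF X(1)] u(2) by simp
      then obtain Y where "Y \<in> carrier P2.T" "X = t (Suc 0) Y" using sub bou' by auto
      then show ?thesis using rt X(2) by simp
    qed
    then show "stays_inj R (P 0) K e M" unfolding stays_inj_def k_def i_def by blast
  next
    assume inj: "stays_inj R (P 0) K e M"
    show "tor_cycles R P d M 1 \<subseteq> tor_boundaries R P d M 1"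
    proof
      fix X assume "X \<in> tor_cycles R P d M 1"
      then have X: "X \<in> carrier P1.T" "t 0 X = \<one>\<^bsub>P0.T\<^esub>" unfolding cyc' by auto
      have "r X = \<one>\<^bsub>Z.T\<^esub>"
        using inj rc[OF X(1)] kr[OF X(1)] X(2) unfolding stays_inj_def k_def i_def by simp
      moreover have "x \<in> d (Suc 0) ` carrier (P (Suc (Suc 0)))"
        if "x \<in> carrier (P (Suc 0))" "d 0 x = \<zero>\<^bsub>?Z\<^esub>" for x
        using that D(8)[of 0] by (auto simp: mod_kernel_def)
      ultimately obtain Y where "Y \<in> carrier P2.T" "t (Suc 0) Y = X"
        using tensor_right_exact[OF TP TP TZ D(4) d0 _ i_def X(1)] unfolding r_def t_def by metis
      then show "X \<in> tor_boundaries R P d M 1" unfolding bou' by blast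
    qed
  qed
  finally show ?thesis .
qed

lemma sfp_copy:
  fixes K :: "('r, 'k) module"
  assumes "sfp R K"
  obtains K' :: "('r, 'r list) module" and j where "sfp R K'" "j \<in> mod_hom R K K'" "bij_betw j (carrier K) (carrier K')"
proof -
  obtain xs where "gens R K xs" using sfp_step[OF assms] .
  then have "fin_gen R K" using sfp_module[OF assms] by (rule gens_imp_fin_gen[rotated])
  then obtain K' :: "('r, 'r list) module" where K': "left_module R K'" "mod_isomorphic R K K'"
    using fin_gen_copy[OF sfp_module[OF assms]] by blast
  then obtain j where j: "j \<in> mod_hom R K K'" "bij_betw j (carrier K) (carrier K')"
    by (auto simp: mod_isomorphic_def)
  then show thesis using sfp_iso[OF assms K'(1)] that by blast
qed

lemma mod_kernel_compose_inj:
  assumes "left_module R K" "left_module R K'" "q \<in> mod_hom R Y K" "j \<in> mod_hom R K K'" "inj_on j (carrier K)"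
  shows "mod_kernel Y K' (compose (carrier Y) j q) = mod_kernel Y K q"
  using mod_hom_inj_iff[OF assms(1,2,4)] assms(5) mod_hom_zero[OF assms(1,2,4)] mod_hom_closed[OF assms(3)]
  by (auto simp: mod_kernel_def compose_eq)

text \<open>\<open>K\<close> may have any type, since it has a copy among the test modules, and
  \<open>Y\<close> may be any module that maps onto \<open>K\<close>: a projective module of a
  resolution lifts to it, which is all that the transfer asks for. The cases of interest have a
  power of \<open>C\<close> as \<open>Y\<close>.\<close>

lemma weak_injective_extends:
  assumes I: "weak_injective S I" and K: "sfp S K" and Y: "left_module S Y"
    and q: "q \<in> mod_hom S Y K" "q ` carrier Y = carrier K"
  shows "extends S Y K q I"
proof -
  have IM: "left_module S I" using I by (simp add: weak_injective_def)
  obtain K' :: "('a, 'a list) module" and j where K': "sfp S K'"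
    and j: "j \<in> mod_hom S K K'" "bij_betw j (carrier K) (carrier K')" by (rule sfp_copy[OF K])
  note KM = sfp_module[OF K] and K'M = sfp_module[OF K']
  have sK': "super_fin_presented S K'" using K' by (simp add: super_fin_presented_iff_sfp)
  then obtain P :: "nat \<Rightarrow> ('a, ('a + 'a list) list) module" and d e where res: "projective_resolution S K' P d e"
    unfolding super_fin_presented_def by blast
  note D = projective_resolutionD[OF res]
  have "trivial_group (ext_group S P d I 1)"
    using I sK' res unfolding weak_injective_def Ext_vanishes_def by blast
  then have ext: "extends S (P 0) K' e I" using ext_group_one_trivial_iff[OF res IM] by blast
  let ?q = "compose (carrier Y) j q"
  have q': "?q \<in> mod_hom S Y K'" by (rule mod_hom_compose[OF Y q(1) j(1)])
  have qs: "?q ` carrier Y = carrier K'"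
    using q(2) j(2) by (simp add: compose_def bij_betw_def image_image[symmetric, of j q] cong: image_cong_simp)
  obtain l where l: "l \<in> mod_hom S (P 0) Y" "\<And>x. x \<in> carrier (P 0) \<Longrightarrow> ?q (l x) = e x"
    using projective_lift[OF D(2) Y K'M q' qs D(5)] by metis
  have "extends S Y K' ?q I" by (rule extends_transfer[OF D(3) Y K'M IM D(5,6) q' l ext])
  then show ?thesis
    using mod_kernel_compose_inj[OF KM K'M q(1) j(1)] j(2) by (simp add: extends_def kernel_mod_def bij_betw_def)
qed

text \<open>One surjection from a free module suffices for each \<open>K\<close>, because the free
  module lifts to the first term of any resolution and the extension property is transferred along
  the lift.\<close>

lemma weak_injectiveI:
  fixes S :: "'s ring"
  assumes I: "left_module S I"
    and ext: "\<And>K :: ('s, 's list) module. sfp S K \<Longrightarrow> \<exists>n q. q \<in> mod_hom S (free_pow S n) K \<and>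
      q ` carrier (free_pow S n) = carrier K \<and> extends S (free_pow S n) K q I"
  shows "weak_injective S I"
  unfolding weak_injective_def Ext_vanishes_def
proof (intro conjI allI impI I)
  fix K :: "('s, 's list) module" and P :: "nat \<Rightarrow> ('s, ('s + 's list) list) module" and d e
  interpret I: left_module S I by (rule I)
  assume "super_fin_presented S K" and res: "projective_resolution S K P d e"
  then obtain n q where q: "q \<in> mod_hom S (free_pow S n) K" "q ` carrier (free_pow S n) = carrier K"
    "extends S (free_pow S n) K q I" using ext super_fin_presented_iff_sfp by metis
  note D = projective_resolutionD[OF res]
  obtain l where l: "l \<in> mod_hom S (free_pow S n) (P 0)" "\<And>x. x \<in> vecs (carrier S) n \<Longrightarrow> e (l x) = q x"
    using free_pow_lift[OF D(3) D(1) D(5,6) q(1)] by metis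
  have "extends S (P 0) K e I"
    by (rule extends_transfer[OF free_pow_module[OF I.R.ring_axioms] D(3) D(1) I q(1,2) D(5) l(1) _ q(3)])
       (simp add: l(2))
  then show "trivial_group (ext_group S P d I 1)" using ext_group_one_trivial_iff[OF res I] by blast
qed

lemma weak_flat_stays_inj:
  assumes M: "weak_flat R M" and K: "sfp (op_ring R) K" and Y: "left_module (op_ring R) Y"
    and q: "q \<in> mod_hom (op_ring R) Y K" "q ` carrier Y = carrier K"
  shows "stays_inj R Y K q M"
proof -
  have MM: "left_module R M" using M by (simp add: weak_flat_def)
  obtain K' :: "('a, 'a list) module" and j where K': "sfp (op_ring R) K'"
    and j: "j \<in> mod_hom (op_ring R) K K'" "bij_betw j (carrier K) (carrier K')" by (rule sfp_copy[OF K])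
  note KM = sfp_module[OF K] and K'M = sfp_module[OF K']
  have sK': "super_fin_presented (op_ring R) K'" using K' by (simp add: super_fin_presented_iff_sfp)
  then obtain P :: "nat \<Rightarrow> ('a, ('a + 'a list) list) module" and d e
    where res: "projective_resolution (op_ring R) K' P d e"
    unfolding super_fin_presented_def by blast
  note D = projective_resolutionD[OF res]
  have "trivial_group (tor_group R P d M 1)"
    using M sK' res unfolding weak_flat_def Tor_vanishes_def by blast
  then have inj: "stays_inj R (P 0) K' e M" using tor_group_one_trivial_iff[OF res MM] by blast
  let ?q = "compose (carrier Y) j q"
  have q': "?q \<in> mod_hom (op_ring R) Y K'" by (rule mod_hom_compose[OF Y q(1) j(1)])
  have qs: "?q ` carrier Y = carrier K'"
    using q(2) j(2) by (simp add: compose_def bij_betw_def image_image[symmetric, of j q] cong: image_cong_simp)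
  obtain l where l: "l \<in> mod_hom (op_ring R) (P 0) Y" "\<And>x. x \<in> carrier (P 0) \<Longrightarrow> ?q (l x) = e x"
    using projective_lift[OF D(2) Y K'M q' qs D(5)] by metis
  have "stays_inj R Y K' ?q M" by (rule stays_inj_transfer[OF D(3) Y K'M MM D(5,6) q' l inj])
  then show ?thesis
    using mod_kernel_compose_inj[OF KM K'M q(1) j(1)] j(2)
    by (simp add: stays_inj_def kernel_mod_def kernel_incl_def bij_betw_def)
qed

lemma weak_flatI:
  fixes R :: "'r ring"
  assumes M: "left_module R M"
    and inj: "\<And>K :: ('r, 'r list) module. sfp (op_ring R) K \<Longrightarrow> \<exists>n q. q \<in> mod_hom (op_ring R) (free_pow (op_ring R) n) K \<and>
      q ` carrier (free_pow (op_ring R) n) = carrier K \<and> stays_inj R (free_pow (op_ring R) n) K q M"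
  shows "weak_flat R M"
  unfolding weak_flat_def Tor_vanishes_def
proof (intro conjI allI impI M)
  fix K :: "('r, 'r list) module" and P :: "nat \<Rightarrow> ('r, ('r + 'r list) list) module" and d e
  interpret M: left_module R M by (rule M)
  assume "super_fin_presented (op_ring R) K" and res: "projective_resolution (op_ring R) K P d e"
  then obtain n q where q: "q \<in> mod_hom (op_ring R) (free_pow (op_ring R) n) K"
    "q ` carrier (free_pow (op_ring R) n) = carrier K"
    "stays_inj R (free_pow (op_ring R) n) K q M" using inj super_fin_presented_iff_sfp by metis
  note D = projective_resolutionD[OF res]
  obtain l where l: "l \<in> mod_hom (op_ring R) (free_pow (op_ring R) n) (P 0)"
    "\<And>x. x \<in> vecs (carrier (op_ring R)) n \<Longrightarrow> e (l x) = q x"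
    using free_pow_lift[OF D(3) D(1) D(5,6) q(1)] by metis
  have "stays_inj R (P 0) K e M"
    by (rule stays_inj_transfer[OF free_pow_module[OF op_ring_ring[OF M.R.ring_axioms]] D(3) D(1) M q(1,2) D(5) l(1) _ q(3)])
       (use l(2) in simp)
  then show "trivial_group (tor_group R P d M 1)" using tor_group_one_trivial_iff[OF res M] by blast
qed

text \<open>The map of the free module given by \<open>y\<close> kills the generators
  \<open>rs\<close> of the syzygies, hence all syzygies, and factors through
  \<open>M\<close>.\<close>

lemma hom_from_gens:
  assumes M: "left_module R M" and I: "left_module R I" and ls: "gens R M ls" and rs: "gens R (syz R M ls) rs"
    and y: "y \<in> vecs (carrier I) (length ls)" and z: "\<And>r. r \<in> set rs \<Longrightarrow> lc I r y = \<zero>\<^bsub>I\<^esub>"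
  obtains \<phi> where "\<phi> \<in> mod_hom R M I" "map \<phi> ls = y" "\<And>a. a \<in> vecs (carrier R) (length ls) \<Longrightarrow> \<phi> (lc M a ls) = lc I a y"
proof -
  interpret I: left_module R I by (rule I)
  interpret M: left_module R M by (rule M)
  define n where "n = length ls"
  let ?F = "free_pow R n"
  have F: "left_module R ?F" by (rule free_pow_module[OF I.R.ring_axioms])
  let ?g = "restrict (\<lambda>a. lc M a ls) (vecs (carrier R) n)" and ?h = "restrict (\<lambda>a. lc I a y) (vecs (carrier R) n)"
  have g: "?g \<in> mod_hom R ?F M" using gens_set[OF ls] by (intro lc_hom_right[OF M]) (simp add: n_def vecsI)
  have h: "?h \<in> mod_hom R ?F I" using y by (intro lc_hom_right[OF I]) (simp add: n_def)
  have gs: "?g ` carrier ?F = carrier M"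
    using short_exactD(7)[OF syz_short_exact[OF M ls]] by (simp add: n_def)
  have ker: "?h a = \<zero>\<^bsub>I\<^esub>" if a: "a \<in> carrier ?F" "?g a = \<zero>\<^bsub>M\<^esub>" for a
  proof -
    have "a \<in> carrier (syz R M ls)" using a by (simp add: n_def)
    from gensE[OF rs this] obtain c where c: "c \<in> vecs (carrier R) (length rs)" "lc (syz R M ls) c rs = a" .
    have rsF: "set rs \<subseteq> carrier ?F" using gens_set[OF rs] by (auto simp: n_def)
    have "lc ?F c rs = a" using c(2) by (simp add: syz_def n_def)
    then have "?h a = lc I c (map ?h rs)" using mod_hom_lc[OF F I h vecs_set[OF c(1)] rsF] by simp
    also have "map ?h rs = replicate (length rs) \<zero>\<^bsub>I\<^esub>"
      using z rsF by (auto simp: map_replicate_const[symmetric] subset_iff)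
    finally show ?thesis using I.lc_zero_right[OF vecs_set[OF c(1)]] by simp
  qed
  obtain \<phi> where \<phi>: "\<phi> \<in> mod_hom R M I" "\<And>a. a \<in> carrier ?F \<Longrightarrow> \<phi> (?g a) = ?h a"
    using factor_through[OF F M I g gs h ker] by metis
  have lc\<phi>: "\<phi> (lc M a ls) = lc I a y" if "a \<in> vecs (carrier R) n" for a
    using \<phi>(2)[of a] that by simp
  have "map \<phi> ls = y"
  proof (rule nth_equalityI)
    show "length (map \<phi> ls) = length y" using y by (simp add: vecs_length)
    fix i assume "i < length (map \<phi> ls)"
    then have i: "i < n" by (simp add: n_def)
    have v: "(replicate n \<zero>\<^bsub>R\<^esub>)[i := \<one>\<^bsub>R\<^esub>] \<in> vecs (carrier R) n" using i by (auto simp: vecs_iff_nth nth_list_update)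
    have 1: "ls \<in> vecs (carrier M) n" "y \<in> vecs (carrier I) n"
      using vecsI[OF gens_set[OF ls]] y by (simp_all add: n_def)
    then have "\<phi> (ls ! i) = y ! i"
      using lc\<phi>[OF v] M.lc_delta_left[OF i 1(1), of "\<one>\<^bsub>R\<^esub>"] I.lc_delta_left[OF i 1(2), of "\<one>\<^bsub>R\<^esub>"]
        vecs_nth[OF 1(1) i] vecs_nth[OF 1(2) i] by simp
    then show "map \<phi> ls ! i = y ! i" using i by (simp add: n_def)
  qed
  with \<phi>(1) show thesis using lc\<phi> n_def by (intro that) auto
qed

lemma hom_eq_on_gens:
  assumes M: "left_module R M" and N: "left_module R N" and xs: "gens R M xs"
    and \<phi>: "\<phi> \<in> mod_hom R M N" and \<psi>: "\<psi> \<in> mod_hom R M N"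
    and eq: "\<And>x. x \<in> set xs \<Longrightarrow> \<phi> x = \<psi> x" and x: "x \<in> carrier M"
  shows "\<phi> x = \<psi> x"
proof -
  obtain a where a: "a \<in> vecs (carrier R) (length xs)" "lc M a xs = x" using gensE[OF xs x] .
  have eq': "map \<phi> xs = map \<psi> xs" using eq by simp
  show ?thesis
    using mod_hom_lc[OF M N \<phi> vecs_set[OF a(1)] gens_set[OF xs]] mod_hom_lc[OF M N \<psi> vecs_set[OF a(1)] gens_set[OF xs]]
    unfolding eq' a(2) by simp
qed

lemma kernel_mod_free_pow:
  "kernel_mod (free_pow R (length xs)) K (restrict (\<lambda>a. lc K a xs) (vecs (carrier R) (length xs))) = syz R K xs"
  by (simp add: kernel_mod_def syz_def mod_kernel_def cong: conj_cong)

text \<open>Homomorphisms from the syzygy module to \<open>I\<close> correspond to vectors over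
  \<open>I\<close> killed by the second syzygies \<open>rs\<close>. Those that extend to the free
  module correspond to images under the matrix \<open>ls\<close>, the preimage being the vector of
  values on the unit vectors.\<close>

lemma extends_iff_exact_at:
  assumes K: "left_module R K" and I: "left_module R I" and xs: "gens R K xs" and ls: "gens R (syz R K xs) ls"
    and rs: "gens R (syz R (syz R K xs) ls) rs"
  shows "extends R (free_pow R (length xs)) K (restrict (\<lambda>a. lc K a xs) (vecs (carrier R) (length xs))) I \<longleftrightarrow>
    exact_at I (length xs) (length ls) ls rs"
proof -
  interpret I: left_module R I by (rule I)
  define n where "n = length xs"
  let ?F = "free_pow R n"
  have F: "left_module R ?F" by (rule free_pow_module[OF I.R.ring_axioms])
  let ?W = "syz R K xs"
  have W: "left_module R ?W" by (rule syz_module[OF K gens_set[OF xs]])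
  let ?q = "restrict (\<lambda>a. lc K a xs) (vecs (carrier R) n)"
  have kq: "kernel_mod ?F K ?q = ?W" unfolding n_def by (rule kernel_mod_free_pow)
  then have mk: "mod_kernel ?F K ?q = carrier ?W" by (metis kernel_mod_simps(1))
  have lsF: "set ls \<subseteq> vecs (carrier R) n" using gens_set[OF ls] by (auto simp: n_def)
  show ?thesis
    unfolding n_def[symmetric]
  proof
    assume ext: "extends R ?F K ?q I"
    show "exact_at I n (length ls) ls rs"
      unfolding exact_at_def
    proof (intro ballI impI)
      fix y assume y: "y \<in> vecs (carrier I) (length ls)" "\<forall>r\<in>set rs. lc I r y = \<zero>\<^bsub>I\<^esub>"
      then obtain \<phi> where \<phi>: "\<phi> \<in> mod_hom R ?W I" "map \<phi> ls = y"
        using hom_from_gens[OF W I ls rs y(1)] by metis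
      then obtain \<psi> where \<psi>: "\<psi> \<in> mod_hom R ?F I" "\<And>x. x \<in> carrier ?W \<Longrightarrow> \<psi> x = \<phi> x"
        using ext unfolding extends_def kq mk by blast
      let ?x = "map \<psi> (unit_vecs R n)"
      have u: "set (unit_vecs R n) \<subseteq> carrier ?F" using vecs_set[OF unit_vecs_in[OF I.R.ring_axioms]] by simp
      have "?x \<in> vecs (carrier I) n" using u mod_hom_closed[OF \<psi>(1)] by (auto simp: vecs_def)
      moreover have "map (\<lambda>r. lc I r ?x) ls = y"
      proof -
        have "lc I r ?x = \<phi> r" if "r \<in> set ls" for r
        proof -
          have r: "r \<in> vecs (carrier R) n" "r \<in> carrier ?W" using that lsF gens_set[OF ls] by auto
          show ?thesis
            using mod_hom_lc[OF F I \<psi>(1) vecs_set[OF r(1)] u] lc_unit_vecs[OF I.R.ring_axioms r(1)] \<psi>(2)[OF r(2)] by simp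
        qed
        then show ?thesis using \<phi>(2) by (metis map_cong)
      qed
      ultimately show "\<exists>x\<in>vecs (carrier I) n. map (\<lambda>r. lc I r x) ls = y" by blast
    qed
  next
    assume ex: "exact_at I n (length ls) ls rs"
    show "extends R ?F K ?q I"
      unfolding extends_def kq mk
    proof
      fix \<phi> assume \<phi>: "\<phi> \<in> mod_hom R ?W I"
      have y: "map \<phi> ls \<in> vecs (carrier I) (length ls)"
        using gens_set[OF ls] mod_hom_closed[OF \<phi>] by (auto simp: vecs_def)
      have "lc I r (map \<phi> ls) = \<zero>\<^bsub>I\<^esub>" if "r \<in> set rs" for r
      proof -
        have r: "r \<in> vecs (carrier R) (length ls)" "lc ?W r ls = \<zero>\<^bsub>?W\<^esub>"
          using gens_set[OF rs] that by auto
        then show ?thesis using mod_hom_lc[OF W I \<phi> vecs_set[OF r(1)] gens_set[OF ls]] mod_hom_zero[OF W I \<phi>] by metis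
      qed
      then obtain x where x: "x \<in> vecs (carrier I) n" "map (\<lambda>r. lc I r x) ls = map \<phi> ls"
        using ex y unfolding exact_at_def by blast
      let ?\<psi> = "restrict (\<lambda>a. lc I a x) (vecs (carrier R) n)"
      have \<psi>: "?\<psi> \<in> mod_hom R ?F I" by (rule lc_hom_right[OF I x(1)])
      have "compose (carrier ?W) ?\<psi> (idm ?W) \<in> mod_hom R ?W I"
        using mod_hom_compose[OF W _ \<psi>] kernel_incl_hom[OF F K, of ?q] short_exactD(4,5)[OF syz_short_exact[OF K xs]]
        by (simp only: n_def)
      moreover have "compose (carrier ?W) ?\<psi> (idm ?W) l = \<phi> l" if "l \<in> set ls" for l
      proof -
        have "l \<in> carrier ?W" "l \<in> vecs (carrier R) n" using that gens_set[OF ls] lsF by auto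
        moreover have "lc I l x = \<phi> l" using x(2) that by simp
        ultimately show ?thesis by (simp add: compose_eq)
      qed
      ultimately have "compose (carrier ?W) ?\<psi> (idm ?W) w = \<phi> w" if "w \<in> carrier ?W" for w
        using hom_eq_on_gens[OF W I ls _ \<phi> _ that] by blast
      then have "?\<psi> w = \<phi> w" if "w \<in> carrier ?W" for w using that by (simp add: compose_eq)
      with \<psi> show "\<exists>\<psi>\<in>mod_hom R ?F I. \<forall>x\<in>carrier ?W. \<psi> x = \<phi> x" by blast
    qed
  qed
qed

text \<open>A tensor over the syzygy module is given by a vector \<open>y\<close> over
  \<open>M\<close>. It dies over the free module if \<open>y\<close> is killed by the columns of
  \<open>ls\<close>, and it is trivial itself if \<open>y\<close> is an image under the columns of
  \<open>rs\<close>. Compared with the statement for Ext, the matrices are transposed and the arrows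
  reversed.\<close>

lemma stays_inj_iff_exact_at:
  assumes K: "left_module (op_ring R) K" and M: "left_module R M" and xs: "gens (op_ring R) K xs"
    and ls: "gens (op_ring R) (syz (op_ring R) K xs) ls"
    and rs: "gens (op_ring R) (syz (op_ring R) (syz (op_ring R) K xs) ls) rs"
  shows "stays_inj R (free_pow (op_ring R) (length xs)) K (restrict (\<lambda>a. lc K a xs) (vecs (carrier R) (length xs))) M \<longleftrightarrow>
    exact_at M (length rs) (length ls) (columns (length ls) rs) (columns (length xs) ls)"
proof -
  interpret M: left_module R M by (rule M)
  note Rop = op_ring_ring[OF M.R.ring_axioms]
  define n where "n = length xs"
  define F where "F = free_pow (op_ring R) n"
  have F: "left_module (op_ring R) F" unfolding F_def by (rule free_pow_module[OF Rop])
  let ?W = "syz (op_ring R) K xs"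
  have W: "left_module (op_ring R) ?W" by (rule syz_module[OF K gens_set[OF xs]])
  let ?q = "restrict (\<lambda>a. lc K a xs) (vecs (carrier R) n)"
  have kq: "kernel_mod F K ?q = ?W" unfolding n_def F_def using kernel_mod_free_pow[of "op_ring R" xs K] by simp
  then have mk: "mod_kernel F K ?q = carrier ?W" by (metis kernel_mod_simps(1))
  have lsF: "set ls \<subseteq> vecs (carrier R) n" using gens_set[OF ls] by (auto simp: n_def)
  note TW = tensor_pairI[OF W M] and TF = tensor_pairI[OF F M]
  interpret W: tensor_pair R ?W M by (rule TW)
  interpret F: tensor_pair R F M by (rule TF)
  define i where "i = idm M"
  have i: "i \<in> mod_hom R M M" unfolding i_def by (rule mod_hom_id[OF M])
  have ii: "map i zs = zs" if "set zs \<subseteq> carrier M" for zs using that by (auto simp: i_def intro!: map_idI)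
  define k where "k = idm ?W"
  have k: "k \<in> mod_hom (op_ring R) ?W F"
    using short_exactD(4)[OF syz_short_exact[OF K xs]] by (simp add: k_def F_def n_def)
  have kl: "map k ls = ls" using gens_set[OF ls] by (auto simp: k_def intro!: map_idI)
  have si: "stays_inj R F K ?q M \<longleftrightarrow> (\<forall>u\<in>carrier W.T. tmap R ?W M F M k i u = \<one>\<^bsub>F.T\<^esub> \<longrightarrow> u = \<one>\<^bsub>W.T\<^esub>)"
    by (simp only: stays_inj_def kq mk kernel_incl_def k_def i_def)
  have fr: "fin_rel (op_ring R) ?W ls rs" using W ls rs by (simp add: fin_rel_def)
  have tk: "tmap R ?W M F M k i (tsum R ?W M ls y) = tsum R F M ls y" if "y \<in> vecs (carrier M) (length ls)" for y
    using tmap_tsum[OF TW TF k i gens_set[OF ls] vecs_set[OF that]] by (simp add: kl ii vecs_set[OF that])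
  have co: "tsum R F M ls y = \<one>\<^bsub>F.T\<^esub> \<longleftrightarrow> (\<forall>r\<in>set (columns n ls). lc M r y = \<zero>\<^bsub>M\<^esub>)"
    if y: "y \<in> vecs (carrier M) (length ls)" for y
  proof
    assume eq: "tsum R F M ls y = \<one>\<^bsub>F.T\<^esub>"
    show "\<forall>r\<in>set (columns n ls). lc M r y = \<zero>\<^bsub>M\<^esub>"
    proof
      fix r assume "r \<in> set (columns n ls)"
      then obtain j where j: "j < n" "r = map (\<lambda>l. l ! j) ls" by (auto simp: columns_def)
      obtain \<kappa> where \<kappa>: "\<kappa> \<in> hom F.T (add_monoid M)" "\<And>as ys. set as \<subseteq> vecs (carrier R) n \<Longrightarrow> set ys \<subseteq> carrier M \<Longrightarrow>
        \<kappa> (tsum R F M as ys) = lc M (map (\<lambda>a. a ! j) as) ys"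
        using free_tensor_coord[OF TF[unfolded F_def] j(1), folded F_def] by metis
      have "\<kappa> \<one>\<^bsub>F.T\<^esub> = \<zero>\<^bsub>M\<^esub>"
        using hom_one[OF \<kappa>(1) F.T.group_axioms] M.M.a_comm_group by (simp add: comm_group_def)
      then show "lc M r y = \<zero>\<^bsub>M\<^esub>" using \<kappa>(2)[OF lsF vecs_set[OF y]] eq j(2) by simp
    qed
  next
    assume z: "\<forall>r\<in>set (columns n ls). lc M r y = \<zero>\<^bsub>M\<^esub>"
    have "tsum R F M ls y = tsum R F M [] []"
    proof (rule free_tensor_eq[OF M F_def lsF _ vecs_set[OF y]])
      show "lc M (map (\<lambda>a. a ! j) ls) y = lc M (map (\<lambda>a. a ! j) []) []" if "j < n" for j
        using z that by (auto simp: columns_def)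
    qed auto
    then show "tsum R F M ls y = \<one>\<^bsub>F.T\<^esub>" by simp
  qed
  show ?thesis
    unfolding n_def[symmetric] F_def[symmetric] si
  proof
    assume inj: "\<forall>u\<in>carrier W.T. tmap R ?W M F M k i u = \<one>\<^bsub>F.T\<^esub> \<longrightarrow> u = \<one>\<^bsub>W.T\<^esub>"
    show "exact_at M (length rs) (length ls) (columns (length ls) rs) (columns n ls)"
      unfolding exact_at_def
    proof (intro ballI impI)
      fix y assume y: "y \<in> vecs (carrier M) (length ls)" "\<forall>r\<in>set (columns n ls). lc M r y = \<zero>\<^bsub>M\<^esub>"
      then have "tmap R ?W M F M k i (tsum R ?W M ls y) = \<one>\<^bsub>F.T\<^esub>" using co tk by simp
      then have "tsum R ?W M ls y = \<one>\<^bsub>W.T\<^esub>"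
        using inj W.tsum_closed[OF gens_set[OF ls] vecs_set[OF y(1)]] by blast
      then show "\<exists>x\<in>vecs (carrier M) (length rs). map (\<lambda>r. lc M r x) (columns (length ls) rs) = y"
        using tensor_presentation[OF M fr y(1)] by blast
    qed
  next
    assume ex: "exact_at M (length rs) (length ls) (columns (length ls) rs) (columns n ls)"
    show "\<forall>u\<in>carrier W.T. tmap R ?W M F M k i u = \<one>\<^bsub>F.T\<^esub> \<longrightarrow> u = \<one>\<^bsub>W.T\<^esub>"
    proof (intro ballI impI)
      fix u assume u: "u \<in> carrier W.T" "tmap R ?W M F M k i u = \<one>\<^bsub>F.T\<^esub>"
      obtain y where y: "y \<in> vecs (carrier M) (length ls)" "u = tsum R ?W M ls y" using W.tensor_gens[OF ls u(1)] .
      then have "\<forall>r\<in>set (columns n ls). lc M r y = \<zero>\<^bsub>M\<^esub>" using co[OF y(1)] tk[OF y(1)] u(2) by simp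
      then show "u = \<one>\<^bsub>W.T\<^esub>" using ex y tensor_presentation[OF M fr y(1)] unfolding exact_at_def by blast
    qed
  qed
qed

section \<open>Equational criteria and closure under purity\<close>

lemma sfp_gens3:
  assumes "sfp R K"
  obtains xs ls rs where "gens R K xs" "gens R (syz R K xs) ls" "gens R (syz R (syz R K xs) ls) rs"
proof -
  obtain xs where xs: "gens R K xs" "sfp R (syz R K xs)" using sfp_step[OF assms] .
  obtain ls where ls: "gens R (syz R K xs) ls" "sfp R (syz R (syz R K xs) ls)" using sfp_step[OF xs(2)] .
  obtain rs where rs: "gens R (syz R (syz R K xs) ls) rs" using sfp_step[OF ls(2)] .
  show thesis by (rule that[OF xs(1) ls(1) rs])
qed

text \<open>The matrices come from the ring alone and \<open>I\<close> enters only as coefficient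
  module. The same exactness statements can therefore be compared for the three terms of a pure
  exact sequence, which have different types.\<close>

lemma weak_injective_iff:
  fixes S :: "'s ring"
  assumes I: "left_module S I"
  shows "weak_injective S I \<longleftrightarrow> (\<forall>(K :: ('s, 's list) module) xs ls rs. sfp S K \<longrightarrow> gens S K xs \<longrightarrow>
    gens S (syz S K xs) ls \<longrightarrow> gens S (syz S (syz S K xs) ls) rs \<longrightarrow> exact_at I (length xs) (length ls) ls rs)"
    (is "_ \<longleftrightarrow> ?R")
proof
  interpret I: left_module S I by (rule I)
  assume wi: "weak_injective S I"
  show ?R
  proof (intro allI impI)
    fix K :: "('s, 's list) module" and xs ls rs
    assume K: "sfp S K" and g: "gens S K xs" "gens S (syz S K xs) ls" "gens S (syz S (syz S K xs) ls) rs"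
    note KM = sfp_module[OF K]
    show "exact_at I (length xs) (length ls) ls rs"
      using weak_injective_extends[OF wi K free_pow_module[OF I.R.ring_axioms] gens_surj[OF KM g(1)]]
      by (simp only: extends_iff_exact_at[OF KM I g])
  qed
next
  assume R: ?R
  show "weak_injective S I"
  proof (rule weak_injectiveI[OF I])
    fix K :: "('s, 's list) module" assume K: "sfp S K"
    note KM = sfp_module[OF K]
    obtain xs ls rs where g: "gens S K xs" "gens S (syz S K xs) ls" "gens S (syz S (syz S K xs) ls) rs"
      using sfp_gens3[OF K] .
    have "exact_at I (length xs) (length ls) ls rs" using R K g by blast
    then show "\<exists>n q. q \<in> mod_hom S (free_pow S n) K \<and> q ` carrier (free_pow S n) = carrier K \<and>
        extends S (free_pow S n) K q I"
      using gens_surj[OF KM g(1)] extends_iff_exact_at[OF KM I g] by blast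
  qed
qed

lemma weak_flat_iff:
  fixes R :: "'r ring"
  assumes M: "left_module R M"
  shows "weak_flat R M \<longleftrightarrow> (\<forall>(K :: ('r, 'r list) module) xs ls rs. sfp (op_ring R) K \<longrightarrow> gens (op_ring R) K xs \<longrightarrow>
    gens (op_ring R) (syz (op_ring R) K xs) ls \<longrightarrow> gens (op_ring R) (syz (op_ring R) (syz (op_ring R) K xs) ls) rs \<longrightarrow>
    exact_at M (length rs) (length ls) (columns (length ls) rs) (columns (length xs) ls))"
    (is "_ \<longleftrightarrow> ?R")
proof
  interpret M: left_module R M by (rule M)
  assume wf: "weak_flat R M"
  show ?R
  proof (intro allI impI)
    fix K :: "('r, 'r list) module" and xs ls rs
    assume K: "sfp (op_ring R) K" and g: "gens (op_ring R) K xs" "gens (op_ring R) (syz (op_ring R) K xs) ls"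
      "gens (op_ring R) (syz (op_ring R) (syz (op_ring R) K xs) ls) rs"
    note KM = sfp_module[OF K]
    show "exact_at M (length rs) (length ls) (columns (length ls) rs) (columns (length xs) ls)"
      using weak_flat_stays_inj[OF wf K free_pow_module[OF op_ring_ring[OF M.R.ring_axioms]] gens_surj[OF KM g(1)]]
      by (simp only: stays_inj_iff_exact_at[OF KM M g] op_ring_simps)
  qed
next
  assume R: ?R
  show "weak_flat R M"
  proof (rule weak_flatI[OF M])
    fix K :: "('r, 'r list) module" assume K: "sfp (op_ring R) K"
    note KM = sfp_module[OF K]
    obtain xs ls rs where g: "gens (op_ring R) K xs" "gens (op_ring R) (syz (op_ring R) K xs) ls"
      "gens (op_ring R) (syz (op_ring R) (syz (op_ring R) K xs) ls) rs"
      using sfp_gens3[OF K] .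
    have "exact_at M (length rs) (length ls) (columns (length ls) rs) (columns (length xs) ls)" using R K g by blast
    then show "\<exists>n q. q \<in> mod_hom (op_ring R) (free_pow (op_ring R) n) K \<and>
        q ` carrier (free_pow (op_ring R) n) = carrier K \<and> stays_inj R (free_pow (op_ring R) n) K q M"
      using gens_surj[OF KM g(1)] stays_inj_iff_exact_at[OF KM M g] by (metis op_ring_simps(1))
  qed
qed

lemma gens_syz_vecs: "gens R (syz R K xs) ls \<Longrightarrow> set ls \<subseteq> vecs (carrier R) (length xs)"
  using gens_set by fastforce

lemma weak_injective_pure_sub:
  assumes "weak_injective S B" "left_module S A" "f \<in> mod_hom S A B" "sys_pure S A f B"
  shows "weak_injective S A"
proof -
  have B: "left_module S B" using assms(1) by (simp add: weak_injective_def)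
  show ?thesis
    using assms(1) unfolding weak_injective_iff[OF B] weak_injective_iff[OF assms(2)]
    by (meson exact_at_sub[OF assms(2) B assms(3,4)] gens_syz_vecs)
qed

lemma weak_injective_pure_quotient:
  assumes "weak_injective S B" "short_exact S A f B g D" "sys_pure S A f B"
  shows "weak_injective S D"
  using assms(1)
  unfolding weak_injective_iff[OF short_exactD(2)[OF assms(2)]] weak_injective_iff[OF short_exactD(3)[OF assms(2)]]
  by (meson exact_at_quotient[OF assms(2,3)] gens_syz_vecs)

lemma gens_syz_columns:
  assumes "gens (op_ring R) (syz (op_ring R) K xs) ls"
  shows "set (columns (length xs) ls) \<subseteq> vecs (carrier R) (length ls)"
  using columns_vecs[OF gens_syz_vecs[OF assms]] by simp

lemma weak_flat_pure_sub:
  assumes "weak_flat R B" "left_module R A" "f \<in> mod_hom R A B" "sys_pure R A f B"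
  shows "weak_flat R A"
proof -
  have B: "left_module R B" using assms(1) by (simp add: weak_flat_def)
  show ?thesis
    using assms(1) unfolding weak_flat_iff[OF B] weak_flat_iff[OF assms(2)]
    by (intro allI impI exact_at_sub[OF assms(2) B assms(3,4)] gens_syz_columns length_columns) blast+
qed

lemma weak_flat_pure_quotient:
  assumes "weak_flat R B" "short_exact R A f B g D" "sys_pure R A f B"
  shows "weak_flat R D"
  using assms(1)
  unfolding weak_flat_iff[OF short_exactD(2)[OF assms(2)]] weak_flat_iff[OF short_exactD(3)[OF assms(2)]]
  by (intro allI impI exact_at_quotient[OF assms(2,3)] gens_syz_columns length_columns) blast+

text \<open>An isomorphism is in particular a pure embedding, so invariance of weak flatness and
  weak injectivity under isomorphism is an instance of closure under pure submodules.\<close>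

lemma sys_pure_iso:
  assumes A: "left_module R A" and B: "left_module R B" and f: "f \<in> mod_hom R A B" "bij_betw f (carrier A) (carrier B)"
  shows "sys_pure R A f B"
  unfolding sys_pure_def
proof (intro allI impI)
  interpret A: left_module R A by (rule A)
  fix n G a b
  assume G: "set G \<subseteq> vecs (carrier R) n" and a: "a \<in> vecs (carrier A) (length G)"
    and b: "b \<in> vecs (carrier B) n" and eq: "map (\<lambda>r. lc B r b) G = map f a"
  have f': "f ` carrier A = carrier B" "inj_on f (carrier A)" using f(2) by (auto simp: bij_betw_def)
  obtain x where x: "set x \<subseteq> carrier A" "map f x = b" using lift_list[OF f'(1) vecs_set[OF b]] by metis
  have xn: "x \<in> vecs (carrier A) n" using x vecs_length[OF b] by (auto simp: vecs_def)
  have Gs: "set r \<subseteq> carrier R" if "r \<in> set G" for r using G that by (auto simp: vecs_def)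
  have "map f (map (\<lambda>r. lc A r x) G) = map f a"
    using eq mod_hom_lc[OF A B f(1) Gs x(1)] x(2) by (simp cong: map_cong)
  moreover have "set (map (\<lambda>r. lc A r x) G) \<subseteq> carrier A" using Gs x(1) by auto
  ultimately have "map (\<lambda>r. lc A r x) G = a"
    using f'(2) vecs_set[OF a] by (metis Un_least inj_on_subset map_inj_on)
  with xn show "\<exists>x\<in>vecs (carrier A) n. map (\<lambda>r. lc A r x) G = a" by blast
qed

lemma weak_flat_iso:
  assumes "weak_flat R B" "left_module R A" "f \<in> mod_hom R A B" "bij_betw f (carrier A) (carrier B)"
  shows "weak_flat R A"
  using weak_flat_pure_sub[OF assms(1-3) sys_pure_iso[OF assms(2) _ assms(3,4)]] assms(1) by (simp add: weak_flat_def)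

lemma weak_flat_isomorphic:
  assumes "weak_flat R B" "left_module R A" "mod_isomorphic R A B" shows "weak_flat R A"
  using assms weak_flat_iso unfolding mod_isomorphic_def by blast

lemma weak_injective_iso:
  assumes "weak_injective R B" "left_module R A" "f \<in> mod_hom R A B" "bij_betw f (carrier A) (carrier B)"
  shows "weak_injective R A"
  using weak_injective_pure_sub[OF assms(1-3) sys_pure_iso[OF assms(2) _ assms(3,4)]] assms(1)
  by (simp add: weak_injective_def)

section \<open>Homomorphisms and tensors on powers\<close>

text \<open>The homomorphism on a power of \<open>C\<close> with components \<open>hs\<close>,
  evaluated at a vector.\<close>

fun ev :: "('s, 'i) module \<Rightarrow> ('c \<Rightarrow> 'i) list \<Rightarrow> 'c list \<Rightarrow> 'i" where
  "ev I (h # hs) (z # zs) = h z \<oplus>\<^bsub>I\<^esub> ev I hs zs"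
| "ev I _ _ = \<zero>\<^bsub>I\<^esub>"

lemma ev_closed:
  assumes "left_module R I" "set hs \<subseteq> mod_hom R C I" "set zs \<subseteq> carrier C"
  shows "ev I hs zs \<in> carrier I"
proof -
  interpret I: left_module R I by fact
  show ?thesis using assms(2,3)
    by (induction hs zs rule: list_induct2') (auto simp: mod_hom_closed)
qed

lemma ev_smult:
  assumes "left_module R I" "left_module R C" "set hs \<subseteq> mod_hom R C I" "set zs \<subseteq> carrier C" "a \<in> carrier R"
  shows "ev I hs (map (\<lambda>z. a \<odot>\<^bsub>C\<^esub> z) zs) = a \<odot>\<^bsub>I\<^esub> ev I hs zs"
proof -
  interpret I: left_module R I by fact
  show ?thesis using assms(3,4)
    by (induction hs zs rule: list_induct2')
       (auto simp: I.smult_zero_r assms(5) mod_hom_smult mod_hom_closed I.smult_r_distr ev_closed[OF assms(1)])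
qed

lemma ev_add:
  assumes "left_module R I" "left_module R C" "length hs = length zs" "length zs = length ws"
    "set hs \<subseteq> mod_hom R C I" "set zs \<subseteq> carrier C" "set ws \<subseteq> carrier C"
  shows "ev I hs (map2 (ring.add C) zs ws) = ev I hs zs \<oplus>\<^bsub>I\<^esub> ev I hs ws"
proof -
  interpret I: left_module R I by fact
  show ?thesis using assms(3-7)
  proof (induction hs zs ws rule: list_induct3)
    case (Cons h hs z zs w ws)
    have "h \<in> mod_hom R C I" using Cons.prems by simp
    note h = mod_hom_closed[OF this] mod_hom_add[OF this]
    have c: "ev I hs zs \<in> carrier I" "ev I hs ws \<in> carrier I"
      using Cons.prems by (auto intro!: ev_closed[OF assms(1)])
    show ?case using Cons h c by (simp add: I.M.a_ac)
  qed simp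
qed

lemma ev_hom:
  assumes I: "left_module R I" and C: "left_module R C" and hs: "hs \<in> vecs (mod_hom R C I) n"
  shows "restrict (ev I hs) (vecs (carrier C) n) \<in> mod_hom R (pow_mod C n) I"
proof -
  note h = vecs_set[OF hs] vecs_length[OF hs]
  have "restrict (ev I hs) (carrier (pow_mod C n)) \<in> mod_hom R (pow_mod C n) I"
  proof (rule mod_hom_restrictI[OF pow_mod_module[OF C]])
    show "ev I hs (a \<odot>\<^bsub>pow_mod C n\<^esub> z) = a \<odot>\<^bsub>I\<^esub> ev I hs z" if "a \<in> carrier R" "z \<in> carrier (pow_mod C n)" for a z
      using ev_smult[OF I C h(1), of z a] that by (simp add: vecs_set)
    show "ev I hs (z \<oplus>\<^bsub>pow_mod C n\<^esub> w) = ev I hs z \<oplus>\<^bsub>I\<^esub> ev I hs w"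
      if "z \<in> carrier (pow_mod C n)" "w \<in> carrier (pow_mod C n)" for z w
      using ev_add[OF I C _ _ h(1), of z w] that h(2) by (simp add: vecs_def)
  qed (use ev_closed[OF I h(1)] in \<open>simp add: vecs_set\<close>)
  then show ?thesis by simp
qed

lemma cons_zero_hom:
  assumes C: "left_module R C"
  shows "restrict (\<lambda>x. x # replicate n \<zero>\<^bsub>C\<^esub>) (carrier C) \<in> mod_hom R C (pow_mod C (Suc n))"
    "restrict (\<lambda>z. \<zero>\<^bsub>C\<^esub> # z) (vecs (carrier C) n) \<in> mod_hom R (pow_mod C n) (pow_mod C (Suc n))"
    "restrict tl (vecs (carrier C) (Suc n)) \<in> mod_hom R (pow_mod C (Suc n)) (pow_mod C n)"
proof -
  interpret C: left_module R C by (rule C)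
  show "restrict (\<lambda>x. x # replicate n \<zero>\<^bsub>C\<^esub>) (carrier C) \<in> mod_hom R C (pow_mod C (Suc n))"
    "restrict tl (vecs (carrier C) (Suc n)) \<in> mod_hom R (pow_mod C (Suc n)) (pow_mod C n)"
    using short_exactD(4,5)[OF pow_mod_Suc_exact[OF C, of n]] .
  have "restrict (\<lambda>z. \<zero>\<^bsub>C\<^esub> # z) (carrier (pow_mod C n)) \<in> mod_hom R (pow_mod C n) (pow_mod C (Suc n))"
    by (rule mod_hom_restrictI[OF pow_mod_module[OF C]]) (auto simp: C.smult_zero_r)
  then show "restrict (\<lambda>z. \<zero>\<^bsub>C\<^esub> # z) (vecs (carrier C) n) \<in> mod_hom R (pow_mod C n) (pow_mod C (Suc n))" by simp
qed

lemma cons_split: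
  assumes C: "left_module R C" and "x \<in> carrier C" "z \<in> vecs (carrier C) n"
  shows "x # z = (x # replicate n \<zero>\<^bsub>C\<^esub>) \<oplus>\<^bsub>pow_mod C (Suc n)\<^esub> (\<zero>\<^bsub>C\<^esub> # z)"
proof -
  interpret C: left_module R C by (rule C)
  have "map2 (ring.add C) (replicate n \<zero>\<^bsub>C\<^esub>) z = z"
    using assms(3) by (auto simp: vecs_iff_nth intro!: nth_equalityI)
  then show ?thesis using assms(2) by simp
qed

text \<open>The components are obtained by splitting off one factor of the power at a time:
  \<open>x # z\<close> is the sum of \<open>x\<close> padded with zeros and of \<open>z\<close>
  preceded by zero.\<close>

lemma hom_as_ev:
  assumes I: "left_module R I" and C: "left_module R C" and \<phi>: "\<phi> \<in> mod_hom R (pow_mod C n) I"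
  obtains hs where "hs \<in> vecs (mod_hom R C I) n" "\<And>z. z \<in> vecs (carrier C) n \<Longrightarrow> ev I hs z = \<phi> z"
proof -
  have "\<exists>hs\<in>vecs (mod_hom R C I) n. \<forall>z\<in>vecs (carrier C) n. ev I hs z = \<phi> z"
    using \<phi>
  proof (induction n arbitrary: \<phi>)
    case 0
    then show ?case using mod_hom_zero[OF pow_mod_module[OF C] I 0] by simp
  next
    case (Suc n)
    interpret C: left_module R C by (rule C)
    note h = cons_zero_hom[OF C, of n]
    let ?h = "compose (carrier C) \<phi> (restrict (\<lambda>x. x # replicate n \<zero>\<^bsub>C\<^esub>) (carrier C))"
    let ?\<phi> = "compose (vecs (carrier C) n) \<phi> (restrict (\<lambda>z. \<zero>\<^bsub>C\<^esub> # z) (vecs (carrier C) n))"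
    have h1: "?h \<in> mod_hom R C I" by (rule mod_hom_compose[OF C h(1) Suc.prems])
    have "?\<phi> \<in> mod_hom R (pow_mod C n) I" using mod_hom_compose[OF pow_mod_module[OF C] h(2) Suc.prems] by simp
    from Suc.IH[OF this] obtain hs where hs: "hs \<in> vecs (mod_hom R C I) n"
      "\<And>z. z \<in> vecs (carrier C) n \<Longrightarrow> ev I hs z = ?\<phi> z" by blast
    have "ev I (?h # hs) z = \<phi> z" if z: "z \<in> vecs (carrier C) (Suc n)" for z
    proof -
      obtain x z' where xz: "z = x # z'" "x \<in> carrier C" "z' \<in> vecs (carrier C) n" using z by (auto simp: vecs_Suc_iff)
      have "\<phi> z = \<phi> (x # replicate n \<zero>\<^bsub>C\<^esub>) \<oplus>\<^bsub>I\<^esub> \<phi> (\<zero>\<^bsub>C\<^esub> # z')"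
        unfolding xz(1) cons_split[OF C xz(2,3)]
        using xz by (intro mod_hom_add[OF Suc.prems]) (auto simp: vecs_replicate)
      then show ?thesis using xz hs(2)[OF xz(3)] by (simp add: compose_eq)
    qed
    then show ?case using hs(1) h1 by (intro bexI[of _ "?h # hs"]) auto
  qed
  then show thesis using that by blast
qed

section \<open>Coordinates on the tensor product with a power\<close>

definition coord :: "('r, 'c) module \<Rightarrow> nat \<Rightarrow> nat \<Rightarrow> 'c list \<Rightarrow> 'c" where
  "coord C n i = restrict (\<lambda>v. v ! i) (vecs (carrier C) n)"

abbreviation tcoord where
  "tcoord R C F n i \<equiv> tmap R (pow_mod C n) F C F (coord C n i) (idm F)"

lemma coord_is_hom: "left_module R C \<Longrightarrow> i < n \<Longrightarrow> coord C n i \<in> mod_hom R (pow_mod C n) C"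
  unfolding coord_def by (rule coord_hom)

text \<open>Both sides are additive in \<open>w\<close>, so it suffices to split the left factor of
  an elementary tensor into its first entry and its tail.\<close>

lemma pow_tensor_split:
  assumes C: "left_module (op_ring R) C" and F: "left_module R F"
    and w: "w \<in> carrier (tensor_group R (pow_mod C (Suc n)) F)"
  shows "w = tmap R C F (pow_mod C (Suc n)) F (restrict (\<lambda>x. x # replicate n \<zero>\<^bsub>C\<^esub>) (carrier C)) (idm F)
        (tcoord R C F (Suc n) 0 w) \<otimes>\<^bsub>tensor_group R (pow_mod C (Suc n)) F\<^esub>
      tmap R (pow_mod C n) F (pow_mod C (Suc n)) F (restrict (\<lambda>z. \<zero>\<^bsub>C\<^esub> # z) (vecs (carrier C) n)) (idm F)
        (tmap R (pow_mod C (Suc n)) F (pow_mod C n) F (restrict tl (vecs (carrier C) (Suc n))) (idm F) w)"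
proof -
  note P = pow_mod_module[OF C]
  note TC = tensor_pairI[OF C F] and TP = tensor_pairI[OF P F]
  interpret A: tensor_pair R "pow_mod C (Suc n)" F by (rule TP)
  note h = cons_zero_hom[OF C, of n] and c0 = coord_is_hom[OF C zero_less_Suc, of n] and id = mod_hom_id[OF F]
  note t1 = tmap_hom[OF TC TP h(1) id] tmap_hom[OF TP TC c0 id] tmap_hom[OF TP TP h(2) id] tmap_hom[OF TP TP h(3) id]
  note e1 = tmap_tens[OF TC TP h(1) id] tmap_tens[OF TP TC c0 id] tmap_tens[OF TP TP h(2) id] tmap_tens[OF TP TP h(3) id]
  define L where "L w = tmap R C F (pow_mod C (Suc n)) F (restrict (\<lambda>x. x # replicate n \<zero>\<^bsub>C\<^esub>) (carrier C)) (idm F)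
        (tcoord R C F (Suc n) 0 w)" for w
  define L' where "L' w = tmap R (pow_mod C n) F (pow_mod C (Suc n)) F (restrict (\<lambda>z. \<zero>\<^bsub>C\<^esub> # z) (vecs (carrier C) n)) (idm F)
        (tmap R (pow_mod C (Suc n)) F (pow_mod C n) F (restrict tl (vecs (carrier C) (Suc n))) (idm F) w)" for w
  have L: "L \<in> hom A.T A.T" "L' \<in> hom A.T A.T"
    using hom_compose[OF t1(2,1)] hom_compose[OF t1(4,3)] by (simp_all add: L_def[abs_def] L'_def[abs_def] comp_def)
  have LL: "(\<lambda>w. L w \<otimes>\<^bsub>A.T\<^esub> L' w) \<in> hom A.T A.T"
    by (rule homI) (use hom_in_carrier[OF L(1)] hom_in_carrier[OF L(2)] in
      \<open>simp_all add: hom_mult[OF L(1)] hom_mult[OF L(2)] A.T.m_ac\<close>)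
  have "(\<lambda>w. w) w = (\<lambda>w. L w \<otimes>\<^bsub>A.T\<^esub> L' w) w"
  proof (rule A.tensor_hom_eqI[OF A.T.group_axioms _ LL _ w])
    show "(\<lambda>w. w) \<in> hom A.T A.T" by (simp add: hom_def)
    fix z y assume zy: "z \<in> carrier (pow_mod C (Suc n))" "y \<in> carrier F"
    then obtain x z' where xz: "z = x # z'" "x \<in> carrier C" "z' \<in> vecs (carrier C) n" by (auto simp: vecs_Suc_iff)
    interpret C: left_module "op_ring R" C by (rule C)
    have c: "x # replicate n \<zero>\<^bsub>C\<^esub> \<in> carrier (pow_mod C (Suc n))" "\<zero>\<^bsub>C\<^esub> # z' \<in> carrier (pow_mod C (Suc n))"
      using xz by (auto simp: vecs_replicate)
    have "coord C (Suc n) 0 z = x" using xz by (simp add: coord_def)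
    then have "L (A.t z y) = A.t (x # replicate n \<zero>\<^bsub>C\<^esub>) y"
      using e1(2)[OF zy] e1(1)[OF xz(2) zy(2)] xz(2) zy(2) by (simp add: L_def)
    moreover have "restrict tl (vecs (carrier C) (Suc n)) z = z'" using xz by simp
    then have "L' (A.t z y) = A.t (\<zero>\<^bsub>C\<^esub> # z') y"
      using e1(4)[OF zy] e1(3)[of z' y] xz(3) zy(2) by (simp add: L'_def)
    moreover have "A.t z y = A.t (x # replicate n \<zero>\<^bsub>C\<^esub>) y \<otimes>\<^bsub>A.T\<^esub> A.t (\<zero>\<^bsub>C\<^esub> # z') y"
      unfolding xz(1) cons_split[OF C xz(2,3)] using c zy(2) by (rule A.t_add_left)
    ultimately show "A.t z y = L (A.t z y) \<otimes>\<^bsub>A.T\<^esub> L' (A.t z y)" by simp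
  qed
  then show ?thesis by (simp add: L_def L'_def)
qed

text \<open>The injective half of the identification of the tensor product of a power of
  \<open>C\<close> and \<open>F\<close> with a power of \<open>C \<otimes> F\<close>. If the
  coordinates vanish, both parts in \<open>pow_tensor_split\<close> do, the second one by
  induction.\<close>

lemma pow_tensor_trivial:
  assumes C: "left_module (op_ring R) C" and F: "left_module R F"
  shows "w \<in> carrier (tensor_group R (pow_mod C n) F) \<Longrightarrow>
    (\<And>i. i < n \<Longrightarrow> tcoord R C F n i w = \<one>\<^bsub>tensor_group R C F\<^esub>) \<Longrightarrow>
    w = \<one>\<^bsub>tensor_group R (pow_mod C n) F\<^esub>"
proof (induction n arbitrary: w)
  case 0
  interpret A: tensor_pair R "pow_mod C 0" F by (rule tensor_pairI[OF pow_mod_module[OF C] F])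
  have "A.t x y = \<one>\<^bsub>A.T\<^esub>" if "x \<in> carrier (pow_mod C 0)" "y \<in> carrier F" for x y
    using that A.t_zero_left[OF that(2)] by simp
  then show ?case using A.tensor_hom_eqI[OF A.T.group_axioms, of "\<lambda>w. w" "\<lambda>_. \<one>\<^bsub>A.T\<^esub>" w] 0(1) by (simp add: hom_def)
next
  case (Suc n)
  note P = pow_mod_module[OF C]
  note TC = tensor_pairI[OF C F] and TP = tensor_pairI[OF P F]
  interpret A: tensor_pair R "pow_mod C (Suc n)" F by (rule TP)
  note h = cons_zero_hom[OF C, of n] and id = mod_hom_id[OF F]
  let ?w' = "tmap R (pow_mod C (Suc n)) F (pow_mod C n) F (restrict tl (vecs (carrier C) (Suc n))) (idm F) w"
  have "?w' \<in> carrier (tensor_group R (pow_mod C n) F)"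
    by (rule hom_in_carrier[OF tmap_hom[OF TP TP h(3) id] Suc.prems(1)])
  moreover have "tcoord R C F n i ?w' = \<one>\<^bsub>tensor_group R C F\<^esub>" if i: "i < n" for i
  proof -
    have "tcoord R C F n i ?w' =
        tmap R (pow_mod C (Suc n)) F C F (coord C (Suc n) (Suc i)) (idm F) w"
      using i by (intro tmap_compose[OF TP TP TC h(3) id coord_is_hom[OF C i] id coord_is_hom[OF C] id _ _ Suc.prems(1)])
        (auto simp: coord_def vecs_Suc_iff)
    then show ?thesis using Suc.prems(2)[of "Suc i"] i by simp
  qed
  ultimately have "?w' = \<one>\<^bsub>tensor_group R (pow_mod C n) F\<^esub>" by (rule Suc.IH)
  then show ?case
    using pow_tensor_split[OF C F Suc.prems(1)] Suc.prems(2)[of 0]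
      tmap_one[OF TP TP h(2) id] tmap_one[OF TC TP h(1) id] by simp
qed

text \<open>The surjective half of the same identification: \<open>z\<close> is placed in the first
  factor and the tensor found for the tail in the remaining ones; each coordinate sees exactly one
  of the two.\<close>

lemma pow_tensor_exists:
  assumes C: "left_module (op_ring R) C" and F: "left_module R F"
  shows "zs \<in> vecs (carrier (tensor_group R C F)) n \<Longrightarrow>
    \<exists>w\<in>carrier (tensor_group R (pow_mod C n) F). \<forall>i<n. tcoord R C F n i w = zs ! i"
proof (induction n arbitrary: zs)
  case 0
  interpret A: tensor_pair R "pow_mod C 0" F by (rule tensor_pairI[OF pow_mod_module[OF C] F])
  show ?case by (intro bexI[of _ "\<one>\<^bsub>A.T\<^esub>"]) auto
next
  case (Suc n)
  interpret C: left_module "op_ring R" C by (rule C)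
  note P = pow_mod_module[OF C]
  note TC = tensor_pairI[OF C F] and TP = tensor_pairI[OF P F]
  interpret A: tensor_pair R "pow_mod C (Suc n)" F by (rule TP)
  interpret B: tensor_pair R C F by (rule TC)
  note h = cons_zero_hom[OF C, of n] and id = mod_hom_id[OF F]
  obtain z zs' where z: "zs = z # zs'" "z \<in> carrier B.T" "zs' \<in> vecs (carrier B.T) n"
    using Suc.prems by (auto simp: vecs_Suc_iff)
  obtain w where w: "w \<in> carrier (tensor_group R (pow_mod C n) F)"
    "\<And>i. i < n \<Longrightarrow> tcoord R C F n i w = zs' ! i" using Suc.IH[OF z(3)] by blast
  let ?a = "tmap R C F (pow_mod C (Suc n)) F (restrict (\<lambda>x. x # replicate n \<zero>\<^bsub>C\<^esub>) (carrier C)) (idm F) z"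
  let ?b = "tmap R (pow_mod C n) F (pow_mod C (Suc n)) F (restrict (\<lambda>z. \<zero>\<^bsub>C\<^esub> # z) (vecs (carrier C) n)) (idm F) w"
  have a: "?a \<in> carrier A.T" by (rule hom_in_carrier[OF tmap_hom[OF TC TP h(1) id] z(2)])
  have b: "?b \<in> carrier A.T" by (rule hom_in_carrier[OF tmap_hom[OF TP TP h(2) id] w(1)])

  have "tcoord R C F (Suc n) i (?a \<otimes>\<^bsub>A.T\<^esub> ?b) = zs ! i" if i: "i < Suc n" for i
  proof -
    note ci = coord_is_hom[OF C i]
    have 1: "tcoord R C F (Suc n) i (?a \<otimes>\<^bsub>A.T\<^esub> ?b) =
      tcoord R C F (Suc n) i ?a \<otimes>\<^bsub>B.T\<^esub>
      tcoord R C F (Suc n) i ?b"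
      using a b by (rule hom_mult[OF tmap_hom[OF TP TC ci id]])
    show ?thesis
    proof (cases i)
      case 0
      have "tcoord R C F (Suc n) i ?a = tmap R C F C F (idm C) (idm F) z"
        using 0 by (intro tmap_compose[OF TC TP TC h(1) id ci id mod_hom_id[OF C] id _ _ z(2)])
          (auto simp: coord_def vecs_replicate)
      moreover have "\<dots> = z" by (rule tmap_id[OF TC mod_hom_id[OF C] id _ _ z(2)]) auto
      moreover have "tcoord R C F (Suc n) i ?b = \<one>\<^bsub>B.T\<^esub>"
        using 0 by (intro tmap_compose_zero[OF TP TP TC h(2) id ci id _ w(1)]) (auto simp: coord_def)
      ultimately show ?thesis using 1 z 0 by simp
    next
      case (Suc j)
      then have j: "j < n" using i by simp
      have "tcoord R C F (Suc n) i ?a = \<one>\<^bsub>B.T\<^esub>"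
        using Suc j by (intro tmap_compose_zero[OF TC TP TC h(1) id ci id _ z(2)])
          (auto simp: coord_def vecs_replicate)
      moreover have "tcoord R C F (Suc n) i ?b =
          tcoord R C F n j w"
        using Suc by (intro tmap_compose[OF TP TP TC h(2) id ci id coord_is_hom[OF C j] id _ _ w(1)]) (auto simp: coord_def)
      ultimately show ?thesis using 1 z Suc w(2)[OF j] vecs_nth[OF z(3) j] by simp
    qed
  qed
  then show ?case using a b by blast
qed

section \<open>The coresolution of the ring by powers of a semidualizing bimodule\<close>

text \<open>One abelian group with two commuting actions, both written on the left. For the bimodule
  \<open>C\<close> the rings are \<open>S\<close> and \<open>op_ring R\<close> in either order, so
  that everything proved here serves both sides.\<close>

locale biaction = CT: left_module Tr CT + CU: left_module U CU
  for Tr :: "'t ring" and CT :: "('t, 'c) module" and U :: "'u ring" and CU :: "('u, 'c) module" +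
  assumes carrier_eq: "carrier CU = carrier CT" and add_eq: "ring.add CU = ring.add CT"
    and zero_eq: "\<zero>\<^bsub>CU\<^esub> = \<zero>\<^bsub>CT\<^esub>"
    and act_comm: "\<And>a b c. a \<in> carrier Tr \<Longrightarrow> b \<in> carrier U \<Longrightarrow> c \<in> carrier CT \<Longrightarrow>
      b \<odot>\<^bsub>CU\<^esub> (a \<odot>\<^bsub>CT\<^esub> c) = a \<odot>\<^bsub>CT\<^esub> (b \<odot>\<^bsub>CU\<^esub> c)"
begin

text \<open>A matrix over \<open>U\<close> acting between powers of \<open>C\<close>; it is linear
  over the other ring because the actions commute.\<close>

definition rowmap :: "nat \<Rightarrow> 'u list list \<Rightarrow> 'c list \<Rightarrow> 'c list" where
  "rowmap n G = restrict (\<lambda>z. map (\<lambda>r. lc CU r z) G) (vecs (carrier CT) n)"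

lemma lc_U_closed: "set r \<subseteq> carrier U \<Longrightarrow> set z \<subseteq> carrier CT \<Longrightarrow> lc CU r z \<in> carrier CT"
  using CU.lc_closed[of r z] carrier_eq by simp

lemma lc_U_smult: "set r \<subseteq> carrier U \<Longrightarrow> set z \<subseteq> carrier CT \<Longrightarrow> a \<in> carrier Tr \<Longrightarrow>
  lc CU r (map (\<lambda>c. a \<odot>\<^bsub>CT\<^esub> c) z) = a \<odot>\<^bsub>CT\<^esub> lc CU r z"
proof (induction r z rule: list_induct2')
  case (4 x r y z)
  then have "x \<odot>\<^bsub>CU\<^esub> y \<in> carrier CT" using CU.smult_closed[of x y] carrier_eq by simp
  then show ?case using 4 lc_U_closed[of r z] by (simp add: add_eq act_comm CT.smult_r_distr)
qed (simp_all add: zero_eq CT.smult_zero_r)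

lemma lc_U_add: "length r = length z \<Longrightarrow> length z = length w \<Longrightarrow>
  set r \<subseteq> carrier U \<Longrightarrow> set z \<subseteq> carrier CT \<Longrightarrow> set w \<subseteq> carrier CT \<Longrightarrow>
  lc CU r (map2 (ring.add CT) z w) = lc CU r z \<oplus>\<^bsub>CT\<^esub> lc CU r w"
  using CU.lc_add_right[of r z w] carrier_eq add_eq by simp

lemma rowmap_hom:
  assumes G: "set G \<subseteq> vecs (carrier U) n"
  shows "rowmap n G \<in> mod_hom Tr (pow_mod CT n) (pow_mod CT (length G))"
proof -
  have "restrict (\<lambda>z. map (\<lambda>r. lc CU r z) G) (carrier (pow_mod CT n)) \<in> mod_hom Tr (pow_mod CT n) (pow_mod CT (length G))"
  proof (rule mod_hom_restrictI[OF pow_mod_module[OF CT.left_module_axioms]])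
    fix z assume z: "z \<in> carrier (pow_mod CT n)"
    then show "map (\<lambda>r. lc CU r z) G \<in> carrier (pow_mod CT (length G))"
      using lc_U_closed G by (auto simp: vecs_def subset_iff)
    {
      fix w assume w: "w \<in> carrier (pow_mod CT n)"
      have lin: "lc CU r (map2 (ring.add CT) z w) = lc CU r z \<oplus>\<^bsub>CT\<^esub> lc CU r w" if "r \<in> set G" for r
        using z w subsetD[OF G that] by (intro lc_U_add) (auto simp: vecs_def)
      then show "map (\<lambda>r. lc CU r (z \<oplus>\<^bsub>pow_mod CT n\<^esub> w)) G =
          map (\<lambda>r. lc CU r z) G \<oplus>\<^bsub>pow_mod CT (length G)\<^esub> map (\<lambda>r. lc CU r w) G"
        using lin[OF nth_mem] by (auto intro!: nth_equalityI)
    }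
    fix a assume a: "a \<in> carrier Tr"
    have "lc CU r (map (\<lambda>c. a \<odot>\<^bsub>CT\<^esub> c) z) = a \<odot>\<^bsub>CT\<^esub> lc CU r z" if "r \<in> set G" for r
      using z a subsetD[OF G that] by (intro lc_U_smult) (auto simp: vecs_def)
    then show "map (\<lambda>r. lc CU r (a \<odot>\<^bsub>pow_mod CT n\<^esub> z)) G = a \<odot>\<^bsub>pow_mod CT (length G)\<^esub> map (\<lambda>r. lc CU r z) G"
      by simp
  qed
  then show ?thesis by (simp add: rowmap_def)
qed

end

text \<open>
  For generators \<^term>\<open>cs\<close> of \<open>C\<close> over \<open>U\<close> with relations \<^term>\<open>sg\<close>, the functor
  \<open>Hom\<^sub>U(-, C)\<close> turns the presentation \<open>U\<^sup>m \<rightarrow> U\<^sup>n \<rightarrow> C \<rightarrow> 0\<close> into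
  \<open>0 \<rightarrow> T \<rightarrow> C\<^sup>n \<rightarrow> C\<^sup>m\<close>, because \<open>T = Hom\<^sub>U(C, C)\<close>. Over \<open>T\<close> the image and
  the cokernel of the last map are again infinitely presented.
\<close>

locale coresolution = biaction Tr CT U CU
  for Tr :: "'t ring" and CT :: "('t, 'c) module" and U :: "'u ring" and CU :: "('u, 'c) module" +
  fixes cs :: "'c list" and sg :: "'u list list"
  assumes sfp_CT: "sfp Tr CT"
    and homothety: "bij_betw (\<lambda>a. \<lambda>c\<in>carrier CT. a \<odot>\<^bsub>CT\<^esub> c) (carrier Tr) (mod_hom U CU CU)"
    and gens_cs: "gens U CU cs" and gens_sg: "gens U (syz U CU cs) sg"
begin

definition n where "n = length cs"
definition m where "m = length sg"

definition sigma where
  "sigma = restrict (\<lambda>z. map (\<lambda>r. lc CU r z) sg) (vecs (carrier CT) n)"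

text \<open>The homothety by \<open>a\<close>, recorded by its values on the generators
  \<open>cs\<close>. In particular the unit of the ring corresponds to the vector \<open>cs\<close>
  itself.\<close>

definition iota where
  "iota = restrict (\<lambda>a. map (\<lambda>c. a \<odot>\<^bsub>CT\<^esub> c) cs) (carrier Tr)"

definition J where
  "J = (pow_mod CT m)\<lparr>carrier := sigma ` vecs (carrier CT) n\<rparr>"

lemma cs_set: "set cs \<subseteq> carrier CT" using gens_set[OF gens_cs] carrier_eq by simp

lemma cs_vecs: "cs \<in> vecs (carrier CT) n" using cs_set by (simp add: n_def vecsI)

lemma sg_set: "r \<in> set sg \<Longrightarrow> r \<in> vecs (carrier U) n \<and> lc CU r cs = \<zero>\<^bsub>CT\<^esub>"
  using gens_set[OF gens_sg] zero_eq by (auto simp: n_def)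

lemma sigma_rowmap: "sigma = rowmap n sg"
  by (simp add: sigma_def rowmap_def)

lemma sigma_hom: "sigma \<in> mod_hom Tr (pow_mod CT n) (pow_mod CT m)"
  unfolding sigma_rowmap m_def using sg_set by (intro rowmap_hom) auto

lemma J_submodule: "submodule (sigma ` vecs (carrier CT) n) Tr (pow_mod CT m)"
  using mod_image_submodule[OF pow_mod_module[OF CT.left_module_axioms] pow_mod_module[OF CT.left_module_axioms] sigma_hom]
  by simp

lemma J_module: "left_module Tr J"
  unfolding J_def by (rule left_module.left_submodule_is_module[OF pow_mod_module[OF CT.left_module_axioms] J_submodule])

lemma J_simps [simp]: "carrier J = sigma ` vecs (carrier CT) n" "\<zero>\<^bsub>J\<^esub> = replicate m \<zero>\<^bsub>CT\<^esub>"
  by (simp_all add: J_def)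

lemma sigma_hom_J: "sigma \<in> mod_hom Tr (pow_mod CT n) J"
  using sigma_hom by (auto simp: mod_hom_def PiE_iff J_def)

lemma iota_hom: "iota \<in> mod_hom Tr (reg_mod Tr) (pow_mod CT n)"
proof -
  have c: "c \<in> carrier CT" if "c \<in> set cs" for c using that cs_set by auto
  have "restrict (\<lambda>a. map (\<lambda>c. a \<odot>\<^bsub>CT\<^esub> c) cs) (carrier (reg_mod Tr)) \<in> mod_hom Tr (reg_mod Tr) (pow_mod CT n)"
    by (rule mod_hom_restrictI[OF reg_mod_module[OF CT.R.ring_axioms]])
       (use c in \<open>auto simp: vecs_def n_def CT.smult_l_distr CT.smult_assoc1 zip_map1 zip_map2 zip_same_conv_map\<close>)
  then show ?thesis by (simp add: iota_def)
qed

lemma iota_one: "iota \<one>\<^bsub>Tr\<^esub> = cs"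
  using cs_set by (auto simp: iota_def intro!: map_idI)

lemma homothety_hom: "a \<in> carrier Tr \<Longrightarrow> (\<lambda>c\<in>carrier CT. a \<odot>\<^bsub>CT\<^esub> c) \<in> mod_hom U CU CU"
  using homothety by (auto simp: bij_betw_def)

text \<open>An endomorphism of \<open>C\<close> over \<open>U\<close> is determined by its values on
  \<open>cs\<close>, and a vector is such a list of values exactly if it satisfies the relations
  \<open>sg\<close>, that is, if \<open>sigma\<close> kills it. By hypothesis the endomorphisms are
  the homotheties, each given by a unique ring element.\<close>

lemma coresolution_exact: "short_exact Tr (reg_mod Tr) iota (pow_mod CT n) sigma J"
proof (rule short_exactI[OF reg_mod_module[OF CT.R.ring_axioms] pow_mod_module[OF CT.left_module_axioms] J_module
      iota_hom sigma_hom_J])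
  show "inj_on iota (carrier (reg_mod Tr))"
  proof (rule inj_onI)
    fix a b assume ab: "a \<in> carrier (reg_mod Tr)" "b \<in> carrier (reg_mod Tr)" "iota a = iota b"
    let ?h = "\<lambda>a. \<lambda>c\<in>carrier CT. a \<odot>\<^bsub>CT\<^esub> c"
    have "?h a = ?h b"
    proof (rule mod_hom_eqI[OF homothety_hom homothety_hom])
      fix x assume "x \<in> carrier CU"
      then show "?h a x = ?h b x"
        by (rule hom_eq_on_gens[OF CU.left_module_axioms CU.left_module_axioms gens_cs homothety_hom homothety_hom, rotated 3])
           (use ab cs_set in \<open>auto simp: iota_def\<close>)
    qed (use ab in auto)
    then show "a = b" using homothety ab by (auto simp: bij_betw_def dest: inj_onD)
  qed
  show "\<exists>y\<in>carrier (pow_mod CT n). sigma y = z" if "z \<in> carrier J" for z using that by auto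
  show "sigma (iota a) = \<zero>\<^bsub>J\<^esub>" if "a \<in> carrier (reg_mod Tr)" for a
  proof -
    have a: "a \<in> carrier Tr" using that by simp
    have "iota a \<in> vecs (carrier CT) n" using mod_hom_closed[OF iota_hom that] by simp
    moreover have "lc CU r (iota a) = \<zero>\<^bsub>CT\<^esub>" if "r \<in> set sg" for r
    proof -
      have "set r \<subseteq> carrier U" "lc CU r cs = \<zero>\<^bsub>CT\<^esub>" using sg_set[OF that] by (auto simp: vecs_def)
      then show ?thesis using a cs_set by (simp add: iota_def lc_U_smult CT.smult_zero_r)
    qed
    ultimately show ?thesis by (auto simp: sigma_def m_def map_replicate_const[symmetric])
  qed
  show "\<exists>a\<in>carrier (reg_mod Tr). iota a = z" if z: "z \<in> carrier (pow_mod CT n)" "sigma z = \<zero>\<^bsub>J\<^esub>" for z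
  proof -
    have z': "z \<in> vecs (carrier CU) (length cs)" using z carrier_eq by (simp add: n_def)
    have "map (\<lambda>r. lc CU r z) sg = map (\<lambda>_. \<zero>\<^bsub>CT\<^esub>) sg"
      using z by (simp add: sigma_def m_def map_replicate_const)
    then have "lc CU r z = \<zero>\<^bsub>CU\<^esub>" if "r \<in> set sg" for r using that zero_eq by simp
    then obtain \<phi> where \<phi>: "\<phi> \<in> mod_hom U CU CU" "map \<phi> cs = z"
      using hom_from_gens[OF CU.left_module_axioms CU.left_module_axioms gens_cs gens_sg z'] by metis
    then obtain a where a: "a \<in> carrier Tr" "\<phi> = (\<lambda>c\<in>carrier CT. a \<odot>\<^bsub>CT\<^esub> c)" using homothety by (auto simp: bij_betw_def)
    then have "iota a = map \<phi> cs" using cs_set by (auto simp: iota_def)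
    then show ?thesis using a \<phi>(2) by (intro bexI[of _ a]) auto
  qed
qed

lemma sfp_J: "sfp Tr J"
  by (rule sfp_quotient[OF coresolution_exact sfp_reg_mod[OF CT.R.ring_axioms] sfp_pow_mod[OF sfp_CT]])

text \<open>\<open>J\<close> is exhibited as the kernel of a surjection from a power of
  \<open>C\<close> onto an infinitely presented module. This is the form in which homomorphisms on
  \<open>J\<close> can be extended and \<open>J\<close> can be tensored without losing
  injectivity.\<close>

lemma cokernel_exists:
  obtains Q :: "('t, 'c list) module" and g where "sfp Tr Q" "g \<in> mod_hom Tr (pow_mod CT m) Q"
    "g ` carrier (pow_mod CT m) = carrier Q" "kernel_mod (pow_mod CT m) Q g = J"
proof -
  obtain Q :: "('t, 'c list) module" and g
    where "short_exact Tr J (restrict (\<lambda>x. x) (sigma ` vecs (carrier CT) n)) (pow_mod CT m) g Q"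
    using quotient_exists[OF pow_mod_module[OF CT.left_module_axioms] J_submodule] unfolding J_def by metis
  note Q = this and D = short_exactD[OF this]
  have "mod_kernel (pow_mod CT m) Q g = carrier J" using Q by (auto simp: short_exact_def)
  then have "kernel_mod (pow_mod CT m) Q g = J" by (simp add: kernel_mod_def J_def)
  with D sfp_quotient[OF Q sfp_J sfp_pow_mod[OF sfp_CT]] show thesis by (intro that) auto
qed

lemma sigma_surj: "sigma ` carrier (pow_mod CT n) = carrier J" by simp

lemma iota_kernel: "iota a \<in> mod_kernel (pow_mod CT n) J sigma" if "a \<in> carrier Tr"
  using that coresolution_exact by (auto simp: short_exact_def)

lemma iota_hom_kernel: "iota \<in> mod_hom Tr (reg_mod Tr) (kernel_mod (pow_mod CT n) J sigma)"
  using iota_hom coresolution_exact by (auto simp: mod_hom_def PiE_iff kernel_mod_def short_exact_def)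

lemma iota_bij: "bij_betw iota (carrier (reg_mod Tr)) (carrier (kernel_mod (pow_mod CT n) J sigma))"
  using coresolution_exact by (auto simp: bij_betw_def short_exact_def)

text \<open>The element \<open>y\<close> defines the homomorphism sending \<open>a\<close> to
  \<open>a y\<close> on the ring, which sits in the power of \<open>C\<close> as the kernel of the
  map onto \<open>J\<close>. It extends to the power since \<open>J\<close> is infinitely presented;
  the extension has components \<open>hs\<close> and takes the value \<open>y\<close> at
  \<open>cs\<close>, the image of the unit.\<close>

lemma evaluation_surj:
  assumes I: "weak_injective Tr I" and y: "y \<in> carrier I"
  obtains hs where "hs \<in> vecs (mod_hom Tr CT I) n" "ev I hs cs = y"
proof -
  have IM: "left_module Tr I" using I by (simp add: weak_injective_def)
  interpret I: left_module Tr I by (rule IM)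
  note reg = reg_mod_module[OF CT.R.ring_axioms]
  note P = pow_mod_module[OF CT.left_module_axioms, of n]
  note X = kernel_mod_module[OF P J_module sigma_hom_J]
  have h: "restrict (\<lambda>a. a \<odot>\<^bsub>I\<^esub> y) (carrier (reg_mod Tr)) \<in> mod_hom Tr (reg_mod Tr) I"
    by (rule mod_hom_restrictI[OF reg]) (use y in \<open>auto simp: I.smult_l_distr I.smult_assoc1\<close>)
  have ib: "inj_on iota (carrier (reg_mod Tr))"
    "iota ` carrier (reg_mod Tr) = carrier (kernel_mod (pow_mod CT n) J sigma)"
    using iota_bij by (simp_all only: bij_betw_def)
  have hz: "restrict (\<lambda>a. a \<odot>\<^bsub>I\<^esub> y) (carrier (reg_mod Tr)) a = \<zero>\<^bsub>I\<^esub>"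
    if "a \<in> carrier (reg_mod Tr)" "iota a = \<zero>\<^bsub>kernel_mod (pow_mod CT n) J sigma\<^esub>" for a
  proof -
    have "a = \<zero>\<^bsub>reg_mod Tr\<^esub>" using that ib(1) mod_hom_inj_iff[OF reg X iota_hom_kernel] by blast
    then show ?thesis using mod_hom_zero[OF reg IM h] by simp
  qed
  obtain \<phi> where \<phi>: "\<phi> \<in> mod_hom Tr (kernel_mod (pow_mod CT n) J sigma) I"
    "\<And>a. a \<in> carrier (reg_mod Tr) \<Longrightarrow> \<phi> (iota a) = restrict (\<lambda>a. a \<odot>\<^bsub>I\<^esub> y) (carrier (reg_mod Tr)) a"
    by (rule factor_through[OF reg X IM iota_hom_kernel ib(2) h hz]) blast+
  have "extends Tr (pow_mod CT n) J sigma I"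
    by (rule weak_injective_extends[OF I sfp_J P sigma_hom_J sigma_surj])
  then obtain \<psi> where \<psi>: "\<psi> \<in> mod_hom Tr (pow_mod CT n) I" "\<And>x. x \<in> mod_kernel (pow_mod CT n) J sigma \<Longrightarrow> \<psi> x = \<phi> x"
    using \<phi>(1) unfolding extends_def by blast
  obtain hs where hs: "hs \<in> vecs (mod_hom Tr CT I) n" "\<And>z. z \<in> vecs (carrier CT) n \<Longrightarrow> ev I hs z = \<psi> z"
    using hom_as_ev[OF IM CT.left_module_axioms \<psi>(1)] by metis
  have "ev I hs cs = y"
    using hs(2)[OF cs_vecs] \<psi>(2)[OF iota_kernel[OF CT.R.one_closed]] \<phi>(2)[of "\<one>\<^bsub>Tr\<^esub>"] y by (simp add: iota_one)
  with hs(1) show thesis by (rule that)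
qed

text \<open>If the map with components \<open>hs\<close> vanishes at \<open>cs\<close>, it vanishes
  on the whole image of \<open>iota\<close> and factors through \<open>J\<close>. It then extends
  from \<open>J\<close> to the next power of \<open>C\<close>, and the components of the extension
  are \<open>hs'\<close>.\<close>

lemma evaluation_kernel:
  assumes I: "weak_injective Tr I" and hs: "hs \<in> vecs (mod_hom Tr CT I) n" and z: "ev I hs cs = \<zero>\<^bsub>I\<^esub>"
  obtains hs' where "hs' \<in> vecs (mod_hom Tr CT I) m"
    "\<And>z. z \<in> vecs (carrier CT) n \<Longrightarrow> ev I hs z = ev I hs' (map (\<lambda>r. lc CU r z) sg)"
proof -
  have IM: "left_module Tr I" using I by (simp add: weak_injective_def)
  interpret I: left_module Tr I by (rule IM)
  note P = pow_mod_module[OF CT.left_module_axioms]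
  let ?e = "restrict (ev I hs) (vecs (carrier CT) n)"
  have e: "?e \<in> mod_hom Tr (pow_mod CT n) I" by (rule ev_hom[OF IM CT.left_module_axioms hs])
  have "?e x = \<zero>\<^bsub>I\<^esub>" if x: "x \<in> carrier (pow_mod CT n)" "sigma x = \<zero>\<^bsub>J\<^esub>" for x
  proof -
    obtain a where a: "a \<in> carrier (reg_mod Tr)" "iota a = x" using short_exact_lift[OF coresolution_exact x] .
    then have "x = map (\<lambda>c. a \<odot>\<^bsub>CT\<^esub> c) cs" by (auto simp: iota_def)
    then have "ev I hs x = a \<odot>\<^bsub>I\<^esub> ev I hs cs" using ev_smult[OF IM CT.left_module_axioms vecs_set[OF hs] cs_set] a(1) by simp
    then show ?thesis using x a(1) z by (simp add: I.smult_zero_r)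
  qed
  then obtain \<chi> where \<chi>: "\<chi> \<in> mod_hom Tr J I" "\<And>x. x \<in> carrier (pow_mod CT n) \<Longrightarrow> \<chi> (sigma x) = ?e x"
    using factor_through[OF P J_module IM sigma_hom_J sigma_surj e] by metis
  obtain Q :: "('t, 'c list) module" and g where Q: "sfp Tr Q" "g \<in> mod_hom Tr (pow_mod CT m) Q"
    "g ` carrier (pow_mod CT m) = carrier Q" "kernel_mod (pow_mod CT m) Q g = J" by (rule cokernel_exists)
  have mk: "mod_kernel (pow_mod CT m) Q g = carrier J" using Q(4) by (metis kernel_mod_simps(1))
  have "extends Tr (pow_mod CT m) Q g I" by (rule weak_injective_extends[OF I Q(1) P Q(2,3)])
  then obtain \<psi> where \<psi>: "\<psi> \<in> mod_hom Tr (pow_mod CT m) I" "\<And>x. x \<in> carrier J \<Longrightarrow> \<psi> x = \<chi> x"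
    using \<chi>(1) unfolding extends_def Q(4) mk by blast
  obtain hs' where hs': "hs' \<in> vecs (mod_hom Tr CT I) m" "\<And>z. z \<in> vecs (carrier CT) m \<Longrightarrow> ev I hs' z = \<psi> z"
    using hom_as_ev[OF IM CT.left_module_axioms \<psi>(1)] by metis
  have "ev I hs z = ev I hs' (map (\<lambda>r. lc CU r z) sg)" if z: "z \<in> vecs (carrier CT) n" for z
  proof -
    have s: "sigma z \<in> vecs (carrier CT) m" using mod_hom_closed[OF sigma_hom, of z] z by simp
    have "ev I hs' (sigma z) = ev I hs z" using hs'(2)[OF s] \<psi>(2)[of "sigma z"] \<chi>(2)[of z] z by simp
    then show ?thesis using z by (simp add: sigma_def)
  qed
  with hs'(1) show thesis by (rule that)
qed

end

lemma reg_tensor_eval: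
  assumes F: "left_module R F" and f: "f \<in> carrier F"
    and z: "tens R (reg_mod (op_ring R)) F \<one>\<^bsub>R\<^esub> f = \<one>\<^bsub>tensor_group R (reg_mod (op_ring R)) F\<^esub>"
  shows "f = \<zero>\<^bsub>F\<^esub>"
proof -
  interpret F: left_module R F by (rule F)
  interpret A: tensor_pair R "reg_mod (op_ring R)" F
    by (rule tensor_pairI[OF reg_mod_module[OF op_ring_ring[OF F.R.ring_axioms]] F])
  obtain \<kappa> where \<kappa>: "\<kappa> \<in> hom A.T (add_monoid F)"
    "\<And>a y. a \<in> carrier (reg_mod (op_ring R)) \<Longrightarrow> y \<in> carrier F \<Longrightarrow> \<kappa> (A.t a y) = a \<odot>\<^bsub>F\<^esub> y"
  proof (rule A.tensor_universal[of "add_monoid F" "\<lambda>a y. a \<odot>\<^bsub>F\<^esub> y"])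
    show "comm_group (add_monoid F)" by (rule F.M.a_comm_group)
  qed (auto simp: F.smult_l_distr F.smult_r_distr F.smult_assoc1)
  have "\<kappa> \<one>\<^bsub>A.T\<^esub> = \<zero>\<^bsub>F\<^esub>" using hom_one[OF \<kappa>(1) A.T.group_axioms] F.M.a_comm_group by (simp add: comm_group_def)
  then show ?thesis using \<kappa>(2)[of "\<one>\<^bsub>R\<^esub>" f] f z by simp
qed

text \<open>With \<open>Tr\<close> taken to be \<open>op_ring R\<close> the coresolution consists of
  right \<open>R\<close>-modules and can be tensored over \<open>R\<close> with a left
  module.\<close>

locale right_coresolution = coresolution "op_ring R" CT U CU cs sg
  for R :: "'r ring" and CT :: "('r, 'c) module" and U :: "'u ring" and CU :: "('u, 'c) module" and cs sg
begin

text \<open>The tensor of \<open>cs\<close> and \<open>f\<close> over the power of \<open>C\<close>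
  has the coordinates \<open>c \<otimes> f\<close>, so it is trivial. As \<open>J\<close> is
  infinitely presented and \<open>F\<close> weak flat, it is already trivial over the kernel of
  \<open>sigma\<close>. This kernel is isomorphic to the ring with \<open>cs\<close> corresponding
  to the unit, so \<open>f\<close> itself is zero.\<close>

lemma coevaluation_inj:
  assumes F: "weak_flat R F" and f: "f \<in> carrier F"
    and z: "\<And>c. c \<in> carrier CT \<Longrightarrow> tens R CT F c f = \<one>\<^bsub>tensor_group R CT F\<^esub>"
  shows "f = \<zero>\<^bsub>F\<^esub>"
proof -
  have FM: "left_module R F" using F by (simp add: weak_flat_def)
  interpret FM: left_module R F by (rule FM)
  note reg = reg_mod_module[OF CT.R.ring_axioms]
  note P = pow_mod_module[OF CT.left_module_axioms, of n]
  let ?X = "kernel_mod (pow_mod CT n) J sigma"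
  note X = kernel_mod_module[OF P J_module sigma_hom_J]
  note TX = tensor_pairI[OF X FM] and TP = tensor_pairI[OF P FM] and TR = tensor_pairI[OF reg FM]
    and TC = tensor_pairI[OF CT.left_module_axioms FM] and id = mod_hom_id[OF FM]
  interpret X: tensor_pair R ?X F by (rule TX)
  interpret P: tensor_pair R "pow_mod CT n" F by (rule TP)
  have csX: "cs \<in> carrier ?X" using iota_kernel[OF CT.R.one_closed] by (simp only: iota_one kernel_mod_simps)
  have csP: "cs \<in> carrier (pow_mod CT n)" using cs_vecs by simp
  have "tens R (pow_mod CT n) F cs f = \<one>\<^bsub>P.T\<^esub>"
  proof (rule pow_tensor_trivial[OF CT.left_module_axioms FM])
    show "tens R (pow_mod CT n) F cs f \<in> carrier P.T" using csP f by (rule P.t_closed)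
    show "tcoord R CT F n i (tens R (pow_mod CT n) F cs f) = \<one>\<^bsub>tensor_group R CT F\<^esub>"
      if i: "i < n" for i
      using tmap_tens[OF TP TC coord_is_hom[OF CT.left_module_axioms i] id csP f] z[of "cs ! i"] f cs_vecs vecs_nth[OF cs_vecs i]
      by (simp add: coord_def)
  qed
  then have "tmap R ?X F (pow_mod CT n) F (kernel_incl (pow_mod CT n) J sigma) (idm F) (tens R ?X F cs f) = \<one>\<^bsub>P.T\<^esub>"
    using tmap_tens[OF TX TP kernel_incl_hom[OF P J_module sigma_hom_J] id csX f] csX f by (simp add: kernel_incl_def)
  moreover have "stays_inj R (pow_mod CT n) J sigma F"
    by (rule weak_flat_stays_inj[OF F sfp_J P sigma_hom_J sigma_surj])
  ultimately have tx: "tens R ?X F cs f = \<one>\<^bsub>X.T\<^esub>"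
    unfolding stays_inj_def using X.t_closed[OF csX f] by blast
  let ?r = "restrict (inv_into (carrier (reg_mod (op_ring R))) iota) (carrier ?X)"
  have r: "?r \<in> mod_hom (op_ring R) ?X (reg_mod (op_ring R))"
    by (rule mod_hom_inverse[OF reg X iota_hom_kernel iota_bij])
  have "?r cs = \<one>\<^bsub>R\<^esub>"
    using csX bij_betw_inv_into_left[OF iota_bij, of "\<one>\<^bsub>R\<^esub>"] iota_one CT.R.one_closed by simp
  then have "tens R (reg_mod (op_ring R)) F \<one>\<^bsub>R\<^esub> f = tmap R ?X F (reg_mod (op_ring R)) F ?r (idm F) (tens R ?X F cs f)"
    using tmap_tens[OF TX TR r id csX f] f by simp
  also have "\<dots> = \<one>\<^bsub>tensor_group R (reg_mod (op_ring R)) F\<^esub>" unfolding tx by (rule tmap_one[OF TX TR r id])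
  finally show ?thesis by (rule reg_tensor_eval[OF FM f])
qed

text \<open>Since the cokernel \<open>Q\<close> is infinitely presented, the tensor product with
  \<open>J\<close> embeds into that with the second power of \<open>C\<close>. So the image
  \<open>w'\<close> of \<open>w\<close> over \<open>J\<close> is already trivial, and right
  exactness gives a tensor over the ring that maps to \<open>w\<close>. Such a tensor has the form
  of the unit tensored with some \<open>f\<close>.\<close>

lemma coevaluation_surj:
  assumes F: "weak_flat R F" and w: "w \<in> carrier (tensor_group R (pow_mod CT n) F)"
    and z: "tmap R (pow_mod CT n) F (pow_mod CT m) F sigma (idm F) w = \<one>\<^bsub>tensor_group R (pow_mod CT m) F\<^esub>"
  obtains f where "f \<in> carrier F" "w = tens R (pow_mod CT n) F cs f"
proof -
  have FM: "left_module R F" using F by (simp add: weak_flat_def)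
  note reg = reg_mod_module[OF CT.R.ring_axioms]
  note P = pow_mod_module[OF CT.left_module_axioms]
  note TP = tensor_pairI[OF P FM] and TR = tensor_pairI[OF reg FM] and TJ = tensor_pairI[OF J_module FM]
    and id = mod_hom_id[OF FM]
  interpret reg: tensor_pair R "reg_mod (op_ring R)" F by (rule TR)
  obtain Q :: "('r, 'c list) module" and g where Q: "sfp (op_ring R) Q" "g \<in> mod_hom (op_ring R) (pow_mod CT m) Q"
    "g ` carrier (pow_mod CT m) = carrier Q" "kernel_mod (pow_mod CT m) Q g = J" by (rule cokernel_exists)
  have mk: "mod_kernel (pow_mod CT m) Q g = carrier J" using Q(4) by (metis kernel_mod_simps(1))
  have inj: "stays_inj R (pow_mod CT m) Q g F" by (rule weak_flat_stays_inj[OF F Q(1) P Q(2,3)])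
  let ?k = "kernel_incl (pow_mod CT m) Q g"
  have k: "?k \<in> mod_hom (op_ring R) J (pow_mod CT m)"
    using kernel_incl_hom[OF P sfp_module[OF Q(1)] Q(2)] by (simp only: Q(4))
  have ke: "?k (sigma x) = sigma x" if "x \<in> carrier (pow_mod CT n)" for x
    unfolding kernel_incl_def mk using that by simp
  define w' where "w' = tmap R (pow_mod CT n) F J F sigma (idm F) w"
  have w'c: "w' \<in> carrier (tensor_group R J F)"
    unfolding w'_def by (rule hom_in_carrier[OF tmap_hom[OF TP TJ sigma_hom_J id] w])
  have "tmap R J F (pow_mod CT m) F ?k (idm F) w' = tmap R (pow_mod CT n) F (pow_mod CT m) F sigma (idm F) w"
    unfolding w'_def by (rule tmap_compose[OF TP TJ TP sigma_hom_J id k id sigma_hom id ke _ w]) auto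
  then have "w' = \<one>\<^bsub>tensor_group R J F\<^esub>" using inj w'c z unfolding stays_inj_def Q(4) by simp
  moreover have "x \<in> iota ` carrier (reg_mod (op_ring R))" if "x \<in> carrier (pow_mod CT n)" "sigma x = \<zero>\<^bsub>J\<^esub>" for x
    using that by (rule short_exact_image[OF coresolution_exact])
  ultimately obtain v where v: "v \<in> carrier reg.T" "tmap R (reg_mod (op_ring R)) F (pow_mod CT n) F iota (idm F) v = w"
    using tensor_right_exact[OF TR TP TJ iota_hom sigma_hom_J sigma_surj _ refl w] unfolding w'_def by metis
  have g1: "gens (op_ring R) (reg_mod (op_ring R)) [\<one>\<^bsub>R\<^esub>]"
    using CT.R.r_one by (force simp: gens_def vecs_Suc_iff)
  obtain ys where "ys \<in> vecs (carrier F) (Suc 0)" "v = tsum R (reg_mod (op_ring R)) F [\<one>\<^bsub>R\<^esub>] ys"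
    using reg.tensor_gens[OF g1 v(1)] by auto
  then obtain f where f: "f \<in> carrier F" "v = tens R (reg_mod (op_ring R)) F \<one>\<^bsub>R\<^esub> f"
    using CT.R.one_closed by (auto simp: vecs_Suc_iff)
  have "w = tens R (pow_mod CT n) F (iota \<one>\<^bsub>R\<^esub>) f"
    using tmap_tens[OF TR TP iota_hom id, of "\<one>\<^bsub>R\<^esub>" f] f v(2) CT.R.one_closed by simp
  then show thesis using f(1) iota_one by (intro that) auto
qed

end

section \<open>Exactness of tensor products with a fixed right module\<close>

lemma (in tensor_pair) inv_mult_cancel:
  "X \<in> carrier T \<Longrightarrow> Y \<in> carrier T \<Longrightarrow> X \<otimes>\<^bsub>T\<^esub> inv\<^bsub>T\<^esub> Y = \<one>\<^bsub>T\<^esub> \<Longrightarrow> X = Y"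
  using T.inv_equality T.inv_inv by fastforce

lemma pow_tensor_eqI:
  assumes C: "left_module (op_ring R) C" and F: "left_module R F"
    and w: "w \<in> carrier (tensor_group R (pow_mod C n) F)" "v \<in> carrier (tensor_group R (pow_mod C n) F)"
    and eq: "\<And>i. i < n \<Longrightarrow> tcoord R C F n i w =
      tcoord R C F n i v"
  shows "w = v"
proof -
  note P = pow_mod_module[OF C]
  note TC = tensor_pairI[OF C F] and TP = tensor_pairI[OF P F]
  interpret A: tensor_pair R "pow_mod C n" F by (rule TP)
  interpret B: tensor_pair R C F by (rule TC)
  have "w \<otimes>\<^bsub>A.T\<^esub> inv\<^bsub>A.T\<^esub> v = \<one>\<^bsub>A.T\<^esub>"
  proof (rule pow_tensor_trivial[OF C F])
    show "w \<otimes>\<^bsub>A.T\<^esub> inv\<^bsub>A.T\<^esub> v \<in> carrier A.T" using w by simp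
    fix i assume i: "i < n"
    let ?c = "tcoord R C F n i"
    have c: "?c \<in> hom A.T B.T" by (rule tmap_hom[OF TP TC coord_is_hom[OF C i] mod_hom_id[OF F]])
    then interpret c: group_hom A.T B.T ?c
      by (intro group_hom.intro group_hom_axioms.intro A.T.group_axioms B.T.group_axioms)
    show "?c (w \<otimes>\<^bsub>A.T\<^esub> inv\<^bsub>A.T\<^esub> v) = \<one>\<^bsub>B.T\<^esub>"
      using w eq[OF i] hom_in_carrier[OF c w(2)] by simp
  qed
  then show ?thesis by (rule A.inv_mult_cancel[OF w])
qed

text \<open>Vanishing over \<open>B\<close> of a tensor over the generators \<open>xs\<close> is
  solvability in \<open>B\<close> of the system given by the relations of \<open>N\<close>, with
  right-hand sides from \<open>A\<close>. Purity solves it in \<open>A\<close>.\<close>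

lemma sys_pure_tensor_inj:
  assumes A: "left_module R A" and B: "left_module R B" and f: "f \<in> mod_hom R A B" and sp: "sys_pure R A f B"
    and N: "fin_rel (op_ring R) N xs ls" and k: "k = idm N"
    and u: "u \<in> carrier (tensor_group R N A)" "tmap R N A N B k f u = \<one>\<^bsub>tensor_group R N B\<^esub>"
  shows "u = \<one>\<^bsub>tensor_group R N A\<^esub>"
proof -
  have NM: "left_module (op_ring R) N" and xs: "gens (op_ring R) N xs"
    and ls: "gens (op_ring R) (syz (op_ring R) N xs) ls" using N by (auto simp: fin_rel_def)
  note TA = tensor_pairI[OF NM A] and TB = tensor_pairI[OF NM B]
  interpret TA: tensor_pair R N A by (rule TA)
  have km: "k \<in> mod_hom (op_ring R) N N" unfolding k by (rule mod_hom_id[OF NM])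
  obtain y where y: "y \<in> vecs (carrier A) (length xs)" "u = tsum R N A xs y" using TA.tensor_gens[OF xs u(1)] .
  have "map k xs = xs" using gens_set[OF xs] by (auto simp: k intro!: map_idI)
  then have "tsum R N B xs (map f y) = \<one>\<^bsub>tensor_group R N B\<^esub>"
    using tmap_tsum[OF TA TB km f gens_set[OF xs] vecs_set[OF y(1)]] u(2) y(2) by simp
  moreover have fy: "map f y \<in> vecs (carrier B) (length xs)" using y(1) mod_hom_closed[OF f] by (rule vecs_map)
  ultimately obtain z where z: "z \<in> vecs (carrier B) (length ls)"
    "map (\<lambda>r. lc B r z) (columns (length xs) ls) = map f y"
    using tensor_presentation[OF B N fy] by blast
  have "set (columns (length xs) ls) \<subseteq> vecs (carrier R) (length ls)" by (rule gens_syz_columns[OF ls])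
  then obtain x where "x \<in> vecs (carrier A) (length ls)" "map (\<lambda>r. lc A r x) (columns (length xs) ls) = y"
    using sp[unfolded sys_pure_def, rule_format, of "columns (length xs) ls" "length ls" y z] y(1) z by auto
  then show ?thesis using tensor_presentation[OF A N y(1)] y(2) by blast
qed

text \<open>If the image of \<open>w\<close> vanishes, its vector over \<open>Z\<close> solves the
  system of the relations of \<open>N\<close>. Lifting the solution to \<open>z'\<close> over
  \<open>Y\<close> produces a vector \<open>v\<close> that represents the trivial tensor and has the
  same image over \<open>Z\<close> as \<open>y\<close>. Subtracting \<open>v\<close> changes nothing
  in the tensor and leaves a vector with entries in \<open>X\<close>.\<close>

lemma tensor_right_exact_second:
  assumes se: "short_exact R X f Y g Z" and N: "fin_rel (op_ring R) N xs ls" and k: "k = idm N"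
    and w: "w \<in> carrier (tensor_group R N Y)" "tmap R N Y N Z k g w = \<one>\<^bsub>tensor_group R N Z\<^esub>"
  obtains v where "v \<in> carrier (tensor_group R N X)" "tmap R N X N Y k f v = w"
proof -
  note D = short_exactD[OF se]
  interpret X: left_module R X by (rule D)
  interpret Y: left_module R Y by (rule D)
  interpret Z: left_module R Z by (rule D)
  have NM: "left_module (op_ring R) N" and xs: "gens (op_ring R) N xs"
    and ls: "gens (op_ring R) (syz (op_ring R) N xs) ls" using N by (auto simp: fin_rel_def)
  note TX = tensor_pairI[OF NM D(1)] and TY = tensor_pairI[OF NM D(2)] and TZ = tensor_pairI[OF NM D(3)]
  interpret TX: tensor_pair R N X by (rule TX)
  interpret TY: tensor_pair R N Y by (rule TY)
  have km: "k \<in> mod_hom (op_ring R) N N" unfolding k by (rule mod_hom_id[OF NM])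
  have kx: "map k xs = xs" using gens_set[OF xs] by (auto simp: k intro!: map_idI)
  define n where "n = length xs"
  obtain y where y: "y \<in> vecs (carrier Y) n" "w = tsum R N Y xs y" using TY.tensor_gens[OF xs w(1)] by (auto simp: n_def)
  have gy: "map g y \<in> vecs (carrier Z) n" using y(1) mod_hom_closed[OF D(5)] by (rule vecs_map)
  have "tsum R N Z xs (map g y) = \<one>\<^bsub>tensor_group R N Z\<^esub>"
    using tmap_tsum[OF TY TZ km D(5) gens_set[OF xs] vecs_set[OF y(1)]] w(2) y(2) kx by simp
  then obtain z where z: "z \<in> vecs (carrier Z) (length ls)" "map (\<lambda>r. lc Z r z) (columns n ls) = map g y"
    using tensor_presentation[OF D(3) N] gy unfolding n_def by blast
  obtain z' where z': "set z' \<subseteq> carrier Y" "map g z' = z" using lift_list[OF D(7) vecs_set[OF z(1)]] by metis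
  have z'v: "z' \<in> vecs (carrier Y) (length ls)" using z' vecs_length[OF z(1)] by (auto simp: vecs_def)
  have tr: "set (columns n ls) \<subseteq> vecs (carrier R) (length ls)" unfolding n_def by (rule gens_syz_columns[OF ls])
  define v where "v = map (\<lambda>r. lc Y r z') (columns n ls)"
  have rs: "set r \<subseteq> carrier R" if "r \<in> set (columns n ls)" for r using tr that by (auto simp: vecs_def)
  have v: "v \<in> vecs (carrier Y) n" unfolding v_def using rs z'(1) by (auto simp: vecs_def)
  have gv: "map g v = map g y"
    unfolding v_def z(2)[symmetric] using mod_hom_lc[OF D(2,3,5) rs z'(1)] z'(2) by simp
  have tv: "tsum R N Y xs v = \<one>\<^bsub>TY.T\<^esub>"
    using tensor_presentation[OF D(2) N, of v] v z'v unfolding n_def v_def by blast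
  define d where "d = map2 (\<lambda>a b. a \<ominus>\<^bsub>Y\<^esub> b) y v"
  have d: "d \<in> vecs (carrier Y) n" using y(1) v by (auto simp: d_def vecs_iff_nth)
  have dv: "map2 (ring.add Y) d v = y"
    using y(1) v by (auto simp: d_def vecs_iff_nth Y.minus_add_cancel intro!: nth_equalityI)
  have "set d \<subseteq> f ` carrier X"
  proof
    fix x assume "x \<in> set d"
    then obtain i where i: "i < n" "x = d ! i" using d by (auto simp: in_set_conv_nth vecs_length)
    have yi: "y ! i \<in> carrier Y" "v ! i \<in> carrier Y" using vecs_nth[OF y(1) i(1)] vecs_nth[OF v i(1)] by auto
    have "g (y ! i) = g (v ! i)"
      using arg_cong[OF gv, of "\<lambda>l. l ! i"] i(1) vecs_length[OF y(1)] vecs_length[OF v] by simp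
    moreover have "x = y ! i \<ominus>\<^bsub>Y\<^esub> v ! i" using i vecs_length[OF y(1)] vecs_length[OF v] by (simp add: d_def)
    ultimately have "x \<in> carrier Y" "g x = \<zero>\<^bsub>Z\<^esub>"
      using yi mod_hom_minus[OF D(2,3,5) yi] mod_hom_closed[OF D(5) yi(1)] by (simp_all add: Z.minus_eq_zero)
    then show "x \<in> f ` carrier X" by (rule short_exact_image[OF se])
  qed
  then obtain x where x: "set x \<subseteq> carrier X" "map f x = d" using lift_list[OF refl, of d f "carrier X"] by metis
  have "tmap R N X N Y k f (tsum R N X xs x) = tsum R N Y xs d"
    using tmap_tsum[OF TX TY km D(4) gens_set[OF xs] x(1)] kx x(2) by simp
  also have "\<dots> = tsum R N Y xs d \<otimes>\<^bsub>TY.T\<^esub> tsum R N Y xs v"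
    unfolding tv using TY.tsum_closed[OF gens_set[OF xs] vecs_set[OF d]] by simp
  also have "\<dots> = w"
    unfolding y(2) using TY.tsum_add_right[of xs d v] d v gens_set[OF xs] dv by (simp add: vecs_def n_def)
  finally show thesis using TX.tsum_closed[OF gens_set[OF xs] x(1)] by (intro that)
qed

lemma tmap_second_surj:
  assumes A: "left_module R A" and B: "left_module R B" and N: "left_module (op_ring R) N"
    and g: "g \<in> mod_hom R A B" "g ` carrier A = carrier B" and k: "k = idm N"
    and u: "u \<in> carrier (tensor_group R N B)"
  obtains w where "w \<in> carrier (tensor_group R N A)" "tmap R N A N B k g w = u"
proof -
  note TA = tensor_pairI[OF N A] and TB = tensor_pairI[OF N B]
  interpret TA: tensor_pair R N A by (rule TA)
  interpret TB: tensor_pair R N B by (rule TB)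
  have km: "k \<in> mod_hom (op_ring R) N N" unfolding k by (rule mod_hom_id[OF N])
  obtain xs ys where u': "set xs \<subseteq> carrier N" "ys \<in> vecs (carrier B) (length xs)" "u = tsum R N B xs ys"
    using TB.tensor_tsum[OF u] by metis
  obtain zs where zs: "set zs \<subseteq> carrier A" "map g zs = ys" using lift_list[OF g(2) vecs_set[OF u'(2)]] by metis
  have "map k xs = xs" using u'(1) by (auto simp: k intro!: map_idI)
  then have "tmap R N A N B k g (tsum R N A xs zs) = u"
    using tmap_tsum[OF TA TB km g(1) u'(1) zs(1)] zs(2) u'(3) by simp
  then show thesis using TA.tsum_closed[OF u'(1) zs(1)] that by blast
qed

section \<open>The functors of a bimodule\<close>

lemma left_mod_simps [simp]:
  "carrier (left_mod C) = carrier C" "ring.add (left_mod C) = ring.add C" "\<zero>\<^bsub>left_mod C\<^esub> = \<zero>\<^bsub>C\<^esub>"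
  "module.smult (left_mod C) = module.smult C"
  by (simp_all add: left_mod_def)

lemma right_mod_simps [simp]:
  "carrier (right_mod C) = carrier C" "ring.add (right_mod C) = ring.add C" "\<zero>\<^bsub>right_mod C\<^esub> = \<zero>\<^bsub>C\<^esub>"
  "module.smult (right_mod C) r c = rsmult C c r"
  by (simp_all add: right_mod_def)

lemma tensor_mod_simps [simp]:
  "carrier (tensor_mod R C F) = carrier (tensor_group R (right_mod C) F)"
  "ring.add (tensor_mod R C F) = monoid.mult (tensor_group R (right_mod C) F)"
  "\<zero>\<^bsub>tensor_mod R C F\<^esub> = \<one>\<^bsub>tensor_group R (right_mod C) F\<^esub>"
  "module.smult (tensor_mod R C F) s = tensor_map R (right_mod C) (right_mod C) F (\<lambda>c. s \<odot>\<^bsub>C\<^esub> c)"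
  by (simp_all add: tensor_mod_def Let_def)

lemma hom_mod_simps [simp]:
  "carrier (hom_mod S C I) = mod_hom S (left_mod C) I"
  "ring.add (hom_mod S C I) = (\<lambda>f g. \<lambda>x\<in>carrier C. f x \<oplus>\<^bsub>I\<^esub> g x)"
  "\<zero>\<^bsub>hom_mod S C I\<^esub> = (\<lambda>x\<in>carrier C. \<zero>\<^bsub>I\<^esub>)"
  "module.smult (hom_mod S C I) r f = (\<lambda>c\<in>carrier C. f (rsmult C c r))"
  by (simp_all add: hom_mod_def Let_def)

text \<open>The action in \<open>tensor_mod\<close> is given by multiplication with \<open>s\<close>
  as a function on the whole type, whereas elements of \<open>mod_hom\<close> are extensional. The
  lemma allows passing from the former to the restricted map \<open>act s\<close>.\<close>

lemma tensor_map_cong: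
  assumes A: "tensor_pair R N M" and eq: "\<And>x. x \<in> carrier N \<Longrightarrow> h x = h' x" and X: "X \<in> carrier (tensor_group R N M)"
  shows "tensor_map R N N' M h X = tensor_map R N N' M h' X"
proof -
  interpret A: tensor_pair R N M by (rule A)
  obtain w where w: "w \<in> carrier A.G" "X = A.K #>\<^bsub>A.G\<^esub> w" using X by (auto simp: A.carrier_T)
  have "frag_extend (\<lambda>(x, y). frag_of (h x, y)) u = frag_extend (\<lambda>(x, y). frag_of (h' x, y)) u" if u: "u \<in> X" for u
  proof -
    have "u \<in> carrier A.G" using u w subgroup.elemrcos_carrier[OF A.K_subgroup] by (metis group_free_Abelian_group)
    then show ?thesis using eq by (intro frag_extend_eq) (auto simp: subset_iff)
  qed
  then show ?thesis by (simp add: tensor_map_def)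
qed

lemma ev_delta:
  assumes I: "left_module R I" and C: "left_module R C" and hs: "hs \<in> vecs (mod_hom R C I) n" and i: "i < n"
    and c: "c \<in> carrier C"
  shows "ev I hs ((replicate n \<zero>\<^bsub>C\<^esub>)[i := c]) = (hs ! i) c"
  using hs i
proof (induction n arbitrary: hs i)
  case (Suc n)
  interpret I: left_module R I by (rule I)
  interpret C: left_module R C by (rule C)
  obtain h hs' where h: "hs = h # hs'" "h \<in> mod_hom R C I" "hs' \<in> vecs (mod_hom R C I) n"
    using Suc.prems(1) by (auto simp: vecs_Suc_iff)
  have z: "ev I hs (replicate n \<zero>\<^bsub>C\<^esub>) = \<zero>\<^bsub>I\<^esub>" if "set hs \<subseteq> mod_hom R C I" for n hs
    using that
  proof (induction hs arbitrary: n)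
    case (Cons h hs)
    then have "h \<zero>\<^bsub>C\<^esub> = \<zero>\<^bsub>I\<^esub>" "set hs \<subseteq> mod_hom R C I" using mod_hom_zero[OF C I] by simp_all
    then show ?case using Cons.IH by (cases n) simp_all
  qed simp
  show ?case
  proof (cases i)
    case 0 then show ?thesis using h c z[OF vecs_set[OF h(3)]] mod_hom_closed[OF h(2) c] by simp
  next
    case (Suc j)
    then show ?thesis using h Suc.IH[OF h(3), of j] Suc.prems(2) mod_hom_zero[OF C I h(2)]
        mod_hom_closed[OF vecs_nth[OF h(3), of j] c] by simp
  qed
qed simp

locale faithful_bimodule =
  fixes R :: "'r ring" and S :: "'s ring" and C :: "('s, 'c, 'r) bimodule"
  assumes ring_R: "ring R" and ring_S: "ring S" and faithful: "faithfully_semidualizing S R C"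
begin

abbreviation "CL \<equiv> left_mod C"
abbreviation "CR \<equiv> right_mod C"
abbreviation "t F \<equiv> tens R CR F"
abbreviation "T F \<equiv> tensor_group R CR F"
abbreviation "TM F \<equiv> tensor_mod R C F"
abbreviation "HM I \<equiv> hom_mod S C I"

lemma CL: "left_module S CL" and CR: "left_module (op_ring R) CR"
  and CC: "\<And>s c r. s \<in> carrier S \<Longrightarrow> c \<in> carrier C \<Longrightarrow> r \<in> carrier R \<Longrightarrow>
      rsmult C (s \<odot>\<^bsub>C\<^esub> c) r = s \<odot>\<^bsub>C\<^esub> rsmult C c r"
  using faithful by (auto simp: faithfully_semidualizing_def semidualizing_def is_bimodule_def)

lemma sfp_CL: "sfp S CL" and sfp_CR: "sfp (op_ring R) CR"
  using faithful by (auto simp: faithfully_semidualizing_def semidualizing_def super_fin_presented_iff_sfp)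

lemma rsmult_closed: "c \<in> carrier C \<Longrightarrow> r \<in> carrier R \<Longrightarrow> rsmult C c r \<in> carrier C"
  using left_module.smult_closed[OF CR, of r c] by simp

lemma lsmult_closed: "c \<in> carrier C \<Longrightarrow> s \<in> carrier S \<Longrightarrow> s \<odot>\<^bsub>C\<^esub> c \<in> carrier C"
  using left_module.smult_closed[OF CL, of s c] by simp

lemma right_coresolution_exists:
  obtains cs sg where "right_coresolution R CR S CL cs sg" "fin_rel S CL cs sg"
proof -
  obtain cs sg where f: "fin_rel S CL cs sg" using sfp_fin_rel[OF sfp_CL] by metis
  have h: "bij_betw (\<lambda>r. \<lambda>c\<in>carrier C. rsmult C c r) (carrier R) (mod_hom S CL CL)"
    using faithful by (simp add: faithfully_semidualizing_def semidualizing_def)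
  have "right_coresolution R CR S CL cs sg"
    unfolding right_coresolution_def
    by (intro coresolution.intro biaction.intro biaction_axioms.intro coresolution_axioms.intro CL CR sfp_CR)
       (use f h in \<open>auto simp: fin_rel_def CC\<close>)
  then show thesis using f that by blast
qed

lemma left_coresolution_exists:
  obtains ds tg where "coresolution S CL (op_ring R) CR ds tg" "fin_rel (op_ring R) CR ds tg"
proof -
  obtain ds tg where f: "fin_rel (op_ring R) CR ds tg" using sfp_fin_rel[OF sfp_CR] by metis
  have h: "bij_betw (\<lambda>s. \<lambda>c\<in>carrier C. s \<odot>\<^bsub>C\<^esub> c) (carrier S) (mod_hom (op_ring R) CR CR)"
    using faithful by (simp add: faithfully_semidualizing_def semidualizing_def)
  have "coresolution S CL (op_ring R) CR ds tg"
    by (intro coresolution.intro biaction.intro biaction_axioms.intro coresolution_axioms.intro CL CR sfp_CL)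
       (use f h in \<open>auto simp: fin_rel_def CC\<close>)
  then show thesis using f that by blast
qed

lemma biaction: "biaction (op_ring R) CR S CL"
  by (intro biaction.intro biaction_axioms.intro CL CR) (auto simp: CC)

definition act :: "'s \<Rightarrow> 'c \<Rightarrow> 'c" where
  "act s = restrict (\<lambda>c. s \<odot>\<^bsub>C\<^esub> c) (carrier C)"

lemma act_apply: "c \<in> carrier C \<Longrightarrow> act s c = s \<odot>\<^bsub>C\<^esub> c"
  by (simp add: act_def)

lemma act_hom: "s \<in> carrier S \<Longrightarrow> act s \<in> mod_hom (op_ring R) CR CR"
  using mod_hom_restrictI[OF CR, of "\<lambda>c. s \<odot>\<^bsub>C\<^esub> c" CR] left_module.smult_r_distr[OF CL, of s]
  by (simp add: act_def CC lsmult_closed)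

lemma idm_CR_hom: "idm CR \<in> mod_hom (op_ring R) CR CR" by (rule mod_hom_id[OF CR])

lemma TP: "left_module R F \<Longrightarrow> tensor_pair R CR F" by (rule tensor_pairI[OF CR])

lemma tensor_mod_smult:
  assumes F: "left_module R F" and s: "s \<in> carrier S" and X: "X \<in> carrier (T F)"
  shows "s \<odot>\<^bsub>TM F\<^esub> X = tmap R CR F CR F (act s) (idm F) X"
proof -
  have "s \<odot>\<^bsub>TM F\<^esub> X = tensor_map R CR CR F (act s) X"
    using tensor_map_cong[OF TP[OF F] _ X, of "\<lambda>c. s \<odot>\<^bsub>C\<^esub> c" "act s"] by (simp add: act_def)
  also have "\<dots> = tmap R CR F CR F (act s) (idm F) X"
    by (rule tensor_map_eq_tmap[OF TP[OF F] TP[OF F] act_hom[OF s] X])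
  finally show ?thesis .
qed

lemma tensor_mod_smult_t:
  assumes F: "left_module R F" and s: "s \<in> carrier S" and "c \<in> carrier C" "f \<in> carrier F"
  shows "s \<odot>\<^bsub>TM F\<^esub> t F c f = t F (s \<odot>\<^bsub>C\<^esub> c) f"
proof -
  interpret A: tensor_pair R CR F by (rule TP[OF F])
  show ?thesis
    using tensor_mod_smult[OF F s, of "t F c f"] tmap_tens[OF TP[OF F] TP[OF F] act_hom[OF s] mod_hom_id[OF F], of c f] assms
    by (simp add: act_apply del: tensor_mod_simps)
qed

lemma tensor_mod_module:
  assumes F: "left_module R F" shows "left_module S (TM F)"
proof -
  interpret A: tensor_pair R CR F by (rule TP[OF F])
  interpret CLm: left_module S CL by (rule CL)
  note id = mod_hom_id[OF F]
  have ab: "abelian_group (TM F)"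
  proof (rule abelian_groupI)
    show "\<exists>y\<in>carrier (TM F). y \<oplus>\<^bsub>TM F\<^esub> x = \<zero>\<^bsub>TM F\<^esub>" if "x \<in> carrier (TM F)" for x
      using that by (intro bexI[of _ "inv\<^bsub>A.T\<^esub> x"]) auto
  qed (auto simp: A.T.m_ac)
  have m: "tmap R CR F CR F (act s) (idm F) \<in> hom A.T A.T" if "s \<in> carrier S" for s
    by (rule tmap_hom[OF TP[OF F] TP[OF F] act_hom[OF that] id])
  note tt = tmap_tens[OF TP[OF F] TP[OF F] act_hom id]
  show ?thesis
  proof (intro left_module.intro left_module_axioms.intro ring_S ab)
    fix a X assume a: "a \<in> carrier S" and X: "X \<in> carrier (TM F)"
    then have XT: "X \<in> carrier A.T" by simp
    show "a \<odot>\<^bsub>TM F\<^esub> X \<in> carrier (TM F)"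
      unfolding tensor_mod_smult[OF F a XT] using hom_in_carrier[OF m[OF a] XT] by simp
    {
      fix Y assume Y: "Y \<in> carrier (TM F)"
      then have YT: "Y \<in> carrier A.T" by simp
      show "a \<odot>\<^bsub>TM F\<^esub> (X \<oplus>\<^bsub>TM F\<^esub> Y) = a \<odot>\<^bsub>TM F\<^esub> X \<oplus>\<^bsub>TM F\<^esub> a \<odot>\<^bsub>TM F\<^esub> Y"
        using hom_mult[OF m[OF a] XT YT] XT YT
        by (simp only: tensor_mod_smult[OF F a] tensor_mod_simps(2) A.T.m_closed)
    }
    fix b assume b: "b \<in> carrier S"
    have ab: "a \<oplus>\<^bsub>S\<^esub> b \<in> carrier S" "a \<otimes>\<^bsub>S\<^esub> b \<in> carrier S" using a b by auto
    have "(\<lambda>X. tmap R CR F CR F (act a) (idm F) X \<otimes>\<^bsub>A.T\<^esub> tmap R CR F CR F (act b) (idm F) X) \<in> hom A.T A.T"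
      using hom_in_carrier[OF m[OF a]] hom_in_carrier[OF m[OF b]]
      by (intro homI) (simp_all add: hom_mult[OF m[OF a]] hom_mult[OF m[OF b]] A.T.m_ac)
    then have "tmap R CR F CR F (act (a \<oplus>\<^bsub>S\<^esub> b)) (idm F) X =
        (\<lambda>X. tmap R CR F CR F (act a) (idm F) X \<otimes>\<^bsub>A.T\<^esub> tmap R CR F CR F (act b) (idm F) X) X"
    proof (rule A.tensor_hom_eqI[OF A.T.group_axioms m[OF ab(1)] _ _ XT])
      fix x y assume "x \<in> carrier CR" "y \<in> carrier F"
      then show "tmap R CR F CR F (act (a \<oplus>\<^bsub>S\<^esub> b)) (idm F) (A.t x y) =
        tmap R CR F CR F (act a) (idm F) (A.t x y) \<otimes>\<^bsub>A.T\<^esub> tmap R CR F CR F (act b) (idm F) (A.t x y)"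
        using a b ab(1) CLm.smult_l_distr[of a b x] A.t_add_left[of "a \<odot>\<^bsub>C\<^esub> x" "b \<odot>\<^bsub>C\<^esub> x" y]
        by (simp add: tt act_apply lsmult_closed)
    qed
    then show "(a \<oplus>\<^bsub>S\<^esub> b) \<odot>\<^bsub>TM F\<^esub> X = a \<odot>\<^bsub>TM F\<^esub> X \<oplus>\<^bsub>TM F\<^esub> b \<odot>\<^bsub>TM F\<^esub> X"
      by (simp only: tensor_mod_smult[OF F _ XT] a b ab tensor_mod_simps(2))
    have "tmap R CR F CR F (act a) (idm F) (tmap R CR F CR F (act b) (idm F) X) =
        tmap R CR F CR F (act (a \<otimes>\<^bsub>S\<^esub> b)) (idm F) X"
      using CLm.smult_assoc1[of a b] a b
      by (intro tmap_compose[OF TP[OF F] TP[OF F] TP[OF F] act_hom[OF b] id act_hom[OF a] id act_hom[OF ab(2)] id _ _ XT])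
        (auto simp: act_apply lsmult_closed)
    then show "(a \<otimes>\<^bsub>S\<^esub> b) \<odot>\<^bsub>TM F\<^esub> X = a \<odot>\<^bsub>TM F\<^esub> (b \<odot>\<^bsub>TM F\<^esub> X)"
      by (simp only: tensor_mod_smult[OF F _ XT] tensor_mod_smult[OF F _ hom_in_carrier[OF m XT]] a b ab)
  next
    fix X assume "X \<in> carrier (TM F)"
    then have XT: "X \<in> carrier A.T" by simp
    have one: "\<one>\<^bsub>S\<^esub> \<in> carrier S" by simp
    show "\<one>\<^bsub>S\<^esub> \<odot>\<^bsub>TM F\<^esub> X = X"
      unfolding tensor_mod_smult[OF F one XT]
      by (rule tmap_id[OF TP[OF F] act_hom[OF one] id _ _ XT]) (use CLm.smult_one in \<open>auto simp: act_apply\<close>)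
  qed
qed

lemma hom_mod_module:
  assumes I: "left_module S I" shows "left_module R (HM I)"
proof -
  interpret I: left_module S I by (rule I)
  interpret CLm: left_module S CL by (rule CL)
  interpret CRm: left_module "op_ring R" CR by (rule CR)
  have G: "comm_group (hom_group S CL I)" by (rule hom_group_group[OF CL I])
  interpret G: comm_group "hom_group S CL I" by (rule G)
  have ab: "abelian_group (HM I)"
  proof (rule abelian_groupI)
    fix f g h assume f: "f \<in> carrier (HM I)" and g: "g \<in> carrier (HM I)"
    then show "f \<oplus>\<^bsub>HM I\<^esub> g \<in> carrier (HM I)" using G.m_closed[of f g] by simp
    show "f \<oplus>\<^bsub>HM I\<^esub> g = g \<oplus>\<^bsub>HM I\<^esub> f" using G.m_comm[of f g] f g by simp
    assume h: "h \<in> carrier (HM I)"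
    show "f \<oplus>\<^bsub>HM I\<^esub> g \<oplus>\<^bsub>HM I\<^esub> h = f \<oplus>\<^bsub>HM I\<^esub> (g \<oplus>\<^bsub>HM I\<^esub> h)" using G.m_assoc[of f g h] f g h by simp
  next
    show "\<zero>\<^bsub>HM I\<^esub> \<in> carrier (HM I)" using G.one_closed by simp
    fix f assume f: "f \<in> carrier (HM I)"
    show "\<zero>\<^bsub>HM I\<^esub> \<oplus>\<^bsub>HM I\<^esub> f = f" using G.l_one[of f] f by simp
    show "\<exists>g\<in>carrier (HM I). g \<oplus>\<^bsub>HM I\<^esub> f = \<zero>\<^bsub>HM I\<^esub>"
      using G.l_inv[of f] G.inv_closed[of f] f by (intro bexI[of _ "inv\<^bsub>hom_group S CL I\<^esub> f"]) simp_all
  qed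
  show ?thesis
  proof (intro left_module.intro left_module_axioms.intro ring_R ab)
    fix a f assume a: "a \<in> carrier R" and f: "f \<in> carrier (HM I)"
    then have f': "f \<in> mod_hom S CL I" by simp
    note fc = mod_hom_closed[OF f'] and fa = mod_hom_add[OF f'] and fs = mod_hom_smult[OF f']
    have "restrict (\<lambda>c. f (rsmult C c a)) (carrier CL) \<in> mod_hom S CL I"
    proof (rule mod_hom_restrictI[OF CL])
      show "f (rsmult C (x \<oplus>\<^bsub>CL\<^esub> y) a) = f (rsmult C x a) \<oplus>\<^bsub>I\<^esub> f (rsmult C y a)"
        if "x \<in> carrier CL" "y \<in> carrier CL" for x y
        using that a CRm.smult_r_distr[of a x y] fa[of "rsmult C x a" "rsmult C y a"] by (simp add: rsmult_closed)
      show "f (rsmult C (s \<odot>\<^bsub>CL\<^esub> x) a) = s \<odot>\<^bsub>I\<^esub> f (rsmult C x a)" if "s \<in> carrier S" "x \<in> carrier CL" for s x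
        using that a fs[of s "rsmult C x a"] by (simp add: CC rsmult_closed)
    qed (use a fc in \<open>simp add: rsmult_closed\<close>)
    then show "a \<odot>\<^bsub>HM I\<^esub> f \<in> carrier (HM I)" by simp
    {
      fix g assume g: "g \<in> carrier (HM I)"
      show "a \<odot>\<^bsub>HM I\<^esub> (f \<oplus>\<^bsub>HM I\<^esub> g) = a \<odot>\<^bsub>HM I\<^esub> f \<oplus>\<^bsub>HM I\<^esub> a \<odot>\<^bsub>HM I\<^esub> g"
        using a by (auto simp: rsmult_closed intro!: restrict_ext)
    }
    fix b assume b: "b \<in> carrier R"
    show "(a \<oplus>\<^bsub>R\<^esub> b) \<odot>\<^bsub>HM I\<^esub> f = a \<odot>\<^bsub>HM I\<^esub> f \<oplus>\<^bsub>HM I\<^esub> b \<odot>\<^bsub>HM I\<^esub> f"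
      using a b CRm.smult_l_distr[of a b] fa by (auto simp: rsmult_closed intro!: restrict_ext)
    show "(a \<otimes>\<^bsub>R\<^esub> b) \<odot>\<^bsub>HM I\<^esub> f = a \<odot>\<^bsub>HM I\<^esub> (b \<odot>\<^bsub>HM I\<^esub> f)"
      using a b CRm.smult_assoc1[of b a] by (auto simp: rsmult_closed intro!: restrict_ext)
  next
    fix f assume "f \<in> carrier (HM I)"
    then have "f \<in> extensional (carrier C)" using mod_hom_ext[of f S CL I] by simp
    then show "\<one>\<^bsub>R\<^esub> \<odot>\<^bsub>HM I\<^esub> f = f"
      using CRm.smult_one by (auto simp: extensional_def fun_eq_iff)
  qed
qed

lemma hom_modD:
  assumes "h \<in> carrier (HM I)" shows "h \<in> mod_hom S CL I" "c \<in> carrier C \<Longrightarrow> h c \<in> carrier I"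
  using assms mod_hom_closed[of h S CL I c] by auto

text \<open>Since \<open>r\<close> acts on \<open>h\<close> by \<open>(r h)(c) = h(c r)\<close>, a
  linear combination in Hom(C, I) evaluated at \<open>c\<close> is a homomorphism on a power of
  \<open>C\<close> evaluated at a single vector. This turns systems over Hom(C, I) into statements
  about powers of \<open>C\<close>.\<close>

lemma lc_hom_mod:
  assumes I: "left_module S I" and r: "set r \<subseteq> carrier R" and hs: "set hs \<subseteq> mod_hom S CL I" and c: "c \<in> carrier C"
  shows "lc (HM I) r hs c = ev I hs (map (\<lambda>x. rsmult C c x) r)"
  using r hs by (induction r hs rule: list_induct2') (use c in auto)

definition Tmap where
  "Tmap A B f = restrict (tmap R CR A CR B (idm CR) f) (carrier (T A))"

lemma Tmap_hom:
  assumes A: "left_module R A" and B: "left_module R B" and f: "f \<in> mod_hom R A B"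
  shows "Tmap A B f \<in> mod_hom S (TM A) (TM B)"
proof -
  interpret A: tensor_pair R CR A by (rule TP[OF A])
  note h = tmap_hom[OF TP[OF A] TP[OF B] idm_CR_hom f]
  have "restrict (tmap R CR A CR B (idm CR) f) (carrier (TM A)) \<in> mod_hom S (TM A) (TM B)"
  proof (rule mod_hom_restrictI[OF tensor_mod_module[OF A]])
    fix X assume X: "X \<in> carrier (TM A)"
    then have XT: "X \<in> carrier A.T" by simp
    show "tmap R CR A CR B (idm CR) f X \<in> carrier (TM B)" using hom_in_carrier[OF h XT] by simp
    show "tmap R CR A CR B (idm CR) f (X \<oplus>\<^bsub>TM A\<^esub> Y) = tmap R CR A CR B (idm CR) f X \<oplus>\<^bsub>TM B\<^esub> tmap R CR A CR B (idm CR) f Y"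
      if "Y \<in> carrier (TM A)" for Y using hom_mult[OF h XT, of Y] that by simp
    fix s assume s: "s \<in> carrier S"
    have "tmap R CR A CR B (idm CR) f (tmap R CR A CR A (act s) (idm A) X) = tmap R CR A CR B (act s) f X"
      by (rule tmap_compose[OF TP[OF A] TP[OF A] TP[OF B] act_hom[OF s] mod_hom_id[OF A] idm_CR_hom f act_hom[OF s] f _ _ XT])
        (use s in \<open>auto simp: act_apply lsmult_closed\<close>)
    moreover have "tmap R CR B CR B (act s) (idm B) (tmap R CR A CR B (idm CR) f X) = tmap R CR A CR B (act s) f X"
      by (rule tmap_compose[OF TP[OF A] TP[OF B] TP[OF B] idm_CR_hom f act_hom[OF s] mod_hom_id[OF B] act_hom[OF s] f _ _ XT])
        (use mod_hom_closed[OF f] in auto)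
    ultimately show "tmap R CR A CR B (idm CR) f (s \<odot>\<^bsub>TM A\<^esub> X) = s \<odot>\<^bsub>TM B\<^esub> tmap R CR A CR B (idm CR) f X"
      by (simp only: tensor_mod_smult[OF A s XT] tensor_mod_smult[OF B s hom_in_carrier[OF h XT]])
  qed
  then show ?thesis by (simp add: Tmap_def)
qed

lemma Tmap_t:
  assumes A: "left_module R A" and B: "left_module R B" and f: "f \<in> mod_hom R A B" and "c \<in> carrier C" "a \<in> carrier A"
  shows "Tmap A B f (t A c a) = t B c (f a)"
proof -
  interpret A: tensor_pair R CR A by (rule TP[OF A])
  show ?thesis using assms tmap_tens[OF TP[OF A] TP[OF B] idm_CR_hom f, of c a] A.t_closed[of c a] by (simp add: Tmap_def)
qed

definition Hmap where
  "Hmap A g = restrict (\<lambda>h. compose (carrier C) g h) (mod_hom S CL A)"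

lemma Hmap_hom:
  assumes A: "left_module S A" and B: "left_module S B" and g: "g \<in> mod_hom S A B"
  shows "Hmap A g \<in> mod_hom R (HM A) (HM B)"
proof -
  have "restrict (\<lambda>h. compose (carrier C) g h) (carrier (HM A)) \<in> mod_hom R (HM A) (HM B)"
  proof (rule mod_hom_restrictI[OF hom_mod_module[OF A]])
    fix h assume h: "h \<in> carrier (HM A)"
    note h' = hom_modD[OF h]
    show "compose (carrier C) g h \<in> carrier (HM B)" using mod_hom_compose[OF CL h'(1) g] by simp
    show "compose (carrier C) g (h \<oplus>\<^bsub>HM A\<^esub> j) = compose (carrier C) g h \<oplus>\<^bsub>HM B\<^esub> compose (carrier C) g j"
      if j: "j \<in> carrier (HM A)" for j
      using h'(2) hom_modD(2)[OF j] by (auto simp: compose_def mod_hom_add[OF g] intro!: restrict_ext)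
    show "compose (carrier C) g (r \<odot>\<^bsub>HM A\<^esub> h) = r \<odot>\<^bsub>HM B\<^esub> compose (carrier C) g h" if "r \<in> carrier R" for r
      using that by (auto simp: compose_def rsmult_closed intro!: restrict_ext)
  qed
  then show ?thesis by (simp add: Hmap_def)
qed

lemma Hmap_apply: "h \<in> mod_hom S CL A \<Longrightarrow> c \<in> carrier C \<Longrightarrow> Hmap A g h c = g (h c)"
  by (simp add: Hmap_def compose_eq)

text \<open>The unit \<open>mu\<close> and the counit \<open>nu\<close> of the adjunction between \<open>C \<otimes> -\<close> and \<open>Hom(C, -)\<close>.\<close>

definition mu where
  "mu F = restrict (\<lambda>f. \<lambda>c\<in>carrier C. t F c f) (carrier F)"

lemma mu_apply: "f \<in> carrier F \<Longrightarrow> c \<in> carrier C \<Longrightarrow> mu F f c = t F c f"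
  by (simp add: mu_def)

lemma mu_closed:
  assumes F: "left_module R F" and f: "f \<in> carrier F"
  shows "mu F f \<in> mod_hom S CL (TM F)"
proof -
  interpret A: tensor_pair R CR F by (rule TP[OF F])
  have "restrict (\<lambda>c. t F c f) (carrier CL) \<in> mod_hom S CL (TM F)"
  proof (rule mod_hom_restrictI[OF CL])
    show "t F (s \<odot>\<^bsub>CL\<^esub> c) f = s \<odot>\<^bsub>TM F\<^esub> t F c f" if "s \<in> carrier S" "c \<in> carrier CL" for s c
      using tensor_mod_smult_t[OF F that(1) _ f, of c] that by simp
  qed (use f in \<open>auto simp: A.t_add_left[simplified]\<close>)
  then show ?thesis using f by (simp add: mu_def)
qed

lemma mu_hom:
  assumes F: "left_module R F" shows "mu F \<in> mod_hom R F (HM (TM F))"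
proof -
  interpret A: tensor_pair R CR F by (rule TP[OF F])
  have cl: "(\<lambda>c\<in>carrier C. t F c f) \<in> mod_hom S CL (TM F)" if "f \<in> carrier F" for f
    using mu_closed[OF F that] that by (simp add: mu_def)
  show ?thesis
    unfolding mu_def
  proof (rule mod_hom_restrictI[OF F])
    show "(\<lambda>c\<in>carrier C. t F c (a \<odot>\<^bsub>F\<^esub> f)) = a \<odot>\<^bsub>HM (TM F)\<^esub> (\<lambda>c\<in>carrier C. t F c f)"
      if "a \<in> carrier R" "f \<in> carrier F" for a f
      using that A.t_balanced[of a _ f] by (auto simp: rsmult_closed intro!: restrict_ext)
  qed (use cl A.t_add_right in \<open>auto intro!: restrict_ext\<close>)
qed

definition nu where
  "nu I = (SOME \<Phi>. \<Phi> \<in> mod_hom S (TM (HM I)) I \<and> (\<forall>c\<in>carrier C. \<forall>h\<in>mod_hom S CL I. \<Phi> (t (HM I) c h) = h c))"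

lemma nu:
  assumes I: "left_module S I"
  shows nu_hom: "nu I \<in> mod_hom S (TM (HM I)) I"
    and nu_t: "\<And>c h. c \<in> carrier C \<Longrightarrow> h \<in> mod_hom S CL I \<Longrightarrow> nu I (t (HM I) c h) = h c"
proof -
  interpret I: left_module S I by (rule I)
  note H = hom_mod_module[OF I]
  interpret A: tensor_pair R CR "HM I" by (rule TP[OF H])
  have agrp: "group (add_monoid I)" using I.M.a_comm_group by (simp add: comm_group_def)
  obtain \<Psi> where \<Psi>: "\<Psi> \<in> hom A.T (add_monoid I)"
    "\<And>c h. c \<in> carrier CR \<Longrightarrow> h \<in> carrier (HM I) \<Longrightarrow> \<Psi> (t (HM I) c h) = h c"
  proof (rule A.tensor_universal[of "add_monoid I" "\<lambda>c h. h c"])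
    show "comm_group (add_monoid I)" by (rule I.M.a_comm_group)
    show "h (x \<oplus>\<^bsub>CR\<^esub> x') = h x \<otimes>\<^bsub>add_monoid I\<^esub> h x'"
      if "x \<in> carrier CR" "x' \<in> carrier CR" "h \<in> carrier (HM I)" for x x' h
      using that mod_hom_add[of h S CL I x x'] by simp
  qed (auto simp: rsmult_closed mod_hom_closed)
  have sm: "\<Psi> (s \<odot>\<^bsub>TM (HM I)\<^esub> X) = s \<odot>\<^bsub>I\<^esub> \<Psi> X" if s: "s \<in> carrier S" and X: "X \<in> carrier A.T" for s X
  proof -
    note a = tmap_hom[OF TP[OF H] TP[OF H] act_hom[OF s] mod_hom_id[OF H]]
    have h1: "(\<lambda>X. s \<odot>\<^bsub>I\<^esub> \<Psi> X) \<in> hom A.T (add_monoid I)"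
      using hom_in_carrier[OF \<Psi>(1)] s by (intro homI) (auto simp: hom_mult[OF \<Psi>(1)] I.smult_r_distr)
    have "(\<Psi> \<circ> tmap R CR (HM I) CR (HM I) (act s) (idm (HM I))) X = (\<lambda>X. s \<odot>\<^bsub>I\<^esub> \<Psi> X) X"
    proof (rule A.tensor_hom_eqI[OF agrp hom_compose[OF a \<Psi>(1)] h1 _ X])
      fix c h assume ch: "c \<in> carrier CR" "h \<in> carrier (HM I)"
      have "tmap R CR (HM I) CR (HM I) (act s) (idm (HM I)) (A.t c h) = A.t (s \<odot>\<^bsub>C\<^esub> c) h"
        using tmap_tens[OF TP[OF H] TP[OF H] act_hom[OF s] mod_hom_id[OF H] ch] ch by (simp add: act_apply)
      then show "(\<Psi> \<circ> tmap R CR (HM I) CR (HM I) (act s) (idm (HM I))) (A.t c h) = s \<odot>\<^bsub>I\<^esub> \<Psi> (A.t c h)"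
        using ch s \<Psi>(2)[of "s \<odot>\<^bsub>C\<^esub> c" h] \<Psi>(2)[OF ch] mod_hom_smult[of h S CL I s c] by (simp add: lsmult_closed)
    qed
    then show ?thesis by (simp only: tensor_mod_smult[OF H s X] comp_apply)
  qed
  have "restrict \<Psi> (carrier (TM (HM I))) \<in> mod_hom S (TM (HM I)) I"
    by (rule mod_hom_restrictI[OF tensor_mod_module[OF H]])
       (use hom_in_carrier[OF \<Psi>(1)] hom_mult[OF \<Psi>(1)] sm in \<open>simp_all del: tensor_mod_simps(4)\<close>)
  moreover have "restrict \<Psi> (carrier (TM (HM I))) (t (HM I) c h) = h c" if "c \<in> carrier C" "h \<in> mod_hom S CL I" for c h
    using that \<Psi>(2)[of c h] A.t_closed[of c h] by simp
  ultimately have "\<exists>\<Phi>. \<Phi> \<in> mod_hom S (TM (HM I)) I \<and> (\<forall>c\<in>carrier C. \<forall>h\<in>mod_hom S CL I. \<Phi> (t (HM I) c h) = h c)"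
    by blast
  then have "nu I \<in> mod_hom S (TM (HM I)) I \<and> (\<forall>c\<in>carrier C. \<forall>h\<in>mod_hom S CL I. nu I (t (HM I) c h) = h c)"
    unfolding nu_def by (rule someI_ex)
  then show "nu I \<in> mod_hom S (TM (HM I)) I"
    "\<And>c h. c \<in> carrier C \<Longrightarrow> h \<in> mod_hom S CL I \<Longrightarrow> nu I (t (HM I) c h) = h c" by auto
qed

lemma nu_tsum:
  assumes I: "left_module S I" and "set ds \<subseteq> carrier C" "set hs \<subseteq> mod_hom S CL I"
  shows "nu I (tsum R CR (HM I) ds hs) = ev I hs ds"
proof -
  note H = hom_mod_module[OF I]
  interpret A: tensor_pair R CR "HM I" by (rule TP[OF H])
  note N = nu_hom[OF I]
  show ?thesis using assms(2,3)
  proof (induction ds hs rule: list_induct2')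
    case (4 d ds h hs)
    then show ?case
      using mod_hom_add[OF N, of "t (HM I) d h" "tsum R CR (HM I) ds hs"] nu_t[OF I, of d h] by simp
  qed (use mod_hom_zero[OF tensor_mod_module[OF H] I N] in simp_all)
qed

text \<open>The matrix \<open>G\<close> acting on the power of \<open>C\<close> inside the tensor
  product acts on coordinates in \<open>C \<otimes> F\<close> as the same matrix over
  \<open>S\<close>. On an elementary tensor with right factor \<open>y\<close> this is the
  \<open>S\<close>-linearity of \<open>mu F y\<close>, and both sides are additive.\<close>

lemma lin_coord:
  assumes F: "left_module R F" and G: "set G \<subseteq> vecs (carrier S) n" and j: "j < length G"
    and w: "w \<in> carrier (tensor_group R (pow_mod CR n) F)"
  shows "tcoord R CR F (length G) j
      (tmap R (pow_mod CR n) F (pow_mod CR (length G)) F (biaction.rowmap CR CL n G) (idm F) w) =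
    lc (TM F) (G ! j) (map (\<lambda>i. tcoord R CR F n i w) [0..<n])"
proof -
  interpret bi: biaction "op_ring R" CR S CL by (rule biaction)
  note P = pow_mod_module[OF CR]
  note TPw = tensor_pairI[OF P F] and TC = TP[OF F] and id = mod_hom_id[OF F]
  interpret A: tensor_pair R "pow_mod CR n" F by (rule TPw)
  interpret B: tensor_pair R CR F by (rule TC)
  interpret TMm: left_module S "TM F" by (rule tensor_mod_module[OF F])
  let ?k = "length G"
  have r: "G ! j \<in> vecs (carrier S) n" using G j by auto
  note rm = bi.rowmap_hom[OF G] and cj = coord_is_hom[OF CR j]
  have c: "tcoord R CR F n i \<in> hom A.T B.T" if "i < n" for i
    by (rule tmap_hom[OF TPw TC coord_is_hom[OF CR that] id])
  let ?q = "compose (carrier (pow_mod CR n)) (coord CR ?k j) (bi.rowmap n G)"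
  have q: "?q \<in> mod_hom (op_ring R) (pow_mod CR n) CR" by (rule mod_hom_compose[OF P rm cj])
  have qz: "?q z = lc CL (G ! j) z" if "z \<in> vecs (carrier C) n" for z
    using that j mod_hom_closed[OF rm, of z] by (simp add: compose_eq coord_def bi.rowmap_def)
  have "tcoord R CR F ?k j (tmap R (pow_mod CR n) F (pow_mod CR ?k) F (bi.rowmap n G) (idm F) w)
     = tmap R (pow_mod CR n) F CR F ?q (idm F) w"
    by (rule tmap_compose[OF TPw tensor_pairI[OF P F] TC rm id cj id q id _ _ w]) (auto simp: compose_eq)
  also have "\<dots> = lc (TM F) (G ! j) (map (\<lambda>i. tcoord R CR F n i w) [0..<n])"
    using w
  proof (induction rule: A.tensor_induct)
    case one
    have "map (\<lambda>i. tcoord R CR F n i \<one>\<^bsub>A.T\<^esub>) [0..<n] = replicate n \<zero>\<^bsub>TM F\<^esub>"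
      using tmap_one[OF TPw TC coord_is_hom[OF CR] id] by (intro nth_equalityI) (simp_all del: restrict_apply)
    then show ?case
      unfolding tmap_one[OF TPw TC q id] using TMm.lc_zero_right[OF vecs_set[OF r]] by (simp only: tensor_mod_simps)
  next
    case (tens z y)
    have z: "z \<in> vecs (carrier C) n" using tens by simp
    have "map (\<lambda>i. tcoord R CR F n i (A.t z y)) [0..<n] = map (mu' y) z"
      if "mu' = (\<lambda>y c. mu F y c)" for mu' :: "_ \<Rightarrow> 'c \<Rightarrow> _"
      using tens z tmap_tens[OF TPw TC coord_is_hom[OF CR] id tens] vecs_nth[OF z] vecs_length[OF z]
      by (auto simp: that mu_apply coord_def intro!: nth_equalityI)
    note 1 = this[OF refl]
    have zC: "set z \<subseteq> carrier CL" using vecs_set[OF z] by simp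
    have "lc CL (G ! j) z \<in> carrier C"
      using left_module.lc_closed[OF CL vecs_set[OF r] zC] by simp
    moreover have "idm F y = y" using tens(2) by simp
    ultimately have "tmap R (pow_mod CR n) F CR F ?q (idm F) (A.t z y) = mu F y (lc CL (G ! j) z)"
      using tmap_tens[OF TPw TC q id tens] qz[OF z] mu_apply[OF tens(2)] by (simp only:)
    then show ?case
      unfolding 1 using mod_hom_lc[OF CL tensor_mod_module[OF F] mu_closed[OF F tens(2)] vecs_set[OF r] zC] by (simp only:)
  next
    case (mult X Y)
    let ?L = "\<lambda>X. map (\<lambda>i. tcoord R CR F n i X) [0..<n]"
    have L: "?L X \<in> vecs (carrier (TM F)) n" if "X \<in> carrier A.T" for X
      using hom_in_carrier[OF c that] by (simp add: vecs_iff_nth del: restrict_apply)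
    have XY: "?L (X \<otimes>\<^bsub>A.T\<^esub> Y) = map2 (ring.add (TM F)) (?L X) (?L Y)"
      using hom_mult[OF c mult(1,2)] by (intro nth_equalityI) (simp_all del: restrict_apply)
    have "lc (TM F) (G ! j) (map2 (ring.add (TM F)) (?L X) (?L Y)) =
        lc (TM F) (G ! j) (?L X) \<oplus>\<^bsub>TM F\<^esub> lc (TM F) (G ! j) (?L Y)"
      by (rule TMm.lc_add_right) (use L[OF mult(1)] L[OF mult(2)] r in \<open>auto simp only: vecs_def mem_Collect_eq\<close>)
    then show ?case
      unfolding XY hom_mult[OF tmap_hom[OF TPw TC q id] mult(1,2)] mult(3,4) by (simp only: tensor_mod_simps(2))
  qed
  finally show ?thesis .
qed

text \<open>For surjectivity, a homomorphism \<open>h\<close> from \<open>C\<close> to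
  \<open>C \<otimes> F\<close> is determined by its values on \<open>cs\<close>, and these are the
  coordinates of one tensor \<open>w\<close> over the power of \<open>C\<close>. The relations among
  \<open>cs\<close> say that \<open>sigma\<close> kills \<open>w\<close>, so by the coresolution
  \<open>w\<close> is \<open>cs\<close> tensored with some \<open>f\<close>. Then \<open>h\<close>
  and \<open>mu F f\<close> agree on \<open>cs\<close>.\<close>

lemma mu_bij:
  assumes F: "weak_flat R F" shows "bij_betw (mu F) (carrier F) (carrier (HM (TM F)))"
proof -
  have FM: "left_module R F" using F by (simp add: weak_flat_def)
  note TMm = tensor_mod_module[OF FM] and HMm = hom_mod_module[OF tensor_mod_module[OF FM]] and id = mod_hom_id[OF FM]
  interpret A: tensor_pair R CR F by (rule TP[OF FM])
  obtain cs sg where rc: "right_coresolution R CR S CL cs sg" and fr: "fin_rel S CL cs sg"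
    by (rule right_coresolution_exists)
  interpret rc: right_coresolution R CR S CL cs sg by (rule rc)
  note P = pow_mod_module[OF CR]
  have cs: "gens S CL cs" using fr by (simp add: fin_rel_def)
  have sg: "set sg \<subseteq> vecs (carrier S) rc.n" "\<And>r. r \<in> set sg \<Longrightarrow> lc CL r cs = \<zero>\<^bsub>CL\<^esub>" using rc.sg_set by auto
  have "inj_on (mu F) (carrier F)"
    unfolding mod_hom_inj_iff[OF FM HMm mu_hom[OF FM]]
  proof (intro ballI impI)
    fix f assume f: "f \<in> carrier F" "mu F f = \<zero>\<^bsub>HM (TM F)\<^esub>"
    have "t F c f = \<one>\<^bsub>T F\<^esub>" if "c \<in> carrier C" for c using fun_cong[OF f(2), of c] f(1) that by (simp add: mu_def)
    then show "f = \<zero>\<^bsub>F\<^esub>" using rc.coevaluation_inj[OF F f(1)] by simp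
  qed
  moreover have "h \<in> mu F ` carrier F" if "h \<in> carrier (HM (TM F))" for h
  proof -
    have h: "h \<in> mod_hom S CL (TM F)" using that by simp
    have hcs: "map h cs \<in> vecs (carrier A.T) rc.n"
      using gens_set[OF cs] mod_hom_closed[OF h] by (auto simp: vecs_def rc.n_def)
    obtain w where w: "w \<in> carrier (tensor_group R (pow_mod CR rc.n) F)"
      "\<And>i. i < rc.n \<Longrightarrow> tmap R (pow_mod CR rc.n) F CR F (coord CR rc.n i) (idm F) w = map h cs ! i"
      using pow_tensor_exists[OF CR FM hcs] by blast
    have wl: "map (\<lambda>i. tmap R (pow_mod CR rc.n) F CR F (coord CR rc.n i) (idm F) w) [0..<rc.n] = map h cs"
      using w(2) by (auto simp: rc.n_def intro!: nth_equalityI)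
    have "tmap R (pow_mod CR rc.n) F (pow_mod CR rc.m) F rc.sigma (idm F) w = \<one>\<^bsub>tensor_group R (pow_mod CR rc.m) F\<^esub>"
    proof (rule pow_tensor_trivial[OF CR FM])
      show "tmap R (pow_mod CR rc.n) F (pow_mod CR rc.m) F rc.sigma (idm F) w \<in> carrier (tensor_group R (pow_mod CR rc.m) F)"
        by (rule hom_in_carrier[OF tmap_hom[OF tensor_pairI[OF P FM] tensor_pairI[OF P FM] rc.sigma_hom id] w(1)])
      fix j assume j: "j < rc.m"
      then have jl: "j < length sg" by (simp add: rc.m_def)
      have r: "sg ! j \<in> vecs (carrier S) rc.n" "lc CL (sg ! j) cs = \<zero>\<^bsub>CL\<^esub>" using sg nth_mem[OF jl] by auto
      have "tmap R (pow_mod CR rc.m) F CR F (coord CR rc.m j) (idm F)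
          (tmap R (pow_mod CR rc.n) F (pow_mod CR rc.m) F rc.sigma (idm F) w) = lc (TM F) (sg ! j) (map h cs)"
        using lin_coord[OF FM sg(1) jl w(1)] unfolding wl rc.sigma_rowmap rc.m_def .
      also have "\<dots> = h (lc CL (sg ! j) cs)" by (rule mod_hom_lc[OF CL TMm h vecs_set[OF r(1)] gens_set[OF cs], symmetric])
      also have "\<dots> = \<one>\<^bsub>A.T\<^esub>" using mod_hom_zero[OF CL TMm h] r(2) by simp
      finally show "tmap R (pow_mod CR rc.m) F CR F (coord CR rc.m j) (idm F)
          (tmap R (pow_mod CR rc.n) F (pow_mod CR rc.m) F rc.sigma (idm F) w) = \<one>\<^bsub>A.T\<^esub>" .
    qed
    then obtain f where f: "f \<in> carrier F" "w = tens R (pow_mod CR rc.n) F cs f" using rc.coevaluation_surj[OF F w(1)] by blast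
    have "h c = mu F f c" if "c \<in> set cs" for c
    proof -
      obtain i where i: "i < rc.n" "c = cs ! i" using \<open>c \<in> set cs\<close> by (auto simp: in_set_conv_nth rc.n_def)
      have csP: "cs \<in> carrier (pow_mod CR rc.n)" using rc.cs_vecs by simp
      have "h c = tmap R (pow_mod CR rc.n) F CR F (coord CR rc.n i) (idm F) (tens R (pow_mod CR rc.n) F cs f)"
        using w(2)[OF i(1)] i f(2) by (simp add: rc.n_def)
      also have "\<dots> = t F (coord CR rc.n i cs) (idm F f)"
        by (rule tmap_tens[OF tensor_pairI[OF P FM] TP[OF FM] coord_is_hom[OF CR i(1)] id csP f(1)])
      also have "\<dots> = mu F f c"
        using f(1) rc.cs_vecs vecs_nth[OF rc.cs_vecs i(1)] i(2) by (simp add: coord_def mu_apply)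
      finally show ?thesis .
    qed
    then have "h c = mu F f c" if "c \<in> carrier CL" for c
      using hom_eq_on_gens[OF CL TMm cs h mu_closed[OF FM f(1)] _ that] by blast
    then have "h = mu F f" by (rule mod_hom_eqI[OF h mu_closed[OF FM f(1)]])
    then show ?thesis using f(1) by blast
  qed
  ultimately show ?thesis using mod_hom_closed[OF mu_hom[OF FM]] by (auto simp: bij_betw_def)
qed

text \<open>An element of the kernel is a sum of tensors of the generators \<open>ds\<close> with
  homomorphisms \<open>hs\<close>, and \<open>ev I hs ds\<close> vanishes. The coresolution then
  writes \<open>hs\<close> as the transposed relations \<open>tg\<close> applied to homomorphisms
  \<open>gs\<close>. By \<open>tensor_presentation\<close> this is just what makes the tensor
  trivial.\<close>

lemma nu_bij:
  assumes I: "weak_injective S I" shows "bij_betw (nu I) (carrier (TM (HM I))) (carrier I)"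
proof -
  have IM: "left_module S I" using I by (simp add: weak_injective_def)
  note HMm = hom_mod_module[OF IM]
  note TMm = tensor_mod_module[OF HMm]
  interpret A: tensor_pair R CR "HM I" by (rule TP[OF HMm])
  obtain ds tg where co: "coresolution S CL (op_ring R) CR ds tg" and fr: "fin_rel (op_ring R) CR ds tg"
    by (rule left_coresolution_exists)
  interpret co: coresolution S CL "op_ring R" CR ds tg by (rule co)
  have ds: "gens (op_ring R) CR ds" using fr by (simp add: fin_rel_def)
  have dsC: "set ds \<subseteq> carrier C" using gens_set[OF ds] by simp
  have tg: "set tg \<subseteq> vecs (carrier R) co.n" using co.sg_set by auto
  have "inj_on (nu I) (carrier (TM (HM I)))"
    unfolding mod_hom_inj_iff[OF TMm IM nu_hom[OF IM]]
  proof (intro ballI impI)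
    fix X assume X: "X \<in> carrier (TM (HM I))" "nu I X = \<zero>\<^bsub>I\<^esub>"
    obtain hs where hs: "hs \<in> vecs (carrier (HM I)) co.n" "X = tsum R CR (HM I) ds hs"
      using A.tensor_gens[OF ds, of X] X(1) by (auto simp: co.n_def)
    have hs': "hs \<in> vecs (mod_hom S CL I) co.n" using hs(1) by simp
    have "ev I hs ds = \<zero>\<^bsub>I\<^esub>" using nu_tsum[OF IM dsC vecs_set[OF hs']] X(2) hs(2) by simp
    then obtain gs where gs: "gs \<in> vecs (mod_hom S CL I) co.m"
      "\<And>z. z \<in> vecs (carrier C) co.n \<Longrightarrow> ev I hs z = ev I gs (map (\<lambda>r. lc CR r z) tg)"
      using co.evaluation_kernel[OF I hs'] by auto
    have "map (\<lambda>r. lc (HM I) r gs) (columns co.n tg) = hs"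
    proof (rule nth_equalityI)
      show "length (map (\<lambda>r. lc (HM I) r gs) (columns co.n tg)) = length hs" using hs by (simp add: vecs_length)
      fix i assume "i < length (map (\<lambda>r. lc (HM I) r gs) (columns co.n tg))"
      then have i: "i < co.n" by simp
      let ?r = "map (\<lambda>l. l ! i) tg"
      have r: "set ?r \<subseteq> carrier R" using tg i by (auto simp: subset_iff vecs_iff_nth)
      have lcl: "lc (HM I) ?r gs \<in> mod_hom S CL I"
        using left_module.lc_closed[OF HMm r, of gs] gs(1) by (simp add: vecs_def)
      have hi: "hs ! i \<in> mod_hom S CL I" by (rule vecs_nth[OF hs' i])
      have "lc (HM I) ?r gs = hs ! i"
      proof (rule mod_hom_eqI[OF lcl hi])
        fix c assume "c \<in> carrier CL"
        then have c: "c \<in> carrier C" by simp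
        \<comment> \<open>The vector with the single entry \<open>c\<close> at place
          \<open>i\<close> isolates component \<open>i\<close> of \<open>hs\<close> on one side and
          column \<open>i\<close> of \<open>tg\<close> applied to \<open>gs\<close> on the
          other.\<close>
        let ?z = "(replicate co.n \<zero>\<^bsub>C\<^esub>)[i := c]"
        have z: "?z \<in> vecs (carrier C) co.n"
          using c i left_module.axioms(2)[OF CL] abelian_monoid.zero_closed[of CL]
          by (auto simp: vecs_iff_nth nth_list_update abelian_group_def)
        have "lc CR r ?z = rsmult C c (r ! i)" if "r \<in> set tg" for r
          using left_module.lc_delta_right[OF CR i, of r c] tg that c by auto
        then have "ev I gs (map (\<lambda>r. lc CR r ?z) tg) = ev I gs (map (\<lambda>x. rsmult C c x) ?r)"
          by (simp add: comp_def cong: map_cong)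
        also have "\<dots> = lc (HM I) ?r gs c" by (rule lc_hom_mod[OF IM r vecs_set[OF gs(1)] c, symmetric])
        finally have "lc (HM I) ?r gs c = ev I hs ?z" using gs(2)[OF z] by simp
        also have "\<dots> = (hs ! i) c" by (rule ev_delta[OF IM CL hs' i, simplified, OF c])
        finally show "lc (HM I) ?r gs c = (hs ! i) c" .
      qed
      then show "map (\<lambda>r. lc (HM I) r gs) (columns co.n tg) ! i = hs ! i" using i by (simp add: columns_def)
    qed
    then have "tsum R CR (HM I) ds hs = \<one>\<^bsub>A.T\<^esub>"
      using tensor_presentation[OF HMm fr, of hs] hs(1) gs(1) unfolding co.n_def co.m_def by auto
    then show "X = \<zero>\<^bsub>TM (HM I)\<^esub>" using hs(2) by simp
  qed
  moreover have "y \<in> nu I ` carrier (TM (HM I))" if y: "y \<in> carrier I" for y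
  proof -
    obtain hs where hs: "hs \<in> vecs (mod_hom S CL I) co.n" "ev I hs ds = y" using co.evaluation_surj[OF I y] by auto
    have "nu I (tsum R CR (HM I) ds hs) = y" using nu_tsum[OF IM dsC vecs_set[OF hs(1)]] hs(2) by simp
    moreover have "tsum R CR (HM I) ds hs \<in> carrier (TM (HM I))"
      using A.tsum_closed[of ds hs] dsC vecs_set[OF hs(1)] by simp
    ultimately show ?thesis by blast
  qed
  ultimately show ?thesis using mod_hom_closed[OF nu_hom[OF IM]] by (auto simp: bij_betw_def)
qed

end

section \<open>Faithfulness\<close>

lemma hom_zeroI:
  assumes M: "left_module R M" and N: "left_module R N"
    and z: "\<And>h x. h \<in> mod_hom R M N \<Longrightarrow> x \<in> carrier M \<Longrightarrow> h x = \<zero>\<^bsub>N\<^esub>"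
  shows "hom_zero R M N"
proof -
  interpret N: left_module R N by (rule N)
  have 0: "(\<lambda>x\<in>carrier M. \<zero>\<^bsub>N\<^esub>) \<in> mod_hom R M N"
    by (rule mod_hom_restrictI[OF M]) (auto simp: N.smult_zero_r)
  have "h = (\<lambda>x\<in>carrier M. \<zero>\<^bsub>N\<^esub>)" if "h \<in> mod_hom R M N" for h
    by (rule mod_hom_eqI[OF that 0]) (use z[OF that] in simp)
  then have "mod_hom R M N \<subseteq> {\<lambda>x\<in>carrier M. \<zero>\<^bsub>N\<^esub>}" by (intro subsetI) (simp only: singleton_iff)
  with 0 show ?thesis unfolding hom_zero_def by (intro subset_antisym) simp_all
qed

text \<open>
  The additive endomorphisms of \<open>W\<close> turn faithfulness into a statement about tensor products: if
  \<open>C \<otimes> W = 0\<close>, then \<open>Hom(C, End W) = Hom(C \<otimes> W, W) = 0\<close>.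
\<close>

definition endo_mod :: "('r, 'w) module \<Rightarrow> ('r, 'w \<Rightarrow> 'w) module" where
  "endo_mod W = mk_module
     {\<phi> \<in> carrier W \<rightarrow>\<^sub>E carrier W. \<forall>x\<in>carrier W. \<forall>y\<in>carrier W. \<phi> (x \<oplus>\<^bsub>W\<^esub> y) = \<phi> x \<oplus>\<^bsub>W\<^esub> \<phi> y}
     (\<lambda>\<phi> \<psi>. \<lambda>x\<in>carrier W. \<phi> x \<oplus>\<^bsub>W\<^esub> \<psi> x) (\<lambda>x\<in>carrier W. \<zero>\<^bsub>W\<^esub>) (\<lambda>r \<phi>. \<lambda>x\<in>carrier W. \<phi> (r \<odot>\<^bsub>W\<^esub> x))"

lemma endo_mod_simps [simp]:
  "carrier (endo_mod W) = {\<phi> \<in> carrier W \<rightarrow>\<^sub>E carrier W. \<forall>x\<in>carrier W. \<forall>y\<in>carrier W. \<phi> (x \<oplus>\<^bsub>W\<^esub> y) = \<phi> x \<oplus>\<^bsub>W\<^esub> \<phi> y}"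
  "\<phi> \<oplus>\<^bsub>endo_mod W\<^esub> \<psi> = (\<lambda>x\<in>carrier W. \<phi> x \<oplus>\<^bsub>W\<^esub> \<psi> x)"
  "\<zero>\<^bsub>endo_mod W\<^esub> = (\<lambda>x\<in>carrier W. \<zero>\<^bsub>W\<^esub>)"
  "r \<odot>\<^bsub>endo_mod W\<^esub> \<phi> = (\<lambda>x\<in>carrier W. \<phi> (r \<odot>\<^bsub>W\<^esub> x))"
  by (simp_all add: endo_mod_def)

lemma endo_mod_module:
  fixes W :: "('r, 'w) module"
  assumes W: "left_module R W" shows "left_module (op_ring R) (endo_mod W)"
proof -
  interpret W: left_module R W by (rule W)
  have ext: "\<phi> = \<psi>" if "\<phi> \<in> extensional (carrier W)" "\<psi> \<in> extensional (carrier W)" "\<And>x. x \<in> carrier W \<Longrightarrow> \<phi> x = \<psi> x"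
    for \<phi> \<psi> :: "'w \<Rightarrow> 'w" using that by (rule extensionalityI)
  have cl: "\<phi> x \<in> carrier W" if "\<phi> \<in> carrier (endo_mod W)" "x \<in> carrier W" for \<phi> x using that by auto
  have ab: "abelian_group (endo_mod W)"
  proof (rule abelian_groupI)
    fix \<phi> assume \<phi>: "\<phi> \<in> carrier (endo_mod W)"
    show "\<exists>\<psi>\<in>carrier (endo_mod W). \<psi> \<oplus>\<^bsub>endo_mod W\<^esub> \<phi> = \<zero>\<^bsub>endo_mod W\<^esub>"
      using \<phi> cl[OF \<phi>] by (intro bexI[of _ "\<lambda>x\<in>carrier W. \<ominus>\<^bsub>W\<^esub> \<phi> x"])
        (auto simp: W.M.l_neg W.M.minus_add intro!: restrict_ext)
    show "\<zero>\<^bsub>endo_mod W\<^esub> \<oplus>\<^bsub>endo_mod W\<^esub> \<phi> = \<phi>" by (rule ext) (use \<phi> in \<open>auto simp: PiE_iff\<close>)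
  qed (auto simp: W.M.a_ac PiE_iff intro!: restrict_ext)
  show ?thesis
  proof (intro left_module.intro left_module_axioms.intro ab op_ring_ring W.R.ring_axioms)
    show "\<one>\<^bsub>op_ring R\<^esub> \<odot>\<^bsub>endo_mod W\<^esub> \<phi> = \<phi>" if "\<phi> \<in> carrier (endo_mod W)" for \<phi>
      by (rule ext) (use that in \<open>auto simp: op_ring_simps PiE_iff\<close>)
  qed (auto simp: op_ring_simps W.smult_r_distr W.smult_l_distr W.smult_assoc1 PiE_iff intro!: restrict_ext)
qed

context faithful_bimodule
begin

lemma faithful_tensor:
  assumes W: "left_module R W" and z: "\<And>c w. c \<in> carrier C \<Longrightarrow> w \<in> carrier W \<Longrightarrow> t W c w = \<one>\<^bsub>T W\<^esub>"
  shows "carrier W = {\<zero>\<^bsub>W\<^esub>}"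
proof -
  interpret W: left_module R W by (rule W)
  interpret A: tensor_pair R CR W by (rule TP[OF W])
  note E = endo_mod_module[OF W]
  have "hom_zero (op_ring R) CR (endo_mod W)"
  proof (rule hom_zeroI[OF CR E])
    fix \<psi> c assume \<psi>: "\<psi> \<in> mod_hom (op_ring R) CR (endo_mod W)" and c: "c \<in> carrier CR"
    have e: "\<psi> x \<in> carrier (endo_mod W)" if "x \<in> carrier CR" for x by (rule mod_hom_closed[OF \<psi> that])
    have ew: "\<psi> x w \<in> carrier W" if "x \<in> carrier CR" "w \<in> carrier W" for x w using e[OF that(1)] that(2) by auto
    \<comment> \<open>A homomorphism from \<open>C\<close> to the endomorphisms of \<open>W\<close>
      is a balanced biadditive map into \<open>W\<close>: the scalar action on endomorphisms is
      precomposition. So it factors through \<open>C \<otimes> W\<close>, where every elementary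
      tensor is trivial.\<close>
    obtain \<Phi> where \<Phi>: "\<Phi> \<in> hom A.T (add_monoid W)"
      "\<And>x w. x \<in> carrier CR \<Longrightarrow> w \<in> carrier W \<Longrightarrow> \<Phi> (t W x w) = \<psi> x w"
    proof (rule A.tensor_universal[of "add_monoid W" \<psi>])
      show "comm_group (add_monoid W)" by (rule W.M.a_comm_group)
      show "\<psi> x w \<in> carrier (add_monoid W)" if "x \<in> carrier CR" "w \<in> carrier W" for x w using ew[OF that] by simp
      show "\<psi> (x \<oplus>\<^bsub>CR\<^esub> x') w = \<psi> x w \<otimes>\<^bsub>add_monoid W\<^esub> \<psi> x' w"
        if "x \<in> carrier CR" "x' \<in> carrier CR" "w \<in> carrier W" for x x' w
        using mod_hom_add[OF \<psi> that(1,2)] that(3) by simp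
      show "\<psi> x (w \<oplus>\<^bsub>W\<^esub> w') = \<psi> x w \<otimes>\<^bsub>add_monoid W\<^esub> \<psi> x w'"
        if "x \<in> carrier CR" "w \<in> carrier W" "w' \<in> carrier W" for x w w'
        using e[OF that(1)] that(2,3) by simp
      show "\<psi> (a \<odot>\<^bsub>CR\<^esub> x) w = \<psi> x (a \<odot>\<^bsub>W\<^esub> w)" if "a \<in> carrier R" "x \<in> carrier CR" "w \<in> carrier W" for a x w
        using mod_hom_smult[OF \<psi>, of a x] that by (simp add: op_ring_simps)
    qed (rule that)
    have "group (add_monoid W)" using W.M.a_comm_group by (simp add: comm_group_def)
    then have "\<Phi> \<one>\<^bsub>A.T\<^esub> = \<zero>\<^bsub>W\<^esub>" using hom_one[OF \<Phi>(1)] A.T.group_axioms by simp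
    then have "\<psi> c w = \<zero>\<^bsub>W\<^esub>" if "w \<in> carrier W" for w using \<Phi>(2)[OF c that] z[of c w] c that by simp
    then show "\<psi> c = \<zero>\<^bsub>endo_mod W\<^esub>" using e[OF c] by (intro extensionalityI[of _ "carrier W"]) (auto simp: PiE_iff)
  qed
  then have "carrier (endo_mod W) = {\<zero>\<^bsub>endo_mod W\<^esub>}" by (rule faithful_all_types(2)[OF faithful E])
  moreover have "idm W \<in> carrier (endo_mod W)" by auto
  ultimately have "idm W = \<zero>\<^bsub>endo_mod W\<^esub>" by blast
  from fun_cong[OF this] have "x = \<zero>\<^bsub>W\<^esub>" if "x \<in> carrier W" for x using that by (simp split: if_splits) metis
  then show ?thesis by auto
qed

lemma TM_hom_eqI:
  assumes A: "left_module R A" and N: "left_module S N"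
    and \<phi>: "\<phi> \<in> mod_hom S (TM A) N" and \<psi>: "\<psi> \<in> mod_hom S (TM A) N"
    and eq: "\<And>c a. c \<in> carrier C \<Longrightarrow> a \<in> carrier A \<Longrightarrow> \<phi> (t A c a) = \<psi> (t A c a)" and X: "X \<in> carrier (T A)"
  shows "\<phi> X = \<psi> X"
proof -
  interpret N: left_module S N by (rule N)
  interpret A: tensor_pair R CR A by (rule TP[OF A])
  have "group (add_monoid N)" using N.M.a_comm_group by (simp add: comm_group_def)
  moreover have "h \<in> hom A.T (add_monoid N)" if "h \<in> mod_hom S (TM A) N" for h
    using mod_hom_closed[OF that] mod_hom_add[OF that] by (intro homI) simp_all
  ultimately show ?thesis using A.tensor_hom_eqI[of "add_monoid N" \<phi> \<psi> X] \<phi> \<psi> eq X by simp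
qed

lemma Tmap_closed:
  assumes "left_module R A" "left_module R B" "f \<in> mod_hom R A B" "X \<in> carrier (T A)"
  shows "Tmap A B f X \<in> carrier (T B)"
  using mod_hom_closed[OF Tmap_hom[OF assms(1-3)], of X] assms(4) by simp

lemma Tmap_compose_zero:
  assumes A: "left_module R A" and B: "left_module R B" and D: "left_module R D"
    and f: "f \<in> mod_hom R A B" and g: "g \<in> mod_hom R B D"
    and z: "\<And>a. a \<in> carrier A \<Longrightarrow> g (f a) = \<zero>\<^bsub>D\<^esub>" and X: "X \<in> carrier (T A)"
  shows "Tmap B D g (Tmap A B f X) = \<one>\<^bsub>T D\<^esub>"
proof -
  note TB = Tmap_closed[OF A B f X]
  have "tmap R CR B CR D (idm CR) g (tmap R CR A CR B (idm CR) f X) = \<one>\<^bsub>T D\<^esub>"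
    by (rule tmap_compose_zero[OF TP[OF A] TP[OF B] TP[OF D] idm_CR_hom f idm_CR_hom g _ X]) (simp add: z)
  then show ?thesis
    unfolding Tmap_def restrict_apply'[OF X] restrict_apply'[OF TB[unfolded Tmap_def restrict_apply'[OF X]]] .
qed

lemma nu_natural:
  assumes A: "left_module S A" and B: "left_module S B" and g: "g \<in> mod_hom S A B" and X: "X \<in> carrier (T (HM A))"
  shows "nu B (Tmap (HM A) (HM B) (Hmap A g) X) = g (nu A X)"
proof -
  note HA = hom_mod_module[OF A] and HB = hom_mod_module[OF B] and Hg = Hmap_hom[OF A B g]
  note TA = tensor_mod_module[OF HA] and TB = tensor_mod_module[OF HB]
  interpret P: tensor_pair R CR "HM A" by (rule TP[OF HA])
  have l: "compose (carrier (TM (HM A))) (nu B) (Tmap (HM A) (HM B) (Hmap A g)) \<in> mod_hom S (TM (HM A)) B"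
    by (rule mod_hom_compose[OF TA Tmap_hom[OF HA HB Hg] nu_hom[OF B]])
  have r: "compose (carrier (TM (HM A))) g (nu A) \<in> mod_hom S (TM (HM A)) B"
    by (rule mod_hom_compose[OF TA nu_hom[OF A] g])
  have "compose (carrier (TM (HM A))) (nu B) (Tmap (HM A) (HM B) (Hmap A g)) X = compose (carrier (TM (HM A))) g (nu A) X"
  proof (rule TM_hom_eqI[OF HA B l r _ X])
    fix c h assume c: "c \<in> carrier C" and h: "h \<in> carrier (HM A)"
    have t: "t (HM A) c h \<in> carrier (TM (HM A))" using P.t_closed[of c h] c h by simp
    have "Hmap A g h \<in> mod_hom S CL B" using mod_hom_closed[OF Hg h] by simp
    then show "compose (carrier (TM (HM A))) (nu B) (Tmap (HM A) (HM B) (Hmap A g)) (t (HM A) c h) =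
        compose (carrier (TM (HM A))) g (nu A) (t (HM A) c h)"
      using t Tmap_t[OF HA HB Hg c h] nu_t[OF B c] nu_t[OF A c] Hmap_apply[of h A c g] h c by (simp add: compose_eq)
  qed
  then show ?thesis using X by (simp add: compose_eq)
qed

text \<open>A homomorphism from \<open>C\<close> into the kernel of \<open>nu B\<close> is in
  particular one into \<open>C \<otimes> Hom(C, B)\<close>, so it is \<open>mu (HM B) g\<close> for
  some \<open>g\<close>, as Hom(C, B) is weak flat. Evaluating with \<open>nu B\<close> returns
  \<open>g c\<close>, which must be zero for all \<open>c\<close>; hence \<open>g\<close> and the
  homomorphism vanish.\<close>

lemma nu_inj:
  assumes B: "left_module S B" and wf: "weak_flat R (HM B)"
  shows "inj_on (nu B) (carrier (TM (HM B)))"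
proof -
  note HB = hom_mod_module[OF B]
  note TB = tensor_mod_module[OF HB]
  interpret TB: left_module S "TM (HM B)" by (rule TB)
  let ?N = "mod_kernel (TM (HM B)) B (nu B)"
  define K where "K = (TM (HM B))\<lparr>carrier := ?N\<rparr>"
  have sub: "submodule ?N S (TM (HM B))" by (rule mod_kernel_submodule[OF TB B nu_hom[OF B]])
  have K: "left_module S K" unfolding K_def by (rule TB.left_submodule_is_module[OF sub])
  have "hom_zero S CL K"
  proof (rule hom_zeroI[OF CL K])
    fix h c assume h: "h \<in> mod_hom S CL K" and c: "c \<in> carrier CL"
    have hN: "h x \<in> ?N" if "x \<in> carrier CL" for x using mod_hom_closed[OF h that] by (simp add: K_def)
    let ?h = "compose (carrier CL) (restrict (\<lambda>x. x) ?N) h"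
    have h': "?h \<in> mod_hom S CL (TM (HM B))"
      using mod_hom_compose[OF CL h submodule_inclusion_hom[OF TB sub, folded K_def]] .
    then obtain g where g: "g \<in> carrier (HM B)" "?h = mu (HM B) g"
      using mu_bij[OF wf] by (auto simp: bij_betw_def)
    have hg: "h x = t (HM B) x g" if "x \<in> carrier C" for x
      using fun_cong[OF g(2), of x] mu_apply[OF g(1) that] hN[of x] that by (simp add: compose_eq)
    have gm: "g \<in> mod_hom S CL B" using g(1) by simp
    have "g x = \<zero>\<^bsub>HM B\<^esub> x" if "x \<in> carrier C" for x
      using hN[of x] nu_t[OF B that gm] hg[OF that] that by (simp add: mod_kernel_def)
    then have "g = \<zero>\<^bsub>HM B\<^esub>"
      using mod_hom_ext[OF gm] by (intro extensionalityI[of _ "carrier C"]) simp_all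
    then have "mu (HM B) g = \<zero>\<^bsub>HM (TM (HM B))\<^esub>"
      using mod_hom_zero[OF HB hom_mod_module[OF TB] mu_hom[OF HB]] by simp
    then have "t (HM B) c g = \<one>\<^bsub>T (HM B)\<^esub>" using mu_apply[OF g(1), of c] c by simp
    then show "h c = \<zero>\<^bsub>K\<^esub>" using hg[of c] c by (simp add: K_def)
  qed
  then have "carrier K = {\<zero>\<^bsub>K\<^esub>}" by (rule faithful_all_types(1)[OF faithful K])
  then have "?N = {\<zero>\<^bsub>TM (HM B)\<^esub>}" by (simp add: K_def)
  then show ?thesis unfolding mod_hom_inj_iff[OF TB B nu_hom[OF B]] by (auto simp: mod_kernel_def)
qed

text \<open>A triangle identity of the adjunction, checked on elementary tensors.\<close>

lemma nu_mu:
  assumes A: "left_module R A" and X: "X \<in> carrier (T A)"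
  shows "nu (TM A) (Tmap A (HM (TM A)) (mu A) X) = X"
proof -
  note TA = tensor_mod_module[OF A]
  note HA = hom_mod_module[OF TA]
  interpret P: tensor_pair R CR A by (rule TP[OF A])
  have l: "compose (carrier (TM A)) (nu (TM A)) (Tmap A (HM (TM A)) (mu A)) \<in> mod_hom S (TM A) (TM A)"
    by (rule mod_hom_compose[OF TA Tmap_hom[OF A HA mu_hom[OF A]] nu_hom[OF TA]])
  have "compose (carrier (TM A)) (nu (TM A)) (Tmap A (HM (TM A)) (mu A)) X = idm (TM A) X"
  proof (rule TM_hom_eqI[OF A TA l mod_hom_id[OF TA] _ X])
    fix c a assume c: "c \<in> carrier C" and a: "a \<in> carrier A"
    have t: "t A c a \<in> carrier (TM A)" using P.t_closed[of c a] c a by simp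
    show "compose (carrier (TM A)) (nu (TM A)) (Tmap A (HM (TM A)) (mu A)) (t A c a) = idm (TM A) (t A c a)"
      using t Tmap_t[OF A HA mu_hom[OF A] c a] nu_t[OF TA c mu_closed[OF A a]] mu_apply[OF a c] by (simp add: compose_eq)
  qed
  then show ?thesis using X by (simp add: compose_eq)
qed

text \<open>Let \<open>W\<close> be the cokernel of \<open>mu A\<close>. The tensors
  \<open>c \<otimes> \<kappa>\<close> and the image of \<open>\<kappa> c\<close> under
  \<open>C \<otimes> mu\<close> have the same value under \<open>nu\<close>, which is injective
  here. So \<open>C \<otimes> mu\<close> hits all elementary tensors, \<open>C \<otimes> W\<close>
  is zero, and faithfulness gives \<open>W = 0\<close>.\<close>

lemma mu_surj:
  fixes A :: "('r, 'a) module"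
  assumes A: "left_module R A" and wi: "weak_injective S (TM A)"
  shows "mu A ` carrier A = carrier (HM (TM A))"
proof -
  note TA = tensor_mod_module[OF A]
  note HA = hom_mod_module[OF TA]
  interpret H: left_module R "HM (TM A)" by (rule HA)
  obtain W :: "('r, 'c \<Rightarrow> ('c \<times> 'a \<Rightarrow>\<^sub>0 int) set) module" and q
    where se: "short_exact R ((HM (TM A))\<lparr>carrier := mu A ` carrier A\<rparr>) (restrict (\<lambda>x. x) (mu A ` carrier A)) (HM (TM A)) q W"
    by (rule quotient_exists[OF HA mod_image_submodule[OF A HA mu_hom[OF A]]])
  note D = short_exactD[OF se]
  interpret W: tensor_pair R CR W by (rule TP[OF D(3)])
  interpret P: tensor_pair R CR "HM (TM A)" by (rule TP[OF HA])
  have qmu: "q (mu A a) = \<zero>\<^bsub>W\<^esub>" if "a \<in> carrier A" for a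
  proof -
    have "mu A a \<in> mod_kernel (HM (TM A)) W q"
      using se that unfolding short_exact_def by (auto simp: image_image)
    then show ?thesis by (simp add: mod_kernel_def)
  qed
  have "carrier W = {\<zero>\<^bsub>W\<^esub>}"
  proof (rule faithful_tensor[OF D(3)])
    fix c w assume c: "c \<in> carrier C" and w: "w \<in> carrier W"
    have "w \<in> q ` carrier (HM (TM A))" using w unfolding D(7) .
    then obtain \<kappa> where \<kappa>: "w = q \<kappa>" "\<kappa> \<in> carrier (HM (TM A))" by (rule imageE)
    note \<kappa> = \<kappa>(2) \<kappa>(1)[symmetric]
    note \<kappa>' = hom_modD[OF \<kappa>(1)]
    have \<kappa>c: "\<kappa> c \<in> carrier (T A)" using \<kappa>'(2)[OF c] by simp
    let ?X = "Tmap A (HM (TM A)) (mu A) (\<kappa> c)"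
    have X: "?X \<in> carrier (T (HM (TM A)))" by (rule Tmap_closed[OF A HA mu_hom[OF A] \<kappa>c])
    have "nu (TM A) ?X = nu (TM A) (t (HM (TM A)) c \<kappa>)" using nu_mu[OF A \<kappa>c] nu_t[OF TA c \<kappa>'(1)] by simp
    moreover have "t (HM (TM A)) c \<kappa> \<in> carrier P.T" using P.t_closed[of c \<kappa>] c \<kappa>(1) by simp
    ultimately have eq: "t (HM (TM A)) c \<kappa> = ?X"
      using nu_bij[OF wi] X by (auto simp: bij_betw_def inj_on_def)

    have "t W c w = Tmap (HM (TM A)) W q (t (HM (TM A)) c \<kappa>)"
      using Tmap_t[OF HA D(3) D(5) c \<kappa>(1)] \<kappa>(2) by simp
    also have "\<dots> = \<one>\<^bsub>T W\<^esub>"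
      unfolding eq by (rule Tmap_compose_zero[OF A HA D(3) mu_hom[OF A] D(5) _ \<kappa>c]) (rule qmu)
    finally show "t W c w = \<one>\<^bsub>T W\<^esub>" .
  qed
  then have "\<kappa> \<in> mu A ` carrier A" if "\<kappa> \<in> carrier (HM (TM A))" for \<kappa>
    using short_exact_image[OF se that] mod_hom_closed[OF D(5) that] by auto
  then show ?thesis using mod_hom_closed[OF mu_hom[OF A]] by auto
qed


section \<open>Preservation of purity\<close>

text \<open>A vector of homomorphisms from \<open>C\<close> is one homomorphism on a power of
  \<open>C\<close>. The equations prescribe its values at vectors obtained by multiplying elements
  of \<open>C\<close> by the rows. The power of \<open>C\<close> is finitely presented over
  \<open>S\<close>, so \<open>pure_extend\<close> replaces a solution into \<open>B\<close> by one
  into \<open>A\<close>.\<close>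

lemma Hmap_sys_pure:
  assumes pe: "pure_exact S A f B g D"
  shows "sys_pure R (HM A) (Hmap A f) (HM B)"
  unfolding sys_pure_def
proof (intro allI impI)
  fix n G a b
  assume G: "set G \<subseteq> vecs (carrier R) n" and a: "a \<in> vecs (carrier (HM A)) (length G)"
    and b: "b \<in> vecs (carrier (HM B)) n" and eq: "map (\<lambda>r. lc (HM B) r b) G = map (Hmap A f) a"
  have "short_exact S A f B g D" using pe by (simp add: pure_exact_def)
  note D = short_exactD[OF this]
  have b': "b \<in> vecs (mod_hom S CL B) n" and a': "a \<in> vecs (mod_hom S CL A) (length G)" using a b by simp_all
  obtain cs sg where "fin_rel S CL cs sg" by (rule sfp_fin_rel[OF sfp_CL])
  then have cs: "gens S CL cs" by (simp add: fin_rel_def)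
  have csC: "c \<in> carrier C" if "c \<in> set cs" for c using gens_set[OF cs] that by auto
  obtain ys ls where Y: "fin_rel S (pow_mod CL n) ys ls" by (rule sfp_fin_rel[OF sfp_pow_mod[OF sfp_CL]])
  define h where "h = restrict (ev B b) (vecs (carrier CL) n)"
  have h: "h \<in> mod_hom S (pow_mod CL n) B" unfolding h_def by (rule ev_hom[OF D(2) CL b'])
  \<comment> \<open>It suffices to impose the equations at the generators \<open>cs\<close>, since
    both sides are homomorphisms on \<open>C\<close>. This makes the list of prescribed values
    finite.\<close>
  define xs where "xs = concat (map (\<lambda>r. map (\<lambda>c. map (rsmult C c) r) cs) G)"
  have z: "map (rsmult C c) r \<in> vecs (carrier CL) n" if "c \<in> carrier C" "r \<in> set G" for c r
    using that G by (auto simp: vecs_def rsmult_closed subset_iff)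
  have hz: "h (map (rsmult C c) (G ! i)) = f ((a ! i) c)" if c: "c \<in> carrier C" and i: "i < length G" for c i
  proof -
    have r: "set (G ! i) \<subseteq> carrier R" using G nth_mem[OF i] by (auto simp: vecs_def)
    have "h (map (rsmult C c) (G ! i)) = lc (HM B) (G ! i) b c"
      using z[OF c nth_mem[OF i]] lc_hom_mod[OF D(2) r vecs_set[OF b'] c] by (simp add: h_def)
    also have "lc (HM B) (G ! i) b = Hmap A f (a ! i)"
      using arg_cong[OF eq, of "\<lambda>l. l ! i"] i vecs_length[OF a] by simp
    also have "Hmap A f (a ! i) c = f ((a ! i) c)" by (rule Hmap_apply[OF vecs_nth[OF a' i] c])
    finally show ?thesis .
  qed
  have xs: "set xs \<subseteq> carrier (pow_mod CL n)" using z csC by (auto simp: xs_def)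
  have "h x \<in> f ` carrier A" if "x \<in> set xs" for x
  proof -
    obtain i c where ic: "i < length G" "c \<in> set cs" "x = map (rsmult C c) (G ! i)"
      using \<open>x \<in> set xs\<close> by (auto simp: xs_def in_set_conv_nth[of _ G])
    then have c: "c \<in> carrier CL" using csC by simp
    show ?thesis unfolding ic(3) using hz[OF csC[OF ic(2)] ic(1)] mod_hom_closed[OF vecs_nth[OF a' ic(1)] c] by simp
  qed
  from pure_extend[OF pe Y xs h this] obtain h' where h': "h' \<in> mod_hom S (pow_mod CL n) A"
    "\<And>x. x \<in> set xs \<Longrightarrow> f (h' x) = h x" by metis
  obtain x where x: "x \<in> vecs (mod_hom S CL A) n" "\<And>z. z \<in> vecs (carrier CL) n \<Longrightarrow> ev A x z = h' z"
    by (rule hom_as_ev[OF D(1) CL h'(1)]) blast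
  have "lc (HM A) (G ! i) x = a ! i" if i: "i < length G" for i
  proof -
    have r: "set (G ! i) \<subseteq> carrier R" using G nth_mem[OF i] by (auto simp: vecs_def)
    have l: "lc (HM A) (G ! i) x \<in> mod_hom S CL A"
      using left_module.lc_closed[OF hom_mod_module[OF D(1)] r, of x] vecs_set[OF x(1)] by simp
    have ai: "a ! i \<in> mod_hom S CL A" by (rule vecs_nth[OF a' i])
    have "lc (HM A) (G ! i) x c = (a ! i) c" if c: "c \<in> set cs" for c
    proof -
      note c' = csC[OF c]
      have cl: "c \<in> carrier CL" using c' by simp
      have "map (rsmult C c) (G ! i) \<in> set xs" using c i by (auto simp: xs_def)
      moreover have "lc (HM A) (G ! i) x c = h' (map (rsmult C c) (G ! i))"
        using lc_hom_mod[OF D(1) r vecs_set[OF x(1)] c'] x(2)[OF z[OF c' nth_mem[OF i]]] by simp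
      ultimately have "f (lc (HM A) (G ! i) x c) = f ((a ! i) c)" using h'(2) hz[OF c' i] by simp
      then show ?thesis
        using inj_onD[OF D(6)] mod_hom_closed[OF l cl] mod_hom_closed[OF ai cl] by blast
    qed
    then have "lc (HM A) (G ! i) x c = (a ! i) c" if "c \<in> carrier CL" for c
      using hom_eq_on_gens[OF CL D(1) cs l ai _ that] by blast
    then show ?thesis by (rule mod_hom_eqI[OF l ai])
  qed
  then have "map (\<lambda>r. lc (HM A) r x) G = a" using vecs_length[OF a] by (intro nth_equalityI) simp_all
  then show "\<exists>x\<in>vecs (carrier (HM A)) n. map (\<lambda>r. lc (HM A) r x) G = a" using x(1) by auto
qed

text \<open>Purity enters in the surjectivity at the right end: homomorphisms from the finitely
  presented module \<open>C\<close> to \<open>D\<close> lift to \<open>B\<close>.\<close>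

lemma Hmap_exact:
  assumes pe: "pure_exact S A f B g D"
  shows "short_exact R (HM A) (Hmap A f) (HM B) (Hmap B g) (HM D)"
proof -
  have se: "short_exact S A f B g D" using pe by (simp add: pure_exact_def)
  note D = short_exactD[OF se]
  note HA = hom_mod_module[OF D(1)] and HB = hom_mod_module[OF D(2)] and HD = hom_mod_module[OF D(3)]
  obtain cs sg where fr: "fin_rel S CL cs sg" by (rule sfp_fin_rel[OF sfp_CL])
  have Hf: "Hmap A f h \<in> mod_hom S CL B" if "h \<in> mod_hom S CL A" for h
    using mod_hom_closed[OF Hmap_hom[OF D(1,2,4)], of h] that by simp
  have Hg: "Hmap B g h \<in> mod_hom S CL D" if "h \<in> mod_hom S CL B" for h
    using mod_hom_closed[OF Hmap_hom[OF D(2,3,5)], of h] that by simp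
  show ?thesis
  proof (rule short_exactI[OF HA HB HD Hmap_hom[OF D(1,2,4)] Hmap_hom[OF D(2,3,5)]])
    show "inj_on (Hmap A f) (carrier (HM A))"
    proof (rule inj_onI)
      fix h j assume "h \<in> carrier (HM A)" "j \<in> carrier (HM A)" and eq: "Hmap A f h = Hmap A f j"
      then have h: "h \<in> mod_hom S CL A" and j: "j \<in> mod_hom S CL A" by simp_all
      show "h = j"
      proof (rule mod_hom_eqI[OF h j])
        fix c assume c: "c \<in> carrier CL"
        then have "f (h c) = f (j c)" using fun_cong[OF eq, of c] Hmap_apply[OF h, of c f] Hmap_apply[OF j, of c f] c by simp
        then show "h c = j c" using inj_onD[OF D(6)] mod_hom_closed[OF h c] mod_hom_closed[OF j c] by blast
      qed
    qed
    fix h assume "h \<in> carrier (HM D)"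
    then have h: "h \<in> mod_hom S CL D" by simp
    obtain h' where h': "h' \<in> mod_hom S CL B" "\<And>c. c \<in> carrier CL \<Longrightarrow> g (h' c) = h c"
      by (rule pure_lift[OF pe fr h]) blast
    have "Hmap B g h' = h"
      by (rule mod_hom_eqI[OF Hg[OF h'(1)] h]) (use h'(2) Hmap_apply[OF h'(1), of _ g] in simp)
    then show "\<exists>h'\<in>carrier (HM B). Hmap B g h' = h" using h'(1) by auto
  next
    fix h assume "h \<in> carrier (HM A)"
    then have h: "h \<in> mod_hom S CL A" by simp
    have "Hmap B g (Hmap A f h) = \<zero>\<^bsub>HM D\<^esub>"
    proof (rule extensionalityI[of _ "carrier C"])
      show "Hmap B g (Hmap A f h) \<in> extensional (carrier C)" using mod_hom_ext[OF Hg[OF Hf[OF h]]] by simp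
      fix c assume c: "c \<in> carrier C"
      then have "h c \<in> carrier A" using mod_hom_closed[OF h, of c] by simp
      then have "f (h c) \<in> mod_kernel B D g" using se by (auto simp: short_exact_def)
      then show "Hmap B g (Hmap A f h) c = \<zero>\<^bsub>HM D\<^esub> c"
        using Hmap_apply[OF Hf[OF h] c, of g] Hmap_apply[OF h c, of f] c by (simp add: mod_kernel_def)
    qed simp
    then show "Hmap B g (Hmap A f h) = \<zero>\<^bsub>HM D\<^esub>" .
  next
    fix h assume "h \<in> carrier (HM B)" and z: "Hmap B g h = \<zero>\<^bsub>HM D\<^esub>"
    then have h: "h \<in> mod_hom S CL B" by simp
    have "g (h c) = \<zero>\<^bsub>D\<^esub>" if "c \<in> carrier CL" for c
      using fun_cong[OF z, of c] Hmap_apply[OF h, of c g] that by simp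
    from short_exact_corestrict[OF se CL h this] obtain h' where h': "h' \<in> mod_hom S CL A"
      "\<And>c. c \<in> carrier CL \<Longrightarrow> f (h' c) = h c" by metis
    have "Hmap A f h' = h"
      by (rule mod_hom_eqI[OF Hf[OF h'(1)] h]) (use h'(2) Hmap_apply[OF h'(1), of _ f] in simp)
    then show "\<exists>h'\<in>carrier (HM A). Hmap A f h' = h" using h'(1) by auto
  qed
qed

lemma tensor_exact_middle:
  assumes se: "short_exact R A f B g D" and w: "w \<in> carrier (T B)" "Tmap B D g w = \<one>\<^bsub>T D\<^esub>"
  obtains v where "v \<in> carrier (T A)" "Tmap A B f v = w"
proof -
  obtain ds tg where N: "fin_rel (op_ring R) CR ds tg" by (rule sfp_fin_rel[OF sfp_CR])
  have "tmap R CR B CR D (idm CR) g w = \<one>\<^bsub>T D\<^esub>" using w by (simp add: Tmap_def)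
  then obtain v where "v \<in> carrier (T A)" "tmap R CR A CR B (idm CR) f v = w"
    using tensor_right_exact_second[OF se N refl w(1)] by metis
  then show thesis using that by (simp add: Tmap_def)
qed

lemma nu_tensor_mod_surj:
  assumes F: "left_module R F"
  shows "nu (TM F) ` carrier (TM (HM (TM F))) = carrier (TM F)"
proof -
  note TF = tensor_mod_module[OF F]
  note HF = hom_mod_module[OF TF]
  have "X \<in> nu (TM F) ` carrier (TM (HM (TM F)))" if "X \<in> carrier (T F)" for X
    using nu_mu[OF F that] Tmap_closed[OF F HF mu_hom[OF F] that] by (metis imageI tensor_mod_simps(1))
  then show ?thesis using mod_hom_closed[OF nu_hom[OF TF]] by auto
qed

lemma weak_flat_pure:
  fixes A :: "('s, 'a) module" and D :: "('s, 'd) module"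
  assumes pe: "pure_exact S A f (TM F) g D" and F: "weak_flat R F"
  shows "weak_flat R (HM A)" "mod_isomorphic S A (TM (HM A))" "weak_flat R (HM D)" "mod_isomorphic S D (TM (HM D))"
proof -
  have FM: "left_module R F" using F by (simp add: weak_flat_def)
  let ?B = "TM F"
  have se: "short_exact S A f ?B g D" using pe by (simp add: pure_exact_def)
  note D = short_exactD[OF se]
  note HA = hom_mod_module[OF D(1)] and HB = hom_mod_module[OF D(2)] and HD = hom_mod_module[OF D(3)]
  note TA = tensor_mod_module[OF HA] and TD = tensor_mod_module[OF HD]
  note sp = Hmap_sys_pure[OF pe] and ex = Hmap_exact[OF pe]
  note E = short_exactD[OF ex]
  have "mod_isomorphic R F (HM ?B)"
    unfolding mod_isomorphic_def using mu_hom[OF FM] mu_bij[OF F] by blast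
  then have wB: "weak_flat R (HM ?B)"
    by (rule weak_flat_isomorphic[OF F HB mod_isomorphic_sym[OF FM HB]])
  show wA: "weak_flat R (HM A)" by (rule weak_flat_pure_sub[OF wB HA E(4) sp])
  show wD: "weak_flat R (HM D)" by (rule weak_flat_pure_quotient[OF wB ex sp])
  note nB = nu_tensor_mod_surj[OF FM]
  have TgD: "nu D (Tmap (HM ?B) (HM D) (Hmap ?B g) X) = g (nu ?B X)" if "X \<in> carrier (T (HM ?B))" for X
    by (rule nu_natural[OF D(2,3,5) that])
  \<comment> \<open>\<open>g\<close> is onto, and \<open>nu\<close> is onto for a module of the form
    \<open>C \<otimes> F\<close>. By naturality the composite passes through
    \<open>nu D\<close>.\<close>
  have "y \<in> nu D ` carrier (TM (HM D))" if "y \<in> carrier D" for y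
  proof -
    have "y \<in> g ` nu ?B ` carrier (TM (HM ?B))" using that unfolding nB D(7) .
    then obtain X where X: "X \<in> carrier (T (HM ?B))" "y = g (nu ?B X)" by auto
    show ?thesis
      unfolding X(2) TgD[OF X(1), symmetric] by (rule imageI) (use Tmap_closed[OF HB HD E(5) X(1)] in simp)
  qed
  then have "nu D ` carrier (TM (HM D)) = carrier D" using mod_hom_closed[OF nu_hom[OF D(3)]] by auto
  then have "bij_betw (nu D) (carrier (TM (HM D))) (carrier D)" using nu_inj[OF D(3) wD] by (simp add: bij_betw_def)
  then have "mod_isomorphic S (TM (HM D)) D" unfolding mod_isomorphic_def using nu_hom[OF D(3)] by blast
  then show "mod_isomorphic S D (TM (HM D))" by (rule mod_isomorphic_sym[OF TD D(3)])
  \<comment> \<open>The chase: \<open>f a\<close> has a preimage \<open>w\<close> under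
    \<open>nu ?B\<close>. The image of \<open>w\<close> in \<open>C \<otimes> Hom(C, D)\<close> is
    killed by the injective \<open>nu D\<close>, hence trivial, so \<open>w\<close> comes from some
    \<open>v\<close> over \<open>A\<close>. Then \<open>nu A v\<close> and \<open>a\<close> have the
    same image under \<open>f\<close>.\<close>
  have "a \<in> nu A ` carrier (TM (HM A))" if a: "a \<in> carrier A" for a
  proof -
    have fa: "f a \<in> mod_kernel ?B D g" using se a by (auto simp: short_exact_def)
    then have "f a \<in> nu ?B ` carrier (TM (HM ?B))" unfolding nB mod_kernel_def by blast
    then obtain w where "f a = nu ?B w" "w \<in> carrier (TM (HM ?B))" by (rule imageE)
    then have w: "f a = nu ?B w" "w \<in> carrier (T (HM ?B))" by simp_all
    note Tw = Tmap_closed[OF HB HD E(5) w(2)]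
    have "nu D (Tmap (HM ?B) (HM D) (Hmap ?B g) w) = \<zero>\<^bsub>D\<^esub>"
      unfolding TgD[OF w(2)] w(1)[symmetric] using fa by (simp add: mod_kernel_def)
    then have "Tmap (HM ?B) (HM D) (Hmap ?B g) w = \<one>\<^bsub>T (HM D)\<^esub>"
      using nu_inj[OF D(3) wD] Tw unfolding mod_hom_inj_iff[OF TD D(3) nu_hom[OF D(3)]] by simp
    then obtain v where v: "v \<in> carrier (T (HM A))" "Tmap (HM A) (HM ?B) (Hmap A f) v = w"
      by (rule tensor_exact_middle[OF ex w(2)])
    have "f (nu A v) = f a" using nu_natural[OF D(1,2,4) v(1)] v(2) w(1) by simp
    moreover have nv: "nu A v \<in> carrier A" using mod_hom_closed[OF nu_hom[OF D(1)], of v] v(1) by simp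
    ultimately have "a = nu A v" using inj_onD[OF D(6)] a by metis
    then show ?thesis using v(1) by (intro image_eqI) simp_all
  qed
  then have "nu A ` carrier (TM (HM A)) = carrier A" using mod_hom_closed[OF nu_hom[OF D(1)]] by auto
  then have "bij_betw (nu A) (carrier (TM (HM A))) (carrier A)" using nu_inj[OF D(1) wA] by (simp add: bij_betw_def)
  then have "mod_isomorphic S (TM (HM A)) A" unfolding mod_isomorphic_def using nu_hom[OF D(1)] by blast
  then show "mod_isomorphic S A (TM (HM A))" by (rule mod_isomorphic_sym[OF TA D(1)])
qed


section \<open>Tensoring pure sequences with the bimodule, and the weak injective case\<close>

lemma Tmap_exact:
  assumes pe: "pure_exact R A f B g D"
  shows "short_exact S (TM A) (Tmap A B f) (TM B) (Tmap B D g) (TM D)"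
proof -
  have se: "short_exact R A f B g D" using pe by (simp add: pure_exact_def)
  note D = short_exactD[OF se]
  note TA = tensor_mod_module[OF D(1)] and TB = tensor_mod_module[OF D(2)] and TD = tensor_mod_module[OF D(3)]
  note Tf = Tmap_hom[OF D(1,2,4)] and Tg = Tmap_hom[OF D(2,3,5)]
  obtain ds tg where N: "fin_rel (op_ring R) CR ds tg" by (rule sfp_fin_rel[OF sfp_CR])
  show ?thesis
  proof (rule short_exactI[OF TA TB TD Tf Tg])
    \<comment> \<open>\<open>C\<close> is finitely presented over \<open>op_ring R\<close>, so
      purity keeps \<open>C \<otimes> f\<close> injective; the rest of the exactness is right
      exactness of the tensor product.\<close>
    show "inj_on (Tmap A B f) (carrier (TM A))"
      unfolding mod_hom_inj_iff[OF TA TB Tf]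
    proof (intro ballI impI)
      fix X assume "X \<in> carrier (TM A)" "Tmap A B f X = \<zero>\<^bsub>TM B\<^esub>"
      then have "X \<in> carrier (T A)" "tmap R CR A CR B (idm CR) f X = \<one>\<^bsub>T B\<^esub>" by (simp_all add: Tmap_def)
      then have "X = \<one>\<^bsub>T A\<^esub>"
        by (rule sys_pure_tensor_inj[OF D(1,2,4) pure_exact_imp_sys_pure[OF pe] N refl])
      then show "X = \<zero>\<^bsub>TM A\<^esub>" by simp
    qed
    fix Y assume "Y \<in> carrier (TM D)"
    then have Y: "Y \<in> carrier (T D)" by simp
    obtain X where X: "X \<in> carrier (T B)" "tmap R CR B CR D (idm CR) g X = Y"
      by (rule tmap_second_surj[OF D(2,3) CR D(5,7) refl Y])
    then show "\<exists>X\<in>carrier (TM B). Tmap B D g X = Y" by (intro bexI[of _ X]) (simp_all add: Tmap_def)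
  next
    fix X assume "X \<in> carrier (TM A)"
    then have X: "X \<in> carrier (T A)" by simp
    have "Tmap B D g (Tmap A B f X) = \<one>\<^bsub>T D\<^esub>"
      by (rule Tmap_compose_zero[OF D(1,2,3,4,5) _ X]) (rule short_exact_zero[OF se])
    then show "Tmap B D g (Tmap A B f X) = \<zero>\<^bsub>TM D\<^esub>" by simp
  next
    fix X assume "X \<in> carrier (TM B)" "Tmap B D g X = \<zero>\<^bsub>TM D\<^esub>"
    then have X: "X \<in> carrier (T B)" "Tmap B D g X = \<one>\<^bsub>T D\<^esub>" by simp_all
    obtain v where "v \<in> carrier (T A)" "Tmap A B f v = X" by (rule tensor_exact_middle[OF se X])
    then show "\<exists>v\<in>carrier (TM A). Tmap A B f v = X" by (intro bexI[of _ v]) simp_all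
  qed
qed

text \<open>The cokernel of a matrix over \<open>S\<close> between powers of \<open>C\<close> is
  finitely presented over \<open>op_ring R\<close>: the powers are infinitely presented and the
  image is finitely generated. It is the test module for systems with this matrix over
  \<open>C \<otimes> A\<close>.\<close>

lemma rowmap_cokernel:
  assumes G: "set G \<subseteq> vecs (carrier S) n"
  obtains E :: "('r, 'c list) module" and q es ls
  where "fin_rel (op_ring R) E es ls" "q \<in> mod_hom (op_ring R) (pow_mod CR (length G)) E"
    "q ` carrier (pow_mod CR (length G)) = carrier E"
    "\<And>x. x \<in> carrier (pow_mod CR (length G)) \<Longrightarrow>
      q x = \<zero>\<^bsub>E\<^esub> \<longleftrightarrow> x \<in> biaction.rowmap CR CL n G ` carrier (pow_mod CR n)"
proof -
  interpret bi: biaction "op_ring R" CR S CL by (rule biaction)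
  note P = pow_mod_module[OF CR]
  let ?Y = "pow_mod CR (length G)" and ?X = "pow_mod CR n"
  define H where "H = bi.rowmap n G ` carrier ?X"
  note \<gamma> = bi.rowmap_hom[OF G]
  obtain E :: "('r, 'c list) module" and q
    where se: "short_exact (op_ring R) (?Y\<lparr>carrier := H\<rparr>) (restrict (\<lambda>x. x) H) ?Y q E"
    unfolding H_def by (rule quotient_exists[OF P mod_image_submodule[OF P P \<gamma>]])
  note D = short_exactD[OF se]
  have ker: "q x = \<zero>\<^bsub>E\<^esub> \<longleftrightarrow> x \<in> H" if x: "x \<in> carrier ?Y" for x
  proof -
    have "H = mod_kernel ?Y E q" using se by (simp add: short_exact_def)
    then show ?thesis using x by (simp only: mod_kernel_def mem_Collect_eq simp_thms)
  qed
  obtain ys ls where Y: "fin_rel (op_ring R) ?Y ys ls" by (rule sfp_fin_rel[OF sfp_pow_mod[OF sfp_CR]])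
  obtain zs where zs: "gens (op_ring R) ?X zs" by (rule sfp_step[OF sfp_pow_mod[OF sfp_CR]])
  have "bi.rowmap n G \<in> mod_hom (op_ring R) ?X (?Y\<lparr>carrier := H\<rparr>)"
    using \<gamma> unfolding mod_hom_def H_def by (auto simp: PiE_iff)
  then have "gens (op_ring R) (?Y\<lparr>carrier := H\<rparr>) (map (bi.rowmap n G) zs)"
    by (rule gens_image[OF P D(1) _ _ zs]) (simp add: H_def)
  from fin_rel_quotient[OF Y se this] obtain ls' where "fin_rel (op_ring R) E (map q ys) ls'" .
  from that[OF this D(5,7)] ker show thesis unfolding H_def by blast
qed

text \<open>The right-hand sides are the coordinates of a tensor \<open>u\<close> of a power of
  \<open>C\<close> with \<open>A\<close>, and the solution over \<open>B\<close> is a tensor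
  \<open>w\<close> that the matrix sends to the image of \<open>u\<close>. So the image of
  \<open>u\<close> in \<open>E \<otimes> A\<close>, with \<open>E\<close> the cokernel of the
  matrix, dies in \<open>E \<otimes> B\<close>. As \<open>E\<close> is finitely presented, purity
  makes it trivial, and by right exactness \<open>u\<close> is an image under the matrix over
  \<open>A\<close>.\<close>

lemma Tmap_sys_pure:
  assumes A: "left_module R A" and B: "left_module R B" and f: "f \<in> mod_hom R A B" and sp: "sys_pure R A f B"
  shows "sys_pure S (TM A) (Tmap A B f) (TM B)"
  unfolding sys_pure_def
proof (intro allI impI)
  fix n G a b
  assume G: "set G \<subseteq> vecs (carrier S) n" and "a \<in> vecs (carrier (TM A)) (length G)"
    and "b \<in> vecs (carrier (TM B)) n" and eq: "map (\<lambda>r. lc (TM B) r b) G = map (Tmap A B f) a"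
  then have a: "a \<in> vecs (carrier (T A)) (length G)" and b: "b \<in> vecs (carrier (T B)) n" by simp_all
  interpret bi: biaction "op_ring R" CR S CL by (rule biaction)
  note P = pow_mod_module[OF CR]
  define m where "m = length G"
  let ?X = "pow_mod CR n" and ?Y = "pow_mod CR m" and ?\<gamma> = "bi.rowmap n G"
  have \<gamma>: "?\<gamma> \<in> mod_hom (op_ring R) ?X ?Y" unfolding m_def by (rule bi.rowmap_hom[OF G])
  note XA = tensor_pairI[OF P[of n] A] and XB = tensor_pairI[OF P[of n] B]
    and YA = tensor_pairI[OF P[of m] A] and YB = tensor_pairI[OF P[of m] B]
  note iA = mod_hom_id[OF A] and iB = mod_hom_id[OF B]
  note iY = mod_hom_id[OF P[of m]]
  obtain E :: "('r, 'c list) module" and q es ls where fE: "fin_rel (op_ring R) E es ls"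
    and q: "q \<in> mod_hom (op_ring R) ?Y E" "q ` carrier ?Y = carrier E"
    and ker: "\<And>x. x \<in> carrier ?Y \<Longrightarrow> q x = \<zero>\<^bsub>E\<^esub> \<longleftrightarrow> x \<in> ?\<gamma> ` carrier ?X"
    unfolding m_def by (rule rowmap_cokernel[OF G]) blast
  have EM: "left_module (op_ring R) E" using fE by (simp add: fin_rel_def)
  note EA = tensor_pairI[OF EM A] and EB = tensor_pairI[OF EM B]
  note iE = mod_hom_id[OF EM]
  obtain u where u: "u \<in> carrier (tensor_group R ?Y A)"
    "\<And>j. j < m \<Longrightarrow> tmap R ?Y A CR A (coord CR m j) (idm A) u = a ! j"
    using pow_tensor_exists[OF CR A a] unfolding m_def by metis
  obtain w where w: "w \<in> carrier (tensor_group R ?X B)"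
    "\<And>i. i < n \<Longrightarrow> tmap R ?X B CR B (coord CR n i) (idm B) w = b ! i"
    using pow_tensor_exists[OF CR B b] by metis
  have wb: "map (\<lambda>i. tmap R ?X B CR B (coord CR n i) (idm B) w) [0..<n] = b"
    using w(2) vecs_length[OF b] by (intro nth_equalityI) (simp_all del: restrict_apply)
  define fu where "fu = tmap R ?Y A ?Y B (idm ?Y) f u"
  have fu: "fu \<in> carrier (tensor_group R ?Y B)"
    unfolding fu_def by (rule hom_in_carrier[OF tmap_hom[OF YA YB iY f] u(1)])
  define gw where "gw = tmap R ?X B ?Y B ?\<gamma> (idm B) w"
  have gw: "gw \<in> carrier (tensor_group R ?Y B)"
    unfolding gw_def by (rule hom_in_carrier[OF tmap_hom[OF XB YB \<gamma> iB] w(1)])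
  \<comment> \<open>Coordinate by coordinate this is the given system over
    \<open>C \<otimes> B\<close>.\<close>
  have "gw = fu"
  proof (rule pow_tensor_eqI[OF CR B gw fu])
    fix j assume j: "j < m"
    note cj = coord_is_hom[OF CR j]
    have aj: "a ! j \<in> carrier (T A)" using vecs_nth[OF a] j by (simp add: m_def)
    have "tmap R ?Y B CR B (coord CR m j) (idm B) gw = lc (TM B) (G ! j) b"
      using lin_coord[OF B G _ w(1), of j] j unfolding gw_def wb m_def by blast
    also have "\<dots> = Tmap A B f (a ! j)"
      using arg_cong[OF eq, of "\<lambda>l. l ! j"] j vecs_length[OF a] by (simp add: m_def)
    also have "\<dots> = tmap R CR A CR B (idm CR) f (tmap R ?Y A CR A (coord CR m j) (idm A) u)"
      unfolding u(2)[OF j] Tmap_def restrict_apply'[OF aj] ..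
    also have "\<dots> = tmap R ?Y A CR B (coord CR m j) f u"
      by (rule tmap_compose[OF YA TP[OF A] TP[OF B] cj iA idm_CR_hom f cj f _ _ u(1)]) (use mod_hom_closed[OF cj] in simp_all)
    also have "\<dots> = tmap R ?Y B CR B (coord CR m j) (idm B) fu"
      unfolding fu_def
      by (rule tmap_compose[OF YA YB TP[OF B] iY f cj iB cj f _ _ u(1), symmetric]) (use mod_hom_closed[OF f] in simp_all)
    finally show "tmap R ?Y B CR B (coord CR m j) (idm B) gw = tmap R ?Y B CR B (coord CR m j) (idm B) fu" .
  qed
  define e where "e = tmap R ?Y A E A q (idm A) u"
  have e: "e \<in> carrier (tensor_group R E A)"
    unfolding e_def by (rule hom_in_carrier[OF tmap_hom[OF YA EA q(1) iA] u(1)])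
  have "tmap R E A E B (idm E) f e = tmap R ?Y A E B q f u"
    unfolding e_def
    by (rule tmap_compose[OF YA EA EB q(1) iA iE f q(1) f _ _ u(1)]) (use mod_hom_closed[OF q(1)] in simp_all)
  also have "\<dots> = tmap R ?Y B E B q (idm B) fu"
    unfolding fu_def
    by (rule tmap_compose[OF YA YB EB iY f q(1) iB q(1) f _ _ u(1), symmetric]) (use mod_hom_closed[OF f] in simp_all)
  also have "\<dots> = \<one>\<^bsub>tensor_group R E B\<^esub>"
    unfolding \<open>gw = fu\<close>[symmetric] gw_def
  proof (rule tmap_compose_zero[OF XB YB EB \<gamma> iB q(1) iB _ w(1)], rule disjI1)
    fix x assume x: "x \<in> carrier ?X"
    show "q (?\<gamma> x) = \<zero>\<^bsub>E\<^esub>" unfolding ker[OF mod_hom_closed[OF \<gamma> x]] by (rule imageI[OF x])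
  qed
  finally have "tmap R E A E B (idm E) f e = \<one>\<^bsub>tensor_group R E B\<^esub>" .
  from sys_pure_tensor_inj[OF A B f sp fE refl e this]
  have "tmap R ?Y A E A q (idm A) u = \<one>\<^bsub>tensor_group R E A\<^esub>" unfolding e_def .
  moreover have "x \<in> ?\<gamma> ` carrier ?X" if "x \<in> carrier ?Y" "q x = \<zero>\<^bsub>E\<^esub>" for x
    using ker[OF that(1)] that(2) by simp
  ultimately obtain v where v: "v \<in> carrier (tensor_group R ?X A)" "tmap R ?X A ?Y A ?\<gamma> (idm A) v = u"
    using tensor_right_exact[OF XA YA EA \<gamma> q _ refl u(1)] by metis
  define x where "x = map (\<lambda>i. tmap R ?X A CR A (coord CR n i) (idm A) v) [0..<n]"
  have "tmap R ?X A CR A (coord CR n i) (idm A) v \<in> carrier (T A)" if "i < n" for i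
    by (rule hom_in_carrier[OF tmap_hom[OF XA TP[OF A] coord_is_hom[OF CR that] iA] v(1)])
  then have x: "x \<in> vecs (carrier (TM A)) n" by (simp add: x_def vecs_iff_nth del: restrict_apply)
  have "lc (TM A) (G ! j) x = a ! j" if j: "j < m" for j
    using lin_coord[OF A G _ v(1), of j] j v(2) u(2)[OF j] unfolding x_def m_def by metis
  then have "map (\<lambda>r. lc (TM A) r x) G = a" using vecs_length[OF a] by (intro nth_equalityI) (simp_all add: m_def)
  then show "\<exists>x\<in>vecs (carrier (TM A)) n. map (\<lambda>r. lc (TM A) r x) G = a" using x by blast
qed

text \<open>The other triangle identity: applying \<open>nu I\<close> to the value of
  \<open>mu (HM I) h\<close> at \<open>c\<close> gives back \<open>h c\<close>.\<close>

lemma mu_hom_mod_inj: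
  assumes I: "left_module S I" shows "inj_on (mu (HM I)) (carrier (HM I))"
proof -
  note HI = hom_mod_module[OF I]
  note TH = tensor_mod_module[OF HI]
  show ?thesis
    unfolding mod_hom_inj_iff[OF HI hom_mod_module[OF TH] mu_hom[OF HI]]
  proof (intro ballI impI)
    fix h assume h: "h \<in> carrier (HM I)" and z: "mu (HM I) h = \<zero>\<^bsub>HM (TM (HM I))\<^esub>"
    have h': "h \<in> mod_hom S CL I" using h by simp
    have "h c = \<zero>\<^bsub>I\<^esub>" if c: "c \<in> carrier C" for c
    proof -
      have "t (HM I) c h = \<zero>\<^bsub>TM (HM I)\<^esub>" using fun_cong[OF z, of c] mu_apply[OF h c] c by simp
      then show ?thesis using nu_t[OF I c h'] mod_hom_zero[OF TH I nu_hom[OF I]] by simp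
    qed
    then show "h = \<zero>\<^bsub>HM I\<^esub>"
      using mod_hom_ext[OF h'] by (intro extensionalityI[of _ "carrier C"]) simp_all
  qed
qed

lemma weak_injective_pure:
  fixes A :: "('r, 'a) module" and D :: "('r, 'd) module"
  assumes pe: "pure_exact R A f (HM I) g D" and I: "weak_injective S I"
  shows "weak_injective S (TM A)" "mod_isomorphic R A (HM (TM A))"
    "weak_injective S (TM D)" "mod_isomorphic R D (HM (TM D))"
proof -
  let ?B = "HM I"
  have se: "short_exact R A f ?B g D" using pe by (simp add: pure_exact_def)
  have IM: "left_module S I" using I by (simp add: weak_injective_def)
  note D = short_exactD[OF se]
  note TA = tensor_mod_module[OF D(1)] and TB = tensor_mod_module[OF D(2)] and TD = tensor_mod_module[OF D(3)]
  note HD = hom_mod_module[OF TD]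
  have wB: "weak_injective S (TM ?B)"
    by (rule weak_injective_iso[OF I TB nu_hom[OF IM] nu_bij[OF I]])
  note ex = Tmap_exact[OF pe]
  note sp = Tmap_sys_pure[OF D(1,2,4) pure_exact_imp_sys_pure[OF pe]]
  note E = short_exactD[OF ex] and ft = Tmap_t[OF D(1,2,4)] and gt = Tmap_t[OF D(2,3,5)]
  show wA: "weak_injective S (TM A)" by (rule weak_injective_pure_sub[OF wB TA E(4) sp])
  show wD: "weak_injective S (TM D)" by (rule weak_injective_pure_quotient[OF wB ex sp])
  note mB = mu_hom_mod_inj[OF IM]
  \<comment> \<open>By naturality \<open>mu ?B (f a)\<close> is \<open>mu A a\<close> followed by
    \<open>C \<otimes> f\<close>, so it can be compared with \<open>mu ?B b\<close> value by
    value.\<close>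
  have fmu: "mu ?B (f a) = mu ?B b"
    if a: "a \<in> carrier A" and b: "b \<in> carrier ?B" and eq: "\<And>c. c \<in> carrier C \<Longrightarrow> Tmap A ?B f (mu A a c) = mu ?B b c" for a b
  proof (rule mod_hom_eqI[OF mu_closed[OF D(2) mod_hom_closed[OF D(4) a]] mu_closed[OF D(2) b]])
    fix c assume "c \<in> carrier CL"
    then have c: "c \<in> carrier C" by simp
    show "mu ?B (f a) c = mu ?B b c"
      using eq[OF c] ft[OF c a] mu_apply[OF a c] mu_apply[OF mod_hom_closed[OF D(4) a] c] by simp
  qed
  have "inj_on (mu A) (carrier A)"
  proof (rule inj_onI)
    fix a a' assume a: "a \<in> carrier A" "a' \<in> carrier A" and eq: "mu A a = mu A a'"
    note fa = mod_hom_closed[OF D(4) a(2)]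
    have "mu ?B (f a) = mu ?B (f a')"
      by (rule fmu[OF a(1) fa]) (use ft[OF _ a(2)] mu_apply[OF a(2)] mu_apply[OF fa] eq in simp)
    then have "f a = f a'" using inj_onD[OF mB] mod_hom_closed[OF D(4) a(1)] fa by blast
    then show "a = a'" using inj_onD[OF D(6)] a by blast
  qed
  then have "bij_betw (mu A) (carrier A) (carrier (HM (TM A)))" using mu_surj[OF D(1) wA] by (simp add: bij_betw_def)
  then show "mod_isomorphic R A (HM (TM A))" unfolding mod_isomorphic_def using mu_hom[OF D(1)] by blast
  \<comment> \<open>Write \<open>d = g b\<close>. If \<open>mu D d\<close> vanishes,
    \<open>mu ?B b\<close> takes values in the kernel of \<open>C \<otimes> g\<close> and comes from
    a homomorphism \<open>h\<close> from \<open>C\<close> to \<open>C \<otimes> A\<close>.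
    Surjectivity of \<open>mu A\<close> gives \<open>h = mu A a\<close>, so \<open>f a\<close> and
    \<open>b\<close> have the same image under the injective \<open>mu ?B\<close>, and
    \<open>d = g (f a)\<close> is zero.\<close>
  have "inj_on (mu D) (carrier D)"
    unfolding mod_hom_inj_iff[OF D(3) HD mu_hom[OF D(3)]]
  proof (intro ballI impI)
    fix d assume d: "d \<in> carrier D" and z: "mu D d = \<zero>\<^bsub>HM (TM D)\<^esub>"
    have "d \<in> g ` carrier ?B" using d unfolding D(7) .
    then obtain b where b: "d = g b" "b \<in> carrier ?B" by (rule imageE)
    have "Tmap ?B D g (mu ?B b c) = \<zero>\<^bsub>TM D\<^esub>" if "c \<in> carrier CL" for c
    proof -
      have c: "c \<in> carrier C" using that by simp
      show ?thesis using fun_cong[OF z, of c] mu_apply[OF d c] gt[OF c b(2)] mu_apply[OF b(2) c] b(1) c by simp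
    qed
    from short_exact_corestrict[OF ex CL mu_closed[OF D(2) b(2)] this]
    obtain h where h: "h \<in> mod_hom S CL (TM A)" "\<And>c. c \<in> carrier CL \<Longrightarrow> Tmap A ?B f (h c) = mu ?B b c" by metis
    have "h \<in> mu A ` carrier A" unfolding mu_surj[OF D(1) wA] using h(1) by simp
    then obtain a where a: "h = mu A a" "a \<in> carrier A" by (rule imageE)
    have "mu ?B (f a) = mu ?B b" by (rule fmu[OF a(2) b(2)]) (use h(2) a(1) in simp)
    then have "f a = b" using inj_onD[OF mB] mod_hom_closed[OF D(4) a(2)] b(2) by blast
    moreover have "f a \<in> mod_kernel ?B D g" using se a(2) by (auto simp: short_exact_def)
    ultimately show "d = \<zero>\<^bsub>D\<^esub>" unfolding b(1) by (simp add: mod_kernel_def)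
  qed
  then have "bij_betw (mu D) (carrier D) (carrier (HM (TM D)))" using mu_surj[OF D(3) wD] by (simp add: bij_betw_def)
  then show "mod_isomorphic R D (HM (TM D))" unfolding mod_isomorphic_def using mu_hom[OF D(3)] by blast
qed

end

theorem proposition2p11:
  fixes R :: "'r ring" and S :: "'s ring" and C :: "('s, 'c, 'r) bimodule"
  assumes "ring R" and "ring S" and "faithfully_semidualizing S R C"
  shows "(\<forall>(A :: ('s, 'a) module) f (B :: ('s, 'b) module) g (D :: ('s, 'd) module).
            pure_exact S A f B g D \<longrightarrow> C_weak_flat TYPE('f) S R C B \<longrightarrow>
              C_weak_flat TYPE('c \<Rightarrow> 'a) S R C A \<and> C_weak_flat TYPE('c \<Rightarrow> 'd) S R C D) \<and>
         (\<forall>(A :: ('r, 'k) module) f (B :: ('r, 'l) module) g (D :: ('r, 'm) module).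
            pure_exact R A f B g D \<longrightarrow> C_weak_injective TYPE('i) S R C B \<longrightarrow>
              C_weak_injective TYPE(('c \<times> 'k \<Rightarrow>\<^sub>0 int) set) S R C A \<and>
              C_weak_injective TYPE(('c \<times> 'm \<Rightarrow>\<^sub>0 int) set) S R C D)"
proof -
  interpret faithful_bimodule R S C by (rule faithful_bimodule.intro[OF assms])
  show ?thesis
  proof (intro conjI allI impI)
    fix A :: "('s, 'a) module" and f and B :: "('s, 'b) module" and g and D :: "('s, 'd) module"
    assume pe: "pure_exact S A f B g D" and "C_weak_flat TYPE('f) S R C B"
    then obtain F :: "('r, 'f) module" where F: "weak_flat R F" "mod_isomorphic S B (TM F)"
      unfolding C_weak_flat_def by blast
    have "left_module S (TM F)" using F(1) by (simp add: weak_flat_def tensor_mod_module)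
    then obtain f' g' where "pure_exact S A f' (TM F) g' D" using pure_exact_transfer[OF pe _ F(2)] by metis
    \<comment> \<open>The weak flat modules that witness the conclusion are Hom(C, A) and Hom(C, D),
      of types \<open>'c \<Rightarrow> 'a\<close> and \<open>'c \<Rightarrow> 'd\<close>.\<close>
    note p = weak_flat_pure[OF this F(1)]
    have "left_module S A" "left_module S D" using pe by (simp_all add: pure_exact_def short_exact_def)
    with p show "C_weak_flat TYPE('c \<Rightarrow> 'a) S R C A" "C_weak_flat TYPE('c \<Rightarrow> 'd) S R C D"
      unfolding C_weak_flat_def by blast+
  next
    fix A :: "('r, 'k) module" and f and B :: "('r, 'l) module" and g and D :: "('r, 'm) module"
    assume pe: "pure_exact R A f B g D" and "C_weak_injective TYPE('i) S R C B"
    then obtain I :: "('s, 'i) module" where I: "weak_injective S I" "mod_isomorphic R B (HM I)"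
      unfolding C_weak_injective_def by blast
    have "left_module R (HM I)" using I(1) by (simp add: weak_injective_def hom_mod_module)
    then obtain f' g' where "pure_exact R A f' (HM I) g' D" using pure_exact_transfer[OF pe _ I(2)] by metis
    \<comment> \<open>Here the witnesses are \<open>C \<otimes> A\<close> and
      \<open>C \<otimes> D\<close>, whose elements are cosets in free abelian groups on
      pairs.\<close>
    note p = weak_injective_pure[OF this I(1)]
    have "left_module R A" "left_module R D" using pe by (simp_all add: pure_exact_def short_exact_def)
    with p show "C_weak_injective TYPE(('c \<times> 'k \<Rightarrow>\<^sub>0 int) set) S R C A"
      "C_weak_injective TYPE(('c \<times> 'm \<Rightarrow>\<^sub>0 int) set) S R C D"
      unfolding C_weak_injective_def by blast+
  qed
qed

end
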